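(* Let $X=(X_n)_{n\in\mathbb N}$, $Y=(Y_n)_{n\in\mathbb N}$, $A=(A_n)_{n\in\mathbb N}$ and $B=(B_n)_{n\in\mathbb N}$ be inductive families of finite sets. (i) If $\Gamma\in\mathcal C_{\rm ns}(X,Y,A,B)$ then there exists a state $s_\Gamma:\mathcal S_{X,A}\otimes_{\max}\mathcal S_{Y,B}\to\mathbb C$ such that $$s_\Gamma\big(\gamma^{(n)}_{X,A}(e_{x,a})\otimes\gamma^{(n)}_{Y,B}(e_{y,b})\big)=|X_n||Y_n|\,\langle\chi_{\tilde x}\otimes\chi_{\tilde y},\Gamma(\chi_{\tilde a}\otimes\chi_{\tilde b})\rangle$$ for all $x\in X_n$, $y\in Y_n$, $a\in A_n$, $b\in B_n$ and all $n\in\mathbb N$. (ii) If $s$ is a state on $\mathcal S_{X,A}\otimes_{\max}\mathcal S_{Y,B}$ then there exists $\Gamma\in\mathcal C_{\rm ns}(X,Y,A,B)$ such that $s=s_\Gamma$.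
   Context: For $d\in\mathbb N$, $[d]=\{1,\dots,d\}$. An inductive family of finite sets is a sequence $X=(X_n)_{n\in\mathbb N}$ of non-empty finite sets with $X_{n+1}=X_n\times[d_n^X]$ for some $d_n^X\in\mathbb N$. Set $d_0^X=|X_1|$ and identify $X_1$ with $[d_0^X]$, so $X_n=\prod_{i=0}^{n-1}[d_i^X]$. Put $\Omega_X=\prod_{i=0}^\infty[d_i^X]$ (product topology), and let $\mu_X$ be the product of the uniform probability measures; $L^1(\Omega_X)$ and $L^\infty(\Omega_X)$ are with respect to $\mu_X$. For $x\in X_n$, $\tilde x\subseteq\Omega_X$ is the cylinder of all points whose first $n$ coordinates form $x$; similarly $\tilde y,\tilde a,\tilde b$. $\mathcal C_{\rm ns}(X,Y,A,B)$ is the set of no-signalling correlations: unital completely positive maps $\Gamma:C(\Omega_A)\otimes C(\Omega_B)\to L^\infty(\Omega_X)\bar\otimes L^\infty(\Omega_Y)=L^\infty(\Omega_X\times\Omega_Y,\mu_X\times\mu_Y)$ with $\Gamma(C(\Omega_A)\otimes1)\subseteq L^\infty(\Omega_X)\otimes1$ and $\Gamma(1\otimes C(\Omega_B))\subseteq1\otimes L^\infty(\Omega_Y)$. The pairing is $\langle g,f\rangle=\int gf\,d(\mu_X\times\mu_Y)$ for $g\in L^1(\Omega_X\times\Omega_Y)$, $f\in L^\infty(\Omega_X\times\Omega_Y)$. For finite sets $S,U$, let $\mathcal D_U$ be the C*-algebra of diagonal $|U|\times|U|$ matrices with canonical basis $(\delta_u)_{u\in U}$, and let $\mathcal S_{S,U}$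 be the operator system coproduct (amalgamated over the units) of $|S|$ copies of $\mathcal D_U$: it comes with unital complete order embeddings $\iota_s:\mathcal D_U\to\mathcal S_{S,U}$, $s\in S$, such that for any operator system $\mathcal R$ and unital completely positive maps $\phi_s:\mathcal D_U\to\mathcal R$ there is a unique unital completely positive $\phi:\mathcal S_{S,U}\to\mathcal R$ with $\phi\circ\iota_s=\phi_s$ for all $s$. Write $e_{s,u}=\iota_s(\delta_u)$. Let $\gamma_{X_n,A_n}:\mathcal S_{X_n,A_n}\to\mathcal S_{X_{n+1},A_{n+1}}$ be the unital completely positive map with $\gamma_{X_n,A_n}(e_{x,a})=\frac1{d_n^X}\sum_{i=1}^{d_n^X}\sum_{j=1}^{d_n^A}e_{(x,i),(a,j)}$. $\mathcal S_{X,A}$ denotes the inductive limit of $(\mathcal S_{X_n,A_n},\gamma_{X_n,A_n})_n$ in the category of operator systems and unital completely positive maps, with canonical maps $\gamma^{(n)}_{X,A}:\mathcal S_{X_n,A_n}\to\mathcal S_{X,A}$ (compatible families of unital completely positive maps $\rho_n:\mathcal S_{X_n,A_n}\to\mathcal R$, $\rho_{n+1}\circ\gamma_{X_n,A_n}=\rho_n$, factor uniquely through a unital completely positive map $\rho:\mathcal S_{X,A}\to\mathcal R$). Similarly for $\mathcal S_{Y,B}$. $\mathcal S\otimes_{\max}\mathcal T$ is the maximal operator system tensor product: the algebraic tensor product $\mathcal S\otimes\mathcal T$ with the (Archimedeanised) matricial cones generated by the elements $P\otimes Q$ with $P\in M_n(\mathcal S)^+$, $Q\in M_m(\mathcal T)^+$.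 A state is a unital positive functional. *)

theory Defs
  imports "HOL-Probability.Probability" "HOL-Algebra.AbelCoset" "HOL-Algebra.Module"
begin

section \<open>Operator systems\<close>

definition complex_ring :: "complex ring" where
  "complex_ring = \<lparr>carrier = UNIV, mult = (*), one = 1, zero = 0, add = (+)\<rparr>"

text \<open>
  An operator system is a complex vector space (a HOL-Algebra module over \<^const>\<open>complex_ring\<close>)
  with an involution \<open>adj\<close>, matrix cones \<open>mpos V n\<close> (the cone of positive elements of $M_n(V)$)
  and an Archimedean matrix order unit. The slot \<open>one\<close> of the record is the order unit; the slot
  \<open>mult\<close> has no meaning here and is never used. An $n \times n$ matrix is a function
  of two indices of which only the values at indices below $n$ matter.
\<close>

record 'v osys = "(complex, 'v) module" +
  adj :: "'v \<Rightarrow> 'v"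
  mpos :: "nat \<Rightarrow> (nat \<Rightarrow> nat \<Rightarrow> 'v) set"

definition mats :: "'v osys \<Rightarrow> nat \<Rightarrow> (nat \<Rightarrow> nat \<Rightarrow> 'v) set" where
  "mats V n = {P. \<forall>i<n. \<forall>j<n. P i j \<in> carrier V}"

definition hermitian :: "'v osys \<Rightarrow> nat \<Rightarrow> (nat \<Rightarrow> nat \<Rightarrow> 'v) \<Rightarrow> bool" where
  "hermitian V n P \<longleftrightarrow> (\<forall>i<n. \<forall>j<n. P j i = adj V (P i j))"

text \<open>The matrix $\alpha P \alpha^*$ for an $m \times m$ matrix $P$ over \<open>V\<close> and a scalar
  matrix $\alpha$ with $m$ columns.\<close>

definition compress :: "'v osys \<Rightarrow> nat \<Rightarrow> (nat \<Rightarrow> nat \<Rightarrow> complex) \<Rightarrow> (nat \<Rightarrow> nat \<Rightarrow> 'v) \<Rightarrow> nat \<Rightarrow> nat \<Rightarrow> 'v" where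
  "compress V m \<alpha> P = (\<lambda>i j. \<Oplus>\<^bsub>V\<^esub>k\<in>{..<m}. \<Oplus>\<^bsub>V\<^esub>l\<in>{..<m}. (\<alpha> i k * cnj (\<alpha> j l)) \<odot>\<^bsub>V\<^esub> P k l)"

definition mshift :: "'v osys \<Rightarrow> real \<Rightarrow> (nat \<Rightarrow> nat \<Rightarrow> 'v) \<Rightarrow> nat \<Rightarrow> nat \<Rightarrow> 'v" where
  "mshift V r P = (\<lambda>i j. if i = j then P i j \<oplus>\<^bsub>V\<^esub> complex_of_real r \<odot>\<^bsub>V\<^esub> \<one>\<^bsub>V\<^esub> else P i j)"

locale complex_space = Module.module complex_ring V for V :: "'v osys" (structure)

locale matrix_ordered = complex_space V for V :: "'v osys" (structure) +
  assumes unit_closed: "\<one> \<in> carrier V"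
    and adj_closed: "x \<in> carrier V \<Longrightarrow> adj V x \<in> carrier V"
    and adj_add: "\<lbrakk>x \<in> carrier V; y \<in> carrier V\<rbrakk> \<Longrightarrow> adj V (x \<oplus> y) = adj V x \<oplus> adj V y"
    and adj_smult: "x \<in> carrier V \<Longrightarrow> adj V (c \<odot> x) = cnj c \<odot> adj V x"
    and adj_adj: "x \<in> carrier V \<Longrightarrow> adj V (adj V x) = x"
    and adj_unit: "adj V \<one> = \<one>"
    and mpos_mats: "P \<in> mpos V n \<Longrightarrow> P \<in> mats V n"
    and mpos_hermitian: "P \<in> mpos V n \<Longrightarrow> hermitian V n P"
    and mpos_cong: "\<lbrakk>P \<in> mpos V n; \<And>i j. \<lbrakk>i < n; j < n\<rbrakk> \<Longrightarrow> Q i j = P i j\<rbrakk> \<Longrightarrow> Q \<in> mpos V n"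
    and mpos_add: "\<lbrakk>P \<in> mpos V n; Q \<in> mpos V n\<rbrakk> \<Longrightarrow> (\<lambda>i j. P i j \<oplus> Q i j) \<in> mpos V n"
    and mpos_compress: "P \<in> mpos V m \<Longrightarrow> compress V m \<alpha> P \<in> mpos V n"
    and order_unit: "\<lbrakk>P \<in> mats V n; hermitian V n P\<rbrakk> \<Longrightarrow> \<exists>r>0. mshift V r P \<in> mpos V n"

locale operator_system = matrix_ordered +
  assumes proper: "\<lbrakk>P \<in> mpos V n; (\<lambda>i j. \<ominus> P i j) \<in> mpos V n; i < n; j < n\<rbrakk> \<Longrightarrow> P i j = \<zero>"
    and archimedean: "\<lbrakk>P \<in> mats V n; \<And>\<epsilon>. \<epsilon> > 0 \<Longrightarrow> mshift V \<epsilon> P \<in> mpos V n\<rbrakk> \<Longrightarrow> P \<in> mpos V n"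

definition linear_map :: "'v osys \<Rightarrow> 'w osys \<Rightarrow> ('v \<Rightarrow> 'w) \<Rightarrow> bool" where
  "linear_map V W \<phi> \<longleftrightarrow>
     (\<forall>x\<in>carrier V. \<phi> x \<in> carrier W) \<and>
     (\<forall>x\<in>carrier V. \<forall>y\<in>carrier V. \<phi> (x \<oplus>\<^bsub>V\<^esub> y) = \<phi> x \<oplus>\<^bsub>W\<^esub> \<phi> y) \<and>
     (\<forall>c. \<forall>x\<in>carrier V. \<phi> (c \<odot>\<^bsub>V\<^esub> x) = c \<odot>\<^bsub>W\<^esub> \<phi> x)"

definition ucp :: "'v osys \<Rightarrow> 'w osys \<Rightarrow> ('v \<Rightarrow> 'w) \<Rightarrow> bool" where
  "ucp V W \<phi> \<longleftrightarrow> linear_map V W \<phi> \<and> \<phi> \<one>\<^bsub>V\<^esub> = \<one>\<^bsub>W\<^esub> \<and>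
     (\<forall>n. \<forall>P\<in>mpos V n. (\<lambda>i j. \<phi> (P i j)) \<in> mpos W n)"

definition complete_order_embedding :: "'v osys \<Rightarrow> 'w osys \<Rightarrow> ('v \<Rightarrow> 'w) \<Rightarrow> bool" where
  "complete_order_embedding V W \<phi> \<longleftrightarrow> ucp V W \<phi> \<and>
     (\<forall>n. \<forall>P\<in>mats V n. (\<lambda>i j. \<phi> (P i j)) \<in> mpos W n \<longrightarrow> P \<in> mpos V n)"

definition state :: "'v osys \<Rightarrow> ('v \<Rightarrow> complex) \<Rightarrow> bool" where
  "state V s \<longleftrightarrow>
     (\<forall>x\<in>carrier V. \<forall>y\<in>carrier V. s (x \<oplus>\<^bsub>V\<^esub> y) = s x + s y) \<and>
     (\<forall>c. \<forall>x\<in>carrier V. s (c \<odot>\<^bsub>V\<^esub> x) = c * s x) \<and>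
     s \<one>\<^bsub>V\<^esub> = 1 \<and>
     (\<forall>x. (\<lambda>i j. x) \<in> mpos V 1 \<longrightarrow> s x \<in> \<real> \<and> 0 \<le> Re (s x))"

definition archimedeanise :: "'v osys \<Rightarrow> 'v osys" where
  "archimedeanise V = V\<lparr>mpos := \<lambda>n. {P \<in> mats V n. \<forall>\<epsilon>>0. mshift V \<epsilon> P \<in> mpos V n}\<rparr>"

text \<open>The quotient of \<open>V\<close> by a subspace \<open>N\<close>; the unit is the class of \<open>u\<close>, and a matrix of
  classes is positive if it has a matrix of representatives satisfying \<open>C\<close>.\<close>

definition quot_osys :: "'v osys \<Rightarrow> 'v set \<Rightarrow> 'v \<Rightarrow> (nat \<Rightarrow> (nat \<Rightarrow> nat \<Rightarrow> 'v) \<Rightarrow> bool) \<Rightarrow> 'v set osys" where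
  "quot_osys V N u C =
     \<lparr>carrier = a_rcosets\<^bsub>V\<^esub> N, mult = undefined, one = N +>\<^bsub>V\<^esub> u, zero = N, add = set_add V,
      smult = (\<lambda>c X. \<Union>x\<in>X. N +>\<^bsub>V\<^esub> (c \<odot>\<^bsub>V\<^esub> x)), adj = (\<lambda>X. \<Union>x\<in>X. N +>\<^bsub>V\<^esub> adj V x),
      mpos = (\<lambda>n. {P. (\<forall>i<n. \<forall>j<n. P i j \<in> a_rcosets\<^bsub>V\<^esub> N) \<and>
                      (\<exists>p. (\<forall>i<n. \<forall>j<n. p i j \<in> P i j) \<and> C n p)})\<rparr>"


section \<open>Function systems\<close>

definition psd :: "nat \<Rightarrow> (nat \<Rightarrow> nat \<Rightarrow> complex) \<Rightarrow> bool" where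
  "psd n M \<longleftrightarrow> (\<forall>v :: nat \<Rightarrow> complex.
     (\<Sum>i<n. \<Sum>j<n. cnj (v i) * M i j * v j) \<in> \<real> \<and> 0 \<le> Re (\<Sum>i<n. \<Sum>j<n. cnj (v i) * M i j * v j))"

text \<open>A space \<open>F\<close> of functions on \<open>K\<close>, with the pointwise structure.\<close>

definition fun_osys :: "'k set \<Rightarrow> ('k \<Rightarrow> complex) set \<Rightarrow> ('k \<Rightarrow> complex) osys" where
  "fun_osys K F =
     \<lparr>carrier = F, mult = undefined, one = indicator K, zero = (\<lambda>_. 0), add = (\<lambda>f g x. f x + g x),
      smult = (\<lambda>c f x. c * f x), adj = (\<lambda>f x. cnj (f x)),
      mpos = (\<lambda>n. {P. (\<forall>i<n. \<forall>j<n. P i j \<in> F) \<and> (\<forall>x\<in>K. psd n (\<lambda>i j. P i j x))})\<rparr>"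

text \<open>$C(K)$ for a compact space; functions are extended by zero outside the space.\<close>

definition C_osys :: "'k topology \<Rightarrow> ('k \<Rightarrow> complex) osys" where
  "C_osys T = fun_osys (topspace T)
     {f. continuous_map T euclidean f \<and> (\<forall>x. x \<notin> topspace T \<longrightarrow> f x = 0)}"

text \<open>The diagonal matrices indexed by \<open>U\<close>, each identified with the function of its diagonal
  entries; the matrix unit $\delta_u$ is the indicator function of \<open>{u}\<close>.\<close>

definition diag_osys :: "'u set \<Rightarrow> ('u \<Rightarrow> complex) osys" where
  "diag_osys U = fun_osys U {f. \<forall>u. u \<notin> U \<longrightarrow> f u = 0}"

definition Linf_fun :: "'k measure \<Rightarrow> ('k \<Rightarrow> complex) set" where
  "Linf_fun M = {f \<in> borel_measurable M. \<exists>c. AE x in M. cmod (f x) \<le> c}"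

definition null_fun :: "'k measure \<Rightarrow> ('k \<Rightarrow> complex) set" where
  "null_fun M = {f \<in> borel_measurable M. AE x in M. f x = 0}"

definition Linf_class :: "'k measure \<Rightarrow> ('k \<Rightarrow> complex) \<Rightarrow> ('k \<Rightarrow> complex) set" where
  "Linf_class M f = null_fun M +>\<^bsub>fun_osys (space M) (Linf_fun M)\<^esub> f"

definition Linf_osys :: "'k measure \<Rightarrow> ('k \<Rightarrow> complex) set osys" where
  "Linf_osys M = quot_osys (fun_osys (space M) (Linf_fun M)) (null_fun M) (indicator (space M))
     (\<lambda>n p. AE x in M. psd n (\<lambda>i j. p i j x))"

text \<open>The pairing of an integrable function with an element of $L^\infty$.\<close>

definition pairing :: "'k measure \<Rightarrow> ('k \<Rightarrow> complex) \<Rightarrow> ('k \<Rightarrow> complex) set \<Rightarrow> complex" where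
  "pairing M g F = (\<integral>\<omega>. g \<omega> * (SOME f. f \<in> F) \<omega> \<partial>M)"

definition ftensor :: "('k \<Rightarrow> complex) \<Rightarrow> ('l \<Rightarrow> complex) \<Rightarrow> 'k \<times> 'l \<Rightarrow> complex" where
  "ftensor f g = (\<lambda>(x, y). f x * g y)"


section \<open>The coproduct of copies of the diagonal matrices\<close>

text \<open>
  The vector space $\mathcal S_{S,U}$ is the direct sum over $s \in S$ of copies of
  $\mathcal D_U$, that is the functions on $S \times U$, modulo the span of the differences
  $1_s - 1_t$ of the units. Its matrix cones are the Archimedean closures of the cones of sums
  of positive matrices over the copies; such a sum is represented by a matrix of functions that is
  positive at every point of $S \times U$. All the units $1_s$ become equal in the quotient, and the
  common unit is represented by their average. That this is an operator system, that the maps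
  \<open>copr_inj\<close> are complete order embeddings and that the universal property of the coproduct holds
  is proved below in \<open>operator_system_copr\<close>, \<open>copr_inj_embedding\<close> and \<open>copr_universal\<close>.
\<close>

definition copr_fun :: "'s set \<Rightarrow> 'u set \<Rightarrow> ('s \<times> 'u \<Rightarrow> complex) set" where
  "copr_fun S U = {f. \<forall>z. z \<notin> S \<times> U \<longrightarrow> f z = 0}"

definition copr_null :: "'s set \<Rightarrow> 'u set \<Rightarrow> ('s \<times> 'u \<Rightarrow> complex) set" where
  "copr_null S U = {f \<in> copr_fun S U. \<exists>c. (\<Sum>s\<in>S. c s) = 0 \<and> (\<forall>s\<in>S. \<forall>u\<in>U. f (s, u) = c s)}"

definition copr_class :: "'s set \<Rightarrow> 'u set \<Rightarrow> ('s \<times> 'u \<Rightarrow> complex) \<Rightarrow> ('s \<times> 'u \<Rightarrow> complex) set" where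
  "copr_class S U f = copr_null S U +>\<^bsub>fun_osys (S \<times> U) (copr_fun S U)\<^esub> f"

definition copr_pre :: "'s set \<Rightarrow> 'u set \<Rightarrow> ('s \<times> 'u \<Rightarrow> complex) set osys" where
  "copr_pre S U = quot_osys (fun_osys (S \<times> U) (copr_fun S U)) (copr_null S U)
     (\<lambda>z. indicator (S \<times> U) z / of_nat (card S))
     (\<lambda>n p. \<forall>z\<in>S \<times> U. psd n (\<lambda>i j. p i j z))"

definition copr :: "'s set \<Rightarrow> 'u set \<Rightarrow> ('s \<times> 'u \<Rightarrow> complex) set osys" where
  "copr S U = archimedeanise (copr_pre S U)"

definition copr_inj :: "'s set \<Rightarrow> 'u set \<Rightarrow> 's \<Rightarrow> ('u \<Rightarrow> complex) \<Rightarrow> ('s \<times> 'u \<Rightarrow> complex) set" where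
  "copr_inj S U s f = copr_class S U (\<lambda>(t, u). if t = s then f u else 0)"

definition copr_gen :: "'s set \<Rightarrow> 'u set \<Rightarrow> 's \<Rightarrow> 'u \<Rightarrow> ('s \<times> 'u \<Rightarrow> complex) set" where
  "copr_gen S U s u = copr_inj S U s (indicator {u})"


section \<open>Inductive limits\<close>

text \<open>The norm of \<open>v\<close> is at most \<open>r\<close>.\<close>

definition norm_le :: "'v osys \<Rightarrow> 'v \<Rightarrow> real \<Rightarrow> bool" where
  "norm_le V v r \<longleftrightarrow>
     (\<lambda>i j. if i = j then complex_of_real r \<odot>\<^bsub>V\<^esub> \<one>\<^bsub>V\<^esub> else if i < j then v else adj V v) \<in> mpos V 2"

text \<open>
  The sequence \<open>V\<close> is indexed by the positive integers, and \<open>\<phi> n\<close> maps \<open>V n\<close> to \<open>V (n + 1)\<close>.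
  The limit consists of the elements of the disjoint union, two of them being identified if the
  distance of their images in \<open>V k\<close> tends to zero as \<open>k\<close> grows (this divides out the null space
  of the algebraic limit); its cones are the Archimedean closures of the unions of the images of
  the cones of the \<open>V n\<close>. See \<open>operator_system_lim\<close>, \<open>lim_emb_ucp\<close> and \<open>lim_universal\<close> below
  for the universal property.
\<close>

definition conn :: "(nat \<Rightarrow> 'v \<Rightarrow> 'v) \<Rightarrow> nat \<Rightarrow> nat \<Rightarrow> 'v \<Rightarrow> 'v" where
  "conn \<phi> n k v = fold \<phi> [n..<k] v"

definition lim_emb :: "(nat \<Rightarrow> 'v osys) \<Rightarrow> (nat \<Rightarrow> 'v \<Rightarrow> 'v) \<Rightarrow> nat \<Rightarrow> 'v \<Rightarrow> (nat \<times> 'v) set" where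
  "lim_emb V \<phi> n v = {(m, w). m \<ge> 1 \<and> w \<in> carrier (V m) \<and>
     (\<forall>\<epsilon>>0. \<exists>k\<ge>max n m. norm_le (V k) (conn \<phi> n k v \<ominus>\<^bsub>V k\<^esub> conn \<phi> m k w) \<epsilon>)}"

definition lim_pre :: "(nat \<Rightarrow> 'v osys) \<Rightarrow> (nat \<Rightarrow> 'v \<Rightarrow> 'v) \<Rightarrow> (nat \<times> 'v) set osys" where
  "lim_pre V \<phi> =
     \<lparr>carrier = {lim_emb V \<phi> n v | n v. n \<ge> 1 \<and> v \<in> carrier (V n)},
      mult = undefined,
      one = lim_emb V \<phi> 1 \<one>\<^bsub>V 1\<^esub>,
      zero = lim_emb V \<phi> 1 \<zero>\<^bsub>V 1\<^esub>,
      add = (\<lambda>X Y. \<Union>(n, v)\<in>X. \<Union>(m, w)\<in>Y.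
        lim_emb V \<phi> (max n m) (conn \<phi> n (max n m) v \<oplus>\<^bsub>V (max n m)\<^esub> conn \<phi> m (max n m) w)),
      smult = (\<lambda>c X. \<Union>(n, v)\<in>X. lim_emb V \<phi> n (c \<odot>\<^bsub>V n\<^esub> v)),
      adj = (\<lambda>X. \<Union>(n, v)\<in>X. lim_emb V \<phi> n (adj (V n) v)),
      mpos = (\<lambda>l. {P. \<exists>n\<ge>1. \<exists>p\<in>mpos (V n) l. \<forall>i<l. \<forall>j<l. P i j = lim_emb V \<phi> n (p i j)})\<rparr>"

definition lim_osys :: "(nat \<Rightarrow> 'v osys) \<Rightarrow> (nat \<Rightarrow> 'v \<Rightarrow> 'v) \<Rightarrow> (nat \<times> 'v) set osys" where
  "lim_osys V \<phi> = archimedeanise (lim_pre V \<phi>)"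


section \<open>The maximal tensor product\<close>

text \<open>The algebraic tensor product is the free vector space on pairs modulo bilinearity.\<close>

definition free_fun :: "'v osys \<Rightarrow> 'w osys \<Rightarrow> ('v \<times> 'w \<Rightarrow> complex) set" where
  "free_fun S T = {f. finite {z. f z \<noteq> 0} \<and> {z. f z \<noteq> 0} \<subseteq> carrier S \<times> carrier T}"

definition free_osys :: "'v osys \<Rightarrow> 'w osys \<Rightarrow> ('v \<times> 'w \<Rightarrow> complex) osys" where
  "free_osys S T = (fun_osys (carrier S \<times> carrier T) (free_fun S T))
     \<lparr>adj := (\<lambda>f (v, w). if v \<in> carrier S \<and> w \<in> carrier T then cnj (f (adj S v, adj T w)) else 0)\<rparr>"

inductive_set bilin_null :: "'v osys \<Rightarrow> 'w osys \<Rightarrow> ('v \<times> 'w \<Rightarrow> complex) set"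
  for S :: "'v osys" and T :: "'w osys" where
  zero: "(\<lambda>_. 0) \<in> bilin_null S T"
| add: "\<lbrakk>f \<in> bilin_null S T; g \<in> bilin_null S T\<rbrakk> \<Longrightarrow> (\<lambda>z. f z + g z) \<in> bilin_null S T"
| smult: "f \<in> bilin_null S T \<Longrightarrow> (\<lambda>z. c * f z) \<in> bilin_null S T"
| add_left: "\<lbrakk>v \<in> carrier S; v' \<in> carrier S; w \<in> carrier T\<rbrakk> \<Longrightarrow>
    (\<lambda>z. indicator {(v \<oplus>\<^bsub>S\<^esub> v', w)} z - indicator {(v, w)} z - indicator {(v', w)} z) \<in> bilin_null S T"
| add_right: "\<lbrakk>v \<in> carrier S; w \<in> carrier T; w' \<in> carrier T\<rbrakk> \<Longrightarrow>
    (\<lambda>z. indicator {(v, w \<oplus>\<^bsub>T\<^esub> w')} z - indicator {(v, w)} z - indicator {(v, w')} z) \<in> bilin_null S T"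
| smult_left: "\<lbrakk>v \<in> carrier S; w \<in> carrier T\<rbrakk> \<Longrightarrow>
    (\<lambda>z. indicator {(c \<odot>\<^bsub>S\<^esub> v, w)} z - c * indicator {(v, w)} z) \<in> bilin_null S T"
| smult_right: "\<lbrakk>v \<in> carrier S; w \<in> carrier T\<rbrakk> \<Longrightarrow>
    (\<lambda>z. indicator {(v, c \<odot>\<^bsub>T\<^esub> w)} z - c * indicator {(v, w)} z) \<in> bilin_null S T"

definition tens :: "'v osys \<Rightarrow> 'w osys \<Rightarrow> 'v \<Rightarrow> 'w \<Rightarrow> ('v \<times> 'w \<Rightarrow> complex) set" where
  "tens S T v w = bilin_null S T +>\<^bsub>free_osys S T\<^esub> indicator {(v, w)}"

text \<open>The algebraic tensor product; its cones are supplied in the definition of the maximal one.\<close>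

definition alg_tensor :: "'v osys \<Rightarrow> 'w osys \<Rightarrow> ('v \<times> 'w \<Rightarrow> complex) set osys" where
  "alg_tensor S T = quot_osys (free_osys S T) (bilin_null S T) (indicator {(\<one>\<^bsub>S\<^esub>, \<one>\<^bsub>T\<^esub>)}) (\<lambda>_ _. False)"

text \<open>The matrices $\alpha (P \otimes Q) \alpha^*$, where the index set of the Kronecker product
  $P \otimes Q$ is $\{0,\dots,k-1\} \times \{0,\dots,m-1\}$.\<close>

definition tensor_cone :: "'v osys \<Rightarrow> 'w osys \<Rightarrow> nat \<Rightarrow> (nat \<Rightarrow> nat \<Rightarrow> ('v \<times> 'w \<Rightarrow> complex) set) set" where
  "tensor_cone S T n = {R. \<exists>k m. \<exists>P\<in>mpos S k. \<exists>Q\<in>mpos T m. \<exists>\<alpha> :: nat \<Rightarrow> nat \<times> nat \<Rightarrow> complex.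
     \<forall>i<n. \<forall>j<n. R i j =
       (\<Oplus>\<^bsub>alg_tensor S T\<^esub>z\<in>{..<k} \<times> {..<m}. \<Oplus>\<^bsub>alg_tensor S T\<^esub>w\<in>{..<k} \<times> {..<m}.
          (\<alpha> i z * cnj (\<alpha> j w)) \<odot>\<^bsub>alg_tensor S T\<^esub> tens S T (P (fst z) (fst w)) (Q (snd z) (snd w)))}"

definition max_tensor :: "'v osys \<Rightarrow> 'w osys \<Rightarrow> ('v \<times> 'w \<Rightarrow> complex) set osys" where
  "max_tensor S T = archimedeanise ((alg_tensor S T)\<lparr>mpos := tensor_cone S T\<rparr>)"


section \<open>Inductive families of finite sets\<close>

text \<open>
  A family \<open>X\<close> is given by the sequence \<open>d\<close> of the numbers $d_i^X \ge 1$; an element of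
  $X_n = \prod_{i<n} [d_i^X]$ is a list of length \<open>n\<close>, and $(x, i) \in X_{n+1}$ is \<open>x @ [i]\<close>.
\<close>

definition inductive_family :: "(nat \<Rightarrow> nat) \<Rightarrow> bool" where
  "inductive_family d \<longleftrightarrow> (\<forall>i. d i \<ge> 1)"

definition fam :: "(nat \<Rightarrow> nat) \<Rightarrow> nat \<Rightarrow> nat list set" where
  "fam d n = {x. length x = n \<and> (\<forall>i<n. x ! i \<in> {1..d i})}"

definition Omega :: "(nat \<Rightarrow> nat) \<Rightarrow> (nat \<Rightarrow> nat) topology" where
  "Omega d = product_topology (\<lambda>i. discrete_topology {1..d i}) UNIV"

definition mu :: "(nat \<Rightarrow> nat) \<Rightarrow> (nat \<Rightarrow> nat) measure" where
  "mu d = PiM UNIV (\<lambda>i. uniform_count_measure {1..d i})"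

definition cyl :: "(nat \<Rightarrow> nat) \<Rightarrow> nat list \<Rightarrow> (nat \<Rightarrow> nat) set" where
  "cyl d x = {\<omega> \<in> topspace (Omega d). \<forall>i<length x. \<omega> i = x ! i}"

definition fam_copr :: "(nat \<Rightarrow> nat) \<Rightarrow> (nat \<Rightarrow> nat) \<Rightarrow> nat \<Rightarrow> (nat list \<times> nat list \<Rightarrow> complex) set osys" where
  "fam_copr dX dA n = copr (fam dX n) (fam dA n)"

abbreviation fam_gen :: "(nat \<Rightarrow> nat) \<Rightarrow> (nat \<Rightarrow> nat) \<Rightarrow> nat \<Rightarrow> nat list \<Rightarrow> nat list \<Rightarrow> (nat list \<times> nat list \<Rightarrow> complex) set" where
  "fam_gen dX dA n x a \<equiv> copr_gen (fam dX n) (fam dA n) x a"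

text \<open>The map $\gamma_{X_n,A_n}$: on representing functions, $f$ goes to
  $((x,i),(a,j)) \mapsto f(x,a) / d_n^X$, so the class of the indicator function of $(x,a)$ goes to
  the average over $i$ of the sums over $j$ of the classes of the indicator functions of
  $((x,i),(a,j))$ (see \<open>fam_conn_gen\<close> and \<open>fam_conn_ucp\<close> below).\<close>

definition fam_conn :: "(nat \<Rightarrow> nat) \<Rightarrow> (nat \<Rightarrow> nat) \<Rightarrow> nat \<Rightarrow>
    (nat list \<times> nat list \<Rightarrow> complex) set \<Rightarrow> (nat list \<times> nat list \<Rightarrow> complex) set" where
  "fam_conn dX dA n F = (\<Union>f\<in>F. copr_class (fam dX (Suc n)) (fam dA (Suc n))
     (\<lambda>(x, a). if x \<in> fam dX (Suc n) \<and> a \<in> fam dA (Suc n)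
               then f (butlast x, butlast a) / of_nat (dX n) else 0))"

definition fam_lim :: "(nat \<Rightarrow> nat) \<Rightarrow> (nat \<Rightarrow> nat) \<Rightarrow> (nat \<times> (nat list \<times> nat list \<Rightarrow> complex) set) set osys" where
  "fam_lim dX dA = lim_osys (fam_copr dX dA) (fam_conn dX dA)"

definition fam_emb :: "(nat \<Rightarrow> nat) \<Rightarrow> (nat \<Rightarrow> nat) \<Rightarrow> nat \<Rightarrow>
    (nat list \<times> nat list \<Rightarrow> complex) set \<Rightarrow> (nat \<times> (nat list \<times> nat list \<Rightarrow> complex) set) set" where
  "fam_emb dX dA = lim_emb (fam_copr dX dA) (fam_conn dX dA)"


section \<open>No-signalling correlations and their states\<close>

text \<open>The C*-algebraic tensor product $C(\Omega_A) \otimes C(\Omega_B)$ is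
  $C(\Omega_A \times \Omega_B)$.\<close>

definition ns_corr :: "(nat \<Rightarrow> nat) \<Rightarrow> (nat \<Rightarrow> nat) \<Rightarrow> (nat \<Rightarrow> nat) \<Rightarrow> (nat \<Rightarrow> nat) \<Rightarrow>
    (((nat \<Rightarrow> nat) \<times> (nat \<Rightarrow> nat) \<Rightarrow> complex) \<Rightarrow> ((nat \<Rightarrow> nat) \<times> (nat \<Rightarrow> nat) \<Rightarrow> complex) set) set" where
  "ns_corr dX dY dA dB = {\<Gamma>.
     ucp (C_osys (prod_topology (Omega dA) (Omega dB))) (Linf_osys (mu dX \<Otimes>\<^sub>M mu dY)) \<Gamma> \<and>
     (\<forall>f\<in>carrier (C_osys (Omega dA)). \<exists>g\<in>Linf_fun (mu dX).
        \<Gamma> (ftensor f \<one>\<^bsub>C_osys (Omega dB)\<^esub>) = Linf_class (mu dX \<Otimes>\<^sub>M mu dY) (ftensor g (\<lambda>_. 1))) \<and>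
     (\<forall>f\<in>carrier (C_osys (Omega dB)). \<exists>g\<in>Linf_fun (mu dY).
        \<Gamma> (ftensor \<one>\<^bsub>C_osys (Omega dA)\<^esub> f) = Linf_class (mu dX \<Otimes>\<^sub>M mu dY) (ftensor (\<lambda>_. 1) g))}"

abbreviation tensor_lim where
  "tensor_lim dX dY dA dB \<equiv> max_tensor (fam_lim dX dA) (fam_lim dY dB)"

definition represents where
  "represents dX dY dA dB \<Gamma> s \<longleftrightarrow>
     (\<forall>n\<ge>1. \<forall>x\<in>fam dX n. \<forall>y\<in>fam dY n. \<forall>a\<in>fam dA n. \<forall>b\<in>fam dB n.
        s (tens (fam_lim dX dA) (fam_lim dY dB)
             (fam_emb dX dA n (fam_gen dX dA n x a)) (fam_emb dY dB n (fam_gen dY dB n y b))) =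
        of_nat (card (fam dX n)) * of_nat (card (fam dY n)) *
          pairing (mu dX \<Otimes>\<^sub>M mu dY) (ftensor (indicator (cyl dX x)) (indicator (cyl dY y)))
            (\<Gamma> (ftensor (indicator (cyl dA a)) (indicator (cyl dB b)))))"

text \<open>The state $s_\Gamma$. The elements at which \<^const>\<open>represents\<close> prescribes its values
  span the tensor product, so it is determined as a function on the carrier.\<close>

definition state_of where
  "state_of dX dY dA dB \<Gamma> = (SOME s. state (tensor_lim dX dY dA dB) s \<and> represents dX dY dA dB \<Gamma> s)"

section \<open>The constructions have their universal properties\<close>

subsection \<open>Complex vector spaces\<close>

lemma complex_ring_simps [simp]:
  "carrier complex_ring = UNIV" "a \<otimes>\<^bsub>complex_ring\<^esub> b = a * b" "\<one>\<^bsub>complex_ring\<^esub> = 1"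
  "\<zero>\<^bsub>complex_ring\<^esub> = 0" "a \<oplus>\<^bsub>complex_ring\<^esub> b = a + b"
  by (simp_all add: complex_ring_def)

lemma cring_complex_ring: "cring complex_ring"
proof (rule cringI)
  show "abelian_group complex_ring"
  proof (rule abelian_groupI)
    fix x :: complex
    show "\<exists>y\<in>carrier complex_ring. y \<oplus>\<^bsub>complex_ring\<^esub> x = \<zero>\<^bsub>complex_ring\<^esub>"
      by (rule bexI[of _ "- x"]) auto
  qed (simp_all add: add.commute add.assoc)
  show "comm_monoid complex_ring"
    by (rule comm_monoidI) (simp_all add: mult.assoc mult.commute)
qed (simp_all add: distrib_right)

lemma complex_spaceI:
  fixes V :: "'v osys" (structure)
  assumes "\<zero> \<in> carrier V"
    and "\<And>x y. \<lbrakk>x \<in> carrier V; y \<in> carrier V\<rbrakk> \<Longrightarrow> x \<oplus> y \<in> carrier V"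
    and "\<And>c x. x \<in> carrier V \<Longrightarrow> c \<odot> x \<in> carrier V"
    and "\<And>x y z. \<lbrakk>x \<in> carrier V; y \<in> carrier V; z \<in> carrier V\<rbrakk> \<Longrightarrow> (x \<oplus> y) \<oplus> z = x \<oplus> (y \<oplus> z)"
    and "\<And>x y. \<lbrakk>x \<in> carrier V; y \<in> carrier V\<rbrakk> \<Longrightarrow> x \<oplus> y = y \<oplus> x"
    and "\<And>x. x \<in> carrier V \<Longrightarrow> \<zero> \<oplus> x = x"
    and neg: "\<And>x. x \<in> carrier V \<Longrightarrow> (-1) \<odot> x \<oplus> x = \<zero>"
    and "\<And>a b x. x \<in> carrier V \<Longrightarrow> (a + b) \<odot> x = a \<odot> x \<oplus> b \<odot> x"
    and "\<And>a x y. \<lbrakk>x \<in> carrier V; y \<in> carrier V\<rbrakk> \<Longrightarrow> a \<odot> (x \<oplus> y) = a \<odot> x \<oplus> a \<odot> y"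
    and "\<And>a b x. x \<in> carrier V \<Longrightarrow> (a * b) \<odot> x = a \<odot> (b \<odot> x)"
    and "\<And>x. x \<in> carrier V \<Longrightarrow> 1 \<odot> x = x"
  shows "complex_space V"
proof (intro complex_space.intro moduleI[OF cring_complex_ring])
  show "abelian_group V"
  proof (rule abelian_groupI)
    fix x assume "x \<in> carrier V"
    then show "\<exists>y\<in>carrier V. y \<oplus> x = \<zero>"
      using assms(3) neg by (intro bexI[of _ "(-1) \<odot> x"]) simp_all
  qed (blast intro: assms)+
qed (unfold complex_ring_simps, (blast intro: assms)+)

context complex_space
begin

lemma smult_closed' [simp, intro]: "x \<in> carrier V \<Longrightarrow> c \<odot> x \<in> carrier V"
  by (rule smult_closed) auto

lemma smult_add: "x \<in> carrier V \<Longrightarrow> (a + b) \<odot> x = a \<odot> x \<oplus> b \<odot> x"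
  using smult_l_distr[of a b x] by simp

lemma smult_add_right: "\<lbrakk>x \<in> carrier V; y \<in> carrier V\<rbrakk> \<Longrightarrow> a \<odot> (x \<oplus> y) = a \<odot> x \<oplus> a \<odot> y"
  using smult_r_distr[of a x y] by simp

lemma smult_smult: "x \<in> carrier V \<Longrightarrow> a \<odot> (b \<odot> x) = (a * b) \<odot> x"
  using smult_assoc1[of a b x] by simp

lemma smult_1 [simp]: "x \<in> carrier V \<Longrightarrow> 1 \<odot> x = x"
  using smult_one[of x] by simp

lemma smult_0 [simp]: "x \<in> carrier V \<Longrightarrow> 0 \<odot> x = \<zero>"
  using smult_l_null[of x] by simp

lemma smult_zero [simp]: "c \<odot> \<zero> = \<zero>"
  using smult_r_null[of c] by simp

lemma smult_m1: "x \<in> carrier V \<Longrightarrow> (-1) \<odot> x = \<ominus> x"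
  using smult_add[of x "-1" 1] by (intro M.minus_equality[symmetric]) simp_all

lemma smult_minus: "x \<in> carrier V \<Longrightarrow> c \<odot> (\<ominus> x) = \<ominus> (c \<odot> x)"
  by (simp add: smult_m1[symmetric] smult_smult)

lemma smult_finsum:
  "f \<in> A \<rightarrow> carrier V \<Longrightarrow> c \<odot> finsum V f A = finsum V (\<lambda>a. c \<odot> f a) A"
proof (induct A rule: infinite_finite_induct)
  case (insert x F)
  then have "f \<in> F \<rightarrow> carrier V" "f x \<in> carrier V" by auto
  with insert show ?case by (simp add: smult_add_right Pi_def)
qed simp_all

lemma diff_zero_iff: "\<lbrakk>x \<in> carrier V; y \<in> carrier V\<rbrakk> \<Longrightarrow> x \<ominus> y = \<zero> \<longleftrightarrow> x = y"
  by (metis a_minus_def M.add.inv_closed M.minus_equality M.r_neg M.minus_minus)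

lemma dsum_closed:
  assumes "\<And>k l. \<lbrakk>k \<in> A; l \<in> B\<rbrakk> \<Longrightarrow> f k l \<in> carrier V"
  shows "(\<Oplus>k\<in>A. \<Oplus>l\<in>B. f k l) \<in> carrier V"
proof (rule M.finsum_closed, rule Pi_I)
  fix k assume "k \<in> A"
  then show "(\<Oplus>l\<in>B. f k l) \<in> carrier V"
    using assms by (intro M.finsum_closed Pi_I)
qed

lemma dsum_cong:
  assumes "\<And>k l. \<lbrakk>k \<in> A; l \<in> B\<rbrakk> \<Longrightarrow> g k l \<in> carrier V"
    and "\<And>k l. \<lbrakk>k \<in> A; l \<in> B\<rbrakk> \<Longrightarrow> f k l = g k l"
  shows "(\<Oplus>k\<in>A. \<Oplus>l\<in>B. f k l) = (\<Oplus>k\<in>A. \<Oplus>l\<in>B. g k l)"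
proof (rule M.finsum_cong'[OF refl])
  show "(\<lambda>k. \<Oplus>l\<in>B. g k l) \<in> A \<rightarrow> carrier V"
    using assms(1) by (intro Pi_I M.finsum_closed)
  fix k assume k: "k \<in> A"
  show "(\<Oplus>l\<in>B. f k l) = (\<Oplus>l\<in>B. g k l)"
    by (rule M.finsum_cong'[OF refl]) (use assms k in \<open>simp_all add: Pi_def\<close>)
qed

lemma dsum_add:
  assumes "\<And>k l. \<lbrakk>k \<in> A; l \<in> B\<rbrakk> \<Longrightarrow> f k l \<in> carrier V"
    and "\<And>k l. \<lbrakk>k \<in> A; l \<in> B\<rbrakk> \<Longrightarrow> g k l \<in> carrier V"
  shows "(\<Oplus>k\<in>A. \<Oplus>l\<in>B. f k l \<oplus> g k l) = (\<Oplus>k\<in>A. \<Oplus>l\<in>B. f k l) \<oplus> (\<Oplus>k\<in>A. \<Oplus>l\<in>B. g k l)"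
proof -
  have "(\<Oplus>k\<in>A. \<Oplus>l\<in>B. f k l \<oplus> g k l) = (\<Oplus>k\<in>A. (\<Oplus>l\<in>B. f k l) \<oplus> (\<Oplus>l\<in>B. g k l))"
  proof (rule M.finsum_cong'[OF refl])
    show "(\<lambda>k. (\<Oplus>l\<in>B. f k l) \<oplus> (\<Oplus>l\<in>B. g k l)) \<in> A \<rightarrow> carrier V"
      using assms by (intro Pi_I M.a_closed M.finsum_closed)
    fix k assume k: "k \<in> A"
    show "(\<Oplus>l\<in>B. f k l \<oplus> g k l) = (\<Oplus>l\<in>B. f k l) \<oplus> (\<Oplus>l\<in>B. g k l)"
      by (rule M.finsum_addf) (use assms k in \<open>simp_all add: Pi_def\<close>)
  qed
  also have "\<dots> = (\<Oplus>k\<in>A. \<Oplus>l\<in>B. f k l) \<oplus> (\<Oplus>k\<in>A. \<Oplus>l\<in>B. g k l)"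
    by (rule M.finsum_addf) (use assms in \<open>auto intro!: M.finsum_closed\<close>)
  finally show ?thesis .
qed

lemma mats_D: "\<lbrakk>P \<in> mats V m; k < m; l < m\<rbrakk> \<Longrightarrow> P k l \<in> carrier V"
  by (simp add: mats_def)

lemma compress_closed: "P \<in> mats V m \<Longrightarrow> compress V m \<alpha> P i j \<in> carrier V"
  unfolding compress_def by (rule dsum_closed) (simp add: mats_D)

lemma compress_cong:
  assumes "\<And>k l. \<lbrakk>k < m; l < m\<rbrakk> \<Longrightarrow> P k l = Q k l" "Q \<in> mats V m"
  shows "compress V m \<alpha> P = compress V m \<alpha> Q"
  unfolding compress_def by (intro ext dsum_cong) (simp_all add: assms mats_D[OF assms(2)])

lemma compress_add:
  assumes "P \<in> mats V m" "Q \<in> mats V m"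
  shows "compress V m \<alpha> (\<lambda>k l. P k l \<oplus> Q k l) i j = compress V m \<alpha> P i j \<oplus> compress V m \<alpha> Q i j"
  unfolding compress_def
  by (subst dsum_add[symmetric]) (auto simp: mats_D[OF assms(1)] mats_D[OF assms(2)] smult_add_right intro!: dsum_cong)

lemma compress_2:
  assumes "P \<in> mats V 2"
  shows "compress V 2 \<alpha> P i j =
    (\<alpha> i 0 * cnj (\<alpha> j 0)) \<odot> P 0 0 \<oplus> (\<alpha> i 0 * cnj (\<alpha> j 1)) \<odot> P 0 1 \<oplus>
    ((\<alpha> i 1 * cnj (\<alpha> j 0)) \<odot> P 1 0 \<oplus> (\<alpha> i 1 * cnj (\<alpha> j 1)) \<odot> P 1 1)"
proof -
  have [simp]: "P 0 0 \<in> carrier V" "P 0 (Suc 0) \<in> carrier V" "P (Suc 0) 0 \<in> carrier V" "P (Suc 0) (Suc 0) \<in> carrier V"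
    using assms by (auto simp: mats_def)
  have 2: "{..<2::nat} = insert 0 {1}" by auto
  show ?thesis unfolding compress_def 2 by (simp add: Pi_def)
qed

lemma compress_1:
  assumes "P 0 0 \<in> carrier V"
  shows "compress V 1 \<alpha> P i j = (\<alpha> i 0 * cnj (\<alpha> j 0)) \<odot> P 0 0"
proof -
  have 1: "{..<1::nat} = insert 0 {}" by auto
  show ?thesis unfolding compress_def 1 using assms by simp
qed

lemma compress_select:
  assumes "P \<in> mats V n" "f i < n" "f j < n"
  shows "compress V n (\<lambda>i k. if k = f i then 1 else 0) P i j = P (f i) (f j)"
proof -
  have [simp]: "P k l \<in> carrier V" if "k < n" "l < n" for k l
    using assms that by (auto simp: mats_def)
  have "compress V n (\<lambda>i k. if k = f i then 1 else 0) P i j =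
    (\<Oplus>k\<in>{..<n}. if f i = k then P k (f j) else \<zero>)"
    unfolding compress_def
  proof (intro M.finsum_cong' refl)
    fix k assume k: "k \<in> {..<n}"
    have "(\<Oplus>l\<in>{..<n}. ((if k = f i then 1 else 0) * cnj (if l = f j then 1 else 0)) \<odot> P k l) =
      (\<Oplus>l\<in>{..<n}. if f j = l then (if k = f i then P k l else \<zero>) else \<zero>)"
      using k by (intro M.finsum_cong') auto
    also have "\<dots> = (if k = f i then P k (f j) else \<zero>)"
      using M.finsum_singleton[of "f j" "{..<n}" "\<lambda>l. if k = f i then P k l else \<zero>"] k assms by auto
    finally show "(\<Oplus>l\<in>{..<n}. ((if k = f i then 1 else 0) * cnj (if l = f j then 1 else 0)) \<odot> P k l) =
      (if f i = k then P k (f j) else \<zero>)" by auto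
  qed (use assms in auto)
  also have "\<dots> = P (f i) (f j)"
    using M.finsum_singleton[of "f i" "{..<n}" "\<lambda>k. P k (f j)"] assms by auto
  finally show ?thesis .
qed

end

context
  fixes V :: "'v osys" and W :: "'w osys" and \<phi>
  assumes V: "complex_space V" and W: "complex_space W" and lin: "linear_map V W \<phi>"
begin

interpretation V: complex_space V by fact
interpretation W: complex_space W by fact

lemma linear_closed: "x \<in> carrier V \<Longrightarrow> \<phi> x \<in> carrier W"
  using lin by (auto simp: linear_map_def)

lemma linear_add: "\<lbrakk>x \<in> carrier V; y \<in> carrier V\<rbrakk> \<Longrightarrow> \<phi> (x \<oplus>\<^bsub>V\<^esub> y) = \<phi> x \<oplus>\<^bsub>W\<^esub> \<phi> y"
  using lin by (auto simp: linear_map_def)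

lemma linear_smult: "x \<in> carrier V \<Longrightarrow> \<phi> (c \<odot>\<^bsub>V\<^esub> x) = c \<odot>\<^bsub>W\<^esub> \<phi> x"
  using lin by (auto simp: linear_map_def)

lemma linear_zero: "\<phi> \<zero>\<^bsub>V\<^esub> = \<zero>\<^bsub>W\<^esub>"
  using linear_smult[of "\<zero>\<^bsub>V\<^esub>" 0] linear_closed by simp

lemma linear_minus: "x \<in> carrier V \<Longrightarrow> \<phi> (\<ominus>\<^bsub>V\<^esub> x) = \<ominus>\<^bsub>W\<^esub> \<phi> x"
  using linear_smult[of x "-1"] linear_closed by (simp add: V.smult_m1 W.smult_m1)

lemma linear_diff: "\<lbrakk>x \<in> carrier V; y \<in> carrier V\<rbrakk> \<Longrightarrow> \<phi> (x \<ominus>\<^bsub>V\<^esub> y) = \<phi> x \<ominus>\<^bsub>W\<^esub> \<phi> y"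
  by (simp add: a_minus_def linear_add linear_minus)

lemma linear_finsum:
  "f \<in> A \<rightarrow> carrier V \<Longrightarrow> \<phi> (finsum V f A) = finsum W (\<lambda>a. \<phi> (f a)) A"
proof (induct A rule: infinite_finite_induct)
  case (insert x F)
  then have "f \<in> F \<rightarrow> carrier V" "f x \<in> carrier V" by auto
  with insert show ?case by (simp add: linear_add linear_closed Pi_def)
qed (simp_all add: linear_zero)

lemma linear_compress:
  assumes "P \<in> mats V m"
  shows "\<phi> (compress V m \<alpha> P i j) = compress W m \<alpha> (\<lambda>k l. \<phi> (P k l)) i j"
proof -
  note [simp] = V.mats_D[OF assms]
  have "\<phi> (compress V m \<alpha> P i j) =
      (\<Oplus>\<^bsub>W\<^esub>k\<in>{..<m}. \<phi> (\<Oplus>\<^bsub>V\<^esub>l\<in>{..<m}. (\<alpha> i k * cnj (\<alpha> j l)) \<odot>\<^bsub>V\<^esub> P k l))"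
    unfolding compress_def by (rule linear_finsum) (intro Pi_I V.M.finsum_closed, simp)
  also have "\<dots> = (\<Oplus>\<^bsub>W\<^esub>k\<in>{..<m}. \<Oplus>\<^bsub>W\<^esub>l\<in>{..<m}. \<phi> ((\<alpha> i k * cnj (\<alpha> j l)) \<odot>\<^bsub>V\<^esub> P k l))"
    by (rule W.M.finsum_cong'[OF refl])
       (auto intro!: W.M.finsum_closed linear_closed linear_finsum)
  also have "\<dots> = compress W m \<alpha> (\<lambda>k l. \<phi> (P k l)) i j"
    unfolding compress_def by (rule W.dsum_cong) (simp_all add: linear_smult linear_closed)
  finally show ?thesis .
qed

lemma linear_shift:
  assumes "P \<in> mats V n" "\<one>\<^bsub>V\<^esub> \<in> carrier V" "\<phi> \<one>\<^bsub>V\<^esub> = \<one>\<^bsub>W\<^esub>" "i < n" "j < n"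
  shows "\<phi> (mshift V r P i j) = mshift W r (\<lambda>k l. \<phi> (P k l)) i j"
  using assms by (simp add: mshift_def mats_def linear_add linear_smult)

lemma linear_mats: "P \<in> mats V n \<Longrightarrow> (\<lambda>i j. \<phi> (P i j)) \<in> mats W n"
  by (simp add: mats_def linear_closed)

end

subsection \<open>Positive semidefinite scalar matrices\<close>

definition nn :: "complex \<Rightarrow> bool" where "nn z \<longleftrightarrow> z \<in> \<real> \<and> 0 \<le> Re z"

lemma nn_add: "nn a \<Longrightarrow> nn b \<Longrightarrow> nn (a + b)"
  by (auto simp: nn_def)

lemma nn_sum: "(\<And>x. x \<in> A \<Longrightarrow> nn (f x)) \<Longrightarrow> nn (sum f A)"
  by (induct A rule: infinite_finite_induct) (auto intro: nn_add simp: nn_def)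

lemma nn_mult: "nn a \<Longrightarrow> nn b \<Longrightarrow> nn (a * b)"
  by (auto simp: nn_def elim!: Reals_cases)

lemma nn_of_real: "0 \<le> r \<Longrightarrow> nn (of_real r)"
  by (simp add: nn_def)

lemma nn_norm: "nn (cnj z * z)" "nn (z * cnj z)"
  using nn_of_real[of "(cmod z)^2"] complex_norm_square[of z] by (simp_all add: mult.commute)

definition quad :: "nat \<Rightarrow> (nat \<Rightarrow> nat \<Rightarrow> complex) \<Rightarrow> (nat \<Rightarrow> complex) \<Rightarrow> complex" where
  "quad n M v = (\<Sum>i<n. \<Sum>j<n. cnj (v i) * M i j * v j)"

lemma psd_quad: "psd n M \<longleftrightarrow> (\<forall>v. nn (quad n M v))"
  by (simp add: psd_def nn_def quad_def)

lemma psd_cong: "(\<And>i j. \<lbrakk>i < n; j < n\<rbrakk> \<Longrightarrow> M i j = M' i j) \<Longrightarrow> psd n M \<longleftrightarrow> psd n M'"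
  unfolding psd_def by (simp cong: sum.cong_simp)

lemma quad_add: "quad n (\<lambda>i j. M i j + M' i j) v = quad n M v + quad n M' v"
  by (simp add: quad_def sum.distrib algebra_simps)

lemma psd_add: "psd n M \<Longrightarrow> psd n M' \<Longrightarrow> psd n (\<lambda>i j. M i j + M' i j)"
  by (simp add: psd_quad quad_add nn_add)

lemma psd_sum: "(\<And>a. a \<in> A \<Longrightarrow> psd n (M a)) \<Longrightarrow> psd n (\<lambda>i j. \<Sum>a\<in>A. M a i j)"
proof (induct A rule: infinite_finite_induct)
  case (insert x F)
  then show ?case using psd_add[of n "M x" "\<lambda>i j. \<Sum>a\<in>F. M a i j"] by simp
qed (simp_all add: psd_quad quad_def nn_def)

lemma psd_scale: "nn c \<Longrightarrow> psd n M \<Longrightarrow> psd n (\<lambda>i j. c * M i j)"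
proof -
  assume c: "nn c" and M: "psd n M"
  have "quad n (\<lambda>i j. c * M i j) v = c * quad n M v" for v
    by (simp add: quad_def sum_distrib_left algebra_simps)
  then show ?thesis using c M by (simp add: psd_quad nn_mult)
qed

lemma psd_diag: "(\<And>i. i < n \<Longrightarrow> nn (d i)) \<Longrightarrow> psd n (\<lambda>i j. if i = j then d i else 0)"
proof -
  assume d: "\<And>i. i < n \<Longrightarrow> nn (d i)"
  have "quad n (\<lambda>i j. if i = j then d i else 0) v = (\<Sum>i<n. (cnj (v i) * v i) * d i)" for v
  proof -
    have "(\<Sum>j<n. cnj (v i) * (if i = j then d i else 0) * v j) = (cnj (v i) * v i) * d i" if "i < n" for i
      using that by (subst sum.remove[of _ i]) (auto simp: mult_ac)
    then show ?thesis by (simp add: quad_def)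
  qed
  then show ?thesis using d by (auto simp: psd_quad intro!: nn_sum nn_mult nn_norm)
qed

lemma psd_compress:
  assumes "psd m M"
  shows "psd n (\<lambda>i j. \<Sum>k<m. \<Sum>l<m. (\<alpha> i k * cnj (\<alpha> j l)) * M k l)"
proof -
  have "quad n (\<lambda>i j. \<Sum>k<m. \<Sum>l<m. (\<alpha> i k * cnj (\<alpha> j l)) * M k l) v =
        quad m M (\<lambda>l. \<Sum>j<n. cnj (\<alpha> j l) * v j)" for v
  proof -
    have "quad m M (\<lambda>l. \<Sum>j<n. cnj (\<alpha> j l) * v j) =
      (\<Sum>k<m. \<Sum>l<m. \<Sum>i<n. \<Sum>j<n. cnj (v i) * ((\<alpha> i k * cnj (\<alpha> j l)) * M k l) * v j)"
      unfolding quad_def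
      by (simp add: sum_distrib_left sum_distrib_right mult_ac)
    also have "\<dots> = (\<Sum>k<m. \<Sum>i<n. \<Sum>l<m. \<Sum>j<n. cnj (v i) * ((\<alpha> i k * cnj (\<alpha> j l)) * M k l) * v j)"
      by (intro sum.cong refl sum.swap)
    also have "\<dots> = (\<Sum>k<m. \<Sum>i<n. \<Sum>j<n. \<Sum>l<m. cnj (v i) * ((\<alpha> i k * cnj (\<alpha> j l)) * M k l) * v j)"
      by (intro sum.cong refl sum.swap)
    also have "\<dots> = (\<Sum>i<n. \<Sum>k<m. \<Sum>j<n. \<Sum>l<m. cnj (v i) * ((\<alpha> i k * cnj (\<alpha> j l)) * M k l) * v j)"
      by (rule sum.swap)
    also have "\<dots> = (\<Sum>i<n. \<Sum>j<n. \<Sum>k<m. \<Sum>l<m. cnj (v i) * ((\<alpha> i k * cnj (\<alpha> j l)) * M k l) * v j)"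
      by (intro sum.cong refl sum.swap)
    also have "\<dots> = quad n (\<lambda>i j. \<Sum>k<m. \<Sum>l<m. (\<alpha> i k * cnj (\<alpha> j l)) * M k l) v"
      unfolding quad_def by (simp add: sum_distrib_left sum_distrib_right)
    finally show ?thesis by simp
  qed
  then show ?thesis using assms by (simp add: psd_quad)
qed

lemma quad_2:
  assumes "i < n" "j < n"
  shows "quad n M (\<lambda>k. (if k = i then a else 0) + (if k = j then b else 0)) =
    cnj a * M i i * a + cnj a * M i j * b + (cnj b * M j i * a + cnj b * M j j * b)"
proof -
  let ?w = "\<lambda>k. (if k = i then a else 0) + (if k = j then b else 0)"
  have 1: "(\<Sum>l<n. cnj (?w k) * M k l * ?w l) = cnj (?w k) * (M k i * a + M k j * b)" for k
    using assms by (simp add: distrib_left sum.distrib if_distrib[of "(*) x" for x] cong: if_cong)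
  have 2: "(\<Sum>k<n. cnj (?w k) * c k) = cnj a * c i + cnj b * c j" for c
    using assms by (simp add: distrib_right sum.distrib if_distrib[of cnj] if_distrib[of "\<lambda>x. x * y" for y] cong: if_cong)
  show ?thesis unfolding quad_def 1 2 by (simp add: algebra_simps)
qed

lemma psd_hermitian:
  assumes "psd n M" "i < n" "j < n"
  shows "M j i = cnj (M i j)"
proof -
  have q: "nn (cnj a * M i i * a + cnj a * M i j * b + (cnj b * M j i * a + cnj b * M j j * b))" for a b
    unfolding quad_2[OF assms(2,3), of M a b, symmetric] using assms(1) by (simp only: psd_quad)
  have "Im (M i i) = 0" "Im (M j j) = 0"
    using q[of 1 0] q[of 0 1] by (auto simp: nn_def complex_is_Real_iff)
  moreover have "Im (M i j) + Im (M j i) = 0"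
    using q[of 1 1] calculation by (auto simp: nn_def complex_is_Real_iff)
  moreover have "Re (M i j) = Re (M j i)"
    using q[of 1 \<i>] calculation by (auto simp: nn_def complex_is_Real_iff)
  ultimately show ?thesis by (auto simp: complex_eq_iff)
qed

lemma psd_order_unit:
  assumes "\<And>i j. \<lbrakk>i < n; j < n\<rbrakk> \<Longrightarrow> M j i = cnj (M i j)"
    and r: "(\<Sum>i<n. \<Sum>j<n. cmod (M i j)) \<le> r"
  shows "psd n (\<lambda>i j. M i j + (if i = j then of_real r else 0))"
  unfolding psd_quad
proof
  fix v
  define N where "N = (\<Sum>i<n. (cmod (v i))\<^sup>2)"
  have "quad n (\<lambda>i j. if i = j then of_real r else 0) v = of_real (r * N)"
  proof -
    have "(\<Sum>j<n. cnj (v i) * (if i = j then of_real r else 0) * v j) = of_real (r * (cmod (v i))\<^sup>2)" if "i < n" for i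
      using that by (subst sum.remove[of _ i]) (auto simp: mult_ac complex_norm_square simp del: of_real_power)
    then show ?thesis by (simp add: quad_def N_def sum_distrib_left)
  qed
  then have e: "quad n (\<lambda>i j. M i j + (if i = j then of_real r else 0)) v = quad n M v + of_real (r * N)"
    by (simp add: quad_add)
  have "cnj (quad n M v) = (\<Sum>i<n. \<Sum>j<n. cnj (v j) * cnj (M i j) * v i)"
    by (simp add: quad_def mult_ac)
  also have "\<dots> = (\<Sum>i<n. \<Sum>j<n. cnj (v j) * M j i * v i)"
    by (intro sum.cong refl) (simp only: assms(1)[symmetric] lessThan_iff)
  also have "\<dots> = quad n M v"
    unfolding quad_def by (rule sum.swap)
  finally have real: "quad n M v \<in> \<real>" by (simp add: Reals_cnj_iff)
  have "cmod (quad n M v) \<le> (\<Sum>i<n. \<Sum>j<n. cmod (M i j) * N)"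
    unfolding quad_def
  proof (intro order_trans[OF norm_sum] sum_mono)
    fix i j assume ij: "i \<in> {..<n}" "j \<in> {..<n}"
    have le: "(cmod (v k))\<^sup>2 \<le> N" if "k < n" for k
      unfolding N_def using that by (intro member_le_sum) auto
    have N: "0 \<le> N" by (simp add: N_def sum_nonneg)
    have "cmod (v i) * cmod (v j) \<le> sqrt N * sqrt N"
      using le ij N by (intro mult_mono) (auto intro!: real_le_rsqrt)
    then show "cmod (cnj (v i) * M i j * v j) \<le> cmod (M i j) * N"
      using N mult_left_mono[of "cmod (v i) * cmod (v j)" N "cmod (M i j)"] by (simp add: norm_mult mult_ac)
  qed
  also have "\<dots> = (\<Sum>i<n. \<Sum>j<n. cmod (M i j)) * N"
    by (simp add: sum_distrib_right)
  also have "\<dots> \<le> r * N"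
    using r by (intro mult_right_mono) (auto simp: N_def sum_nonneg)
  finally have "- (r * N) \<le> Re (quad n M v)"
    using abs_Re_le_cmod[of "quad n M v"] by linarith
  then show "nn (quad n (\<lambda>i j. M i j + (if i = j then of_real r else 0)) v)"
    using real by (simp add: e nn_def)
qed

lemma psd_bound:
  assumes "psd n (\<lambda>i j. M i j + (if i = j then of_real \<epsilon> else 0))"
    and "psd n (\<lambda>i j. - M i j + (if i = j then of_real \<epsilon> else 0))" "i < n" "j < n"
  shows "cmod (M i j) \<le> 6 * \<epsilon>"
proof -
  have q: "\<bar>Re (cnj a * M i i * a + cnj a * M i j * b + (cnj b * M j i * a + cnj b * M j j * b))\<bar>
     \<le> Re (cnj a * \<epsilon> * a + cnj a * (if i = j then \<epsilon> else 0) * b + (cnj b * (if i = j then \<epsilon> else 0) * a + cnj b * \<epsilon> * b))" for a b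
    using assms(1,2)[unfolded psd_quad, rule_format, of "\<lambda>k. (if k = i then a else 0) + (if k = j then b else 0)"]
    unfolding quad_2[OF assms(3,4)]
    by (auto simp: nn_def algebra_simps split: if_splits)
  have h: "M j i = cnj (M i j)" if "i \<noteq> j"
    using psd_hermitian[OF assms(1,3,4)] that by simp
  have im: "Im (M i i) = 0"
    using psd_hermitian[OF assms(1,3,3)] by (simp add: complex_eq_iff)
  have 0: "0 \<le> \<epsilon>" "\<bar>Re (M i i)\<bar> \<le> \<epsilon>" "\<bar>Re (M j j)\<bar> \<le> \<epsilon>"
    using q[of 1 0] q[of 0 1] by (auto split: if_splits)
  show ?thesis
  proof (cases "i = j")
    case True
    then show ?thesis using 0 im cmod_le[of "M i j"] by simp
  next
    case False
    have "\<bar>2 * Re (M i j)\<bar> \<le> 4 * \<epsilon>"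
      using q[of 1 1] h 0 False by simp
    moreover have "\<bar>2 * Im (M i j)\<bar> \<le> 4 * \<epsilon>"
      using q[of 1 \<i>] h 0 False by simp
    ultimately show ?thesis using cmod_le[of "M i j"] 0 by linarith
  qed
qed


subsection \<open>Function systems\<close>

definition fun_space :: "('k \<Rightarrow> complex) set \<Rightarrow> bool" where
  "fun_space F \<longleftrightarrow> (\<lambda>_. 0) \<in> F \<and> (\<forall>f\<in>F. \<forall>g\<in>F. (\<lambda>x. f x + g x) \<in> F) \<and> (\<forall>c. \<forall>f\<in>F. (\<lambda>x. c * f x) \<in> F)"

lemma fun_osys_simps [simp]:
  "carrier (fun_osys K F) = F" "\<one>\<^bsub>fun_osys K F\<^esub> = indicator K" "\<zero>\<^bsub>fun_osys K F\<^esub> = (\<lambda>_. 0)"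
  "f \<oplus>\<^bsub>fun_osys K F\<^esub> g = (\<lambda>x. f x + g x)" "c \<odot>\<^bsub>fun_osys K F\<^esub> f = (\<lambda>x. c * f x)"
  "adj (fun_osys K F) f = (\<lambda>x. cnj (f x))"
  "mpos (fun_osys K F) n = {P. (\<forall>i<n. \<forall>j<n. P i j \<in> F) \<and> (\<forall>x\<in>K. psd n (\<lambda>i j. P i j x))}"
  by (simp_all add: fun_osys_def)

lemma complex_space_fun: "fun_space F \<Longrightarrow> complex_space (fun_osys K F)"
  by (rule complex_spaceI) (auto simp: fun_space_def algebra_simps)

lemma fun_minus: 
  assumes "fun_space F" "f \<in> F"
  shows "\<ominus>\<^bsub>fun_osys K F\<^esub> f = (\<lambda>x. - f x)"
  using complex_space.smult_m1[OF complex_space_fun[OF assms(1)], of f K] assms(2) by simp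

lemma fun_diff:
  assumes "fun_space F" "f \<in> F" "g \<in> F"
  shows "f \<ominus>\<^bsub>fun_osys K F\<^esub> g = (\<lambda>x. f x - g x)"
  using assms by (simp add: a_minus_def fun_minus)

lemma fun_finsum:
  assumes F: "fun_space F" and "finite A" "\<And>a. a \<in> A \<Longrightarrow> f a \<in> F"
  shows "finsum (fun_osys K F) f A = (\<lambda>x. \<Sum>a\<in>A. f a x) \<and> (\<lambda>x. \<Sum>a\<in>A. f a x) \<in> F"
proof -
  interpret complex_space "fun_osys K F" by (rule complex_space_fun[OF F])
  show ?thesis using assms(2,3)
  proof (induct A)
    case empty
    then show ?case using F by (simp add: fun_space_def)
  next
    case (insert a A)
    then have "f \<in> A \<rightarrow> carrier (fun_osys K F)" "f a \<in> carrier (fun_osys K F)" by auto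
    with insert show ?case using F by (simp add: fun_space_def)
  qed
qed

lemma fun_compress:
  assumes F: "fun_space F" and P: "P \<in> mats (fun_osys K F) m"
  shows "compress (fun_osys K F) m \<alpha> P i j = (\<lambda>x. \<Sum>k<m. \<Sum>l<m. (\<alpha> i k * cnj (\<alpha> j l)) * P k l x)"
proof -
  interpret complex_space "fun_osys K F" by (rule complex_space_fun[OF F])
  note P' = mats_D[OF P]
  have in_: "(\<lambda>x. (\<alpha> i k * cnj (\<alpha> j l)) * P k l x) \<in> F" if "k < m" "l < m" for k l
    using P'[OF that] F by (simp add: fun_space_def)
  have 1: "(\<Oplus>\<^bsub>fun_osys K F\<^esub>l\<in>{..<m}. (\<alpha> i k * cnj (\<alpha> j l)) \<odot>\<^bsub>fun_osys K F\<^esub> P k l) =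
      (\<lambda>x. \<Sum>l<m. (\<alpha> i k * cnj (\<alpha> j l)) * P k l x) \<and> (\<lambda>x. \<Sum>l<m. (\<alpha> i k * cnj (\<alpha> j l)) * P k l x) \<in> F"
    if "k < m" for k
    using fun_finsum[OF F, of "{..<m}" "\<lambda>l. (\<lambda>x. (\<alpha> i k * cnj (\<alpha> j l)) * P k l x)" K] in_ that by auto
  have "compress (fun_osys K F) m \<alpha> P i j =
     (\<Oplus>\<^bsub>fun_osys K F\<^esub>k\<in>{..<m}. (\<lambda>x. \<Sum>l<m. (\<alpha> i k * cnj (\<alpha> j l)) * P k l x))"
    unfolding compress_def by (rule M.finsum_cong'[OF refl]) (use 1 in auto)
  also have "\<dots> = (\<lambda>x. \<Sum>k<m. \<Sum>l<m. (\<alpha> i k * cnj (\<alpha> j l)) * P k l x)"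
    using fun_finsum[OF F, of "{..<m}" "\<lambda>k. (\<lambda>x. \<Sum>l<m. (\<alpha> i k * cnj (\<alpha> j l)) * P k l x)" K] 1 by auto
  finally show ?thesis .
qed


subsection \<open>Quotients\<close>

lemma (in complex_space) quotient:
  fixes C :: "nat \<Rightarrow> (nat \<Rightarrow> nat \<Rightarrow> 'v) \<Rightarrow> bool"
  assumes N: "submodule N complex_ring V"
    and adj_closed: "\<And>x. x \<in> carrier V \<Longrightarrow> adj V x \<in> carrier V"
    and adj_add: "\<And>x y. \<lbrakk>x \<in> carrier V; y \<in> carrier V\<rbrakk> \<Longrightarrow> adj V (x \<oplus> y) = adj V x \<oplus> adj V y"
    and adj_N: "\<And>x. x \<in> N \<Longrightarrow> adj V x \<in> N"
    and u: "u \<in> carrier V"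
  defines "W \<equiv> quot_osys V N u C"
  shows "complex_space W" "linear_map V W (\<lambda>x. N +> x)" "carrier W = (\<lambda>x. N +> x) ` carrier V"
    "\<one>\<^bsub>W\<^esub> = N +> u"
    "\<And>x. x \<in> carrier V \<Longrightarrow> adj W (N +> x) = N +> adj V x"
    "\<And>x y. \<lbrakk>x \<in> carrier V; y \<in> carrier V\<rbrakk> \<Longrightarrow> N +> x = N +> y \<longleftrightarrow> x \<ominus> y \<in> N"
    "\<And>x. x \<in> carrier V \<Longrightarrow> x \<in> N +> x"
    "\<And>x y. \<lbrakk>x \<in> carrier V; y \<in> N +> x\<rbrakk> \<Longrightarrow> y \<in> carrier V \<and> N +> y = N +> x"
proof -
  interpret N: abelian_subgroup N V
    by (rule abelian_subgroupI3) (use N in \<open>auto simp: additive_subgroup_def submodule_def intro: M.abelian_group_axioms\<close>)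
  have smult_N: "c \<odot> x \<in> N" if "x \<in> N" for c x
    using submodule.smult_closed[OF N, of c x] that by simp
  have mem: "y \<in> N +> x \<longleftrightarrow> y \<in> carrier V \<and> y \<ominus> x \<in> N" if "x \<in> carrier V" for x y
    using N.a_elemrcos_carrier[OF that] N.a_rcos_module[OF that, of y] by (auto simp: a_minus_def)
  show eq: "N +> x = N +> y \<longleftrightarrow> x \<ominus> y \<in> N" if "x \<in> carrier V" "y \<in> carrier V" for x y
  proof
    assume "N +> x = N +> y"
    then show "x \<ominus> y \<in> N" using N.a_rcos_self[OF that(1)] mem[OF that(2), of x] by auto
  next
    assume "x \<ominus> y \<in> N"
    then have "x \<in> N +> y" using mem[OF that(2), of x] that by auto
    then show "N +> x = N +> y" using N.a_repr_independence' that by blast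
  qed
  show self: "x \<in> N +> x" if "x \<in> carrier V" for x using N.a_rcos_self[OF that] .
  show rep: "y \<in> carrier V \<and> N +> y = N +> x" if "x \<in> carrier V" "y \<in> N +> x" for x y
    using that mem N.a_repr_independence'[OF that(2,1)] by auto
  show car: "carrier W = (\<lambda>x. N +> x) ` carrier V"
    by (auto simp: W_def quot_osys_def A_RCOSETS_def')
  show "\<one>\<^bsub>W\<^esub> = N +> u" by (simp add: W_def quot_osys_def)
  have zero: "\<zero>\<^bsub>W\<^esub> = N +> \<zero>"
    using N.a_subset by (simp add: W_def quot_osys_def)
  have add: "(N +> x) \<oplus>\<^bsub>W\<^esub> (N +> y) = N +> (x \<oplus> y)" if "x \<in> carrier V" "y \<in> carrier V" for x y
    using that by (simp add: W_def quot_osys_def N.a_rcos_sum)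
  have smult: "c \<odot>\<^bsub>W\<^esub> (N +> x) = N +> (c \<odot> x)" if x: "x \<in> carrier V" for c x
  proof -
    have "N +> (c \<odot> y) = N +> (c \<odot> x)" if y: "y \<in> N +> x" for y
    proof -
      have yc: "y \<in> carrier V" "y \<ominus> x \<in> N" using y mem[OF x] by auto
      then have "c \<odot> (y \<ominus> x) \<in> N" by (intro smult_N)
      then have "c \<odot> y \<ominus> c \<odot> x \<in> N" using yc x by (simp add: a_minus_def smult_add_right smult_minus)
      then show ?thesis using eq[of "c \<odot> y" "c \<odot> x"] yc x by simp
    qed
    then have "(\<Union>y\<in>N +> x. N +> (c \<odot> y)) = N +> (c \<odot> x)"
      by (intro UN_constant_eq[OF self[OF x]] ballI)
    then show ?thesis by (simp add: W_def quot_osys_def)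
  qed
  have adj_minus: "adj V (\<ominus> x) = \<ominus> adj V x" if "x \<in> carrier V" for x
  proof -
    have 0: "adj V \<zero> = \<zero>"
    proof -
      have "adj V \<zero> \<oplus> adj V \<zero> = adj V \<zero>" using adj_add[of \<zero> \<zero>] by simp
      then show ?thesis using adj_closed[of \<zero>] by (metis M.add.r_cancel_one' M.zero_closed)
    qed
    have "adj V (\<ominus> x) \<oplus> adj V x = \<zero>"
      using adj_add[of "\<ominus> x" x] that 0 by (simp add: M.l_neg)
    then show ?thesis using adj_closed that by (intro M.minus_equality[symmetric]) auto
  qed
  show "adj W (N +> x) = N +> adj V x" if x: "x \<in> carrier V" for x
  proof -
    have "N +> adj V y = N +> adj V x" if y: "y \<in> N +> x" for y
    proof -
      have yc: "y \<in> carrier V" "y \<ominus> x \<in> N" using y mem[OF x] by auto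
      then have "adj V (y \<ominus> x) \<in> N" by (intro adj_N)
      then have "adj V y \<ominus> adj V x \<in> N" using yc x by (simp add: a_minus_def adj_add adj_minus)
      then show ?thesis using eq[of "adj V y" "adj V x"] yc x adj_closed by simp
    qed
    then have "(\<Union>y\<in>N +> x. N +> adj V y) = N +> adj V x"
      by (intro UN_constant_eq[OF self[OF x]] ballI)
    then show ?thesis by (simp add: W_def quot_osys_def)
  qed
  show lin: "linear_map V W (\<lambda>x. N +> x)"
    unfolding linear_map_def by (auto simp: car add smult)
  show "complex_space W"
  proof (rule complex_spaceI)
    show "(-1) \<odot>\<^bsub>W\<^esub> x \<oplus>\<^bsub>W\<^esub> x = \<zero>\<^bsub>W\<^esub>" if "x \<in> carrier W" for x
      using that by (auto simp: car zero add smult smult_m1 M.l_neg)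
    show "x \<oplus>\<^bsub>W\<^esub> y = y \<oplus>\<^bsub>W\<^esub> x" if "x \<in> carrier W" "y \<in> carrier W" for x y
      using that M.a_comm by (auto simp: car add)
  qed (auto simp: car zero add smult smult_add smult_add_right smult_smult M.a_assoc)
qed

lemma psd_archimedean:
  assumes "\<And>\<epsilon>. \<epsilon> > 0 \<Longrightarrow> psd n (\<lambda>i j. M i j + (if i = j then of_real \<epsilon> else 0))"
  shows "psd n M"
  unfolding psd_quad
proof
  fix v
  define N where "N = quad n (\<lambda>i j. if i = j then 1 else 0) v"
  have e: "quad n (\<lambda>i j. M i j + (if i = j then of_real \<epsilon> else 0)) v = quad n M v + of_real \<epsilon> * N" for \<epsilon>
  proof -
    have "(\<lambda>i j. M i j + (if i = j then of_real \<epsilon> else 0)) = (\<lambda>i j. M i j + of_real \<epsilon> * (if i = j then 1 else 0))"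
      by (intro ext) simp
    then show ?thesis
      by (simp only: quad_add N_def) (simp add: quad_def sum_distrib_left mult_ac)
  qed
  have "psd n (\<lambda>i j. if i = j then 1 else 0)"
    by (rule psd_diag) (simp add: nn_def)
  then have N: "nn N" by (simp add: N_def psd_quad)
  have *: "nn (quad n M v + of_real \<epsilon> * N)" if "\<epsilon> > 0" for \<epsilon>
    using assms[OF that] unfolding psd_quad e[symmetric] by blast
  have "Im (quad n M v) = 0"
    using *[of 1] N by (simp add: nn_def complex_is_Real_iff)
  have le: "- Re (quad n M v) \<le> \<epsilon> * Re N" if "\<epsilon> > 0" for \<epsilon>
    using *[OF that] N by (simp add: nn_def complex_is_Real_iff)
  have "- Re (quad n M v) \<le> 0"
  proof (rule field_le_epsilon)
    fix e :: real assume "0 < e"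
    have "Re N \<ge> 0" using N by (simp add: nn_def)
    then have "e / (Re N + 1) * Re N \<le> e" using \<open>0 < e\<close> by (simp add: field_simps)
    then show "- Re (quad n M v) \<le> 0 + e"
      using le[of "e / (Re N + 1)"] \<open>0 < e\<close> \<open>Re N \<ge> 0\<close> by simp
  qed
  then show "nn (quad n M v)" using \<open>Im (quad n M v) = 0\<close> by (simp add: nn_def complex_is_Real_iff)
qed

subsection \<open>Archimedean closure\<close>

context complex_space
begin

lemma compress_scaled:
  assumes "P \<in> mats V n" "f i < n" "f j < n"
  shows "compress V n (\<lambda>i k. if k = f i then c i else 0) P i j = (c i * cnj (c j)) \<odot> P (f i) (f j)"
proof -
  note [simp] = mats_D[OF assms(1)]
  have "compress V n (\<lambda>i k. if k = f i then c i else 0) P i j =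
    (\<Oplus>k\<in>{..<n}. if f i = k then (c i * cnj (c j)) \<odot> P k (f j) else \<zero>)"
    unfolding compress_def
  proof (rule M.finsum_cong'[OF refl])
    fix k assume k: "k \<in> {..<n}"
    have "(\<Oplus>l\<in>{..<n}. ((if k = f i then c i else 0) * cnj (if l = f j then c j else 0)) \<odot> P k l) =
      (\<Oplus>l\<in>{..<n}. if f j = l then (if f i = k then (c i * cnj (c j)) \<odot> P k l else \<zero>) else \<zero>)"
      using k by (intro M.finsum_cong'[OF refl]) auto
    also have "\<dots> = (if f i = k then (c i * cnj (c j)) \<odot> P k (f j) else \<zero>)"
      using M.finsum_singleton[of "f j" "{..<n}" "\<lambda>l. if f i = k then (c i * cnj (c j)) \<odot> P k l else \<zero>"] k assms by auto
    finally show "(\<Oplus>l\<in>{..<n}. ((if k = f i then c i else 0) * cnj (if l = f j then c j else 0)) \<odot> P k l) =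
      (if f i = k then (c i * cnj (c j)) \<odot> P k (f j) else \<zero>)" .
  qed (use assms in auto)
  also have "\<dots> = (c i * cnj (c j)) \<odot> P (f i) (f j)"
    using M.finsum_singleton[of "f i" "{..<n}" "\<lambda>k. (c i * cnj (c j)) \<odot> P k (f j)"] assms by auto
  finally show ?thesis .
qed

lemma finsum_smult_left:
  "\<lbrakk>finite A; x \<in> carrier V\<rbrakk> \<Longrightarrow> (\<Oplus>a\<in>A. c a \<odot> x) = (\<Sum>a\<in>A. c a) \<odot> x"
  by (induct A rule: finite_induct) (simp_all add: smult_add Pi_def)

end

context matrix_ordered
begin

lemma mpos_scale:
  assumes "P \<in> mpos V n" "0 \<le> r"
  shows "(\<lambda>i j. of_real r \<odot> P i j) \<in> mpos V n"
proof -
  have "compress V n (\<lambda>i k. if k = i then of_real (sqrt r) else 0) P \<in> mpos V n"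
    by (rule mpos_compress) fact
  then show ?thesis
  proof (rule mpos_cong)
    fix i j assume that: "i < n" "j < n"
    show "of_real r \<odot> P i j = compress V n (\<lambda>i k. if k = i then of_real (sqrt r) else 0) P i j"
    using compress_scaled[OF mpos_mats[OF assms(1)], of "\<lambda>i. i" i j "\<lambda>_. of_real (sqrt r)"] that assms(2)
    by (simp flip: of_real_mult)
  qed
qed

lemma mpos_zero: "(\<lambda>i j. \<zero>) \<in> mpos V n"
proof -
  have "(\<lambda>i j. \<zero>) \<in> mats V n" "hermitian V n (\<lambda>i j. \<zero>)"
    using adj_smult[of \<zero> 0] by (auto simp: mats_def hermitian_def adj_closed)
  from order_unit[OF this] obtain r where "mshift V r (\<lambda>i j. \<zero>) \<in> mpos V n" by auto
  from mpos_scale[OF this, of 0] show ?thesis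
    by (rule mpos_cong) (auto simp: mshift_def unit_closed)
qed

lemma mpos_unit:
  assumes "0 \<le> r" shows "mshift V r (\<lambda>i j. \<zero>) \<in> mpos V n"
proof -
  have "(\<lambda>i j. \<zero>) \<in> mats V n" "hermitian V n (\<lambda>i j. \<zero>)"
    using adj_smult[of \<zero> 0] by (auto simp: mats_def hermitian_def adj_closed)
  from order_unit[OF this] obtain s where s: "s > 0" "mshift V s (\<lambda>i j. \<zero>) \<in> mpos V n" by auto
  from mpos_scale[OF s(2), of "r / s"] show ?thesis
    by (rule mpos_cong) (use s assms in \<open>auto simp: mshift_def unit_closed smult_smult\<close>)
qed

lemma shift_mats: "P \<in> mats V n \<Longrightarrow> mshift V r P \<in> mats V n"
  by (auto simp: mshift_def mats_def unit_closed)

lemma shift_shift: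
  assumes "P \<in> mats V n" "i < n" "j < n"
  shows "mshift V r (mshift V s P) i j = mshift V (r + s) P i j"
  using mats_D[OF assms] by (auto simp: mshift_def unit_closed smult_add M.a_ac)

lemma mpos_shift:
  assumes "P \<in> mpos V n" "0 \<le> r" shows "mshift V r P \<in> mpos V n"
proof -
  from mpos_add[OF assms(1) mpos_unit[OF assms(2)]] show ?thesis
    by (rule mpos_cong) (use mats_D[OF mpos_mats[OF assms(1)]] in \<open>auto simp: mshift_def unit_closed\<close>)
qed

lemma mpos_finsum:
  "\<lbrakk>finite A; \<And>a. a \<in> A \<Longrightarrow> P a \<in> mpos V n\<rbrakk> \<Longrightarrow> (\<lambda>i j. \<Oplus>a\<in>A. P a i j) \<in> mpos V n"
proof (induct A rule: finite_induct)
  case empty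
  then show ?case by (simp add: mpos_zero)
next
  case (insert x F)
  then have "(\<lambda>i j. P x i j \<oplus> (\<Oplus>a\<in>F. P a i j)) \<in> mpos V n" by (intro mpos_add) auto
  then show ?case
  proof (rule mpos_cong)
    fix i j assume "i < n" "j < n"
    then have "P a i j \<in> carrier V" if "a \<in> insert x F" for a
      using insert.prems[OF that] mpos_mats mats_D by blast
    then show "(\<Oplus>a\<in>insert x F. P a i j) = P x i j \<oplus> (\<Oplus>a\<in>F. P a i j)"
      using insert(1,2) by (simp add: Pi_def)
  qed
qed

lemma compress_shift:
  assumes P: "P \<in> mats V m"
  shows "compress V m \<alpha> (mshift V r P) i j =
    compress V m \<alpha> P i j \<oplus> (of_real r * (\<Sum>k<m. \<alpha> i k * cnj (\<alpha> j k))) \<odot> \<one>"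
proof -
  let ?D = "\<lambda>k l. if k = l then of_real r \<odot> \<one> else \<zero>"
  have D: "?D \<in> mats V m" by (simp add: mats_def unit_closed)
  have "compress V m \<alpha> (mshift V r P) = compress V m \<alpha> (\<lambda>k l. P k l \<oplus> ?D k l)"
    by (rule compress_cong) (use P D in \<open>auto simp: mshift_def mats_def unit_closed\<close>)
  moreover have "compress V m \<alpha> ?D i j = (\<Oplus>k\<in>{..<m}. (of_real r * (\<alpha> i k * cnj (\<alpha> j k))) \<odot> \<one>)"
    unfolding compress_def
  proof (rule M.finsum_cong'[OF refl])
    fix k assume k: "k \<in> {..<m}"
    have "(\<Oplus>l\<in>{..<m}. (\<alpha> i k * cnj (\<alpha> j l)) \<odot> ?D k l) =
      (\<Oplus>l\<in>{..<m}. if k = l then (of_real r * (\<alpha> i k * cnj (\<alpha> j l))) \<odot> \<one> else \<zero>)"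
      by (rule M.finsum_cong'[OF refl]) (auto simp: unit_closed smult_smult mult_ac)
    also have "\<dots> = (of_real r * (\<alpha> i k * cnj (\<alpha> j k))) \<odot> \<one>"
      using M.finsum_singleton[of k "{..<m}" "\<lambda>l. (of_real r * (\<alpha> i k * cnj (\<alpha> j l))) \<odot> \<one>"] k unit_closed by auto
    finally show "(\<Oplus>l\<in>{..<m}. (\<alpha> i k * cnj (\<alpha> j l)) \<odot> ?D k l) = (of_real r * (\<alpha> i k * cnj (\<alpha> j k))) \<odot> \<one>" .
  qed (auto simp: unit_closed)
  ultimately show ?thesis
    using compress_add[OF P D, of \<alpha> i j]
    by (simp add: finsum_smult_left unit_closed sum_distrib_left)
qed

end

lemma archimedeanise_simps [simp]:
  "carrier (archimedeanise V) = carrier V" "\<one>\<^bsub>archimedeanise V\<^esub> = \<one>\<^bsub>V\<^esub>" "\<zero>\<^bsub>archimedeanise V\<^esub> = \<zero>\<^bsub>V\<^esub>"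
  "add (archimedeanise V) = add V" "smult (archimedeanise V) = smult V" "adj (archimedeanise V) = adj V"
  "mats (archimedeanise V) = mats V" "hermitian (archimedeanise V) = hermitian V"
  "finsum (archimedeanise V) = finsum V" "a_inv (archimedeanise V) = a_inv V"
  "compress (archimedeanise V) = compress V" "mshift (archimedeanise V) = mshift V"
  "mpos (archimedeanise V) n = {P \<in> mats V n. \<forall>\<epsilon>>0. mshift V \<epsilon> P \<in> mpos V n}"
  by (auto simp: archimedeanise_def mats_def hermitian_def compress_def mshift_def finsum_def a_inv_def fun_eq_iff)

lemma linear_map_archimedeanise [simp]:
  "linear_map (archimedeanise V) W \<phi> \<longleftrightarrow> linear_map V W \<phi>"
  "linear_map V (archimedeanise W) \<phi> \<longleftrightarrow> linear_map V W \<phi>"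
  by (simp_all add: linear_map_def)

lemma complex_space_archimedeanise:
  assumes "complex_space V" shows "complex_space (archimedeanise V)"
proof -
  interpret complex_space V by fact
  show ?thesis
    by (rule complex_spaceI)
      (auto simp: smult_add smult_add_right smult_smult smult_m1 M.a_assoc M.l_neg intro: M.a_comm)
qed

lemma mpos_archimedeanise:
  assumes "matrix_ordered V" "P \<in> mpos V n" shows "P \<in> mpos (archimedeanise V) n"
  using assms matrix_ordered.mpos_shift[OF assms, of \<epsilon> for \<epsilon>] matrix_ordered.mpos_mats[OF assms] by auto

lemma operator_system_archimedeanise:
  fixes V :: "'v osys" (structure)
  assumes "matrix_ordered V"
    and proper: "\<And>P n i j. \<lbrakk>P \<in> mats V n; \<And>\<epsilon>. \<epsilon> > 0 \<Longrightarrow> mshift V \<epsilon> P \<in> mpos V n;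
       \<And>\<epsilon>. \<epsilon> > 0 \<Longrightarrow> mshift V \<epsilon> (\<lambda>i j. \<ominus>\<^bsub>V\<^esub> P i j) \<in> mpos V n; i < n; j < n\<rbrakk> \<Longrightarrow> P i j = \<zero>\<^bsub>V\<^esub>"
  shows "operator_system (archimedeanise V)"
proof -
  interpret matrix_ordered V by fact
  show ?thesis
  proof (intro operator_system.intro matrix_ordered.intro matrix_ordered_axioms.intro
      operator_system_axioms.intro complex_space_archimedeanise complex_space_axioms; (unfold archimedeanise_simps)?)
    show "\<one> \<in> carrier V" by (rule unit_closed)
    fix P Q n
    show "hermitian V n P" if P: "P \<in> {P \<in> mats V n. \<forall>\<epsilon>>0. mshift V \<epsilon> P \<in> mpos V n}"
      unfolding hermitian_def
    proof (intro allI impI)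
      fix i j assume ij: "i < n" "j < n"
      have h: "hermitian V n (mshift V 1 P)" using P mpos_hermitian by auto
      have c: "P k l \<in> carrier V" if "k < n" "l < n" for k l using P that by (auto simp: mats_def)
      show "P j i = adj V (P i j)"
      proof (cases "i = j")
        case True
        have "P i i \<oplus> \<one> = adj V (P i i) \<oplus> \<one>"
        proof -
          have "mshift V 1 P i i = adj V (mshift V 1 P i i)"
            using h ij unfolding hermitian_def by blast
          then show ?thesis using ij c unit_closed by (simp add: mshift_def adj_add adj_unit)
        qed
        then have "P i i = adj V (P i i)"
          using c ij unit_closed adj_closed M.add.right_cancel by blast
        then show ?thesis using True by simp
      next
        case False
        have "mshift V 1 P j i = adj V (mshift V 1 P i j)"
          using h ij unfolding hermitian_def by blast
        then show ?thesis using False by (simp add: mshift_def)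
      qed
    qed
    show "Q \<in> {P \<in> mats V n. \<forall>\<epsilon>>0. mshift V \<epsilon> P \<in> mpos V n}"
      if P: "P \<in> {P \<in> mats V n. \<forall>\<epsilon>>0. mshift V \<epsilon> P \<in> mpos V n}" and "\<And>i j. \<lbrakk>i < n; j < n\<rbrakk> \<Longrightarrow> Q i j = P i j"
    proof -
      have "mshift V \<epsilon> Q \<in> mpos V n" if "\<epsilon> > 0" for \<epsilon>
        by (rule mpos_cong[of "mshift V \<epsilon> P"]) (use that P \<open>\<And>i j. \<lbrakk>i < n; j < n\<rbrakk> \<Longrightarrow> Q i j = P i j\<close> in \<open>auto simp: mshift_def\<close>)
      then show ?thesis using that by (auto simp: mats_def)
    qed
    show "(\<lambda>i j. P i j \<oplus> Q i j) \<in> {P \<in> mats V n. \<forall>\<epsilon>>0. mshift V \<epsilon> P \<in> mpos V n}"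
      if P: "P \<in> {P \<in> mats V n. \<forall>\<epsilon>>0. mshift V \<epsilon> P \<in> mpos V n}"
        and Q: "Q \<in> {P \<in> mats V n. \<forall>\<epsilon>>0. mshift V \<epsilon> P \<in> mpos V n}"
    proof -
      have c: "P k l \<in> carrier V" "Q k l \<in> carrier V" if "k < n" "l < n" for k l using P Q that by (auto simp: mats_def)
      have "mshift V \<epsilon> (\<lambda>i j. P i j \<oplus> Q i j) \<in> mpos V n" if "\<epsilon> > 0" for \<epsilon>
      proof -
        have "(\<lambda>i j. mshift V (\<epsilon>/2) P i j \<oplus> mshift V (\<epsilon>/2) Q i j) \<in> mpos V n"
          using P Q that by (intro mpos_add) auto
        then show ?thesis
        proof (rule mpos_cong)
          fix i j assume ij: "i < n" "j < n"
          have "of_real \<epsilon> \<odot> \<one> = of_real (\<epsilon>/2) \<odot> \<one> \<oplus> of_real (\<epsilon>/2) \<odot> \<one>"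
            by (simp add: smult_add[symmetric] unit_closed)
          then show "mshift V \<epsilon> (\<lambda>i j. P i j \<oplus> Q i j) i j = mshift V (\<epsilon>/2) P i j \<oplus> mshift V (\<epsilon>/2) Q i j"
            using c[OF ij] unit_closed by (auto simp: mshift_def M.a_ac)
        qed
      qed
      then show ?thesis using c by (auto simp: mats_def)
    qed
    show "compress V n \<alpha> P \<in> {P \<in> mats V l. \<forall>\<epsilon>>0. mshift V \<epsilon> P \<in> mpos V l}"
      if P: "P \<in> {P \<in> mats V n. \<forall>\<epsilon>>0. mshift V \<epsilon> P \<in> mpos V n}" for \<alpha> l
    proof -
      let ?a = "\<lambda>i j. \<Sum>k<n. \<alpha> i k * cnj (\<alpha> j k)"
      let ?H = "\<lambda>i j. (- ?a i j) \<odot> \<one>"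
      have "?H \<in> mats V l" "hermitian V l ?H"
        by (auto simp: mats_def hermitian_def unit_closed adj_smult adj_unit mult.commute)
      then obtain r where r: "r > 0" "mshift V r ?H \<in> mpos V l" using order_unit by blast
      have Pm: "P \<in> mats V n" using P by simp
      have "mshift V \<epsilon> (compress V n \<alpha> P) \<in> mpos V l" if "\<epsilon> > 0" for \<epsilon>
      proof -
        let ?d = "\<epsilon> / r"
        have "(\<lambda>i j. compress V n \<alpha> (mshift V ?d P) i j \<oplus> of_real ?d \<odot> mshift V r ?H i j) \<in> mpos V l"
          using P r that by (intro mpos_add mpos_compress mpos_scale) auto
        then show ?thesis
        proof (rule mpos_cong)
          fix i j
          have c: "compress V n \<alpha> P i j \<in> carrier V" by (rule compress_closed[OF Pm])
          have "(of_real ?d * ?a i j) \<odot> \<one> \<oplus> of_real ?d \<odot> mshift V r ?H i j = (if i = j then of_real \<epsilon> \<odot> \<one> else \<zero>)"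
          proof (cases "i = j")
            case True
            have "mshift V r ?H i j = (of_real r - ?a i j) \<odot> \<one>"
              using True by (simp add: mshift_def smult_add[symmetric] unit_closed)
            then have "(of_real ?d * ?a i j) \<odot> \<one> \<oplus> of_real ?d \<odot> mshift V r ?H i j =
                (of_real ?d * ?a i j + of_real ?d * (of_real r - ?a i j)) \<odot> \<one>"
              by (simp only: smult_smult[OF unit_closed] smult_add[OF unit_closed])
            also have "of_real ?d * ?a i j + of_real ?d * (of_real r - ?a i j) = complex_of_real \<epsilon>"
              using r by (simp add: right_diff_distrib)
            finally show ?thesis using True by simp
          next
            case False
            then show ?thesis
              by (simp add: mshift_def smult_add[symmetric] unit_closed smult_smult)
          qed
          then show "mshift V \<epsilon> (compress V n \<alpha> P) i j =
              compress V n \<alpha> (mshift V ?d P) i j \<oplus> of_real ?d \<odot> mshift V r ?H i j"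
            using c compress_shift[OF Pm, of \<alpha> ?d i j]
            by (auto simp: mshift_def M.a_assoc unit_closed)
        qed
      qed
      then show ?thesis using compress_closed[OF Pm] by (auto simp: mats_def)
    qed
    show "\<exists>r>0. mshift V r P \<in> {P \<in> mats V n. \<forall>\<epsilon>>0. mshift V \<epsilon> P \<in> mpos V n}"
      if "P \<in> mats V n" "hermitian V n P"
    proof -
      obtain r where "r > 0" "mshift V r P \<in> mpos V n" using order_unit[OF \<open>P \<in> mats V n\<close> \<open>hermitian V n P\<close>] by blast
      then show ?thesis using shift_mats[OF \<open>P \<in> mats V n\<close>] mpos_shift by (intro exI[of _ r]) auto
    qed
    show "P i j = \<zero>" if "P \<in> {P \<in> mats V n. \<forall>\<epsilon>>0. mshift V \<epsilon> P \<in> mpos V n}"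
      "(\<lambda>i j. \<ominus> P i j) \<in> {P \<in> mats V n. \<forall>\<epsilon>>0. mshift V \<epsilon> P \<in> mpos V n}" "i < n" "j < n" for i j
      using that by (intro proper[of P n]) auto
    show "P \<in> {P \<in> mats V n. \<forall>\<epsilon>>0. mshift V \<epsilon> P \<in> mpos V n}"
      if P: "P \<in> mats V n" and *: "\<And>\<epsilon>. \<epsilon> > 0 \<Longrightarrow> mshift V \<epsilon> P \<in> {P \<in> mats V n. \<forall>\<epsilon>>0. mshift V \<epsilon> P \<in> mpos V n}"
    proof -
      have "mshift V \<epsilon> P \<in> mpos V n" if "\<epsilon> > 0" for \<epsilon>
      proof (rule mpos_cong)
        show "mshift V (\<epsilon>/2) (mshift V (\<epsilon>/2) P) \<in> mpos V n" using *[of "\<epsilon>/2"] that by simp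
        show "mshift V \<epsilon> P i j = mshift V (\<epsilon>/2) (mshift V (\<epsilon>/2) P) i j" if "i < n" "j < n" for i j
          using shift_shift[OF P that, of "\<epsilon>/2" "\<epsilon>/2"] by simp
      qed
      then show ?thesis using P by simp
    qed
  qed (auto intro: adj_closed adj_add adj_smult adj_adj adj_unit)
qed

lemma ucp_archimedeanise:
  assumes V: "matrix_ordered V" and R: "operator_system R" and lin: "linear_map V R \<phi>"
    and unit: "\<phi> \<one>\<^bsub>V\<^esub> = \<one>\<^bsub>R\<^esub>" and pos: "\<And>n P. P \<in> mpos V n \<Longrightarrow> (\<lambda>i j. \<phi> (P i j)) \<in> mpos R n"
  shows "ucp (archimedeanise V) R \<phi>"
  unfolding ucp_def
proof (intro conjI allI ballI)
  interpret V: matrix_ordered V by fact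
  interpret R: operator_system R by fact
  fix n P assume P: "P \<in> mpos (archimedeanise V) n"
  note l = V.complex_space_axioms R.complex_space_axioms lin
  show "(\<lambda>i j. \<phi> (P i j)) \<in> mpos R n"
  proof (rule R.archimedean)
    show "(\<lambda>i j. \<phi> (P i j)) \<in> mats R n" using P linear_mats[OF l] by simp
    fix \<epsilon> :: real assume "\<epsilon> > 0"
    then have "(\<lambda>i j. \<phi> (mshift V \<epsilon> P i j)) \<in> mpos R n" using P pos by simp
    then show "mshift R \<epsilon> (\<lambda>i j. \<phi> (P i j)) \<in> mpos R n"
      by (rule R.mpos_cong) (use P linear_shift[OF l _ V.unit_closed unit, of P n] in simp)
  qed
qed (use lin unit in simp_all)

subsection \<open>The coproduct\<close>

locale coproduct =
  fixes S :: "'s set" and U :: "'u set"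
  assumes S: "finite S" "S \<noteq> {}" and U: "finite U" "U \<noteq> {}"
begin

abbreviation "B \<equiv> fun_osys (S \<times> U) (copr_fun S U)"
abbreviation "N \<equiv> copr_null S U"
abbreviation "Q \<equiv> copr_pre S U"
abbreviation "cls \<equiv> copr_class S U"

definition e0 :: "'s \<times> 'u \<Rightarrow> complex" where
  "e0 = (\<lambda>z. indicator (S \<times> U) z / of_nat (card S))"

lemma copr_funI: "(\<And>z. z \<notin> S \<times> U \<Longrightarrow> f z = 0) \<Longrightarrow> f \<in> copr_fun S U"
  unfolding copr_fun_def by blast

lemma copr_funD: "\<lbrakk>f \<in> copr_fun S U; z \<notin> S \<times> U\<rbrakk> \<Longrightarrow> f z = 0"
  unfolding copr_fun_def by blast

lemma fun_space_copr: "fun_space (copr_fun S U)"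
  by (auto simp: fun_space_def copr_fun_def)

sublocale B: complex_space B
  by (rule complex_space_fun[OF fun_space_copr])

lemma N_sub: "submodule N complex_ring B"
proof (rule B.submoduleI)
  show "N \<subseteq> carrier B" by (auto simp: copr_null_def)
  show "\<zero>\<^bsub>B\<^esub> \<in> N" by (auto simp: copr_null_def copr_fun_def intro!: exI[of _ "\<lambda>_. 0"])
  have sm: "(\<lambda>x. c * f x) \<in> N" if "f \<in> N" for c f
  proof -
    from that obtain d where "(\<Sum>s\<in>S. d s) = 0" "\<forall>s\<in>S. \<forall>u\<in>U. f (s, u) = d s" "f \<in> copr_fun S U"
      by (auto simp: copr_null_def)
    then show ?thesis
      by (auto simp: copr_null_def copr_fun_def sum_distrib_left[symmetric] intro!: exI[of _ "\<lambda>s. c * d s"])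
  qed
  then show "a \<odot>\<^bsub>B\<^esub> f \<in> N" if "f \<in> N" for a f using that by simp
  show "\<ominus>\<^bsub>B\<^esub> f \<in> N" if "f \<in> N" for f
    using sm[OF that, of "-1"] that by (simp add: fun_minus[OF fun_space_copr] copr_null_def)
  show "f \<oplus>\<^bsub>B\<^esub> g \<in> N" if f: "f \<in> N" and g: "g \<in> N" for f g
  proof -
    from f obtain d where d: "(\<Sum>s\<in>S. d s) = 0" "\<forall>s\<in>S. \<forall>u\<in>U. f (s, u) = d s" "f \<in> copr_fun S U"
      by (auto simp: copr_null_def)
    from g obtain d' where d': "(\<Sum>s\<in>S. d' s) = 0" "\<forall>s\<in>S. \<forall>u\<in>U. g (s, u) = d' s" "g \<in> copr_fun S U"
      by (auto simp: copr_null_def)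
    have "(\<Sum>s\<in>S. d s + d' s) = 0" using d d' by (simp add: sum.distrib)
    then show ?thesis using d d'
      by (auto simp: copr_null_def copr_fun_def intro!: exI[of _ "\<lambda>s. d s + d' s"])
  qed
qed

lemma e0: "e0 \<in> copr_fun S U"
  by (rule copr_funI) (simp add: e0_def)

lemma adj_N: "f \<in> N \<Longrightarrow> (\<lambda>z. cnj (f z)) \<in> N"
proof -
  assume "f \<in> N"
  then obtain d where d: "(\<Sum>s\<in>S. d s) = 0" "\<forall>s\<in>S. \<forall>u\<in>U. f (s, u) = d s" "f \<in> copr_fun S U"
    by (auto simp: copr_null_def)
  have "(\<Sum>s\<in>S. cnj (d s)) = 0" using d(1) by (simp flip: cnj_sum)
  then show ?thesis using d by (auto simp: copr_null_def copr_fun_def intro!: exI[of _ "\<lambda>s. cnj (d s)"])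
qed

lemma copr_quotient:
  shows space_Q: "complex_space Q" and cls_linear: "linear_map B Q cls"
    and carrier_Q: "carrier Q = cls ` copr_fun S U" and unit_Q: "\<one>\<^bsub>Q\<^esub> = cls e0"
    and adj_cls: "\<And>f. f \<in> copr_fun S U \<Longrightarrow> adj Q (cls f) = cls (\<lambda>z. cnj (f z))"
    and cls_eq: "\<And>f g. \<lbrakk>f \<in> copr_fun S U; g \<in> copr_fun S U\<rbrakk> \<Longrightarrow> cls f = cls g \<longleftrightarrow> (\<lambda>z. f z - g z) \<in> N"
    and cls_self: "\<And>f. f \<in> copr_fun S U \<Longrightarrow> f \<in> cls f"
    and cls_rep: "\<And>f g. \<lbrakk>f \<in> copr_fun S U; g \<in> cls f\<rbrakk> \<Longrightarrow> g \<in> copr_fun S U \<and> cls g = cls f"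
proof -
  have cl: "cls = (\<lambda>f. N +>\<^bsub>B\<^esub> f)" by (auto simp: copr_class_def)
  have Q: "Q = quot_osys B N e0 (\<lambda>n p. \<forall>z\<in>S \<times> U. psd n (\<lambda>i j. p i j z))"
    by (simp add: copr_pre_def e0_def)
  have a: "\<And>x. x \<in> carrier B \<Longrightarrow> adj B x \<in> carrier B" by (auto simp: copr_fun_def)
  have 1: "\<And>x y. \<lbrakk>x \<in> carrier B; y \<in> carrier B\<rbrakk> \<Longrightarrow> adj B (x \<oplus>\<^bsub>B\<^esub> y) = adj B x \<oplus>\<^bsub>B\<^esub> adj B y" by simp
  have 2: "\<And>x. x \<in> N \<Longrightarrow> adj B x \<in> N" using adj_N by simp
  have 3: "e0 \<in> carrier B" using e0 by simp
  note q = B.quotient[OF N_sub a 1 2 3]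
  show "complex_space Q" unfolding Q by (rule q(1))
  show "linear_map B Q cls" unfolding Q cl by (rule q(2))
  show "carrier Q = cls ` copr_fun S U" unfolding Q cl using q(3) by (simp only: fun_osys_simps)
  show "\<one>\<^bsub>Q\<^esub> = cls e0" unfolding Q cl by (rule q(4))
  show "adj Q (cls f) = cls (\<lambda>z. cnj (f z))" if "f \<in> copr_fun S U" for f
    unfolding Q cl by (subst q(5)) (use that in simp_all)
  show "cls f = cls g \<longleftrightarrow> (\<lambda>z. f z - g z) \<in> N" if "f \<in> copr_fun S U" "g \<in> copr_fun S U" for f g
    unfolding cl by (subst q(6)) (use that in \<open>simp_all add: fun_diff[OF fun_space_copr]\<close>)
  show "f \<in> cls f" if "f \<in> copr_fun S U" for f
    unfolding cl using q(7)[of f] that by simp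
  show "g \<in> copr_fun S U \<and> cls g = cls f" if "f \<in> copr_fun S U" "g \<in> cls f" for f g
    using q(8)[of f g] that unfolding cl by simp
qed

sublocale Q: complex_space Q by (rule space_Q)

lemmas cls_add = linear_add[OF B.complex_space_axioms space_Q cls_linear, simplified]
  and cls_smult = linear_smult[OF B.complex_space_axioms space_Q cls_linear, simplified]
  and cls_zero = linear_zero[OF B.complex_space_axioms space_Q cls_linear, simplified]

lemma mpos_Q:
  "P \<in> mpos Q n \<longleftrightarrow> (\<exists>p. (\<forall>i<n. \<forall>j<n. p i j \<in> copr_fun S U \<and> P i j = cls (p i j)) \<and>
     (\<forall>z\<in>S \<times> U. psd n (\<lambda>i j. p i j z)))"
proof -
  have 1: "a_rcosets\<^bsub>B\<^esub> N = carrier Q" by (simp add: copr_pre_def quot_osys_def)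
  have "P \<in> mpos Q n \<longleftrightarrow> (\<forall>i<n. \<forall>j<n. P i j \<in> cls ` copr_fun S U) \<and>
    (\<exists>p. (\<forall>i<n. \<forall>j<n. p i j \<in> P i j) \<and> (\<forall>z\<in>S \<times> U. psd n (\<lambda>i j. p i j z)))"
    by (simp add: copr_pre_def quot_osys_def 1[unfolded carrier_Q])
  also have "\<dots> \<longleftrightarrow> (\<exists>p. (\<forall>i<n. \<forall>j<n. p i j \<in> copr_fun S U \<and> P i j = cls (p i j)) \<and>
     (\<forall>z\<in>S \<times> U. psd n (\<lambda>i j. p i j z)))"
  proof (intro iffI; elim conjE exE)
    fix p assume "\<forall>i<n. \<forall>j<n. P i j \<in> cls ` copr_fun S U" "\<forall>i<n. \<forall>j<n. p i j \<in> P i j"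
      "\<forall>z\<in>S \<times> U. psd n (\<lambda>i j. p i j z)"
    moreover from this have "p i j \<in> copr_fun S U \<and> P i j = cls (p i j)" if "i < n" "j < n" for i j
    proof -
      from calculation(1) that have "P i j \<in> cls ` copr_fun S U" by simp
      then obtain f where "P i j = cls f" "f \<in> copr_fun S U" by (rule imageE)
      then show ?thesis using cls_rep[of f "p i j"] calculation(2) that by auto
    qed
    ultimately show "\<exists>p. (\<forall>i<n. \<forall>j<n. p i j \<in> copr_fun S U \<and> P i j = cls (p i j)) \<and>
     (\<forall>z\<in>S \<times> U. psd n (\<lambda>i j. p i j z))" by blast
  next
    fix p assume "\<forall>i<n. \<forall>j<n. p i j \<in> copr_fun S U \<and> P i j = cls (p i j)"
      "\<forall>z\<in>S \<times> U. psd n (\<lambda>i j. p i j z)"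
    then show "(\<forall>i<n. \<forall>j<n. P i j \<in> cls ` copr_fun S U) \<and>
      (\<exists>p. (\<forall>i<n. \<forall>j<n. p i j \<in> P i j) \<and> (\<forall>z\<in>S \<times> U. psd n (\<lambda>i j. p i j z)))"
      using cls_self by (intro conjI exI[of _ p]) auto
  qed
  finally show ?thesis .
qed

lemma mats_Q: "P \<in> mats Q n \<Longrightarrow> \<exists>p. \<forall>i<n. \<forall>j<n. p i j \<in> copr_fun S U \<and> P i j = cls (p i j)"
proof -
  assume "P \<in> mats Q n"
  then have "\<forall>i j. \<exists>f. i < n \<longrightarrow> j < n \<longrightarrow> f \<in> copr_fun S U \<and> P i j = cls f"
    unfolding mats_def carrier_Q by blast
  then show ?thesis by metis
qed

lemma hermitian_psd:
  assumes "\<And>i j. \<lbrakk>i < n; j < n\<rbrakk> \<Longrightarrow> p i j \<in> copr_fun S U"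
    and "\<forall>z\<in>S \<times> U. psd n (\<lambda>i j. p i j z)" "i < n" "j < n"
  shows "p j i = (\<lambda>z. cnj (p i j z))"
proof
  fix z
  show "p j i z = cnj (p i j z)"
  proof (cases "z \<in> S \<times> U")
    case True
    then show ?thesis using assms(2-4) by (intro psd_hermitian[of n "\<lambda>i j. p i j z"]) auto
  next
    case False
    then show ?thesis using copr_funD[OF assms(1)[OF assms(3,4)]] copr_funD[OF assms(1)[OF assms(4,3)]] by simp
  qed
qed

lemma matrix_ordered_Q: "matrix_ordered Q"
proof (intro matrix_ordered.intro space_Q matrix_ordered_axioms.intro)
  show "\<one>\<^bsub>Q\<^esub> \<in> carrier Q" by (simp add: unit_Q carrier_Q e0)
  have cf: "(\<lambda>z. cnj (f z)) \<in> copr_fun S U" if "f \<in> copr_fun S U" for f using that by (auto simp: copr_fun_def)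
  have af: "(\<lambda>z. f z + g z) \<in> copr_fun S U" if "f \<in> copr_fun S U" "g \<in> copr_fun S U" for f g using that by (auto simp: copr_fun_def)
  have sf: "(\<lambda>z. c * f z) \<in> copr_fun S U" if "f \<in> copr_fun S U" for c f using that by (auto simp: copr_fun_def)
  show "adj Q x \<in> carrier Q" if "x \<in> carrier Q" for x using that cf by (auto simp: carrier_Q adj_cls)
  show "adj Q (x \<oplus>\<^bsub>Q\<^esub> y) = adj Q x \<oplus>\<^bsub>Q\<^esub> adj Q y" if xy: "x \<in> carrier Q" "y \<in> carrier Q" for x y
  proof -
    from xy obtain f g where "f \<in> copr_fun S U" "x = cls f" "g \<in> copr_fun S U" "y = cls g" by (auto simp: carrier_Q)
    then show ?thesis using cf af by (simp add: adj_cls flip: cls_add)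
  qed
  show "adj Q (c \<odot>\<^bsub>Q\<^esub> x) = cnj c \<odot>\<^bsub>Q\<^esub> adj Q x" if x: "x \<in> carrier Q" for x c
  proof -
    from x obtain f where "f \<in> copr_fun S U" "x = cls f" by (auto simp: carrier_Q)
    then show ?thesis using cf sf by (simp add: adj_cls flip: cls_smult)
  qed
  show "adj Q (adj Q x) = x" if "x \<in> carrier Q" for x using that cf by (auto simp: carrier_Q adj_cls)
  show "adj Q \<one>\<^bsub>Q\<^esub> = \<one>\<^bsub>Q\<^esub>" unfolding unit_Q adj_cls[OF e0]
    by (rule arg_cong[where f = cls]) (simp add: e0_def indicator_def fun_eq_iff)
  show "P \<in> mats Q n" if "P \<in> mpos Q n" for P n using that by (auto simp: mpos_Q mats_def carrier_Q)
  show "hermitian Q n P" if P: "P \<in> mpos Q n" for P n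
  proof -
    from P obtain p where p: "\<And>i j. \<lbrakk>i < n; j < n\<rbrakk> \<Longrightarrow> p i j \<in> copr_fun S U"
      "\<And>i j. \<lbrakk>i < n; j < n\<rbrakk> \<Longrightarrow> P i j = cls (p i j)" "\<forall>z\<in>S \<times> U. psd n (\<lambda>i j. p i j z)"
      unfolding mpos_Q by blast
    show ?thesis unfolding hermitian_def
    proof (intro allI impI)
      fix i j assume ij: "i < n" "j < n"
      show "P j i = adj Q (P i j)"
        using hermitian_psd[OF p(1,3) ij] by (simp add: p(1,2) ij adj_cls)
    qed
  qed
  show "P' \<in> mpos Q n" if P: "P \<in> mpos Q n" "\<And>i j. \<lbrakk>i < n; j < n\<rbrakk> \<Longrightarrow> P' i j = P i j" for P P' n
  proof -
    from P(1) obtain p where "\<forall>i<n. \<forall>j<n. p i j \<in> copr_fun S U \<and> P i j = cls (p i j)"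
      "\<forall>z\<in>S \<times> U. psd n (\<lambda>i j. p i j z)" unfolding mpos_Q by blast
    then show ?thesis unfolding mpos_Q by (intro exI[of _ p]) (simp add: P(2))
  qed
  show "(\<lambda>i j. P i j \<oplus>\<^bsub>Q\<^esub> P' i j) \<in> mpos Q n" if P: "P \<in> mpos Q n" "P' \<in> mpos Q n" for P P' n
  proof -
    from P obtain p p' where p: "\<forall>i<n. \<forall>j<n. p i j \<in> copr_fun S U \<and> P i j = cls (p i j)"
      "\<forall>z\<in>S \<times> U. psd n (\<lambda>i j. p i j z)" "\<forall>i<n. \<forall>j<n. p' i j \<in> copr_fun S U \<and> P' i j = cls (p' i j)"
      "\<forall>z\<in>S \<times> U. psd n (\<lambda>i j. p' i j z)" unfolding mpos_Q by blast
    show ?thesis unfolding mpos_Q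
      by (rule exI[of _ "\<lambda>i j z. p i j z + p' i j z"]) (use p af in \<open>auto simp: cls_add intro!: psd_add\<close>)
  qed
  show "compress Q m \<alpha> P \<in> mpos Q n" if P: "P \<in> mpos Q m" for P m \<alpha> n
  proof -
    from P obtain p where p: "\<And>i j. \<lbrakk>i < m; j < m\<rbrakk> \<Longrightarrow> p i j \<in> copr_fun S U"
      "\<And>i j. \<lbrakk>i < m; j < m\<rbrakk> \<Longrightarrow> P i j = cls (p i j)" "\<forall>z\<in>S \<times> U. psd m (\<lambda>i j. p i j z)"
      unfolding mpos_Q by blast
    have pm: "p \<in> mats B m" using p(1) by (simp add: mats_def)
    have Pm: "(\<lambda>k l. cls (p k l)) \<in> mats Q m" using linear_mats[OF B.complex_space_axioms space_Q cls_linear pm] .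
    have "compress Q m \<alpha> P = compress Q m \<alpha> (\<lambda>k l. cls (p k l))"
      by (rule Q.compress_cong) (use p Pm in auto)
    then have "compress Q m \<alpha> P i j = cls (compress B m \<alpha> p i j)" for i j
      using linear_compress[OF B.complex_space_axioms space_Q cls_linear pm] by simp
    moreover have "compress B m \<alpha> p i j \<in> copr_fun S U" for i j using B.compress_closed[OF pm] by simp
    moreover have "psd n (\<lambda>i j. compress B m \<alpha> p i j z)" if "z \<in> S \<times> U" for z
      using psd_compress[where n = n and m = m and M = "\<lambda>i j. p i j z" and \<alpha> = \<alpha>] p(3) that by (simp only: fun_compress[OF fun_space_copr pm])
    ultimately show ?thesis unfolding mpos_Q by (intro exI[of _ "compress B m \<alpha> p"]) auto
  qed
  show "\<exists>r>0. mshift Q r P \<in> mpos Q n" if P: "P \<in> mats Q n" and h: "hermitian Q n P" for P n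
  proof -
    obtain p where p: "\<And>i j. \<lbrakk>i < n; j < n\<rbrakk> \<Longrightarrow> p i j \<in> copr_fun S U"
      "\<And>i j. \<lbrakk>i < n; j < n\<rbrakk> \<Longrightarrow> P i j = cls (p i j)" using mats_Q[OF P] by blast
    define q where "q i j = (\<lambda>z. (1/2) * (p i j z + cnj (p j i z)))" for i j
    have q: "q i j \<in> copr_fun S U" if "i < n" "j < n" for i j
      using p(1)[OF that] p(1)[OF that(2,1)] by (auto simp: q_def copr_fun_def)
    have Pq: "P i j = cls (q i j)" if ij: "i < n" "j < n" for i j
    proof -
      have "cls (q i j) = (1/2) \<odot>\<^bsub>Q\<^esub> (cls (p i j) \<oplus>\<^bsub>Q\<^esub> cls (\<lambda>z. cnj (p j i z)))"
        unfolding q_def using p(1)[OF ij] cf[OF p(1)[OF ij(2,1)]]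
        by (simp only: cls_smult cls_add af)
      also have "cls (\<lambda>z. cnj (p j i z)) = P i j"
      proof -
        have "P i j = adj Q (P j i)" using h ij unfolding hermitian_def by blast
        then show ?thesis unfolding p(2)[OF ij(2,1)] adj_cls[OF p(1)[OF ij(2,1)]] by (rule sym)
      qed
      also have "(1/2) \<odot>\<^bsub>Q\<^esub> (cls (p i j) \<oplus>\<^bsub>Q\<^esub> P i j) = P i j"
        using Q.smult_add_right[OF Q.mats_D[OF P ij] Q.mats_D[OF P ij], of "1/2"]
          Q.smult_add[OF Q.mats_D[OF P ij], of "1/2" "1/2"] Q.mats_D[OF P ij]
        by (simp flip: p(2)[OF ij])
      finally show ?thesis by simp
    qed
    define r where "r = 1 + (\<Sum>z\<in>S \<times> U. \<Sum>i<n. \<Sum>j<n. cmod (q i j z))"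
    have r: "r > 0" unfolding r_def by (intro add_pos_nonneg sum_nonneg) auto
    have cS: "card S > 0" using S by (simp add: card_gt_0_iff)
    have "mshift Q (r * card S) P \<in> mpos Q n" unfolding mpos_Q
    proof (intro exI[of _ "\<lambda>i j z. q i j z + (if i = j then of_real r * indicator (S \<times> U) z else 0)"] conjI ballI allI impI)
      let ?q = "\<lambda>i j z. q i j z + (if i = j then of_real r * indicator (S \<times> U) z else 0)"
      fix i j assume ij: "i < n" "j < n"
      show "?q i j \<in> copr_fun S U" using q[OF ij] by (auto simp: copr_fun_def)
      have "complex_of_real (r * card S) \<odot>\<^bsub>Q\<^esub> \<one>\<^bsub>Q\<^esub> = cls (\<lambda>z. of_real r * indicator (S \<times> U) z)"
        unfolding unit_Q cls_smult[OF e0, symmetric]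
        by (rule arg_cong[where f = cls]) (use cS in \<open>auto simp: e0_def fun_eq_iff\<close>)
      moreover have "(\<lambda>z. of_real r * indicator (S \<times> U) z) \<in> copr_fun S U" by (auto simp: copr_fun_def)
      ultimately show "mshift Q (r * card S) P i j = cls (?q i j)"
        using q[OF ij] Pq[OF ij] by (auto simp: mshift_def simp flip: cls_add)
    next
      fix z assume z: "z \<in> S \<times> U"
      have "psd n (\<lambda>i j. q i j z + (if i = j then of_real r else 0))"
      proof (rule psd_order_unit)
        show "q j i z = cnj (q i j z)" for i j by (simp add: q_def)
        have "(\<Sum>i<n. \<Sum>j<n. cmod (q i j z)) \<le> (\<Sum>z\<in>S \<times> U. \<Sum>i<n. \<Sum>j<n. cmod (q i j z))"
          using z S U by (intro member_le_sum) (auto intro!: sum_nonneg)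
        then show "(\<Sum>i<n. \<Sum>j<n. cmod (q i j z)) \<le> r" by (simp add: r_def)
      qed
      then show "psd n (\<lambda>i j. q i j z + (if i = j then of_real r * indicator (S \<times> U) z else 0))"
        using z by (simp cong: if_cong)
    qed
    then show ?thesis using r cS by (intro exI[of _ "r * card S"]) simp
  qed
qed

sublocale Q: matrix_ordered Q by (rule matrix_ordered_Q)

text \<open>Summing the values along a section separates the elements of the coproduct.\<close>

definition ev :: "('s \<Rightarrow> 'u) \<Rightarrow> ('s \<times> 'u \<Rightarrow> complex) \<Rightarrow> complex" where
  "ev h f = (\<Sum>s\<in>S. f (s, h s))"

lemma ev_cls:
  assumes "f \<in> copr_fun S U" "g \<in> copr_fun S U" "cls f = cls g" "h \<in> S \<rightarrow> U"
  shows "ev h f = ev h g"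
proof -
  from assms obtain c where c: "(\<Sum>s\<in>S. c s) = 0" "\<forall>s\<in>S. \<forall>u\<in>U. f (s, u) - g (s, u) = c s"
    by (auto simp: cls_eq copr_null_def)
  have "(\<Sum>s\<in>S. f (s, h s) - g (s, h s)) = (\<Sum>s\<in>S. c s)"
    using c(2) assms(4) by (intro sum.cong) auto
  then show ?thesis using c(1) by (simp add: ev_def sum_subtractf)
qed

lemma ev_separates:
  assumes f: "f \<in> copr_fun S U" and 0: "\<And>h. h \<in> S \<rightarrow> U \<Longrightarrow> ev h f = 0"
  shows "f \<in> N"
proof -
  obtain u0 where u0: "u0 \<in> U" using U by auto
  have c: "f (s, u) = f (s, u0)" if s: "s \<in> S" and u: "u \<in> U" for s u
  proof -
    have "ev (\<lambda>t. if t = s then u else u0) f - ev (\<lambda>_. u0) f = f (s, u) - f (s, u0)"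
      unfolding ev_def sum.remove[OF S(1) s] by simp
    then show ?thesis using 0[of "\<lambda>t. if t = s then u else u0"] 0[of "\<lambda>_. u0"] u u0 by auto
  qed
  moreover have "(\<Sum>s\<in>S. f (s, u0)) = 0" using 0[of "\<lambda>_. u0"] u0 by (simp add: ev_def)
  ultimately show ?thesis using f by (auto simp: copr_null_def intro!: exI[of _ "\<lambda>s. f (s, u0)"])
qed

lemma psd_ev:
  assumes p: "\<And>i j. \<lbrakk>i < n; j < n\<rbrakk> \<Longrightarrow> p i j \<in> copr_fun S U"
    and P: "\<And>i j. \<lbrakk>i < n; j < n\<rbrakk> \<Longrightarrow> P i j = cls (p i j)"
    and pos: "mshift Q \<epsilon> P \<in> mpos Q n" and h: "h \<in> S \<rightarrow> U"
  shows "psd n (\<lambda>i j. ev h (p i j) + (if i = j then of_real \<epsilon> else 0))"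
proof -
  from pos obtain q where q: "\<And>i j. \<lbrakk>i < n; j < n\<rbrakk> \<Longrightarrow> q i j \<in> copr_fun S U"
      "\<And>i j. \<lbrakk>i < n; j < n\<rbrakk> \<Longrightarrow> mshift Q \<epsilon> P i j = cls (q i j)" "\<forall>z\<in>S \<times> U. psd n (\<lambda>i j. q i j z)"
    unfolding mpos_Q by blast
  have "psd n (\<lambda>i j. ev h (q i j))"
    unfolding ev_def using q(3) h by (intro psd_sum) auto
  moreover have "ev h (q i j) = ev h (p i j) + (if i = j then of_real \<epsilon> else 0)" if ij: "i < n" "j < n" for i j
  proof -
    have se: "(\<lambda>z. of_real \<epsilon> * e0 z) \<in> copr_fun S U" using copr_funD[OF e0] by (intro copr_funI) simp
    let ?p = "\<lambda>z. p i j z + (if i = j then of_real \<epsilon> * e0 z else 0)"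
    have pf: "?p \<in> copr_fun S U" using p[OF ij] se by (auto simp: copr_fun_def)
    have "mshift Q \<epsilon> P i j = cls ?p"
      using p[OF ij] se P[OF ij]
      by (cases "i = j") (simp_all add: mshift_def unit_Q cls_smult[OF e0, symmetric] cls_add[symmetric])
    then have "ev h (q i j) = ev h ?p"
      using q(1,2)[OF ij] pf h by (intro ev_cls) auto
    also have "\<dots> = ev h (p i j) + (if i = j then of_real \<epsilon> * (\<Sum>s\<in>S. e0 (s, h s)) else 0)"
      by (simp add: ev_def sum.distrib sum_distrib_left)
    also have "(\<Sum>s\<in>S. e0 (s, h s)) = (\<Sum>s\<in>S. 1 / of_nat (card S))"
      using h by (intro sum.cong) (auto simp: e0_def indicator_def)
    also have "\<dots> = 1" using S by simp
    finally show ?thesis by simp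
  qed
  ultimately show ?thesis by (subst psd_cong) auto
qed

theorem operator_system_copr: "operator_system (copr S U)"
  unfolding copr_def
proof (rule operator_system_archimedeanise[OF matrix_ordered_Q])
  fix P n i j
  assume P: "P \<in> mats Q n" and 1: "\<And>\<epsilon>. \<epsilon> > 0 \<Longrightarrow> mshift Q \<epsilon> P \<in> mpos Q n"
    and 2: "\<And>\<epsilon>. \<epsilon> > 0 \<Longrightarrow> mshift Q \<epsilon> (\<lambda>i j. \<ominus>\<^bsub>Q\<^esub> P i j) \<in> mpos Q n" and ij: "i < n" "j < n"
  obtain p where p: "\<And>i j. \<lbrakk>i < n; j < n\<rbrakk> \<Longrightarrow> p i j \<in> copr_fun S U"
    "\<And>i j. \<lbrakk>i < n; j < n\<rbrakk> \<Longrightarrow> P i j = cls (p i j)" using mats_Q[OF P] by blast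
  have p': "(\<lambda>z. - p i j z) \<in> copr_fun S U" "\<ominus>\<^bsub>Q\<^esub> P i j = cls (\<lambda>z. - p i j z)" if "i < n" "j < n" for i j
    using p[OF that] cls_smult[of "p i j" "-1"] Q.smult_m1[OF Q.mats_D[OF P that]] copr_funD[of "p i j"]
    by (simp_all add: copr_funI)
  have "p i j \<in> N"
  proof (rule ev_separates)
    show "p i j \<in> copr_fun S U" using p(1)[OF ij] .
    fix h assume h: "h \<in> S \<rightarrow> U"
    have "cmod (ev h (p i j)) \<le> 6 * \<epsilon>" if "\<epsilon> > 0" for \<epsilon>
    proof (rule psd_bound[of n "\<lambda>i j. ev h (p i j)"])
      show "psd n (\<lambda>i j. ev h (p i j) + (if i = j then of_real \<epsilon> else 0))"
        by (rule psd_ev[of n p, OF p 1[OF that] h])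
      show "psd n (\<lambda>i j. - ev h (p i j) + (if i = j then of_real \<epsilon> else 0))"
        using psd_ev[of n "\<lambda>i j z. - p i j z", OF p' 2[OF that] h] by (simp add: ev_def sum_negf)
    qed fact+
    then have "cmod (ev h (p i j)) \<le> 0 + e" if "e > 0" for e :: real
      using that \<open>\<And>\<epsilon>. 0 < \<epsilon> \<Longrightarrow> cmod (ev h (p i j)) \<le> 6 * \<epsilon>\<close>[of "e / 6"] by simp
    then have "cmod (ev h (p i j)) \<le> 0" by (rule field_le_epsilon)
    then show "ev h (p i j) = 0" by simp
  qed
  moreover have 0: "(\<lambda>_. 0) \<in> copr_fun S U" by (simp add: copr_fun_def)
  ultimately have "cls (p i j) = cls (\<lambda>_. 0)" using p(1)[OF ij] by (subst cls_eq) auto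
  then show "P i j = \<zero>\<^bsub>Q\<^esub>" using p(2)[OF ij] by (simp add: cls_zero)
qed

end

context coproduct
begin

lemma inj_fun: "f \<in> carrier (diag_osys U) \<Longrightarrow> s \<in> S \<Longrightarrow> (\<lambda>(t, u). if t = s then f u else 0) \<in> copr_fun S U"
  by (rule copr_funI) (auto simp: diag_osys_def split: if_splits)

lemma linear_mapI_Q:
  assumes "\<And>f. f \<in> copr_fun S U \<Longrightarrow> \<psi> (cls f) \<in> carrier R"
    and "\<And>f g. \<lbrakk>f \<in> copr_fun S U; g \<in> copr_fun S U\<rbrakk> \<Longrightarrow> \<psi> (cls f \<oplus>\<^bsub>Q\<^esub> cls g) = \<psi> (cls f) \<oplus>\<^bsub>R\<^esub> \<psi> (cls g)"
    and "\<And>c f. f \<in> copr_fun S U \<Longrightarrow> \<psi> (c \<odot>\<^bsub>Q\<^esub> cls f) = c \<odot>\<^bsub>R\<^esub> \<psi> (cls f)"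
  shows "linear_map Q R \<psi>"
  unfolding linear_map_def carrier_Q
  by (intro conjI ballI allI; elim imageE; hypsubst; rule assms; assumption)

lemma carrier_copr [simp]: "carrier (copr S U) = carrier Q" "add (copr S U) = add Q"
  "smult (copr S U) = smult Q" "\<one>\<^bsub>copr S U\<^esub> = \<one>\<^bsub>Q\<^esub>" "finsum (copr S U) = finsum Q"
  by (simp_all add: copr_def)

lemma copr_inj_linear:
  assumes s: "s \<in> S"
  shows "linear_map (diag_osys U) Q (copr_inj S U s)"
  unfolding linear_map_def
proof (intro conjI ballI allI)
  let ?i = "\<lambda>f. \<lambda>(t, u). if t = s then f u else (0::complex)"
  fix f assume f: "f \<in> carrier (diag_osys U)"
  show "copr_inj S U s f \<in> carrier Q"
    using inj_fun[OF f s] by (auto simp: copr_inj_def carrier_Q)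
  show "copr_inj S U s (f \<oplus>\<^bsub>diag_osys U\<^esub> g) = copr_inj S U s f \<oplus>\<^bsub>Q\<^esub> copr_inj S U s g"
    if g: "g \<in> carrier (diag_osys U)" for g
    unfolding copr_inj_def cls_add[OF inj_fun[OF f s] inj_fun[OF g s], symmetric]
    by (rule arg_cong[where f = cls]) (auto simp: diag_osys_def)
  show "copr_inj S U s (c \<odot>\<^bsub>diag_osys U\<^esub> f) = c \<odot>\<^bsub>Q\<^esub> copr_inj S U s f" for c
    unfolding copr_inj_def cls_smult[OF inj_fun[OF f s], symmetric]
    by (rule arg_cong[where f = cls]) (auto simp: diag_osys_def)
qed

lemma copr_inj_unit:
  assumes s: "s \<in> S" shows "copr_inj S U s \<one>\<^bsub>diag_osys U\<^esub> = \<one>\<^bsub>Q\<^esub>"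
proof -
  let ?f = "\<lambda>(t, u). if t = s then indicator U u else (0::complex)"
  have f: "?f \<in> copr_fun S U" using s by (intro copr_funI) (auto simp: indicator_def split: if_splits)
  have "(\<lambda>z. ?f z - e0 z) \<in> N"
    unfolding copr_null_def
  proof (intro CollectI conjI exI)
    show "(\<lambda>z. ?f z - e0 z) \<in> copr_fun S U" using copr_funD[OF f] copr_funD[OF e0] by (intro copr_funI) simp
    let ?c = "\<lambda>t. (if t = s then 1 else 0) - 1 / of_nat (card S) :: complex"
    show "(\<Sum>t\<in>S. ?c t) = 0" using S s by (simp add: sum_subtractf)
    show "\<forall>t\<in>S. \<forall>u\<in>U. ?f (t, u) - e0 (t, u) = ?c t" by (simp add: e0_def)
  qed
  then have "cls ?f = cls e0" using cls_eq[OF f e0] by simp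
  then show ?thesis by (simp add: copr_inj_def unit_Q diag_osys_def)
qed

lemma copr_inj_pos:
  assumes s: "s \<in> S" and P: "P \<in> mpos (diag_osys U) n"
  shows "(\<lambda>i j. copr_inj S U s (P i j)) \<in> mpos Q n"
  unfolding mpos_Q
proof (intro exI[of _ "\<lambda>i j. \<lambda>(t, u). if t = s then P i j u else 0"] conjI allI impI ballI)
  fix i j assume "i < n" "j < n"
  then have "P i j \<in> carrier (diag_osys U)" using P by (auto simp: diag_osys_def)
  then show "(\<lambda>(t, u). if t = s then P i j u else 0) \<in> copr_fun S U" by (rule inj_fun[OF _ s])
  show "copr_inj S U s (P i j) = cls (\<lambda>(t, u). if t = s then P i j u else 0)"
    by (simp add: copr_inj_def)
next
  fix z assume "z \<in> S \<times> U"
  then obtain t u where z: "z = (t, u)" "u \<in> U" by auto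
  have "psd n (\<lambda>i j. 0)" by (simp add: psd_def)
  moreover have "psd n (\<lambda>i j. P i j u)" using P z by (auto simp: diag_osys_def)
  ultimately show "psd n (\<lambda>i j. (\<lambda>(t, u). if t = s then P i j u else 0) z)" by (cases "t = s") (simp_all add: z)
qed

text \<open>The canonical maps of the coproduct are unital complete order embeddings.\<close>

theorem copr_inj_embedding:
  assumes s: "s \<in> S"
  shows "complete_order_embedding (diag_osys U) (copr S U) (copr_inj S U s)"
  unfolding complete_order_embedding_def
proof (intro conjI allI ballI impI)
  show "ucp (diag_osys U) (copr S U) (copr_inj S U s)"
    unfolding ucp_def
    using copr_inj_linear[OF s] copr_inj_unit[OF s] mpos_archimedeanise[OF matrix_ordered_Q copr_inj_pos[OF s]]
    by (simp add: copr_def)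
  fix n P assume P: "P \<in> mats (diag_osys U) n" and pos: "(\<lambda>i j. copr_inj S U s (P i j)) \<in> mpos (copr S U) n"
  have c: "P i j \<in> carrier (diag_osys U)" if "i < n" "j < n" for i j using P that by (auto simp: mats_def)
  let ?p = "\<lambda>i j. \<lambda>(t, u). if t = s then P i j u else 0"
  have "psd n (\<lambda>i j. P i j u)" if u: "u \<in> U" for u
  proof (rule psd_archimedean)
    fix \<epsilon> :: real assume "\<epsilon> > 0"
    then have "mshift Q \<epsilon> (\<lambda>i j. copr_inj S U s (P i j)) \<in> mpos Q n" using pos by (simp add: copr_def)
    then have "psd n (\<lambda>i j. ev (\<lambda>_. u) (?p i j) + (if i = j then of_real \<epsilon> else 0))"
      by (rule psd_ev[rotated 2]) (use c u in \<open>auto intro!: inj_fun s simp: copr_inj_def\<close>)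
    moreover have "ev (\<lambda>_. u) (?p i j) = P i j u" for i j
      using S s by (simp add: ev_def)
    ultimately show "psd n (\<lambda>i j. P i j u + (if i = j then of_real \<epsilon> else 0))" by simp
  qed
  then show "P \<in> mpos (diag_osys U) n" using c by (auto simp: diag_osys_def)
qed

lemma cls_decompose:
  assumes f: "f \<in> copr_fun S U"
  shows "cls f = (\<Oplus>\<^bsub>Q\<^esub>s\<in>S. copr_inj S U s (\<lambda>u. f (s, u)))"
proof -
  let ?g = "\<lambda>s. \<lambda>(t, u). if t = s then f (s, u) else 0"
  have g: "?g s \<in> copr_fun S U" if "s \<in> S" for s
    using inj_fun[OF _ that, of "\<lambda>u. f (s, u)"] copr_funD[OF f] by (simp add: diag_osys_def)
  have "finsum B ?g S = (\<lambda>z. \<Sum>s\<in>S. ?g s z)"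
    using fun_finsum[OF fun_space_copr S(1), of ?g "S \<times> U"] g by blast
  also have "\<dots> = f"
  proof
    fix z :: "'s \<times> 'u"
    obtain t u where z: "z = (t, u)" by force
    show "(\<Sum>s\<in>S. ?g s z) = f z"
      using S copr_funD[OF f, of z] by (cases "t \<in> S") (simp_all add: z)
  qed
  finally have "cls f = cls (finsum B ?g S)" by simp
  also have "\<dots> = finsum Q (\<lambda>s. cls (?g s)) S"
    by (rule linear_finsum[OF B.complex_space_axioms space_Q cls_linear]) (use g in auto)
  finally show ?thesis by (simp add: copr_inj_def)
qed

text \<open>The universal property of the coproduct, for operator systems \<open>R\<close> over any type.\<close>

theorem copr_universal:
  fixes R :: "'r osys" and \<phi> :: "'s \<Rightarrow> ('u \<Rightarrow> complex) \<Rightarrow> 'r"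
  assumes R: "operator_system R" and ucp: "\<And>s. s \<in> S \<Longrightarrow> ucp (diag_osys U) R (\<phi> s)"
  shows "\<exists>\<psi>. ucp (copr S U) R \<psi> \<and>
      (\<forall>s\<in>S. \<forall>f\<in>carrier (diag_osys U). \<psi> (copr_inj S U s f) = \<phi> s f) \<and>
      (\<forall>\<psi>'. ucp (copr S U) R \<psi>' \<longrightarrow> (\<forall>s\<in>S. \<forall>f\<in>carrier (diag_osys U). \<psi>' (copr_inj S U s f) = \<phi> s f) \<longrightarrow>
         (\<forall>x\<in>carrier (copr S U). \<psi>' x = \<psi> x))"
proof -
  interpret R: operator_system R by fact
  have dspace: "complex_space (diag_osys U)"
    unfolding diag_osys_def by (rule complex_space_fun) (auto simp: fun_space_def)
  have lin: "linear_map (diag_osys U) R (\<phi> s)" if "s \<in> S" for s using ucp[OF that] by (simp add: ucp_def)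
  note l_closed = linear_closed[OF dspace R.complex_space_axioms lin]
    and l_add = linear_add[OF dspace R.complex_space_axioms lin]
    and l_smult = linear_smult[OF dspace R.complex_space_axioms lin]
    and l_zero = linear_zero[OF dspace R.complex_space_axioms lin]
  have dc: "(\<lambda>u. f (s, u)) \<in> carrier (diag_osys U)" if "f \<in> copr_fun S U" for f s
    using copr_funD[OF that] by (auto simp: diag_osys_def)
  define \<psi>0 where "\<psi>0 f = (\<Oplus>\<^bsub>R\<^esub>s\<in>S. \<phi> s (\<lambda>u. f (s, u)))" for f
  have c0: "\<phi> s (\<lambda>u. f (s, u)) \<in> carrier R" if "s \<in> S" "f \<in> copr_fun S U" for s f
    using l_closed[OF that(1) dc[OF that(2)]] .
  have closed: "\<psi>0 f \<in> carrier R" if "f \<in> copr_fun S U" for f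
    unfolding \<psi>0_def using c0[OF _ that] by (intro R.M.finsum_closed) auto
  have add: "\<psi>0 (\<lambda>z. f z + g z) = \<psi>0 f \<oplus>\<^bsub>R\<^esub> \<psi>0 g" if f: "f \<in> copr_fun S U" and g: "g \<in> copr_fun S U" for f g
  proof -
    have "\<psi>0 (\<lambda>z. f z + g z) = (\<Oplus>\<^bsub>R\<^esub>s\<in>S. \<phi> s (\<lambda>u. f (s, u)) \<oplus>\<^bsub>R\<^esub> \<phi> s (\<lambda>u. g (s, u)))"
      unfolding \<psi>0_def
      by (rule R.M.finsum_cong'[OF refl])
        (use c0 f g l_add[OF _ dc[OF f] dc[OF g]] in \<open>auto simp: diag_osys_def\<close>)
    also have "\<dots> = \<psi>0 f \<oplus>\<^bsub>R\<^esub> \<psi>0 g"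
      unfolding \<psi>0_def by (rule R.M.finsum_addf) (use c0 f g in auto)
    finally show ?thesis .
  qed
  have smult: "\<psi>0 (\<lambda>z. c * f z) = c \<odot>\<^bsub>R\<^esub> \<psi>0 f" if f: "f \<in> copr_fun S U" for c f
  proof -
    have "\<psi>0 (\<lambda>z. c * f z) = (\<Oplus>\<^bsub>R\<^esub>s\<in>S. c \<odot>\<^bsub>R\<^esub> \<phi> s (\<lambda>u. f (s, u)))"
      unfolding \<psi>0_def
      by (rule R.M.finsum_cong'[OF refl])
        (use c0 f l_smult[OF _ dc[OF f]] in \<open>auto simp: diag_osys_def\<close>)
    also have "\<dots> = c \<odot>\<^bsub>R\<^esub> \<psi>0 f"
      unfolding \<psi>0_def by (rule R.smult_finsum[symmetric]) (use c0 f in auto)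
    finally show ?thesis .
  qed
  have const: "\<psi>0 f = (\<Sum>s\<in>S. c s) \<odot>\<^bsub>R\<^esub> \<one>\<^bsub>R\<^esub>"
    if f: "f \<in> copr_fun S U" and c: "\<forall>s\<in>S. \<forall>u\<in>U. f (s, u) = c s" for f c
  proof -
    have "\<phi> s (\<lambda>u. f (s, u)) = c s \<odot>\<^bsub>R\<^esub> \<one>\<^bsub>R\<^esub>" if s: "s \<in> S" for s
    proof -
      have "(\<lambda>u. f (s, u)) = c s \<odot>\<^bsub>diag_osys U\<^esub> \<one>\<^bsub>diag_osys U\<^esub>"
        using c s copr_funD[OF f] by (auto simp: diag_osys_def indicator_def fun_eq_iff)
      moreover have "\<one>\<^bsub>diag_osys U\<^esub> \<in> carrier (diag_osys U)" by (auto simp: diag_osys_def)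
      ultimately show ?thesis using l_smult[OF s] ucp[OF s] by (simp add: ucp_def)
    qed
    then have "\<psi>0 f = (\<Oplus>\<^bsub>R\<^esub>s\<in>S. c s \<odot>\<^bsub>R\<^esub> \<one>\<^bsub>R\<^esub>)"
      unfolding \<psi>0_def by (intro R.M.finsum_cong'[OF refl]) (auto simp: R.unit_closed)
    then show ?thesis by (simp add: R.finsum_smult_left S R.unit_closed)
  qed
  have null: "\<psi>0 f = \<psi>0 g" if f: "f \<in> copr_fun S U" and g: "g \<in> copr_fun S U" and eq: "cls f = cls g" for f g
  proof -
    let ?d = "\<lambda>z. f z - g z"
    obtain c where c: "(\<Sum>s\<in>S. c s) = 0" "\<forall>s\<in>S. \<forall>u\<in>U. ?d (s, u) = c s"
      using eq cls_eq[OF f g] by (auto simp: copr_null_def)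
    have d: "?d \<in> copr_fun S U" using copr_funD[OF f] copr_funD[OF g] by (intro copr_funI) simp
    have "\<psi>0 ?d = \<zero>\<^bsub>R\<^esub>" using const[OF d c(2)] c(1) by (simp add: R.unit_closed)
    moreover have "\<psi>0 f = \<psi>0 ?d \<oplus>\<^bsub>R\<^esub> \<psi>0 g" using add[OF d g] by simp
    ultimately show ?thesis using closed[OF g] by simp
  qed
  define \<psi> where "\<psi> F = \<psi>0 (SOME f. f \<in> F)" for F
  have \<psi>: "\<psi> (cls f) = \<psi>0 f" if f: "f \<in> copr_fun S U" for f
  proof -
    have "(SOME g. g \<in> cls f) \<in> cls f" by (rule someI[of _ f]) (rule cls_self[OF f])
    then show ?thesis unfolding \<psi>_def using cls_rep[OF f] f by (intro null) auto
  qed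
  have lin\<psi>: "linear_map Q R \<psi>"
  proof (rule linear_mapI_Q)
    fix f g assume f: "f \<in> copr_fun S U" and g: "g \<in> copr_fun S U"
    have "(\<lambda>z. f z + g z) \<in> copr_fun S U" using copr_funD[OF f] copr_funD[OF g] by (intro copr_funI) simp
    then show "\<psi> (cls f \<oplus>\<^bsub>Q\<^esub> cls g) = \<psi> (cls f) \<oplus>\<^bsub>R\<^esub> \<psi> (cls g)"
      using f g by (simp add: cls_add[symmetric] \<psi> add)
  next
    fix f c assume f: "f \<in> copr_fun S U"
    have "(\<lambda>z. c * f z) \<in> copr_fun S U" using copr_funD[OF f] by (intro copr_funI) simp
    then show "\<psi> (c \<odot>\<^bsub>Q\<^esub> cls f) = c \<odot>\<^bsub>R\<^esub> \<psi> (cls f)"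
      using f by (simp add: cls_smult[symmetric] \<psi> smult)
  qed (simp add: \<psi> closed)
  have inj: "\<psi> (copr_inj S U s f) = \<phi> s f" if s: "s \<in> S" and f: "f \<in> carrier (diag_osys U)" for s f
  proof -
    let ?f = "\<lambda>(t, u). if t = s then f u else 0"
    have "\<psi> (copr_inj S U s f) = (\<Oplus>\<^bsub>R\<^esub>t\<in>S. \<phi> t (\<lambda>u. ?f (t, u)))"
      using \<psi>[OF inj_fun[OF f s]] by (simp add: copr_inj_def \<psi>0_def)
    also have "\<dots> = (\<Oplus>\<^bsub>R\<^esub>t\<in>S. if s = t then \<phi> t f else \<zero>\<^bsub>R\<^esub>)"
    proof (rule R.M.finsum_cong'[OF refl])
      show "(\<lambda>t. if s = t then \<phi> t f else \<zero>\<^bsub>R\<^esub>) \<in> S \<rightarrow> carrier R"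
        using l_closed[OF _ f] by auto
      fix t assume t: "t \<in> S"
      show "\<phi> t (\<lambda>u. ?f (t, u)) = (if s = t then \<phi> t f else \<zero>\<^bsub>R\<^esub>)"
        using l_zero[OF t] by (auto simp: diag_osys_def)
    qed
    also have "\<dots> = \<phi> s f"
      by (rule R.M.finsum_singleton[OF s S(1)]) (use l_closed[OF _ f] in auto)
    finally show ?thesis .
  qed
  have "ucp (copr S U) R \<psi>"
    unfolding copr_def
  proof (rule ucp_archimedeanise[OF matrix_ordered_Q R lin\<psi>])
    have "\<psi> \<one>\<^bsub>Q\<^esub> = (\<Sum>s\<in>S. 1 / of_nat (card S)) \<odot>\<^bsub>R\<^esub> \<one>\<^bsub>R\<^esub>"
      unfolding unit_Q \<psi>[OF e0] by (rule const[OF e0]) (simp add: e0_def)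
    then show "\<psi> \<one>\<^bsub>Q\<^esub> = \<one>\<^bsub>R\<^esub>" using S by (simp add: R.unit_closed)
    fix n P assume "P \<in> mpos Q n"
    then obtain p where p: "\<And>i j. \<lbrakk>i < n; j < n\<rbrakk> \<Longrightarrow> p i j \<in> copr_fun S U"
      "\<And>i j. \<lbrakk>i < n; j < n\<rbrakk> \<Longrightarrow> P i j = cls (p i j)" "\<forall>z\<in>S \<times> U. psd n (\<lambda>i j. p i j z)"
      unfolding mpos_Q by blast
    have "(\<lambda>i j. \<Oplus>\<^bsub>R\<^esub>s\<in>S. \<phi> s (\<lambda>u. p i j (s, u))) \<in> mpos R n"
    proof (rule R.mpos_finsum[OF S(1)])
      fix s assume s: "s \<in> S"
      have "(\<lambda>i j. (\<lambda>u. p i j (s, u))) \<in> mpos (diag_osys U) n"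
        using p(3) s copr_funD[OF p(1)] by (auto simp: diag_osys_def)
      then show "(\<lambda>i j. \<phi> s (\<lambda>u. p i j (s, u))) \<in> mpos R n"
        using ucp[OF s] by (auto simp: ucp_def)
    qed
    then show "(\<lambda>i j. \<psi> (P i j)) \<in> mpos R n"
      by (rule R.mpos_cong) (simp add: p(1,2) \<psi> \<psi>0_def)
  qed
  moreover have "\<psi>' x = \<psi> x"
    if \<psi>': "ucp (copr S U) R \<psi>'" and agree: "\<forall>s\<in>S. \<forall>f\<in>carrier (diag_osys U). \<psi>' (copr_inj S U s f) = \<phi> s f"
      and x: "x \<in> carrier (copr S U)" for \<psi>' x
  proof -
    obtain f where f: "f \<in> copr_fun S U" and xf: "x = cls f" using x by (auto simp: carrier_Q)
    have lin': "linear_map Q R \<psi>'" using \<psi>' by (simp add: ucp_def linear_map_def)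
    have ic: "(\<lambda>s. copr_inj S U s (\<lambda>u. f (s, u))) \<in> S \<rightarrow> carrier Q"
      using linear_closed[OF dspace space_Q copr_inj_linear dc[OF f]] by auto
    have "\<psi>' x = (\<Oplus>\<^bsub>R\<^esub>s\<in>S. \<psi>' (copr_inj S U s (\<lambda>u. f (s, u))))"
      unfolding xf cls_decompose[OF f] by (rule linear_finsum[OF space_Q R.complex_space_axioms lin' ic])
    also have "\<dots> = \<psi>0 f"
      unfolding \<psi>0_def by (rule R.M.finsum_cong'[OF refl]) (use c0 f agree dc[OF f] in auto)
    finally show ?thesis by (simp add: xf \<psi>[OF f])
  qed
  ultimately show ?thesis using inj by blast
qed

end

subsection \<open>The connecting maps\<close>

lemma finite_fam: "finite (fam d n)"
proof (rule finite_subset)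
  show "fam d n \<subseteq> {x. set x \<subseteq> (\<Union>i<n. {1..d i}) \<and> length x = n}"
    by (fastforce simp: fam_def in_set_conv_nth)
qed (rule finite_lists_length_eq, simp)

lemma fam_Suc: "fam d (Suc n) = (\<lambda>(x, i). x @ [i]) ` (fam d n \<times> {1..d n})"
proof (intro equalityI subsetI)
  fix y assume y: "y \<in> fam d (Suc n)"
  then have "y \<noteq> []" by (auto simp: fam_def)
  then have "y = butlast y @ [last y]" by simp
  moreover have "butlast y \<in> fam d n" using y by (auto simp: fam_def nth_butlast)
  moreover have "last y \<in> {1..d n}" using y \<open>y \<noteq> []\<close> by (auto simp: fam_def last_conv_nth)
  ultimately show "y \<in> (\<lambda>(x, i). x @ [i]) ` (fam d n \<times> {1..d n})"
    by (intro image_eqI[of _ _ "(butlast y, last y)"]) auto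
qed (auto simp: fam_def nth_append less_Suc_eq)

lemma inj_snoc: "inj_on (\<lambda>(x, i). x @ [i]) A"
  by (auto simp: inj_on_def)

lemma sum_fam_Suc: "(\<Sum>y\<in>fam d (Suc n). f y) = (\<Sum>x\<in>fam d n. \<Sum>i=1..d n. f (x @ [i]))"
  unfolding fam_Suc sum.reindex[OF inj_snoc] sum.cartesian_product by (simp add: case_prod_beta)

lemma fam_nonempty: "inductive_family d \<Longrightarrow> fam d n \<noteq> {}"
proof (induction n)
  case 0
  then show ?case by (auto simp: fam_def)
next
  case (Suc n)
  then have "d n \<ge> 1" "fam d n \<noteq> {}" by (auto simp: inductive_family_def)
  then show ?case by (auto simp: fam_Suc)
qed

lemma card_fam_Suc: "card (fam d (Suc n)) = card (fam d n) * d n"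
  unfolding fam_Suc card_image[OF inj_snoc] by (simp add: card_cartesian_product)

lemma coproduct_fam: "\<lbrakk>inductive_family dX; inductive_family dA\<rbrakk> \<Longrightarrow> coproduct (fam dX n) (fam dA n)"
  by (intro coproduct.intro finite_fam fam_nonempty)

context
  fixes dX dA :: "nat \<Rightarrow> nat"
  assumes X: "inductive_family dX" and A: "inductive_family dA"
begin

definition pull :: "nat \<Rightarrow> (nat list \<times> nat list \<Rightarrow> complex) \<Rightarrow> nat list \<times> nat list \<Rightarrow> complex" where
  "pull n f = (\<lambda>(x, a). if x \<in> fam dX (Suc n) \<and> a \<in> fam dA (Suc n)
               then f (butlast x, butlast a) / of_nat (dX n) else 0)"

interpretation C: coproduct "fam dX n" "fam dA n" for n
  by (rule coproduct_fam[OF X A])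

lemma butlast_fam: "x \<in> fam d (Suc n) \<Longrightarrow> butlast x \<in> fam d n"
  by (auto simp: fam_Suc)

lemma pull_fun: "pull n f \<in> copr_fun (fam dX (Suc n)) (fam dA (Suc n))"
  by (rule C.copr_funI) (auto simp: pull_def split: if_splits)

lemma fam_conn_cls:
  assumes f: "f \<in> copr_fun (fam dX n) (fam dA n)"
  shows "fam_conn dX dA n (copr_class (fam dX n) (fam dA n) f) =
    copr_class (fam dX (Suc n)) (fam dA (Suc n)) (pull n f)"
proof -
  have "copr_class (fam dX (Suc n)) (fam dA (Suc n)) (pull n g) =
        copr_class (fam dX (Suc n)) (fam dA (Suc n)) (pull n f)"
    if g: "g \<in> copr_class (fam dX n) (fam dA n) f" for g
  proof -
    have g': "g \<in> copr_fun (fam dX n) (fam dA n)"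
      "copr_class (fam dX n) (fam dA n) g = copr_class (fam dX n) (fam dA n) f"
      using C.cls_rep[OF f g] by auto
    then obtain c where c: "(\<Sum>s\<in>fam dX n. c s) = 0" "\<forall>s\<in>fam dX n. \<forall>u\<in>fam dA n. g (s, u) - f (s, u) = c s"
      using C.cls_eq[OF g'(1) f] by (auto simp: copr_null_def)
    let ?c = "\<lambda>x. c (butlast x) / of_nat (dX n)"
    have "(\<Sum>x\<in>fam dX (Suc n). ?c x) = 0"
    proof -
      have "dX n \<noteq> 0" using X by (auto simp: inductive_family_def dest: spec[of _ n])
      then show ?thesis unfolding sum_fam_Suc using c(1) by simp
    qed
    moreover have "\<forall>s\<in>fam dX (Suc n). \<forall>u\<in>fam dA (Suc n). pull n g (s, u) - pull n f (s, u) = ?c s"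
      using c(2) butlast_fam by (auto simp: pull_def simp flip: diff_divide_distrib)
    moreover have "(\<lambda>z. pull n g z - pull n f z) \<in> copr_fun (fam dX (Suc n)) (fam dA (Suc n))"
      using C.copr_funD[OF pull_fun] by (intro C.copr_funI) simp
    ultimately show ?thesis
      unfolding C.cls_eq[OF pull_fun pull_fun] copr_null_def by blast
  qed
  then have "(\<Union>g\<in>copr_class (fam dX n) (fam dA n) f. copr_class (fam dX (Suc n)) (fam dA (Suc n)) (pull n g)) =
     copr_class (fam dX (Suc n)) (fam dA (Suc n)) (pull n f)"
    by (intro UN_constant_eq[OF C.cls_self[OF f]] ballI)
  then show ?thesis unfolding fam_conn_def pull_def .
qed

lemma fam_conn_linear:
  "linear_map (fam_copr dX dA n) (fam_copr dX dA (Suc n)) (fam_conn dX dA n)"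
proof -
  have "linear_map (copr_pre (fam dX n) (fam dA n)) (copr_pre (fam dX (Suc n)) (fam dA (Suc n))) (fam_conn dX dA n)"
  proof (rule C.linear_mapI_Q)
  fix f g assume f: "f \<in> copr_fun (fam dX n) (fam dA n)" and g: "g \<in> copr_fun (fam dX n) (fam dA n)"
  have fg: "(\<lambda>z. f z + g z) \<in> copr_fun (fam dX n) (fam dA n)" using C.copr_funD[OF f] C.copr_funD[OF g] by (intro C.copr_funI) simp
  show "fam_conn dX dA n (copr_class (fam dX n) (fam dA n) f \<oplus>\<^bsub>copr_pre (fam dX n) (fam dA n)\<^esub> copr_class (fam dX n) (fam dA n) g) =
    fam_conn dX dA n (copr_class (fam dX n) (fam dA n) f) \<oplus>\<^bsub>copr_pre (fam dX (Suc n)) (fam dA (Suc n))\<^esub> fam_conn dX dA n (copr_class (fam dX n) (fam dA n) g)"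
    unfolding C.cls_add[OF f g, symmetric] fam_conn_cls[OF f] fam_conn_cls[OF g] fam_conn_cls[OF fg] C.cls_add[OF pull_fun pull_fun, symmetric]
    by (rule arg_cong[where f = "copr_class _ _"]) (auto simp: pull_def add_divide_distrib)
next
  fix c f assume f: "f \<in> copr_fun (fam dX n) (fam dA n)"
  have cf: "(\<lambda>z. c * f z) \<in> copr_fun (fam dX n) (fam dA n)" using C.copr_funD[OF f] by (intro C.copr_funI) simp
  show "fam_conn dX dA n (c \<odot>\<^bsub>copr_pre (fam dX n) (fam dA n)\<^esub> copr_class (fam dX n) (fam dA n) f) =
    c \<odot>\<^bsub>copr_pre (fam dX (Suc n)) (fam dA (Suc n))\<^esub> fam_conn dX dA n (copr_class (fam dX n) (fam dA n) f)"
    unfolding C.cls_smult[OF f, symmetric] fam_conn_cls[OF f] fam_conn_cls[OF cf] C.cls_smult[OF pull_fun, symmetric]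
    by (rule arg_cong[where f = "copr_class _ _"]) (auto simp: pull_def)
  qed (auto simp: fam_conn_cls pull_fun C.carrier_Q)
  then show ?thesis by (simp add: linear_map_def fam_copr_def)
qed

theorem fam_conn_ucp: "ucp (fam_copr dX dA n) (fam_copr dX dA (Suc n)) (fam_conn dX dA n)"
proof -
  have "ucp (archimedeanise (copr_pre (fam dX n) (fam dA n))) (fam_copr dX dA (Suc n)) (fam_conn dX dA n)"
  proof (rule ucp_archimedeanise[OF C.matrix_ordered_Q])
    show "operator_system (fam_copr dX dA (Suc n))"
      unfolding fam_copr_def by (rule C.operator_system_copr)
    show "linear_map (copr_pre (fam dX n) (fam dA n)) (fam_copr dX dA (Suc n)) (fam_conn dX dA n)"
      using fam_conn_linear[of n] by (simp add: linear_map_def fam_copr_def)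
    have "pull n (C.e0 n) = C.e0 (Suc n)"
      unfolding pull_def C.e0_def card_fam_Suc
      using butlast_fam by (auto simp: indicator_def fun_eq_iff split: if_splits)
    then show "fam_conn dX dA n \<one>\<^bsub>copr_pre (fam dX n) (fam dA n)\<^esub> = \<one>\<^bsub>fam_copr dX dA (Suc n)\<^esub>"
      unfolding fam_copr_def C.carrier_copr C.unit_Q fam_conn_cls[OF C.e0] by simp
    fix l P assume "P \<in> mpos (copr_pre (fam dX n) (fam dA n)) l"
    then obtain p where p: "\<And>i j. \<lbrakk>i < l; j < l\<rbrakk> \<Longrightarrow> p i j \<in> copr_fun (fam dX n) (fam dA n)"
      "\<And>i j. \<lbrakk>i < l; j < l\<rbrakk> \<Longrightarrow> P i j = copr_class (fam dX n) (fam dA n) (p i j)"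
      "\<forall>z\<in>fam dX n \<times> fam dA n. psd l (\<lambda>i j. p i j z)"
      unfolding C.mpos_Q by blast
    have "(\<lambda>i j. fam_conn dX dA n (P i j)) \<in> mpos (copr_pre (fam dX (Suc n)) (fam dA (Suc n))) l"
      unfolding C.mpos_Q
    proof (intro exI[of _ "\<lambda>i j. pull n (p i j)"] conjI allI impI ballI)
      fix i j assume ij: "i < l" "j < l"
      show "pull n (p i j) \<in> copr_fun (fam dX (Suc n)) (fam dA (Suc n))" by (rule pull_fun)
      show "fam_conn dX dA n (P i j) = copr_class (fam dX (Suc n)) (fam dA (Suc n)) (pull n (p i j))"
        unfolding p(2)[OF ij] fam_conn_cls[OF p(1)[OF ij]] ..
    next
      fix z assume "z \<in> fam dX (Suc n) \<times> fam dA (Suc n)"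
      then obtain x a where z: "z = (x, a)" "x \<in> fam dX (Suc n)" "a \<in> fam dA (Suc n)" by auto
      then have "psd l (\<lambda>i j. p i j (butlast x, butlast a))"
        using p(3) butlast_fam by blast
      then have "psd l (\<lambda>i j. of_real (1 / dX n) * p i j (butlast x, butlast a))"
        by (rule psd_scale[rotated]) (rule nn_of_real, simp)
      then show "psd l (\<lambda>i j. pull n (p i j) z)" using z by (simp add: pull_def)
    qed
    then show "(\<lambda>i j. fam_conn dX dA n (P i j)) \<in> mpos (fam_copr dX dA (Suc n)) l"
      unfolding fam_copr_def copr_def by (rule mpos_archimedeanise[OF C.matrix_ordered_Q])
  qed
  then show ?thesis by (simp add: fam_copr_def copr_def)
qed

theorem fam_conn_gen:
  assumes x: "x \<in> fam dX n" and a: "a \<in> fam dA n"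
  shows "fam_conn dX dA n (fam_gen dX dA n x a) =
    (1 / of_nat (dX n)) \<odot>\<^bsub>fam_copr dX dA (Suc n)\<^esub>
      (\<Oplus>\<^bsub>fam_copr dX dA (Suc n)\<^esub>i\<in>{1..dX n}. \<Oplus>\<^bsub>fam_copr dX dA (Suc n)\<^esub>j\<in>{1..dA n}.
         fam_gen dX dA (Suc n) (x @ [i]) (a @ [j]))"
proof -
  let ?X = "fam dX (Suc n)" and ?A = "fam dA (Suc n)"
  let ?B = "fun_osys (?X \<times> ?A) (copr_fun ?X ?A)"
  let ?g = "\<lambda>i j. indicator {(x @ [i], a @ [j])} :: nat list \<times> nat list \<Rightarrow> complex"
  have gen: "copr_gen S U s u = copr_class S U (indicator {(s, u)})" for S :: "nat list set" and U :: "nat list set" and s u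
    unfolding copr_gen_def copr_inj_def by (rule arg_cong[where f = "copr_class _ _"]) (auto simp: indicator_def)
  have g: "?g i j \<in> copr_fun ?X ?A" if "i \<in> {1..dX n}" "j \<in> {1..dA n}" for i j
    using that x a by (intro C.copr_funI) (auto simp: fam_Suc indicator_def)
  have fs: "fun_space (copr_fun ?X ?A)" by (rule C.fun_space_copr)
  have s1: "(\<lambda>z. \<Sum>j=1..dA n. ?g i j z) \<in> copr_fun ?X ?A \<and>
      (\<Oplus>\<^bsub>?B\<^esub>j\<in>{1..dA n}. ?g i j) = (\<lambda>z. \<Sum>j=1..dA n. ?g i j z)" if "i \<in> {1..dX n}" for i
    using fun_finsum[OF fs, of "{1..dA n}" "?g i" "?X \<times> ?A"] g[OF that] by auto
  have s2: "(\<lambda>z. \<Sum>i=1..dX n. \<Sum>j=1..dA n. ?g i j z) \<in> copr_fun ?X ?A \<and>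
      (\<Oplus>\<^bsub>?B\<^esub>i\<in>{1..dX n}. (\<lambda>z. \<Sum>j=1..dA n. ?g i j z)) = (\<lambda>z. \<Sum>i=1..dX n. \<Sum>j=1..dA n. ?g i j z)"
    using fun_finsum[OF fs, of "{1..dX n}" "\<lambda>i z. \<Sum>j=1..dA n. ?g i j z" "?X \<times> ?A"] s1 by auto
  note lf = linear_finsum[OF C.B.complex_space_axioms C.space_Q C.cls_linear]
  have "(\<Oplus>\<^bsub>copr_pre ?X ?A\<^esub>i\<in>{1..dX n}. \<Oplus>\<^bsub>copr_pre ?X ?A\<^esub>j\<in>{1..dA n}. copr_class ?X ?A (?g i j)) =
    (\<Oplus>\<^bsub>copr_pre ?X ?A\<^esub>i\<in>{1..dX n}. copr_class ?X ?A (\<lambda>z. \<Sum>j=1..dA n. ?g i j z))"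
  proof (rule C.Q.M.finsum_cong'[OF refl])
    show "(\<lambda>i. copr_class ?X ?A (\<lambda>z. \<Sum>j=1..dA n. ?g i j z)) \<in> {1..dX n} \<rightarrow> carrier (copr_pre ?X ?A)"
      using s1 unfolding C.carrier_Q by blast
    fix i assume i: "i \<in> {1..dX n}"
    have "copr_class ?X ?A (\<Oplus>\<^bsub>?B\<^esub>j\<in>{1..dA n}. ?g i j) = (\<Oplus>\<^bsub>copr_pre ?X ?A\<^esub>j\<in>{1..dA n}. copr_class ?X ?A (?g i j))"
      by (rule lf) (use g[OF i] in auto)
    then show "(\<Oplus>\<^bsub>copr_pre ?X ?A\<^esub>j\<in>{1..dA n}. copr_class ?X ?A (?g i j)) = copr_class ?X ?A (\<lambda>z. \<Sum>j=1..dA n. ?g i j z)"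
      using s1[OF i] by simp
  qed
  also have "\<dots> = copr_class ?X ?A (\<Oplus>\<^bsub>?B\<^esub>i\<in>{1..dX n}. (\<lambda>z. \<Sum>j=1..dA n. ?g i j z))"
    by (rule lf[symmetric]) (use s1 in auto)
  also have "\<dots> = copr_class ?X ?A (\<lambda>z. \<Sum>i=1..dX n. \<Sum>j=1..dA n. ?g i j z)"
    using s2 by simp
  finally have sum: "(\<Oplus>\<^bsub>copr_pre ?X ?A\<^esub>i\<in>{1..dX n}. \<Oplus>\<^bsub>copr_pre ?X ?A\<^esub>j\<in>{1..dA n}. copr_class ?X ?A (?g i j)) =
    copr_class ?X ?A (\<lambda>z. \<Sum>i=1..dX n. \<Sum>j=1..dA n. ?g i j z)" .
  have xa: "indicator {(x, a)} \<in> copr_fun (fam dX n) (fam dA n)"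
    using x a by (intro C.copr_funI) (auto simp: indicator_def)
  have "pull n (indicator {(x, a)}) = (\<lambda>z. (1 / of_nat (dX n)) * (\<Sum>i=1..dX n. \<Sum>j=1..dA n. ?g i j z))"
  proof
    fix z :: "nat list \<times> nat list"
    obtain y b where z: "z = (y, b)" by force
    show "pull n (indicator {(x, a)}) z = (1 / of_nat (dX n)) * (\<Sum>i=1..dX n. \<Sum>j=1..dA n. ?g i j z)"
    proof (cases "y \<in> ?X \<and> b \<in> ?A")
      case True
      then obtain y' k b' m where yb: "y = y' @ [k]" "b = b' @ [m]" "k \<in> {1..dX n}" "m \<in> {1..dA n}"
        by (auto simp: fam_Suc)
      have "(\<Sum>i=1..dX n. \<Sum>j=1..dA n. ?g i j z) = (\<Sum>i=1..dX n. \<Sum>j=1..dA n. if k = i then (if m = j then indicator {(x, a)} (y', b') else 0) else 0)"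
        by (intro sum.cong refl) (auto simp: z yb indicator_def)
      also have "\<dots> = (\<Sum>i=1..dX n. if k = i then indicator {(x, a)} (y', b') else 0)"
        using yb(4) by (intro sum.cong refl) simp
      also have "\<dots> = indicator {(x, a)} (y', b')" using yb(3) by simp
      finally show ?thesis using True by (simp add: pull_def z yb(1,2))
    next
      case False
      then have "?g i j z = 0" if "i \<in> {1..dX n}" "j \<in> {1..dA n}" for i j
        using C.copr_funD[OF g[OF that], of z] by (auto simp: z)
      then show ?thesis using False by (auto simp: pull_def z)
    qed
  qed
  then show ?thesis
    unfolding gen fam_conn_cls[OF xa] fam_copr_def C.carrier_copr sum
    using C.cls_smult[of "\<lambda>z. \<Sum>i=1..dX n. \<Sum>j=1..dA n. ?g i j z" "Suc n" "1 / of_nat (dX n)"] s2 by simp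
qed

end

subsection \<open>The norm of an operator system\<close>

lemma ucp_comp: "\<lbrakk>ucp V W \<phi>; ucp W Z \<psi>\<rbrakk> \<Longrightarrow> ucp V Z (\<lambda>x. \<psi> (\<phi> x))"
  by (simp add: ucp_def linear_map_def)

lemma ucp_mpos: "\<lbrakk>ucp V W \<phi>; P \<in> mpos V n\<rbrakk> \<Longrightarrow> (\<lambda>i j. \<phi> (P i j)) \<in> mpos W n"
  by (simp add: ucp_def)

lemma UN_pair_const:
  assumes "(a, b) \<in> X" and "\<And>x y. (x, y) \<in> X \<Longrightarrow> f x y = C"
  shows "(\<Union>(x, y)\<in>X. f x y) = C"
proof (rule UN_constant_eq[OF assms(1)], rule ballI)
  fix z assume "z \<in> X"
  then show "(case z of (x, y) \<Rightarrow> f x y) = C" by (cases z) (simp add: assms(2))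
qed

lemma ucp_id: "ucp V V (\<lambda>x. x)"
  by (simp add: ucp_def linear_map_def)

context operator_system
begin

abbreviation nm :: "'a \<Rightarrow> real \<Rightarrow> nat \<Rightarrow> nat \<Rightarrow> 'a" where
  "nm v r \<equiv> (\<lambda>i j. if i = j then complex_of_real r \<odot> \<one> else if i < j then v else adj V v)"

lemma nm_mats: "v \<in> carrier V \<Longrightarrow> nm v r \<in> mats V 2"
  by (auto simp: mats_def unit_closed adj_closed)

lemma adj_zero: "adj V \<zero> = \<zero>"
  using adj_smult[of \<zero> 0] adj_closed[of \<zero>] by simp

lemma adj_minus: "x \<in> carrier V \<Longrightarrow> adj V (\<ominus> x) = \<ominus> adj V x"
  using adj_smult[of x "-1"] by (simp add: smult_m1 adj_closed)

lemma norm_le_ex: 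
  assumes v: "v \<in> carrier V" shows "\<exists>r>0. norm_le V v r"
proof -
  have "nm v 0 \<in> mats V 2" by (rule nm_mats[OF v])
  moreover have "hermitian V 2 (nm v 0)"
    unfolding hermitian_def using v by (auto simp: adj_smult adj_unit adj_adj unit_closed adj_zero)
  ultimately obtain r where r: "r > 0" "mshift V r (nm v 0) \<in> mpos V 2" using order_unit by blast
  from r(2) have "nm v r \<in> mpos V 2"
    by (rule mpos_cong) (auto simp: mshift_def unit_closed)
  then show ?thesis using r(1) by (auto simp: norm_le_def)
qed

lemma norm_le_0: "0 \<le> r \<Longrightarrow> norm_le V \<zero> r"
  unfolding norm_le_def
  by (rule mpos_cong[OF mpos_unit]) (auto simp: mshift_def unit_closed adj_zero)

lemma norm_le_add:
  assumes "v \<in> carrier V" "w \<in> carrier V" "norm_le V v r" "norm_le V w s"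
  shows "norm_le V (v \<oplus> w) (r + s)"
  unfolding norm_le_def
  by (rule mpos_cong[OF mpos_add[OF assms(3,4)[unfolded norm_le_def]]])
     (auto simp: assms adj_add smult_add unit_closed)

lemma norm_le_mono:
  assumes "v \<in> carrier V" "norm_le V v r" "r \<le> s"
  shows "norm_le V v s"
  using norm_le_add[OF assms(1) M.zero_closed assms(2) norm_le_0[of "s - r"]] assms by simp

lemma norm_le_minus:
  assumes v: "v \<in> carrier V" and r: "norm_le V v r"
  shows "norm_le V (\<ominus> v) r"
proof -
  let ?a = "\<lambda>i k :: nat. if k = i then (if i = 0 then 1 else -1) else (0::complex)"
  have "compress V 2 ?a (nm v r) \<in> mpos V 2" by (rule mpos_compress[OF r[unfolded norm_le_def]])
  then show ?thesis unfolding norm_le_def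
  proof (rule mpos_cong)
    fix i j :: nat assume ij: "i < 2" "j < 2"
    have "compress V 2 ?a (nm v r) i j = ((if i = 0 then 1 else -1) * cnj (if j = 0 then 1 else -1)) \<odot> nm v r i j"
      using compress_scaled[OF nm_mats[OF v], of "\<lambda>i. i" i j "\<lambda>i. if i = 0 then 1 else -1" r] ij by simp
    then show "nm (\<ominus> v) r i j = compress V 2 ?a (nm v r) i j"
      using ij v by (auto simp: less_2_cases_iff smult_m1 adj_minus adj_closed unit_closed)
  qed
qed

lemma norm_le_zero:
  assumes v: "v \<in> carrier V" and le: "\<And>\<epsilon>. \<epsilon> > 0 \<Longrightarrow> norm_le V v \<epsilon>"
  shows "v = \<zero>"
proof -
  have 0: "nm w 0 \<in> mpos V 2" if w: "w \<in> carrier V" and le: "\<And>\<epsilon>. \<epsilon> > 0 \<Longrightarrow> norm_le V w \<epsilon>" for w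
  proof (rule archimedean[OF nm_mats[OF w]])
    fix \<epsilon> :: real assume "\<epsilon> > 0"
    from le[OF this] show "mshift V \<epsilon> (nm w 0) \<in> mpos V 2"
      unfolding norm_le_def by (rule mpos_cong) (auto simp: mshift_def unit_closed)
  qed
  have "(\<lambda>i j. \<ominus> nm v 0 i j) \<in> mpos V 2"
    by (rule mpos_cong[OF 0[of "\<ominus> v"]]) (use v norm_le_minus le in \<open>auto simp: adj_minus unit_closed\<close>)
  then show "v = \<zero>" using proper[OF 0[OF v le], of 0 1] by simp
qed

lemma norm_le_bound:
  assumes d: "d \<in> carrier V" "adj V d = d" and r: "norm_le V d r"
  shows "(\<lambda>i j. of_real r \<odot> \<one> \<ominus> d) \<in> mpos V 1"
proof -
  let ?a = "\<lambda>i k :: nat. if k = 0 then 1 else (-1::complex)"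
  have "compress V 2 ?a (nm d r) \<in> mpos V 1" by (rule mpos_compress[OF r[unfolded norm_le_def]])
  from mpos_scale[OF this, of "1/2"]
  have "(\<lambda>i j. of_real (1/2) \<odot> compress V 2 ?a (nm d r) i j) \<in> mpos V 1" by simp
  then show ?thesis
  proof (rule mpos_cong)
    fix i j :: nat
    let ?u = "of_real r \<odot> \<one>"
    have c: "?u \<in> carrier V" "\<ominus> d \<in> carrier V" using d unit_closed by auto
    have "compress V 2 ?a (nm d r) i j = ?u \<oplus> \<ominus> d \<oplus> (\<ominus> d \<oplus> ?u)"
      using d compress_2[OF nm_mats[OF d(1)], where \<alpha> = ?a and i = i and j = j] c unit_closed by (simp add: smult_m1 M.minus_minus)
    also have "\<dots> = (?u \<oplus> \<ominus> d) \<oplus> (?u \<oplus> \<ominus> d)"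
      using c by (simp add: M.a_comm)
    also have "\<dots> = 2 \<odot> (?u \<oplus> \<ominus> d)"
      using smult_add[of "?u \<oplus> \<ominus> d" 1 1] c by simp
    finally show "?u \<ominus> d = of_real (1/2) \<odot> compress V 2 ?a (nm d r) i j"
      using c by (simp add: a_minus_def smult_smult del: of_real_divide) (simp add: smult_smult)
  qed
qed

lemma norm_le_entry:
  assumes P: "P \<in> mpos V n" and ij: "i < n" "j < n"
    and i: "(\<lambda>_ _. of_real r \<odot> \<one> \<ominus> P i i) \<in> mpos V 1" and j: "(\<lambda>_ _. of_real r \<odot> \<one> \<ominus> P j j) \<in> mpos V 1"
  shows "norm_le V (P i j) r"
proof -
  note c = mats_D[OF mpos_mats[OF P]]
  let ?f = "\<lambda>k::nat. if k = 0 then i else j"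
  let ?S = "compress V n (\<lambda>k l. if l = ?f k then 1 else 0) P"
  let ?x = "of_real r \<odot> \<one> \<ominus> P i i" and ?y = "of_real r \<odot> \<one> \<ominus> P j j"
  let ?A = "compress V 1 (\<lambda>k l. if k = 0 then 1 else 0) (\<lambda>_ _. ?x)"
  let ?B = "compress V 1 (\<lambda>k l. if k = 1 then 1 else 0) (\<lambda>_ _. ?y)"
  have u: "complex_of_real r \<odot> \<one> \<in> carrier V" using unit_closed by simp
  have xy: "?x \<in> carrier V" "?y \<in> carrier V" using u c ij by auto
  have S: "?S k l = P (?f k) (?f l)" for k l
    by (rule compress_select[OF mpos_mats[OF P]]) (use ij in auto)
  have A: "?A k l = (if k = 0 \<and> l = 0 then ?x else \<zero>)" for k l
    using compress_1[of "\<lambda>_ _. ?x" "\<lambda>k l. if k = 0 then 1 else 0" k l] xy by auto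
  have B: "?B k l = (if k = 1 \<and> l = 1 then ?y else \<zero>)" for k l
    using compress_1[of "\<lambda>_ _. ?y" "\<lambda>k l. if k = 1 then 1 else 0" k l] xy by auto
  have "(\<lambda>k l. ?S k l \<oplus> (?A k l \<oplus> ?B k l)) \<in> mpos V 2"
    by (intro mpos_add mpos_compress P i j)
  then show ?thesis unfolding norm_le_def
  proof (rule mpos_cong)
    fix k l :: nat assume kl: "k < 2" "l < 2"
    have h: "P j i = adj V (P i j)" using mpos_hermitian[OF P] ij unfolding hermitian_def by blast
    have canc: "p \<oplus> (of_real r \<odot> \<one> \<ominus> p) = of_real r \<odot> \<one>" if "p \<in> carrier V" for p
      using u that by (simp add: a_minus_def M.a_lcomm[of p] M.r_neg)
    show "nm (P i j) r k l = ?S k l \<oplus> (?A k l \<oplus> ?B k l)"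
      unfolding S A B using kl h canc c ij xy by (auto simp: less_2_cases_iff adj_closed)
  qed
qed

lemma diff_split:
  "\<lbrakk>x \<in> carrier V; y \<in> carrier V; z \<in> carrier V\<rbrakk> \<Longrightarrow> x \<ominus> z = (x \<ominus> y) \<oplus> (y \<ominus> z)"
  by (simp add: a_minus_def M.a_assoc M.r_neg1 M.r_neg2)

lemma diff_add:
  "\<lbrakk>a \<in> carrier V; a' \<in> carrier V; b \<in> carrier V; b' \<in> carrier V\<rbrakk> \<Longrightarrow>
    (a \<oplus> b) \<ominus> (a' \<oplus> b') = (a \<ominus> a') \<oplus> (b \<ominus> b')"
  by (simp add: a_minus_def M.minus_add M.a_ac)

lemma minus_diff: "\<lbrakk>a \<in> carrier V; b \<in> carrier V\<rbrakk> \<Longrightarrow> \<ominus> (a \<ominus> b) = b \<ominus> a"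
  by (simp add: a_minus_def M.minus_add M.minus_minus M.a_comm)

lemma norm_le_adj:
  assumes v: "v \<in> carrier V" and r: "norm_le V v r"
  shows "norm_le V (adj V v) r"
proof -
  let ?f = "\<lambda>k::nat. 1 - k"
  have "compress V 2 (\<lambda>k l. if l = ?f k then 1 else 0) (nm v r) \<in> mpos V 2"
    by (rule mpos_compress[OF r[unfolded norm_le_def]])
  then show ?thesis unfolding norm_le_def
  proof (rule mpos_cong)
    fix k l :: nat assume kl: "k < 2" "l < 2"
    have "compress V 2 (\<lambda>k l. if l = ?f k then 1 else 0) (nm v r) k l = nm v r (?f k) (?f l)"
      by (rule compress_select[OF nm_mats[OF v]]) auto
    then show "nm (adj V v) r k l = compress V 2 (\<lambda>k l. if l = ?f k then 1 else 0) (nm v r) k l"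
      using kl v by (auto simp: less_2_cases_iff adj_adj)
  qed
qed

lemma norm_le_scale:
  assumes v: "v \<in> carrier V" and r: "norm_le V v r" and c: "c \<noteq> 0"
  shows "norm_le V (c \<odot> v) (cmod c * r)"
proof -
  define t where "t = complex_of_real (sqrt (cmod c))"
  have t: "t \<noteq> 0" "t * t = of_real (cmod c)" "cnj t = t"
    using c by (simp_all add: t_def flip: of_real_mult)
  let ?c = "\<lambda>i::nat. if i = 0 then c / t else t"
  have "compress V 2 (\<lambda>i k. if k = i then ?c i else 0) (nm v r) \<in> mpos V 2"
    by (rule mpos_compress[OF r[unfolded norm_le_def]])
  then show ?thesis unfolding norm_le_def
  proof (rule mpos_cong)
    fix k l :: nat assume kl: "k < 2" "l < 2"
    have "compress V 2 (\<lambda>i k. if k = i then ?c i else 0) (nm v r) k l = (?c k * cnj (?c l)) \<odot> nm v r k l"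
      using compress_scaled[OF nm_mats[OF v], of "\<lambda>i. i" k l ?c r] kl by simp
    moreover have "c / t * cnj (c / t) = t * t"
    proof -
      have "c * cnj c = (t * t) * (t * t)" unfolding t(2) by (simp add: complex_norm_square[symmetric] power2_eq_square)
      then show ?thesis using t by (simp add: field_simps)
    qed
    ultimately show "nm (c \<odot> v) (cmod c * r) k l = compress V 2 (\<lambda>i k. if k = i then ?c i else 0) (nm v r) k l"
      using kl v t by (auto simp: less_2_cases_iff smult_smult unit_closed adj_smult adj_closed)
  qed
qed

end

context
  fixes V :: "'v osys" and W :: "'w osys" and \<phi>
  assumes V: "operator_system V" and W: "operator_system W" and u: "ucp V W \<phi>"
begin

interpretation V: operator_system V by fact
interpretation W: operator_system W by fact

lemma ucp_adj: "v \<in> carrier V \<Longrightarrow> \<phi> (adj V v) = adj W (\<phi> v)"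
proof -
  assume v: "v \<in> carrier V"
  then obtain r where "norm_le V v r" using V.norm_le_ex by blast
  then have "(\<lambda>i j. \<phi> (V.nm v r i j)) \<in> mpos W 2" unfolding norm_le_def by (rule ucp_mpos[OF u])
  then have "hermitian W 2 (\<lambda>i j. \<phi> (V.nm v r i j))" by (rule W.mpos_hermitian)
  then have "\<forall>i<2. \<forall>j<2. \<phi> (V.nm v r j i) = adj W (\<phi> (V.nm v r i j))"
    unfolding hermitian_def .
  from this[rule_format, of 0 1] show ?thesis by simp
qed

lemma ucp_norm_le: "\<lbrakk>v \<in> carrier V; norm_le V v r\<rbrakk> \<Longrightarrow> norm_le W (\<phi> v) r"
proof -
  assume v: "v \<in> carrier V" and "norm_le V v r"
  have "(\<lambda>i j. \<phi> (V.nm v r i j)) \<in> mpos W 2"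
    using \<open>norm_le V v r\<close> unfolding norm_le_def by (rule ucp_mpos[OF u])
  then show "norm_le W (\<phi> v) r" unfolding norm_le_def
    by (rule W.mpos_cong) (use u v V.unit_closed ucp_adj[OF v] in \<open>auto simp: ucp_def linear_map_def\<close>)
qed

end

subsection \<open>Inductive limits\<close>

locale os_sequence =
  fixes V :: "nat \<Rightarrow> 'v osys" and \<phi> :: "nat \<Rightarrow> 'v \<Rightarrow> 'v"
  assumes os: "n \<ge> 1 \<Longrightarrow> operator_system (V n)"
    and ucp: "n \<ge> 1 \<Longrightarrow> ucp (V n) (V (Suc n)) (\<phi> n)"
begin

abbreviation "L \<equiv> lim_pre V \<phi>"
abbreviation "cn \<equiv> conn \<phi>"
abbreviation "emb \<equiv> lim_emb V \<phi>"

lemma cs: "n \<ge> 1 \<Longrightarrow> complex_space (V n)"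
  using os[of n] by (simp add: operator_system_def matrix_ordered_def)

lemma mo: "n \<ge> 1 \<Longrightarrow> matrix_ordered (V n)"
  using os[of n] by (simp add: operator_system_def)

lemma cn_same [simp]: "cn n n v = v"
  by (simp add: conn_def)

lemma cn_Suc: "n \<le> k \<Longrightarrow> cn n (Suc k) v = \<phi> k (cn n k v)"
  by (simp add: conn_def)

lemma cn_cn: "\<lbrakk>n \<le> m; m \<le> k\<rbrakk> \<Longrightarrow> cn m k (cn n m v) = cn n k v"
proof -
  assume "n \<le> m" "m \<le> k"
  then have "[n..<k] = [n..<m] @ [m..<k]" using upt_add_eq_append[of n m "k - m"] by simp
  then show ?thesis by (simp add: conn_def)
qed

lemma cn_ucp:
  assumes "1 \<le> n" "n \<le> k" shows "ucp (V n) (V k) (cn n k)"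
  using assms(2)
proof (induction k rule: dec_induct)
  case base
  then show ?case using ucp_id[of "V n"] by (simp add: ucp_def linear_map_def)
next
  case (step k)
  have "ucp (V n) (V (Suc k)) (\<lambda>x. \<phi> k (cn n k x))"
    by (rule ucp_comp[OF step(3) ucp]) (use step assms(1) in auto)
  moreover have "(\<lambda>x. \<phi> k (cn n k x)) = cn n (Suc k)" using step(1) by (simp add: fun_eq_iff cn_Suc)
  ultimately show ?case by simp
qed

lemma cn_lin: "\<lbrakk>1 \<le> n; n \<le> k\<rbrakk> \<Longrightarrow> linear_map (V n) (V k) (cn n k)"
  using cn_ucp[of n k] by (simp add: ucp_def)

lemma cn_closed: "\<lbrakk>1 \<le> n; n \<le> k; v \<in> carrier (V n)\<rbrakk> \<Longrightarrow> cn n k v \<in> carrier (V k)"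
  using cn_lin[of n k] by (simp add: linear_map_def)

lemma cn_add: "\<lbrakk>1 \<le> n; n \<le> k; v \<in> carrier (V n); w \<in> carrier (V n)\<rbrakk> \<Longrightarrow>
    cn n k (v \<oplus>\<^bsub>V n\<^esub> w) = cn n k v \<oplus>\<^bsub>V k\<^esub> cn n k w"
  using cn_lin[of n k] by (simp add: linear_map_def)

lemma cn_smult: "\<lbrakk>1 \<le> n; n \<le> k; v \<in> carrier (V n)\<rbrakk> \<Longrightarrow> cn n k (c \<odot>\<^bsub>V n\<^esub> v) = c \<odot>\<^bsub>V k\<^esub> cn n k v"
  using cn_lin[of n k] by (simp add: linear_map_def)

lemma cn_unit: "\<lbrakk>1 \<le> n; n \<le> k\<rbrakk> \<Longrightarrow> cn n k \<one>\<^bsub>V n\<^esub> = \<one>\<^bsub>V k\<^esub>"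
  using cn_ucp[of n k] by (simp add: ucp_def)

lemma cn_zero: "\<lbrakk>1 \<le> n; n \<le> k\<rbrakk> \<Longrightarrow> cn n k \<zero>\<^bsub>V n\<^esub> = \<zero>\<^bsub>V k\<^esub>"
  by (rule linear_zero[OF cs cs cn_lin]) auto

lemma cn_diff: "\<lbrakk>1 \<le> n; n \<le> k; v \<in> carrier (V n); w \<in> carrier (V n)\<rbrakk> \<Longrightarrow>
    cn n k (v \<ominus>\<^bsub>V n\<^esub> w) = cn n k v \<ominus>\<^bsub>V k\<^esub> cn n k w"
  by (rule linear_diff[OF cs cs cn_lin]) auto

lemma cn_adj: "\<lbrakk>1 \<le> n; n \<le> k; v \<in> carrier (V n)\<rbrakk> \<Longrightarrow> cn n k (adj (V n) v) = adj (V k) (cn n k v)"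
  by (rule ucp_adj[OF os os cn_ucp]) auto

lemma cn_mpos: "\<lbrakk>1 \<le> n; n \<le> k; P \<in> mpos (V n) l\<rbrakk> \<Longrightarrow> (\<lambda>i j. cn n k (P i j)) \<in> mpos (V k) l"
  using cn_ucp[of n k] by (simp add: ucp_def)

definition R :: "nat \<Rightarrow> 'v \<Rightarrow> nat \<Rightarrow> 'v \<Rightarrow> bool" where
  "R n v m w \<longleftrightarrow> (\<forall>\<epsilon>>0. \<exists>k\<ge>max n m. norm_le (V k) (cn n k v \<ominus>\<^bsub>V k\<^esub> cn m k w) \<epsilon>)"

lemma emb_R: "emb n v = {(m, w). m \<ge> 1 \<and> w \<in> carrier (V m) \<and> R n v m w}"
  by (simp add: lim_emb_def R_def)

abbreviation "el n v \<equiv> 1 \<le> n \<and> v \<in> carrier (V n)"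

lemma R_later:
  assumes "el n v" "el m w" "max n m \<le> k" "k \<le> k'" "norm_le (V k) (cn n k v \<ominus>\<^bsub>V k\<^esub> cn m k w) \<epsilon>"
  shows "norm_le (V k') (cn n k' v \<ominus>\<^bsub>V k'\<^esub> cn m k' w) \<epsilon>"
proof -
  interpret Vk: operator_system "V k" using assms by (intro os) auto
  have c: "cn n k v \<in> carrier (V k)" "cn m k w \<in> carrier (V k)" using assms by (auto intro: cn_closed)
  have k: "1 \<le> k" "1 \<le> k'" using assms by auto
  have "norm_le (V k') (cn k k' (cn n k v \<ominus>\<^bsub>V k\<^esub> cn m k w)) \<epsilon>"
    by (rule ucp_norm_le[OF os[OF k(1)] os[OF k(2)] cn_ucp[OF k(1) assms(4)] _ assms(5)]) (use c in auto)
  moreover have "cn k k' (cn n k v \<ominus>\<^bsub>V k\<^esub> cn m k w) = cn n k' v \<ominus>\<^bsub>V k'\<^esub> cn m k' w"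
    using cn_diff[OF k(1) assms(4) c] assms by (simp add: cn_cn)
  ultimately show ?thesis by simp
qed

lemma R_evD:
  assumes "el n v" "el m w" "R n v m w" "\<epsilon> > 0"
  shows "\<exists>k0\<ge>max n m. \<forall>k\<ge>k0. norm_le (V k) (cn n k v \<ominus>\<^bsub>V k\<^esub> cn m k w) \<epsilon>"
  using assms(3,4) R_later[OF assms(1,2)] unfolding R_def by meson

lemma R_refl: "el n v \<Longrightarrow> R n v n v"
  unfolding R_def
proof (intro allI impI)
  fix \<epsilon> :: real assume n: "el n v" and e: "0 < \<epsilon>"
  interpret Vn: operator_system "V n" using n by (intro os) auto
  show "\<exists>k\<ge>max n n. norm_le (V k) (cn n k v \<ominus>\<^bsub>V k\<^esub> cn n k v) \<epsilon>"
    using n e Vn.norm_le_0[of \<epsilon>] by (intro exI[of _ n]) (simp add: a_minus_def Vn.M.r_neg)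
qed

lemma R_sym: assumes "el n v" "el m w" "R n v m w" shows "R m w n v"
  unfolding R_def
proof (intro allI impI)
  fix \<epsilon> :: real assume e: "0 < \<epsilon>"
  obtain k where k: "k \<ge> max n m" "norm_le (V k) (cn n k v \<ominus>\<^bsub>V k\<^esub> cn m k w) \<epsilon>"
    using assms(3) e by (auto simp: R_def)
  interpret Vk: operator_system "V k" using k assms by (intro os) auto
  have c: "cn n k v \<in> carrier (V k)" "cn m k w \<in> carrier (V k)" using k assms by (auto intro: cn_closed)
  show "\<exists>k\<ge>max m n. norm_le (V k) (cn m k w \<ominus>\<^bsub>V k\<^esub> cn n k v) \<epsilon>"
    using Vk.norm_le_minus[OF _ k(2)] c k(1) by (intro exI[of _ k]) (simp add: Vk.minus_diff)
qed

lemma R_trans: assumes "el n v" "el m w" "el l x" "R n v m w" "R m w l x" shows "R n v l x"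
  unfolding R_def
proof (intro allI impI)
  fix \<epsilon> :: real assume e: "0 < \<epsilon>"
  obtain k1 where k1: "k1 \<ge> max n m" "\<forall>k\<ge>k1. norm_le (V k) (cn n k v \<ominus>\<^bsub>V k\<^esub> cn m k w) (\<epsilon>/2)"
    using R_evD[OF assms(1,2,4), of "\<epsilon>/2"] e by auto
  obtain k2 where k2: "k2 \<ge> max m l" "\<forall>k\<ge>k2. norm_le (V k) (cn m k w \<ominus>\<^bsub>V k\<^esub> cn l k x) (\<epsilon>/2)"
    using R_evD[OF assms(2,3,5), of "\<epsilon>/2"] e by auto
  define k where "k = max k1 k2"
  have k: "k \<ge> k1" "k \<ge> k2" "k \<ge> n" "k \<ge> m" "k \<ge> l" using k1 k2 by (auto simp: k_def)
  interpret Vk: operator_system "V k" using k assms by (intro os) auto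
  have c: "cn n k v \<in> carrier (V k)" "cn m k w \<in> carrier (V k)" "cn l k x \<in> carrier (V k)"
    using k assms by (auto intro: cn_closed)
  have "norm_le (V k) ((cn n k v \<ominus>\<^bsub>V k\<^esub> cn m k w) \<oplus>\<^bsub>V k\<^esub> (cn m k w \<ominus>\<^bsub>V k\<^esub> cn l k x)) (\<epsilon>/2 + \<epsilon>/2)"
    using k1 k2 k c by (intro Vk.norm_le_add) auto
  then show "\<exists>k\<ge>max n l. norm_le (V k) (cn n k v \<ominus>\<^bsub>V k\<^esub> cn l k x) \<epsilon>"
    using k c by (intro exI[of _ k]) (simp flip: Vk.diff_split)
qed

lemma emb_eq: assumes "el n v" "el m w" shows "emb n v = emb m w \<longleftrightarrow> R n v m w"
proof
  assume "emb n v = emb m w"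
  moreover have "(m, w) \<in> emb m w" using assms R_refl by (auto simp: emb_R)
  ultimately show "R n v m w" by (auto simp: emb_R)
next
  assume r: "R n v m w"
  show "emb n v = emb m w"
    unfolding emb_R using R_trans[OF assms(2,1)] R_trans[OF assms] R_sym[OF assms r] r by blast
qed

lemma emb_self: "el n v \<Longrightarrow> (n, v) \<in> emb n v"
  using R_refl by (auto simp: emb_R)

lemma emb_mem: assumes "el n v" "(m, w) \<in> emb n v" shows "el m w \<and> emb m w = emb n v \<and> R n v m w"
  using assms emb_eq[of n v m w] by (auto simp: emb_R)

lemma emb_cn: assumes "el n v" "n \<le> k" shows "emb k (cn n k v) = emb n v"
proof -
  have "R n v k (cn n k v)"
    unfolding R_def
  proof (intro allI impI)
    fix \<epsilon> :: real assume e: "0 < \<epsilon>"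
    interpret Vk: operator_system "V k" using assms by (intro os) auto
    have "cn n k v \<in> carrier (V k)" using assms by (auto intro: cn_closed)
    then show "\<exists>k'\<ge>max n k. norm_le (V k') (cn n k' v \<ominus>\<^bsub>V k'\<^esub> cn k k' (cn n k v)) \<epsilon>"
      using assms e Vk.norm_le_0[of \<epsilon>] by (intro exI[of _ k]) (simp add: a_minus_def Vk.M.r_neg)
  qed
  then show ?thesis using assms emb_eq[of n v k "cn n k v"] cn_closed[of n k v] by auto
qed

lemma emb_zero_iff:
  assumes "el n v"
  shows "emb n v = emb 1 \<zero>\<^bsub>V 1\<^esub> \<longleftrightarrow> (\<forall>\<epsilon>>0. \<exists>k\<ge>n. norm_le (V k) (cn n k v) \<epsilon>)"
proof -
  interpret V1: operator_system "V (Suc 0)" by (intro os) auto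
  have "cn n k v \<ominus>\<^bsub>V k\<^esub> cn 1 k \<zero>\<^bsub>V 1\<^esub> = cn n k v" if "k \<ge> n" for k
  proof -
    interpret Vk: operator_system "V k" using assms that by (intro os) auto
    show ?thesis using that assms cn_zero[of 1 k] cn_closed[of n k v] by (simp add: a_minus_def)
  qed
  moreover have "max n 1 = n" using assms by auto
  ultimately show ?thesis
    using emb_eq[of n v 1 "\<zero>\<^bsub>V 1\<^esub>"] assms V1.M.zero_closed by (simp add: R_def cong: conj_cong)
qed

lemma lim_add:
  assumes "el n v" "el m w"
  shows "emb n v \<oplus>\<^bsub>L\<^esub> emb m w =
    emb (max n m) (cn n (max n m) v \<oplus>\<^bsub>V (max n m)\<^esub> cn m (max n m) w)"
proof -
  let ?s = "\<lambda>n v m w. cn n (max n m) v \<oplus>\<^bsub>V (max n m)\<^esub> cn m (max n m) w"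
  have el: "el (max n m) (?s n v m w)" if "el n v" "el m w" for n v m w
  proof -
    interpret Vk: operator_system "V (max n m)" using that by (intro os) auto
    show ?thesis using that by (auto intro!: Vk.M.a_closed cn_closed)
  qed
  have eq: "emb (max n' m') (?s n' v' m' w') = emb (max n m) (?s n v m w)"
    if 1: "(n', v') \<in> emb n v" and 2: "(m', w') \<in> emb m w" for n' v' m' w'
  proof -
    have e': "el n' v'" "el m' w'" "R n v n' v'" "R m w m' w'"
      using emb_mem[OF assms(1) 1] emb_mem[OF assms(2) 2] by auto
    have "R (max n m) (?s n v m w) (max n' m') (?s n' v' m' w')"
      unfolding R_def
    proof (intro allI impI)
      fix \<epsilon> :: real assume e: "0 < \<epsilon>"
      obtain k1 where k1: "k1 \<ge> max n n'" "\<forall>k\<ge>k1. norm_le (V k) (cn n k v \<ominus>\<^bsub>V k\<^esub> cn n' k v') (\<epsilon>/2)"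
        using R_evD[OF assms(1) e'(1) e'(3), of "\<epsilon>/2"] e by auto
      obtain k2 where k2: "k2 \<ge> max m m'" "\<forall>k\<ge>k2. norm_le (V k) (cn m k w \<ominus>\<^bsub>V k\<^esub> cn m' k w') (\<epsilon>/2)"
        using R_evD[OF assms(2) e'(2) e'(4), of "\<epsilon>/2"] e by auto
      define k where "k = max k1 k2"
      have k: "k \<ge> k1" "k \<ge> k2" "k \<ge> n" "k \<ge> m" "k \<ge> n'" "k \<ge> m'" using k1 k2 by (auto simp: k_def)
      interpret Vk: operator_system "V k" using k assms by (intro os) auto
      have c: "cn n k v \<in> carrier (V k)" "cn m k w \<in> carrier (V k)" "cn n' k v' \<in> carrier (V k)" "cn m' k w' \<in> carrier (V k)"
        using k assms e' by (auto intro: cn_closed)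
      have s: "cn (max n m) k (?s n v m w) = cn n k v \<oplus>\<^bsub>V k\<^esub> cn m k w"
        if "el n v" "el m w" "n \<le> k" "m \<le> k" for n v m w
        using that by (subst cn_add) (auto intro!: cn_closed simp: cn_cn)
      have "norm_le (V k) ((cn n k v \<ominus>\<^bsub>V k\<^esub> cn n' k v') \<oplus>\<^bsub>V k\<^esub> (cn m k w \<ominus>\<^bsub>V k\<^esub> cn m' k w')) (\<epsilon>/2 + \<epsilon>/2)"
        using k1 k2 k c by (intro Vk.norm_le_add) auto
      then have "norm_le (V k) (cn (max n m) k (?s n v m w) \<ominus>\<^bsub>V k\<^esub> cn (max n' m') k (?s n' v' m' w')) \<epsilon>"
        unfolding s[OF assms k(3,4)] s[OF e'(1,2) k(5,6)] Vk.diff_add[OF c(1,3,2,4)] by simp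
      then show "\<exists>k\<ge>max (max n m) (max n' m'). norm_le (V k) (cn (max n m) k (?s n v m w) \<ominus>\<^bsub>V k\<^esub> cn (max n' m') k (?s n' v' m' w')) \<epsilon>"
        using k by (intro exI[of _ k]) auto
    qed
    then show ?thesis using emb_eq[OF el[OF assms] el[OF e'(1,2)]] by simp
  qed
  show ?thesis
    unfolding lim_pre_def
    by simp (intro UN_pair_const[OF emb_self[OF assms(1)]] UN_pair_const[OF emb_self[OF assms(2)]] eq)
qed

lemma lim_smult:
  assumes "el n v"
  shows "c \<odot>\<^bsub>L\<^esub> emb n v = emb n (c \<odot>\<^bsub>V n\<^esub> v)"
proof -
  have el: "el n (c \<odot>\<^bsub>V n\<^esub> v)" if "el n v" for n v
    using that complex_space.smult_closed'[OF cs] by auto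
  have eq: "emb n' (c \<odot>\<^bsub>V n'\<^esub> v') = emb n (c \<odot>\<^bsub>V n\<^esub> v)" if 1: "(n', v') \<in> emb n v" for n' v'
  proof -
    have e': "el n' v'" "R n v n' v'" using emb_mem[OF assms 1] by auto
    have "R n (c \<odot>\<^bsub>V n\<^esub> v) n' (c \<odot>\<^bsub>V n'\<^esub> v')"
      unfolding R_def
    proof (intro allI impI)
      fix \<epsilon> :: real assume e: "0 < \<epsilon>"
      have pos: "\<epsilon> / (cmod c + 1) > 0" using e by (intro divide_pos_pos add_nonneg_pos) auto
      obtain k where k: "k \<ge> max n n'" "norm_le (V k) (cn n k v \<ominus>\<^bsub>V k\<^esub> cn n' k v') (\<epsilon> / (cmod c + 1))"
        using R_evD[OF assms e', OF pos] by auto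
      interpret Vk: operator_system "V k" using k assms by (intro os) auto
      have cc: "cn n k v \<in> carrier (V k)" "cn n' k v' \<in> carrier (V k)" using k assms e' by (auto intro: cn_closed)
      let ?d = "cn n k v \<ominus>\<^bsub>V k\<^esub> cn n' k v'"
      have d: "?d \<in> carrier (V k)" using cc by auto
      have "norm_le (V k) (c \<odot>\<^bsub>V k\<^esub> ?d) \<epsilon>"
      proof (cases "c = 0")
        case True
        then show ?thesis using Vk.norm_le_0[of \<epsilon>] e d by simp
      next
        case False
        have "cmod c * (\<epsilon> / (cmod c + 1)) \<le> \<epsilon>"
          using e by (simp add: divide_le_eq add_nonneg_pos mult.commute distrib_left)
        then show ?thesis using Vk.norm_le_mono[OF _ Vk.norm_le_scale[OF d k(2) False]] d by auto
      qed
      moreover have "cn n k (c \<odot>\<^bsub>V n\<^esub> v) \<ominus>\<^bsub>V k\<^esub> cn n' k (c \<odot>\<^bsub>V n'\<^esub> v') = c \<odot>\<^bsub>V k\<^esub> ?d"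
        using assms e' k cc by (simp add: cn_smult a_minus_def Vk.smult_add_right Vk.smult_minus)
      ultimately show "\<exists>k\<ge>max n n'. norm_le (V k) (cn n k (c \<odot>\<^bsub>V n\<^esub> v) \<ominus>\<^bsub>V k\<^esub> cn n' k (c \<odot>\<^bsub>V n'\<^esub> v')) \<epsilon>"
        using k by (intro exI[of _ k]) auto
    qed
    then show ?thesis using emb_eq[OF el[OF assms] el[OF e'(1)]] by simp
  qed
  show ?thesis
    unfolding lim_pre_def by simp (intro UN_pair_const[OF emb_self[OF assms]] eq)
qed

lemma lim_adj:
  assumes "el n v"
  shows "adj L (emb n v) = emb n (adj (V n) v)"
proof -
  have el: "el n (adj (V n) v)" if "el n v" for n v
    using that matrix_ordered.adj_closed[OF mo] by auto
  have eq: "emb n' (adj (V n') v') = emb n (adj (V n) v)" if 1: "(n', v') \<in> emb n v" for n' v'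
  proof -
    have e': "el n' v'" "R n v n' v'" using emb_mem[OF assms 1] by auto
    have "R n (adj (V n) v) n' (adj (V n') v')"
      unfolding R_def
    proof (intro allI impI)
      fix \<epsilon> :: real assume e: "0 < \<epsilon>"
      obtain k where k: "k \<ge> max n n'" "norm_le (V k) (cn n k v \<ominus>\<^bsub>V k\<^esub> cn n' k v') \<epsilon>"
        using R_evD[OF assms e' e] by auto
      interpret Vk: operator_system "V k" using k assms by (intro os) auto
      have cc: "cn n k v \<in> carrier (V k)" "cn n' k v' \<in> carrier (V k)" using k assms e' by (auto intro: cn_closed)
      have "norm_le (V k) (adj (V k) (cn n k v \<ominus>\<^bsub>V k\<^esub> cn n' k v')) \<epsilon>"
        using Vk.norm_le_adj[OF _ k(2)] cc by auto
      then show "\<exists>k\<ge>max n n'. norm_le (V k) (cn n k (adj (V n) v) \<ominus>\<^bsub>V k\<^esub> cn n' k (adj (V n') v')) \<epsilon>"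
        using k assms e' cc by (intro exI[of _ k]) (simp add: cn_adj a_minus_def Vk.adj_add Vk.adj_minus)
    qed
    then show ?thesis using emb_eq[OF el[OF assms] el[OF e'(1)]] by simp
  qed
  show ?thesis
    unfolding lim_pre_def by simp (intro UN_pair_const[OF emb_self[OF assms]] eq)
qed

lemma lim_carrier: "carrier L = {emb n v | n v. el n v}"
  by (auto simp: lim_pre_def)

lemma emb_closed: "el n v \<Longrightarrow> emb n v \<in> carrier L"
  unfolding lim_carrier by blast

lemma lim_zero: "n \<ge> 1 \<Longrightarrow> \<zero>\<^bsub>L\<^esub> = emb n \<zero>\<^bsub>V n\<^esub>"
proof -
  assume n: "n \<ge> 1"
  interpret V1: operator_system "V (Suc 0)" by (intro os) auto
  show ?thesis using emb_cn[of 1 "\<zero>\<^bsub>V 1\<^esub>" n] n cn_zero[of 1 n] by (simp add: lim_pre_def)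
qed

lemma lim_one: "n \<ge> 1 \<Longrightarrow> \<one>\<^bsub>L\<^esub> = emb n \<one>\<^bsub>V n\<^esub>"
proof -
  assume n: "n \<ge> 1"
  interpret V1: operator_system "V (Suc 0)" by (intro os) auto
  show ?thesis using emb_cn[of 1 "\<one>\<^bsub>V 1\<^esub>" n] n cn_unit[of 1 n] V1.unit_closed by (simp add: lim_pre_def)
qed

lemma lim_add': "\<lbrakk>el n v; el n w\<rbrakk> \<Longrightarrow> emb n v \<oplus>\<^bsub>L\<^esub> emb n w = emb n (v \<oplus>\<^bsub>V n\<^esub> w)"
  using lim_add[of n v n w] by simp

lemma emb_linear: "n \<ge> 1 \<Longrightarrow> linear_map (V n) L (emb n)"
  by (auto simp: linear_map_def lim_carrier lim_add' lim_smult)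

lemma lim_rep:
  assumes "x \<in> carrier L"
  obtains n where "n \<ge> 1" "\<forall>k\<ge>n. \<exists>v\<in>carrier (V k). x = emb k v"
proof -
  obtain n v where nv: "x = emb n v" "el n v" using assms by (auto simp: lim_carrier)
  have "\<exists>w\<in>carrier (V k). x = emb k w" if "k \<ge> n" for k
    using nv emb_cn[OF nv(2) that] cn_closed[of n k v] that by (intro bexI[of _ "cn n k v"]) auto
  then show ?thesis using nv that by blast
qed

lemma lim_rep2:
  assumes "x \<in> carrier L" "y \<in> carrier L"
  obtains n v w where "n \<ge> 1" "v \<in> carrier (V n)" "w \<in> carrier (V n)" "x = emb n v" "y = emb n w"
proof -
  obtain n where n: "n \<ge> 1" "\<forall>k\<ge>n. \<exists>v\<in>carrier (V k). x = emb k v" using lim_rep[OF assms(1)] .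
  obtain m where m: "m \<ge> 1" "\<forall>k\<ge>m. \<exists>v\<in>carrier (V k). y = emb k v" using lim_rep[OF assms(2)] .
  have k: "n \<le> max n m" "m \<le> max n m" "1 \<le> max n m" using n(1) by auto
  show ?thesis using n(2)[rule_format, OF k(1)] m(2)[rule_format, OF k(2)] k(3) that by blast
qed

lemma lim_rep3:
  assumes "x \<in> carrier L" "y \<in> carrier L" "z \<in> carrier L"
  obtains n u v w where "n \<ge> 1" "u \<in> carrier (V n)" "v \<in> carrier (V n)" "w \<in> carrier (V n)"
    "x = emb n u" "y = emb n v" "z = emb n w"
proof -
  obtain n where n: "n \<ge> 1" "\<forall>k\<ge>n. \<exists>v\<in>carrier (V k). x = emb k v" using lim_rep[OF assms(1)] .
  obtain m where m: "m \<ge> 1" "\<forall>k\<ge>m. \<exists>v\<in>carrier (V k). y = emb k v" using lim_rep[OF assms(2)] .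
  obtain l where l: "l \<ge> 1" "\<forall>k\<ge>l. \<exists>v\<in>carrier (V k). z = emb k v" using lim_rep[OF assms(3)] .
  let ?k = "max n (max m l)"
  have k: "n \<le> ?k" "m \<le> ?k" "l \<le> ?k" "1 \<le> ?k" using n(1) by auto
  show ?thesis using n(2)[rule_format, OF k(1)] m(2)[rule_format, OF k(2)] l(2)[rule_format, OF k(3)] k(4) that by blast
qed

lemma lim_space: "complex_space L"
proof (rule complex_spaceI)
  interpret V1: operator_system "V (Suc 0)" by (intro os) auto
  show "\<zero>\<^bsub>L\<^esub> \<in> carrier L" unfolding lim_zero[of 1, simplified] by (simp add: emb_closed)
  fix x y z assume x: "x \<in> carrier L"
  fix c d :: complex
  obtain n u where u: "n \<ge> 1" "u \<in> carrier (V n)" "x = emb n u" using x by (auto simp: lim_carrier)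
  interpret Vn: operator_system "V n" using u by (intro os)
  show "c \<odot>\<^bsub>L\<^esub> x \<in> carrier L" using u emb_linear[of n] by (auto simp: linear_map_def lim_smult)
  show "\<zero>\<^bsub>L\<^esub> \<oplus>\<^bsub>L\<^esub> x = x" using u by (simp add: lim_zero[of n] lim_add')
  show "(-1) \<odot>\<^bsub>L\<^esub> x \<oplus>\<^bsub>L\<^esub> x = \<zero>\<^bsub>L\<^esub>"
    using u by (simp add: lim_zero[of n] lim_add' lim_smult Vn.smult_m1 Vn.M.l_neg)
  show "(c + d) \<odot>\<^bsub>L\<^esub> x = c \<odot>\<^bsub>L\<^esub> x \<oplus>\<^bsub>L\<^esub> d \<odot>\<^bsub>L\<^esub> x"
    using u by (simp add: lim_add' lim_smult Vn.smult_add)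
  show "(c * d) \<odot>\<^bsub>L\<^esub> x = c \<odot>\<^bsub>L\<^esub> (d \<odot>\<^bsub>L\<^esub> x)"
    using u by (simp add: lim_smult Vn.smult_smult)
  show "1 \<odot>\<^bsub>L\<^esub> x = x" using u by (simp add: lim_smult)
  assume y: "y \<in> carrier L"
  obtain m v w where m: "m \<ge> 1" "v \<in> carrier (V m)" "w \<in> carrier (V m)" "x = emb m v" "y = emb m w"
    using lim_rep2[OF x y] .
  interpret Vm: operator_system "V m" using m by (intro os)
  show "x \<oplus>\<^bsub>L\<^esub> y \<in> carrier L" using m emb_linear[of m] by (auto simp: linear_map_def lim_add')
  show "x \<oplus>\<^bsub>L\<^esub> y = y \<oplus>\<^bsub>L\<^esub> x" using m by (simp add: lim_add' Vm.M.a_comm)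
  show "c \<odot>\<^bsub>L\<^esub> (x \<oplus>\<^bsub>L\<^esub> y) = c \<odot>\<^bsub>L\<^esub> x \<oplus>\<^bsub>L\<^esub> c \<odot>\<^bsub>L\<^esub> y"
    using m by (simp add: lim_add' lim_smult Vm.smult_add_right)
  assume z: "z \<in> carrier L"
  obtain l p q r where l: "l \<ge> 1" "p \<in> carrier (V l)" "q \<in> carrier (V l)" "r \<in> carrier (V l)"
    "x = emb l p" "y = emb l q" "z = emb l r" using lim_rep3[OF x y z] .
  interpret Vl: operator_system "V l" using l by (intro os)
  show "x \<oplus>\<^bsub>L\<^esub> y \<oplus>\<^bsub>L\<^esub> z = x \<oplus>\<^bsub>L\<^esub> (y \<oplus>\<^bsub>L\<^esub> z)" using l by (simp add: lim_add' Vl.M.a_assoc)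
qed

sublocale L: complex_space L by (rule lim_space)

lemma mpos_L: "P \<in> mpos L l \<longleftrightarrow> (\<exists>n\<ge>1. \<exists>p\<in>mpos (V n) l. \<forall>i<l. \<forall>j<l. P i j = emb n (p i j))"
  by (simp add: lim_pre_def)

lemma mpos_L_later:
  assumes "n \<ge> 1" "p \<in> mpos (V n) l" "\<forall>i<l. \<forall>j<l. P i j = emb n (p i j)" "n \<le> k"
  shows "\<exists>q\<in>mpos (V k) l. \<forall>i<l. \<forall>j<l. P i j = emb k (q i j)"
proof (intro bexI[of _ "\<lambda>i j. cn n k (p i j)"] allI impI)
  show "(\<lambda>i j. cn n k (p i j)) \<in> mpos (V k) l" using assms by (intro cn_mpos)
  fix i j assume ij: "i < l" "j < l"
  have "p i j \<in> carrier (V n)"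
    using complex_space.mats_D[OF cs matrix_ordered.mpos_mats[OF mo]] assms ij by blast
  then show "P i j = emb k (cn n k (p i j))" using assms ij by (simp add: emb_cn)
qed

lemma mats_L:
  assumes "P \<in> mats L l"
  shows "\<exists>n\<ge>1. \<exists>p\<in>mats (V n) l. \<forall>i<l. \<forall>j<l. P i j = emb n (p i j)"
proof -
  have "\<exists>n. i < l \<longrightarrow> j < l \<longrightarrow> (n \<ge> 1 \<and> (\<forall>k\<ge>n. \<exists>v\<in>carrier (V k). P i j = emb k v))" for i j
  proof (cases "i < l \<and> j < l")
    case True
    then have "P i j \<in> carrier L" using assms by (auto simp: mats_def)
    then show ?thesis using lim_rep by metis
  qed auto
  then obtain N where N: "\<And>i j. \<lbrakk>i < l; j < l\<rbrakk> \<Longrightarrow> \<forall>k\<ge>N i j. \<exists>v\<in>carrier (V k). P i j = emb k v"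
    by metis
  define k where "k = 1 + (\<Sum>i<l. \<Sum>j<l. N i j)"
  have "N i j \<le> k" if ij: "i < l" "j < l" for i j
  proof -
    have "N i j \<le> (\<Sum>j<l. N i j)" using ij by (intro member_le_sum) auto
    also have "\<dots> \<le> (\<Sum>i<l. \<Sum>j<l. N i j)" using ij by (intro member_le_sum[of i _ "\<lambda>i. \<Sum>j<l. N i j"]) auto
    finally show ?thesis by (simp add: k_def)
  qed
  then have "\<exists>v. i < l \<longrightarrow> j < l \<longrightarrow> v \<in> carrier (V k) \<and> P i j = emb k v" for i j using N by blast
  then obtain p where "\<And>i j. \<lbrakk>i < l; j < l\<rbrakk> \<Longrightarrow> p i j \<in> carrier (V k) \<and> P i j = emb k (p i j)" by metis
  moreover have "k \<ge> 1" by (simp add: k_def)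
  ultimately show ?thesis by (intro exI[of _ k] conjI bexI[of _ p]) (auto simp: mats_def)
qed

lemma matrix_ordered_L: "matrix_ordered L"
proof (intro matrix_ordered.intro lim_space matrix_ordered_axioms.intro)
  interpret V1: operator_system "V (Suc 0)" by (intro os) auto
  show one: "\<one>\<^bsub>L\<^esub> \<in> carrier L" unfolding lim_one[of 1, simplified] using V1.unit_closed by (simp add: emb_closed)
  show "adj L x \<in> carrier L" "adj L (c \<odot>\<^bsub>L\<^esub> x) = cnj c \<odot>\<^bsub>L\<^esub> adj L x" "adj L (adj L x) = x"
    if x: "x \<in> carrier L" for x c
  proof -
    obtain n u where u: "n \<ge> 1" "u \<in> carrier (V n)" "x = emb n u" using x by (auto simp: lim_carrier)
    interpret Vn: operator_system "V n" using u by (intro os)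
    show "adj L x \<in> carrier L" using u emb_linear[of n] Vn.adj_closed by (auto simp: linear_map_def lim_adj)
    show "adj L (c \<odot>\<^bsub>L\<^esub> x) = cnj c \<odot>\<^bsub>L\<^esub> adj L x" "adj L (adj L x) = x"
      using u Vn.adj_closed by (simp_all add: lim_adj lim_smult Vn.adj_smult Vn.adj_adj)
  qed
  show "adj L (x \<oplus>\<^bsub>L\<^esub> y) = adj L x \<oplus>\<^bsub>L\<^esub> adj L y" if x: "x \<in> carrier L" and y: "y \<in> carrier L" for x y
  proof -
    obtain m v w where m: "m \<ge> 1" "v \<in> carrier (V m)" "w \<in> carrier (V m)" "x = emb m v" "y = emb m w"
      using lim_rep2[OF x y] .
    interpret Vm: operator_system "V m" using m by (intro os)
    show ?thesis using m Vm.adj_closed by (simp add: lim_adj lim_add' Vm.adj_add)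
  qed
  show "adj L \<one>\<^bsub>L\<^esub> = \<one>\<^bsub>L\<^esub>" using V1.unit_closed V1.adj_unit by (simp add: lim_one[of 1, simplified] lim_adj)
  fix P Q l n
  {
    assume "P \<in> mpos L l"
    then obtain n p where p: "n \<ge> 1" "p \<in> mpos (V n) l" "\<forall>i<l. \<forall>j<l. P i j = emb n (p i j)"
      unfolding mpos_L by blast
    interpret Vn: operator_system "V n" using p by (intro os)
    have c: "p i j \<in> carrier (V n)" if "i < l" "j < l" for i j
      using Vn.mats_D[OF Vn.mpos_mats[OF p(2)] that] .
    show mP: "P \<in> mats L l" using p c by (auto simp: mats_def emb_closed)
    show "hermitian L l P"
      unfolding hermitian_def
    proof (intro allI impI)
      fix i j assume ij: "i < l" "j < l"
      have "p j i = adj (V n) (p i j)" using Vn.mpos_hermitian[OF p(2)] ij unfolding hermitian_def by blast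
      then show "P j i = adj L (P i j)" using p ij c by (simp add: lim_adj)
    qed
    show "Q \<in> mpos L l" if "\<And>i j. \<lbrakk>i < l; j < l\<rbrakk> \<Longrightarrow> Q i j = P i j"
      unfolding mpos_L using p that by (intro exI[of _ n] conjI bexI[of _ p]) auto
    show "compress L l \<alpha> P \<in> mpos L n'" for \<alpha> n'
      unfolding mpos_L
    proof (intro exI[of _ n] conjI bexI[of _ "compress (V n) l \<alpha> p"] allI impI)
      show "n \<ge> 1" by fact
      show "compress (V n) l \<alpha> p \<in> mpos (V n) n'" by (rule Vn.mpos_compress[OF p(2)])
      fix i j
      have "compress L l \<alpha> P = compress L l \<alpha> (\<lambda>k m. emb n (p k m))"
        by (rule L.compress_cong) (use p linear_mats[OF Vn.complex_space_axioms lim_space emb_linear Vn.mpos_mats[OF p(2)]] in auto)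
      then show "compress L l \<alpha> P i j = emb n (compress (V n) l \<alpha> p i j)"
        using linear_compress[OF Vn.complex_space_axioms lim_space emb_linear[OF p(1)] Vn.mpos_mats[OF p(2)]] by simp
    qed
    assume "Q \<in> mpos L l"
    then obtain m q where q: "m \<ge> 1" "q \<in> mpos (V m) l" "\<forall>i<l. \<forall>j<l. Q i j = emb m (q i j)"
      unfolding mpos_L by blast
    define k where "k = max n m"
    have k: "k \<ge> 1" "n \<le> k" "m \<le> k" using p by (auto simp: k_def)
    obtain p' where p': "p' \<in> mpos (V k) l" "\<forall>i<l. \<forall>j<l. P i j = emb k (p' i j)"
      using mpos_L_later[OF p k(2)] by blast
    obtain q' where q': "q' \<in> mpos (V k) l" "\<forall>i<l. \<forall>j<l. Q i j = emb k (q' i j)"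
      using mpos_L_later[OF q k(3)] by blast
    interpret Vk: operator_system "V k" using k by (intro os)
    show "(\<lambda>i j. P i j \<oplus>\<^bsub>L\<^esub> Q i j) \<in> mpos L l"
      unfolding mpos_L
    proof (intro exI[of _ k] conjI bexI[of _ "\<lambda>i j. p' i j \<oplus>\<^bsub>V k\<^esub> q' i j"] allI impI)
      show "1 \<le> k" by fact
      show "(\<lambda>i j. p' i j \<oplus>\<^bsub>V k\<^esub> q' i j) \<in> mpos (V k) l" by (rule Vk.mpos_add[OF p'(1) q'(1)])
      fix i j assume ij: "i < l" "j < l"
      show "P i j \<oplus>\<^bsub>L\<^esub> Q i j = emb k (p' i j \<oplus>\<^bsub>V k\<^esub> q' i j)"
        using p' q' ij k Vk.mats_D[OF Vk.mpos_mats[OF p'(1)] ij] Vk.mats_D[OF Vk.mpos_mats[OF q'(1)] ij] by (simp add: lim_add')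
    qed
  }
  show "\<exists>r>0. mshift L r P \<in> mpos L l" if P: "P \<in> mats L l" and h: "hermitian L l P"
  proof -
    obtain n p where p: "n \<ge> 1" "p \<in> mats (V n) l" "\<And>i j. \<lbrakk>i < l; j < l\<rbrakk> \<Longrightarrow> P i j = emb n (p i j)"
      using mats_L[OF P] by blast
    interpret Vn: operator_system "V n" using p by (intro os)
    note c = Vn.mats_D[OF p(2)]
    define q where "q i j = (1/2) \<odot>\<^bsub>V n\<^esub> (p i j \<oplus>\<^bsub>V n\<^esub> adj (V n) (p j i))" for i j
    have qm: "q \<in> mats (V n) l" using c Vn.adj_closed by (auto simp: mats_def q_def)
    have "hermitian (V n) l q"
      unfolding hermitian_def q_def
      using c Vn.adj_closed by (auto simp: Vn.adj_smult Vn.adj_add Vn.adj_adj Vn.M.a_comm)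
    then obtain r where r: "r > 0" "mshift (V n) r q \<in> mpos (V n) l" using Vn.order_unit[OF qm] by blast
    have Pq: "P i j = emb n (q i j)" if ij: "i < l" "j < l" for i j
    proof -
      have Pc: "P i j \<in> carrier L" using L.mats_D[OF P ij] .
      have "P i j = adj L (P j i)" using h ij unfolding hermitian_def by blast
      then have 2: "emb n (adj (V n) (p j i)) = P i j" using p(1) p(3)[OF ij(2,1)] c[OF ij(2,1)] by (simp add: lim_adj)
      have "emb n (q i j) = (1/2) \<odot>\<^bsub>L\<^esub> (emb n (p i j) \<oplus>\<^bsub>L\<^esub> emb n (adj (V n) (p j i)))"
        unfolding q_def using p(1) c[OF ij] c[OF ij(2,1)] Vn.adj_closed by (simp add: lim_add' lim_smult)
      also have "\<dots> = P i j"
        unfolding 2 p(3)[OF ij, symmetric] using L.smult_add_right[OF Pc Pc, of "1/2"] L.smult_add[OF Pc, of "1/2" "1/2"] Pc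
        by simp
      finally show ?thesis ..
    qed
    have "mshift L r P \<in> mpos L l"
      unfolding mpos_L
    proof (intro exI[of _ n] conjI bexI[OF _ r(2)] allI impI)
      fix i j assume ij: "i < l" "j < l"
      show "mshift L r P i j = emb n (mshift (V n) r q i j)"
        using Pq[OF ij] Vn.mats_D[OF qm ij] p(1) Vn.unit_closed
        by (cases "i = j") (simp_all add: mshift_def lim_one[OF p(1)] lim_smult lim_add')
    qed fact
    then show ?thesis using r by blast
  qed
qed

sublocale L: matrix_ordered L by (rule matrix_ordered_L)

theorem operator_system_lim: "operator_system (lim_osys V \<phi>)"
  unfolding lim_osys_def
proof (rule operator_system_archimedeanise[OF matrix_ordered_L])
  fix P l i j
  assume P: "P \<in> mats L l" and 1: "\<And>\<epsilon>. \<epsilon> > 0 \<Longrightarrow> mshift L \<epsilon> P \<in> mpos L l"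
    and 2: "\<And>\<epsilon>. \<epsilon> > 0 \<Longrightarrow> mshift L \<epsilon> (\<lambda>i j. \<ominus>\<^bsub>L\<^esub> P i j) \<in> mpos L l" and ij: "i < l" "j < l"
  obtain n v where nv: "n \<ge> 1" "v \<in> mats (V n) l" "\<And>i j. \<lbrakk>i < l; j < l\<rbrakk> \<Longrightarrow> P i j = emb n (v i j)"
    using mats_L[OF P] by blast
  have elv: "el n (v i j)" if "i < l" "j < l" for i j using nv complex_space.mats_D[OF cs nv(2)] that by auto
  have "\<exists>k\<ge>n. norm_le (V k) (cn n k (v i j)) \<epsilon>" if e: "\<epsilon> > 0" for \<epsilon>
  proof -
    define d where "d = \<epsilon> / 6"
    have d: "d > 0" using e by (simp add: d_def)
    obtain n1 p1 where p1: "n1 \<ge> 1" "p1 \<in> mpos (V n1) l" "\<forall>i<l. \<forall>j<l. mshift L d P i j = emb n1 (p1 i j)"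
      using 1[OF d] unfolding mpos_L by blast
    obtain n2 q1 where q1: "n2 \<ge> 1" "q1 \<in> mpos (V n2) l" "\<forall>i<l. \<forall>j<l. mshift L d (\<lambda>i j. \<ominus>\<^bsub>L\<^esub> P i j) i j = emb n2 (q1 i j)"
      using 2[OF d] unfolding mpos_L by blast
    define m where "m = max n (max n1 n2)"
    have m: "m \<ge> 1" "n \<le> m" "n1 \<le> m" "n2 \<le> m" using nv(1) by (auto simp: m_def)
    obtain p where p: "p \<in> mpos (V m) l" "\<And>i j. \<lbrakk>i < l; j < l\<rbrakk> \<Longrightarrow> mshift L d P i j = emb m (p i j)"
      using mpos_L_later[OF p1 m(3)] by blast
    obtain q where q: "q \<in> mpos (V m) l" "\<And>i j. \<lbrakk>i < l; j < l\<rbrakk> \<Longrightarrow> mshift L d (\<lambda>i j. \<ominus>\<^bsub>L\<^esub> P i j) i j = emb m (q i j)"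
      using mpos_L_later[OF q1 m(4)] by blast
    interpret Vm: operator_system "V m" using m by (intro os)
    have cp: "p i j \<in> carrier (V m)" if "i < l" "j < l" for i j using Vm.mats_D[OF Vm.mpos_mats[OF p(1)] that] .
    have cq: "q i j \<in> carrier (V m)" if "i < l" "j < l" for i j using Vm.mats_D[OF Vm.mpos_mats[OF q(1)] that] .
    let ?w = "\<lambda>i j. cn n m (v i j)"
    have cw: "?w i j \<in> carrier (V m)" if "i < l" "j < l" for i j
      using elv[OF that] m by (auto intro: cn_closed)
    have Pw: "P i j = emb m (?w i j)" if "i < l" "j < l" for i j
      using nv(3)[OF that] emb_cn[OF elv[OF that] m(2)] by simp
    have u: "c \<odot>\<^bsub>V m\<^esub> \<one>\<^bsub>V m\<^esub> \<in> carrier (V m)" for c using Vm.unit_closed by simp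
    have diag: "R m (p i i \<oplus>\<^bsub>V m\<^esub> q i i) m (of_real (2 * d) \<odot>\<^bsub>V m\<^esub> \<one>\<^bsub>V m\<^esub>)" if i: "i < l" for i
    proof -
      have Pc: "P i i \<in> carrier L" using L.mats_D[OF P i i] .
      have "emb m (p i i \<oplus>\<^bsub>V m\<^esub> q i i) = mshift L d P i i \<oplus>\<^bsub>L\<^esub> mshift L d (\<lambda>i j. \<ominus>\<^bsub>L\<^esub> P i j) i i"
        using p(2)[OF i i] q(2)[OF i i] m(1) cp[OF i i] cq[OF i i] by (simp add: lim_add')
      also have "\<dots> = of_real d \<odot>\<^bsub>L\<^esub> \<one>\<^bsub>L\<^esub> \<oplus>\<^bsub>L\<^esub> of_real d \<odot>\<^bsub>L\<^esub> \<one>\<^bsub>L\<^esub>"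
        using Pc L.unit_closed by (simp add: mshift_def L.M.a_assoc L.M.a_lcomm[of "of_real d \<odot>\<^bsub>L\<^esub> \<one>\<^bsub>L\<^esub>"] L.M.r_neg1 L.M.r_neg2)
      also have "\<dots> = of_real (2 * d) \<odot>\<^bsub>L\<^esub> \<one>\<^bsub>L\<^esub>"
        using L.smult_add[OF L.unit_closed, of "of_real d" "of_real d"] by simp
      also have "\<dots> = emb m (of_real (2 * d) \<odot>\<^bsub>V m\<^esub> \<one>\<^bsub>V m\<^esub>)"
        using m(1) Vm.unit_closed by (simp add: lim_one[OF m(1)] lim_smult)
      finally show ?thesis using emb_eq[of m "p i i \<oplus>\<^bsub>V m\<^esub> q i i" m "of_real (2 * d) \<odot>\<^bsub>V m\<^esub> \<one>\<^bsub>V m\<^esub>"]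
        m(1) cp[OF i i] cq[OF i i] u by simp
    qed
    let ?t = "if i = j then of_real d \<odot>\<^bsub>V m\<^esub> \<one>\<^bsub>V m\<^esub> else \<zero>\<^bsub>V m\<^esub>"
    have t: "?t \<in> carrier (V m)" using u by simp
    have off: "R m (?w i j \<oplus>\<^bsub>V m\<^esub> ?t) m (p i j)"
    proof -
      have "emb m (?w i j \<oplus>\<^bsub>V m\<^esub> ?t) = mshift L d P i j"
        using Pw[OF ij] m(1) cw[OF ij] Vm.unit_closed
        by (auto simp: mshift_def lim_one[OF m(1)] lim_smult lim_add')
      then show ?thesis using p(2)[OF ij] emb_eq[of m "?w i j \<oplus>\<^bsub>V m\<^esub> ?t" m "p i j"] m(1) cw[OF ij] t cp[OF ij] by simp
    qed
    have el: "el m (p i i \<oplus>\<^bsub>V m\<^esub> q i i)" if "i < l" for i using m(1) cp[OF that that] cq[OF that that] by simp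
    have elu: "el m (of_real (2 * d) \<odot>\<^bsub>V m\<^esub> \<one>\<^bsub>V m\<^esub>)" using m(1) u by simp
    have elp: "el m (p i j)" using m(1) cp[OF ij] by simp
    have elw: "el m (?w i j \<oplus>\<^bsub>V m\<^esub> ?t)" using m(1) cw[OF ij] t by simp
    obtain k1 where k1: "k1 \<ge> m" "\<forall>k\<ge>k1. norm_le (V k) (cn m k (p i i \<oplus>\<^bsub>V m\<^esub> q i i) \<ominus>\<^bsub>V k\<^esub> cn m k (of_real (2 * d) \<odot>\<^bsub>V m\<^esub> \<one>\<^bsub>V m\<^esub>)) d"
      using R_evD[OF el[OF ij(1)] elu diag[OF ij(1)] d] by auto
    obtain k2 where k2: "k2 \<ge> m" "\<forall>k\<ge>k2. norm_le (V k) (cn m k (p j j \<oplus>\<^bsub>V m\<^esub> q j j) \<ominus>\<^bsub>V k\<^esub> cn m k (of_real (2 * d) \<odot>\<^bsub>V m\<^esub> \<one>\<^bsub>V m\<^esub>)) d"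
      using R_evD[OF el[OF ij(2)] elu diag[OF ij(2)] d] by auto
    obtain k3 where k3: "k3 \<ge> m" "\<forall>k\<ge>k3. norm_le (V k) (cn m k (?w i j \<oplus>\<^bsub>V m\<^esub> ?t) \<ominus>\<^bsub>V k\<^esub> cn m k (p i j)) d"
      using R_evD[OF elw elp off d] by auto
    define k where "k = max k1 (max k2 k3)"
    have k: "k1 \<le> k" "k2 \<le> k" "k3 \<le> k" "m \<le> k" "n \<le> k" "1 \<le> k" using k1 k2 k3 m by (auto simp: k_def)
    interpret Vk: operator_system "V k" using k by (intro os)
    let ?p = "\<lambda>i j. cn m k (p i j)" and ?q = "\<lambda>i j. cn m k (q i j)"
    let ?c = "\<lambda>r. complex_of_real r \<odot>\<^bsub>V k\<^esub> \<one>\<^bsub>V k\<^esub>"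
    have uk: "?c r \<in> carrier (V k)" for r using Vk.unit_closed by simp
    have pk: "?p \<in> mpos (V k) l" and qk: "?q \<in> mpos (V k) l"
      using p(1) q(1) m(1) k(4) by (auto intro: cn_mpos)
    have cpk: "?p i j \<in> carrier (V k)" if "i < l" "j < l" for i j using Vk.mats_D[OF Vk.mpos_mats[OF pk] that] .
    have cqk: "?q i j \<in> carrier (V k)" if "i < l" "j < l" for i j using Vk.mats_D[OF Vk.mpos_mats[OF qk] that] .
    have bound: "(\<lambda>_ _. ?c (3 * d) \<ominus>\<^bsub>V k\<^esub> ?p i i) \<in> mpos (V k) 1"
      if i: "i < l" and le: "norm_le (V k) (cn m k (p i i \<oplus>\<^bsub>V m\<^esub> q i i) \<ominus>\<^bsub>V k\<^esub> cn m k (of_real (2 * d) \<odot>\<^bsub>V m\<^esub> \<one>\<^bsub>V m\<^esub>)) d" for i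
    proof -
      let ?x = "?p i i" and ?y = "?q i i"
      let ?d = "(?x \<oplus>\<^bsub>V k\<^esub> ?y) \<ominus>\<^bsub>V k\<^esub> ?c (2 * d)"
      have xy: "?x \<in> carrier (V k)" "?y \<in> carrier (V k)" using cpk[OF i i] cqk[OF i i] by auto
      have hx: "adj (V k) ?x = ?x" "adj (V k) ?y = ?y"
        using Vk.mpos_hermitian[OF pk, unfolded hermitian_def, rule_format, OF i i]
          Vk.mpos_hermitian[OF qk, unfolded hermitian_def, rule_format, OF i i] by (metis+)
      have dc: "?d \<in> carrier (V k)" by (intro Vk.M.minus_closed Vk.M.a_closed xy uk)
      have "adj (V k) ?d = ?d"
        using xy hx uk Vk.unit_closed by (simp add: a_minus_def Vk.adj_add Vk.adj_minus Vk.adj_smult Vk.adj_unit)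
      moreover have "norm_le (V k) ?d d"
        using le m(1) k(4) cp[OF i i] cq[OF i i] Vm.unit_closed by (simp add: cn_add cn_smult cn_unit)
      ultimately have "(\<lambda>_ _. ?c d \<ominus>\<^bsub>V k\<^esub> ?d) \<in> mpos (V k) 1" using Vk.norm_le_bound[OF dc] by blast
      moreover have "(\<lambda>_ _. ?y) \<in> mpos (V k) 1"
      proof -
        have "compress (V k) l (\<lambda>_ b. if b = i then 1 else 0) ?q \<in> mpos (V k) 1" by (rule Vk.mpos_compress[OF qk])
        then show ?thesis
          by (rule Vk.mpos_cong) (use Vk.compress_select[OF Vk.mpos_mats[OF qk], of "\<lambda>_. i"] i in simp)
      qed
      ultimately have "(\<lambda>_ _. (?c d \<ominus>\<^bsub>V k\<^esub> ?d) \<oplus>\<^bsub>V k\<^esub> ?y) \<in> mpos (V k) 1" by (rule Vk.mpos_add)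
      moreover have "(?c d \<ominus>\<^bsub>V k\<^esub> ?d) \<oplus>\<^bsub>V k\<^esub> ?y = ?c (3 * d) \<ominus>\<^bsub>V k\<^esub> ?x"
      proof -
        have "?c (3 * d) = ?c d \<oplus>\<^bsub>V k\<^esub> ?c (2 * d)"
          using Vk.smult_add[OF Vk.unit_closed, of "of_real d" "of_real (2 * d)"] by simp
        moreover have "(a \<ominus>\<^bsub>V k\<^esub> ((x \<oplus>\<^bsub>V k\<^esub> y) \<ominus>\<^bsub>V k\<^esub> b)) \<oplus>\<^bsub>V k\<^esub> y = (a \<oplus>\<^bsub>V k\<^esub> b) \<ominus>\<^bsub>V k\<^esub> x"
          if "a \<in> carrier (V k)" "b \<in> carrier (V k)" "x \<in> carrier (V k)" "y \<in> carrier (V k)" for a b x y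
          using that by (simp add: a_minus_def Vk.M.minus_add Vk.M.minus_minus Vk.M.a_ac Vk.M.r_neg1 Vk.M.r_neg2 Vk.M.r_neg)
            (simp add: Vk.M.a_comm[of "\<ominus>\<^bsub>V k\<^esub> x" "\<ominus>\<^bsub>V k\<^esub> y"] Vk.M.r_neg2)
        ultimately show ?thesis using xy uk by metis
      qed
      ultimately show ?thesis by simp
    qed
    have np: "norm_le (V k) (?p i j) (3 * d)"
      using Vk.norm_le_entry[OF pk ij bound[OF ij(1)] bound[OF ij(2)]] k1 k2 k by blast
    let ?W = "cn n k (v i j)"
    let ?T = "if i = j then ?c d else \<zero>\<^bsub>V k\<^esub>"
    have WT: "?W \<in> carrier (V k)" "?T \<in> carrier (V k)" using elv[OF ij] k uk by (auto intro: cn_closed)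
    have "cn m k (?w i j \<oplus>\<^bsub>V m\<^esub> ?t) = ?W \<oplus>\<^bsub>V k\<^esub> ?T"
      using m(1,2) k(4) cw[OF ij] t Vm.unit_closed by (auto simp: cn_add cn_smult cn_unit cn_zero cn_cn)
    then have n1: "norm_le (V k) ((?W \<oplus>\<^bsub>V k\<^esub> ?T) \<ominus>\<^bsub>V k\<^esub> ?p i j) d" using k3 k by auto
    have nT: "norm_le (V k) (\<ominus>\<^bsub>V k\<^esub> ?T) d"
    proof (rule Vk.norm_le_minus[OF WT(2)])
      have "norm_le (V k) \<one>\<^bsub>V k\<^esub> 1"
      proof -
        have "compress (V k) 1 (\<lambda>_ _. 1) (mshift (V k) 1 (\<lambda>_ _. \<zero>\<^bsub>V k\<^esub>)) \<in> mpos (V k) 2"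
          by (rule Vk.mpos_compress[OF Vk.mpos_unit]) simp
        then show ?thesis unfolding norm_le_def
          by (rule Vk.mpos_cong) (use Vk.compress_1[of "mshift (V k) 1 (\<lambda>_ _. \<zero>\<^bsub>V k\<^esub>)" "\<lambda>_ _. 1"] in
            \<open>simp add: mshift_def Vk.unit_closed Vk.adj_unit\<close>)
      qed
      from Vk.norm_le_scale[OF Vk.unit_closed this, of "of_real d"] d
      show "norm_le (V k) ?T d" using Vk.norm_le_0[of d] by auto
    qed
    have "norm_le (V k) (((?W \<oplus>\<^bsub>V k\<^esub> ?T) \<ominus>\<^bsub>V k\<^esub> ?p i j) \<oplus>\<^bsub>V k\<^esub> (?p i j \<oplus>\<^bsub>V k\<^esub> \<ominus>\<^bsub>V k\<^esub> ?T)) (d + (3 * d + d))"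
      using WT cpk[OF ij] by (intro Vk.norm_le_add n1 np nT) simp_all
    moreover have "((?W \<oplus>\<^bsub>V k\<^esub> ?T) \<ominus>\<^bsub>V k\<^esub> ?p i j) \<oplus>\<^bsub>V k\<^esub> (?p i j \<oplus>\<^bsub>V k\<^esub> \<ominus>\<^bsub>V k\<^esub> ?T) = ?W"
    proof -
      have "((W \<oplus>\<^bsub>V k\<^esub> T) \<ominus>\<^bsub>V k\<^esub> x) \<oplus>\<^bsub>V k\<^esub> (x \<oplus>\<^bsub>V k\<^esub> \<ominus>\<^bsub>V k\<^esub> T) = W"
        if "W \<in> carrier (V k)" "T \<in> carrier (V k)" "x \<in> carrier (V k)" for W T x
        using that by (simp add: a_minus_def Vk.M.a_assoc Vk.M.r_neg1 Vk.M.r_neg2 Vk.M.r_neg)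
      then show ?thesis using WT cpk[OF ij] by blast
    qed
    ultimately have "norm_le (V k) ?W (5 * d)" by simp
    then have "norm_le (V k) ?W \<epsilon>" by (rule Vk.norm_le_mono[OF WT(1)]) (use e in \<open>simp add: d_def\<close>)
    then show ?thesis using k by blast
  qed
  then show "P i j = \<zero>\<^bsub>L\<^esub>"
    using nv(3)[OF ij] emb_zero_iff[OF elv[OF ij]] by (simp add: lim_zero[of 1, simplified])
qed

lemma lim_simps [simp]: "carrier (lim_osys V \<phi>) = carrier L" "\<one>\<^bsub>lim_osys V \<phi>\<^esub> = \<one>\<^bsub>L\<^esub>"
  "add (lim_osys V \<phi>) = add L" "smult (lim_osys V \<phi>) = smult L"
  by (simp_all add: lim_osys_def)

text \<open>The canonical maps into the limit.\<close>

theorem lim_emb_ucp: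
  assumes "n \<ge> 1"
  shows "ucp (V n) (lim_osys V \<phi>) (emb n)"
    and "v \<in> carrier (V n) \<Longrightarrow> emb (Suc n) (\<phi> n v) = emb n v"
proof -
  have "(\<lambda>i j. emb n (P i j)) \<in> mpos L l" if "P \<in> mpos (V n) l" for P l
    unfolding mpos_L using that assms by blast
  then show "ucp (V n) (lim_osys V \<phi>) (emb n)"
    unfolding ucp_def using emb_linear[OF assms] lim_one[OF assms] mpos_archimedeanise[OF matrix_ordered_L]
    by (auto simp: linear_map_def lim_osys_def)
  show "emb (Suc n) (\<phi> n v) = emb n v" if "v \<in> carrier (V n)"
    using emb_cn[of n v "Suc n"] cn_Suc[of n n v] that assms by simp
qed

text \<open>The universal property of the limit, for operator systems \<open>W\<close> over any type.\<close>

theorem lim_universal: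
  fixes W :: "'w osys" and \<rho> :: "nat \<Rightarrow> 'v \<Rightarrow> 'w"
  assumes W: "operator_system W" and \<rho>: "\<And>n. n \<ge> 1 \<Longrightarrow> ucp (V n) W (\<rho> n)"
    and comp: "\<And>n v. \<lbrakk>n \<ge> 1; v \<in> carrier (V n)\<rbrakk> \<Longrightarrow> \<rho> (Suc n) (\<phi> n v) = \<rho> n v"
  shows "\<exists>\<psi>. ucp (lim_osys V \<phi>) W \<psi> \<and> (\<forall>n\<ge>1. \<forall>v\<in>carrier (V n). \<psi> (emb n v) = \<rho> n v) \<and>
    (\<forall>\<psi>'. ucp (lim_osys V \<phi>) W \<psi>' \<longrightarrow> (\<forall>n\<ge>1. \<forall>v\<in>carrier (V n). \<psi>' (emb n v) = \<rho> n v) \<longrightarrow>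
       (\<forall>x\<in>carrier (lim_osys V \<phi>). \<psi>' x = \<psi> x))"
proof -
  interpret W: operator_system W by fact
  have \<rho>lin: "linear_map (V n) W (\<rho> n)" if "n \<ge> 1" for n using \<rho>[OF that] by (simp add: ucp_def)
  have \<rho>cn: "\<rho> k (cn n k v) = \<rho> n v" if "el n v" "n \<le> k" for n k v
    using that(2)
  proof (induction k rule: dec_induct)
    case (step k)
    have "cn n k v \<in> carrier (V k)" using that step by (intro cn_closed) auto
    then show ?case using step that comp[of k "cn n k v"] by (simp add: cn_Suc)
  qed simp
  have \<rho>R: "\<rho> n v = \<rho> m w" if nv: "el n v" and mw: "el m w" and r: "R n v m w" for n v m w
  proof -
    have c: "\<rho> n v \<in> carrier W" "\<rho> m w \<in> carrier W"
      using \<rho>lin[of n] \<rho>lin[of m] nv mw by (auto simp: linear_map_def)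
    have "\<rho> n v \<ominus>\<^bsub>W\<^esub> \<rho> m w = \<zero>\<^bsub>W\<^esub>"
    proof (rule W.norm_le_zero)
      show "\<rho> n v \<ominus>\<^bsub>W\<^esub> \<rho> m w \<in> carrier W" using c by simp
      fix \<epsilon> :: real assume "\<epsilon> > 0"
      then obtain k where k: "k \<ge> max n m" "norm_le (V k) (cn n k v \<ominus>\<^bsub>V k\<^esub> cn m k w) \<epsilon>"
        using r by (auto simp: R_def)
      have k1: "k \<ge> 1" using k nv by auto
      interpret Vk: operator_system "V k" by (rule os[OF k1])
      have ck: "cn n k v \<in> carrier (V k)" "cn m k w \<in> carrier (V k)" using k nv mw by (auto intro: cn_closed)
      have "norm_le W (\<rho> k (cn n k v \<ominus>\<^bsub>V k\<^esub> cn m k w)) \<epsilon>"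
        by (rule ucp_norm_le[OF Vk.operator_system_axioms W \<rho>[OF k1] _ k(2)]) (use ck in simp)
      moreover have "\<rho> k (cn n k v \<ominus>\<^bsub>V k\<^esub> cn m k w) = \<rho> n v \<ominus>\<^bsub>W\<^esub> \<rho> m w"
        using linear_diff[OF Vk.complex_space_axioms W.complex_space_axioms \<rho>lin[OF k1] ck] \<rho>cn[OF nv, of k] \<rho>cn[OF mw, of k] k by simp
      ultimately show "norm_le W (\<rho> n v \<ominus>\<^bsub>W\<^esub> \<rho> m w) \<epsilon>" by simp
    qed
    then show ?thesis using c W.diff_zero_iff by blast
  qed
  define \<psi> where "\<psi> X = (case (SOME z. z \<in> X) of (n, v) \<Rightarrow> \<rho> n v)" for X
  have \<psi>: "\<psi> (emb n v) = \<rho> n v" if nv: "el n v" for n v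
  proof -
    have "(SOME z. z \<in> emb n v) \<in> emb n v" by (rule someI[of _ "(n, v)"]) (rule emb_self[OF nv])
    moreover obtain a b where ab: "(SOME z. z \<in> emb n v) = (a, b)" by force
    ultimately have "(a, b) \<in> emb n v" by simp
    then have "\<rho> n v = \<rho> a b" using \<rho>R[OF nv, of a b] emb_mem[OF nv, of a b] by auto
    then show ?thesis by (simp add: \<psi>_def ab)
  qed
  have lin: "linear_map L W \<psi>"
    unfolding linear_map_def
  proof (intro conjI ballI allI)
    fix x assume x: "x \<in> carrier L"
    then obtain n v where v: "el n v" "x = emb n v" by (auto simp: lim_carrier)
    show "\<psi> x \<in> carrier W" using v \<psi>[OF v(1)] \<rho>lin[of n] by (simp add: linear_map_def)
    show "\<psi> (c \<odot>\<^bsub>L\<^esub> x) = c \<odot>\<^bsub>W\<^esub> \<psi> x" for c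
    proof -
      interpret Vn: operator_system "V n" using v by (intro os) auto
      show ?thesis using v \<rho>lin[of n] by (simp add: linear_map_def \<psi> lim_smult)
    qed
    show "\<psi> (x \<oplus>\<^bsub>L\<^esub> y) = \<psi> x \<oplus>\<^bsub>W\<^esub> \<psi> y" if y: "y \<in> carrier L" for y
    proof -
      obtain m v w where m: "m \<ge> 1" "v \<in> carrier (V m)" "w \<in> carrier (V m)" "x = emb m v" "y = emb m w"
        using lim_rep2[OF x y] .
      interpret Vm: operator_system "V m" using m by (intro os)
      show ?thesis using m \<rho>lin[of m] by (simp add: linear_map_def \<psi> lim_add')
    qed
  qed
  have "ucp (lim_osys V \<phi>) W \<psi>"
    unfolding lim_osys_def
  proof (rule ucp_archimedeanise[OF matrix_ordered_L W lin])
    interpret V1: operator_system "V (Suc 0)" by (intro os) auto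
    show "\<psi> \<one>\<^bsub>L\<^esub> = \<one>\<^bsub>W\<^esub>"
      using \<psi>[of 1 "\<one>\<^bsub>V 1\<^esub>"] V1.unit_closed \<rho>[of 1] by (simp add: lim_one[of 1, simplified] ucp_def)
    fix l P assume "P \<in> mpos L l"
    then obtain n p where p: "n \<ge> 1" "p \<in> mpos (V n) l" "\<forall>i<l. \<forall>j<l. P i j = emb n (p i j)"
      unfolding mpos_L by blast
    interpret Vn: operator_system "V n" using p by (intro os)
    have "(\<lambda>i j. \<rho> n (p i j)) \<in> mpos W l" using \<rho>[OF p(1)] p(2) by (simp add: ucp_def)
    then show "(\<lambda>i j. \<psi> (P i j)) \<in> mpos W l"
    proof (rule W.mpos_cong)
      fix i j assume ij: "i < l" "j < l"
      show "\<psi> (P i j) = \<rho> n (p i j)"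
        using p ij \<psi>[of n "p i j"] Vn.mats_D[OF Vn.mpos_mats[OF p(2)] ij] by simp
    qed
  qed
  moreover have "\<forall>n\<ge>1. \<forall>v\<in>carrier (V n). \<psi> (emb n v) = \<rho> n v" using \<psi> by blast
  moreover have "\<psi>' x = \<psi> x" if "\<forall>n\<ge>1. \<forall>v\<in>carrier (V n). \<psi>' (emb n v) = \<rho> n v" "x \<in> carrier (lim_osys V \<phi>)" for \<psi>' x
    using that \<psi> by (auto simp: lim_carrier)
  ultimately show ?thesis by blast
qed

end

lemma os_sequence_fam:
  assumes "inductive_family dX" "inductive_family dA"
  shows "os_sequence (fam_copr dX dA) (fam_conn dX dA)"
proof (rule os_sequence.intro)
  show "operator_system (fam_copr dX dA n)" for n
    unfolding fam_copr_def by (rule coproduct.operator_system_copr[OF coproduct_fam[OF assms]])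
  show "ucp (fam_copr dX dA n) (fam_copr dX dA (Suc n)) (fam_conn dX dA n)" for n
    by (rule fam_conn_ucp[OF assms])
qed

end

theory Submission
  imports Defs
begin

text \<open>A correlation $\Gamma$ and a state $s$ are both determined by a family of numbers
  $p_n(x, y, a, b)$: the mean of $\Gamma(\chi_{\tilde a} \otimes \chi_{\tilde b})$ over the cell
  $\tilde x \times \tilde y$ on one side, the value of $s$ at
  $\gamma^{(n)}(e_{x,a}) \otimes \gamma^{(n)}(e_{y,b})$ on the other. On both sides these numbers are
  nonnegative, add up to 1 over $(a, b)$, have marginals in which the other party's
  input does not occur, and the numbers at level $n$ are averages over $(x, y)$ and sums over
  $(a, b)$ of those at level $n + 1$. The theorem says that such a family always comes from a state
  and always comes from a correlation.

  From numbers to a state: for fixed $(y, b)$ the numbers are a positive kernel in $(x, a)$ with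
  constant row sums, so the universal properties of the coproduct and of the limit turn them into a
  functional on $\mathcal S_{X,A}$ (\<open>kernel_functional\<close>), and likewise for fixed $(x, a)$. The two
  families of functionals fit together to a bilinear form (\<open>kernel_form\<close>). For a state on
  the maximal tensor product one has to check that a Kronecker product of two positive matrices has
  nonnegative image under this form. After a small multiple of the unit has been added, both
  matrices have representatives that are positive semidefinite at each pair of indices
  (\<open>fam_lim_positive\<close>), and the form becomes a sum, with weights $p \ge 0$, of
  expressions that are nonnegative because Kronecker products of positive semidefinite matrices are
  (\<open>psd_kronecker\<close>); then the multiple tends to zero (\<open>kernel_form_positive\<close>).

  From numbers to a correlation: at each point $(\omega, \omega')$ of $\Omega_X \times \Omega_Y$ the
  numbers $p_n(\omega|_n, \omega'|_n, \cdot, \cdot)$ are a probability distribution on the level $n$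
  cylinders of $\Omega_A \times \Omega_B$. Integrating $f$ against it gives a function $\Phi_n(f)$ of
  $(\omega, \omega')$, and $f \mapsto \Phi_n(f)$ is unital and completely positive as an integral with
  respect to probability distributions. When $f$ is the indicator function of a cylinder, the averaging property makes
  $(\Phi_n(f))_n$ a bounded martingale (\<open>integral_Phi\<close>). Its increments are orthogonal in
  $L^2$, so one common subsequence converges almost everywhere for all of the countably many
  cylinders (\<open>bounded_martingales_subsequence\<close>). As continuous functions are uniform limits of
  combinations of cylinders (\<open>compact_cylinder_approximation\<close>) and every $\Phi_n$ is a
  contraction, $\Phi_n(f)$ converges along this subsequence for every continuous $f$
  (\<open>Phi_convergent\<close>). The limit is the correlation: positivity, the unit and the
  dependence of $\Phi_n(f \otimes 1)$ on $\omega$ alone pass to the limit, and the means over cells do so by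
  dominated convergence (\<open>limit_corr_represents\<close>).

  Finally the generators of all levels span the tensor product, so a state is determined by its
  values there (\<open>generators_determine\<close>), which identifies $s$ with $s_\Gamma$.\<close>


section \<open>Linear functionals on inductive limits of coproducts\<close>

text \<open>The complex numbers, as the functions on a one-point set. In this form they are an operator
  system to which the universal properties of coproducts and limits apply.\<close>

definition scalars :: "(unit \<Rightarrow> complex) osys" where
  "scalars = fun_osys UNIV UNIV"

lemma scalars_simps [simp]:
  "carrier scalars = UNIV" "\<one>\<^bsub>scalars\<^esub> = (\<lambda>_. 1)" "\<zero>\<^bsub>scalars\<^esub> = (\<lambda>_. 0)"
  "f \<oplus>\<^bsub>scalars\<^esub> g = (\<lambda>x. f x + g x)" "c \<odot>\<^bsub>scalars\<^esub> f = (\<lambda>x. c * f x)"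
  "adj scalars f = (\<lambda>x. cnj (f x))"
  "mpos scalars n = {P. psd n (\<lambda>i j. P i j ())}"
  by (auto simp: scalars_def)

lemma complex_space_scalars: "complex_space scalars"
  unfolding scalars_def by (rule complex_space_fun) (simp add: fun_space_def)

lemma operator_system_scalars: "operator_system scalars"
proof (intro operator_system.intro matrix_ordered.intro complex_space_scalars
    matrix_ordered_axioms.intro operator_system_axioms.intro)
  interpret complex_space scalars by (rule complex_space_scalars)
  show "hermitian scalars n P" if "P \<in> mpos scalars n" for P n
    unfolding hermitian_def
  proof (intro allI impI)
    fix i j assume "i < n" "j < n"
    then show "P j i = adj scalars (P i j)"
      using psd_hermitian[of n "\<lambda>i j. P i j ()" i j] that by (auto simp: fun_eq_iff)
  qed
  show "Q \<in> mpos scalars n" if "P \<in> mpos scalars n" "\<And>i j. \<lbrakk>i < n; j < n\<rbrakk> \<Longrightarrow> Q i j = P i j" for P Q n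
    using that psd_cong[of n "\<lambda>i j. Q i j ()" "\<lambda>i j. P i j ()"] by simp
  show "(\<lambda>i j. P i j \<oplus>\<^bsub>scalars\<^esub> Q i j) \<in> mpos scalars n" if "P \<in> mpos scalars n" "Q \<in> mpos scalars n" for P Q n
    using that by (simp add: psd_add)
  show "compress scalars m \<alpha> P \<in> mpos scalars n" if "P \<in> mpos scalars m" for P m n \<alpha>
  proof -
    have "compress scalars m \<alpha> P i j = (\<lambda>x. \<Sum>k<m. \<Sum>l<m. (\<alpha> i k * cnj (\<alpha> j l)) * P k l x)" for i j
      unfolding scalars_def by (rule fun_compress) (simp_all add: fun_space_def mats_def)
    then show ?thesis using psd_compress[of m "\<lambda>i j. P i j ()" n \<alpha>] that by simp
  qed
  show "\<exists>r>0. mshift scalars r P \<in> mpos scalars n" if P: "hermitian scalars n P" for P n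
  proof (intro exI conjI)
    let ?r = "(\<Sum>i<n. \<Sum>j<n. cmod (P i j ())) + 1"
    show "?r > 0" by (intro add_nonneg_pos sum_nonneg) auto
    have "psd n (\<lambda>i j. P i j () + (if i = j then of_real ?r else 0))"
    proof (rule psd_order_unit)
      show "P j i () = cnj (P i j ())" if "i < n" "j < n" for i j
        using P[unfolded hermitian_def, rule_format, OF that] by (rule ssubst) simp
    qed simp
    then show "mshift scalars ?r P \<in> mpos scalars n"
      using psd_cong[of n "\<lambda>i j. mshift scalars ?r P i j ()" "\<lambda>i j. P i j () + (if i = j then of_real ?r else 0)"]
      by (simp add: mshift_def)
  qed
  show "P i j = \<zero>\<^bsub>scalars\<^esub>"
    if "P \<in> mpos scalars n" "(\<lambda>i j. \<ominus>\<^bsub>scalars\<^esub> P i j) \<in> mpos scalars n" "i < n" "j < n" for P n i j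
  proof -
    have "\<ominus>\<^bsub>scalars\<^esub> P i j = (\<lambda>x. - P i j x)" for i j
      unfolding scalars_def by (rule fun_minus) (simp_all add: fun_space_def)
    then have "psd n (\<lambda>i j. P i j () + (if i = j then of_real 0 else 0))"
      "psd n (\<lambda>i j. - P i j () + (if i = j then of_real 0 else 0))"
      using that by (simp_all cong: if_cong)
    then have "cmod (P i j ()) \<le> 6 * 0"
      using that by (intro psd_bound)
    then show ?thesis by (auto simp: fun_eq_iff)
  qed
  show "P \<in> mpos scalars n" if "\<And>\<epsilon>. \<epsilon> > 0 \<Longrightarrow> mshift scalars \<epsilon> P \<in> mpos scalars n" for P n
  proof -
    have "psd n (\<lambda>i j. P i j () + (if i = j then of_real \<epsilon> else 0))" if "\<epsilon> > 0" for \<epsilon>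
    proof -
      have "(\<lambda>i j. mshift scalars \<epsilon> P i j ()) = (\<lambda>i j. P i j () + (if i = j then of_real \<epsilon> else 0))"
        by (auto simp: mshift_def fun_eq_iff)
      then show ?thesis using \<open>\<And>\<epsilon>. \<epsilon> > 0 \<Longrightarrow> mshift scalars \<epsilon> P \<in> mpos scalars n\<close>[OF that] by simp
    qed
    then show ?thesis using psd_archimedean[of n "\<lambda>i j. P i j ()"] by simp
  qed
qed (auto simp: mats_def algebra_simps)

definition linear_functional :: "'v osys \<Rightarrow> ('v \<Rightarrow> complex) \<Rightarrow> bool" where
  "linear_functional V s \<longleftrightarrow>
     (\<forall>x\<in>carrier V. \<forall>y\<in>carrier V. s (x \<oplus>\<^bsub>V\<^esub> y) = s x + s y) \<and>
     (\<forall>c. \<forall>x\<in>carrier V. s (c \<odot>\<^bsub>V\<^esub> x) = c * s x)"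

lemma linear_functional_map: "linear_functional V s \<longleftrightarrow> linear_map V scalars (\<lambda>v _. s v)"
  by (auto simp: linear_functional_def linear_map_def fun_eq_iff)

lemma linear_functional_finsum:
  assumes "complex_space V" "linear_functional V s" "finite A" "f \<in> A \<rightarrow> carrier V"
  shows "s (finsum V f A) = (\<Sum>a\<in>A. s (f a))"
proof -
  have "(\<lambda>_. s (finsum V f A)) = finsum scalars (\<lambda>a _. s (f a)) A"
    using linear_finsum[OF assms(1) complex_space_scalars _ assms(4), of "\<lambda>v _. s v"] assms(2)
    by (simp add: linear_functional_map)
  also have "\<dots> = (\<lambda>_. \<Sum>a\<in>A. s (f a))"
    unfolding scalars_def using fun_finsum[of UNIV A "\<lambda>a _. s (f a)" UNIV] assms(3) by (simp add: fun_space_def)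
  finally show ?thesis by (simp add: fun_eq_iff)
qed

lemma linear_functional_comp:
  "\<lbrakk>linear_map V W \<phi>; linear_functional W s\<rbrakk> \<Longrightarrow> linear_functional V (\<lambda>v. s (\<phi> v))"
  by (simp add: linear_functional_def linear_map_def)

context coproduct
begin

lemma copr_gen_cls: "copr_gen S U s u = cls (indicator {(s, u)})"
  unfolding copr_gen_def copr_inj_def by (rule arg_cong[where f = cls]) (auto simp: indicator_def)

lemma gen_fun: "\<lbrakk>s \<in> S; u \<in> U\<rbrakk> \<Longrightarrow> indicator {(s, u)} \<in> copr_fun S U"
  by (rule copr_funI) (auto simp: indicator_def)

lemma linear_functional_cls:
  assumes s: "linear_functional Q \<sigma>" and f: "f \<in> copr_fun S U"
  shows "\<sigma> (cls f) = (\<Sum>z\<in>S \<times> U. f z * \<sigma> (copr_gen S U (fst z) (snd z)))"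
proof -
  have s': "linear_functional B (\<lambda>f. \<sigma> (cls f))"
    using linear_functional_comp[OF cls_linear s] .
  have g: "(\<lambda>x. f z * indicator {z} x) \<in> copr_fun S U" if "z \<in> S \<times> U" for z
    using that by (intro copr_funI) (auto simp: indicator_def)
  have g': "indicator {z} \<in> copr_fun S U" if "z \<in> S \<times> U" for z
    using that by (intro copr_funI) (auto simp: indicator_def)
  have fin: "finite (S \<times> U)" using S U by simp
  have "finsum B (\<lambda>z x. f z * indicator {z} x) (S \<times> U) = (\<lambda>x. \<Sum>z\<in>S \<times> U. f z * indicator {z} x)"
    using fun_finsum[OF fun_space_copr fin, of "\<lambda>z x. f z * indicator {z} x" "S \<times> U"] g by blast
  also have "\<dots> = f"
  proof
    fix x
    show "(\<Sum>z\<in>S \<times> U. f z * indicator {z} x) = f x"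
    proof (cases "x \<in> S \<times> U")
      case True
      then have "(\<Sum>z\<in>S \<times> U. f z * indicator {z} x) = (\<Sum>z\<in>S \<times> U. if x = z then f z else 0)"
        by (intro sum.cong) (auto simp: indicator_def)
      then show ?thesis using True fin by simp
    next
      case False
      then have "(\<Sum>z\<in>S \<times> U. f z * indicator {z} x) = (\<Sum>z\<in>S \<times> U. 0)"
        by (intro sum.cong) (auto simp: indicator_def)
      then show ?thesis using copr_funD[OF f False] by simp
    qed
  qed
  finally have "\<sigma> (cls f) = \<sigma> (cls (finsum B (\<lambda>z x. f z * indicator {z} x) (S \<times> U)))" by simp
  also have "\<dots> = (\<Sum>z\<in>S \<times> U. \<sigma> (cls (\<lambda>x. f z * indicator {z} x)))"
    by (rule linear_functional_finsum[OF B.complex_space_axioms s' fin]) (use g in auto)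
  also have "\<dots> = (\<Sum>z\<in>S \<times> U. f z * \<sigma> (copr_gen S U (fst z) (snd z)))"
  proof (rule sum.cong[OF refl])
    fix z assume z: "z \<in> S \<times> U"
    show "\<sigma> (cls (\<lambda>x. f z * indicator {z} x)) = f z * \<sigma> (copr_gen S U (fst z) (snd z))"
      using s' g'[OF z] by (simp add: linear_functional_def copr_gen_cls)
  qed
  finally show ?thesis .
qed

text \<open>A kernel whose rows are probability vectors is a family of states, one on each copy of
  $\mathcal D_U$. The sum of a function against the kernel depends only on its class: two representatives
  differ by a function that is constant on each copy, with constants adding up to zero, and every
  row of the kernel has mass one.\<close>

lemma kernel_ucp:
  assumes nn: "\<And>s u. \<lbrakk>s \<in> S; u \<in> U\<rbrakk> \<Longrightarrow> nn (k s u)" and one: "\<And>s. s \<in> S \<Longrightarrow> (\<Sum>u\<in>U. k s u) = 1"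
  shows "\<exists>\<rho>. ucp (copr S U) scalars \<rho> \<and>
    (\<forall>f\<in>copr_fun S U. \<rho> (cls f) = (\<lambda>_. \<Sum>s\<in>S. \<Sum>u\<in>U. f (s, u) * k s u))"
proof -
  define \<rho> where "\<rho> v = (\<lambda>_ :: unit. \<Sum>s\<in>S. \<Sum>u\<in>U. (SOME f. f \<in> v) (s, u) * k s u)" for v
  have \<rho>: "\<rho> (cls f) = (\<lambda>_. \<Sum>s\<in>S. \<Sum>u\<in>U. f (s, u) * k s u)" if f: "f \<in> copr_fun S U" for f
  proof -
    define g where "g = (SOME g. g \<in> cls f)"
    have "g \<in> cls f" unfolding g_def by (rule someI[of _ f]) (rule cls_self[OF f])
    then have g: "g \<in> copr_fun S U" "cls g = cls f" using cls_rep[OF f] by auto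
    then have "(\<lambda>z. g z - f z) \<in> N" using cls_eq f by blast
    then obtain c where c: "(\<Sum>s\<in>S. c s) = 0" "\<forall>s\<in>S. \<forall>u\<in>U. g (s, u) - f (s, u) = c s"
      by (auto simp: copr_null_def)
    have "(\<Sum>s\<in>S. \<Sum>u\<in>U. g (s, u) * k s u) - (\<Sum>s\<in>S. \<Sum>u\<in>U. f (s, u) * k s u)
        = (\<Sum>s\<in>S. \<Sum>u\<in>U. (g (s, u) - f (s, u)) * k s u)"
      by (simp add: sum_subtractf algebra_simps)
    also have "\<dots> = (\<Sum>s\<in>S. \<Sum>u\<in>U. c s * k s u)" using c by (intro sum.cong) auto
    also have "\<dots> = (\<Sum>s\<in>S. c s)" using one by (simp add: sum_distrib_left[symmetric])
    finally show ?thesis using c by (simp add: \<rho>_def g_def)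
  qed
  have "ucp (archimedeanise Q) scalars \<rho>"
  proof (rule ucp_archimedeanise[OF matrix_ordered_Q operator_system_scalars])
    show "linear_map Q scalars \<rho>"
    proof (rule linear_mapI_Q)
      fix f g assume f: "f \<in> copr_fun S U" and g: "g \<in> copr_fun S U"
      have "(\<lambda>z. f z + g z) \<in> copr_fun S U" using f g fun_space_copr by (auto simp: fun_space_def)
      then show "\<rho> (cls f \<oplus>\<^bsub>Q\<^esub> cls g) = \<rho> (cls f) \<oplus>\<^bsub>scalars\<^esub> \<rho> (cls g)"
        unfolding cls_add[OF f g, symmetric] by (simp add: \<rho> f g algebra_simps sum.distrib)
    next
      fix c f assume f: "f \<in> copr_fun S U"
      have "(\<lambda>z. c * f z) \<in> copr_fun S U" using f fun_space_copr by (auto simp: fun_space_def)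
      then show "\<rho> (c \<odot>\<^bsub>Q\<^esub> cls f) = c \<odot>\<^bsub>scalars\<^esub> \<rho> (cls f)"
        unfolding cls_smult[OF f, symmetric] by (simp add: \<rho> f algebra_simps sum_distrib_left)
    qed simp
    have "(\<Sum>s\<in>S. \<Sum>u\<in>U. e0 (s, u) * k s u) = (\<Sum>s\<in>S. 1 / of_nat (card S) * (\<Sum>u\<in>U. k s u))"
      unfolding sum_distrib_left by (intro sum.cong) (auto simp: e0_def indicator_def)
    also have "\<dots> = 1" using S one by simp
    finally show "\<rho> \<one>\<^bsub>Q\<^esub> = \<one>\<^bsub>scalars\<^esub>" unfolding unit_Q \<rho>[OF e0] by simp
    fix n P assume "P \<in> mpos Q n"
    then obtain p where p: "\<forall>i<n. \<forall>j<n. p i j \<in> copr_fun S U \<and> P i j = cls (p i j)"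
        "\<forall>z\<in>S \<times> U. psd n (\<lambda>i j. p i j z)"
      unfolding mpos_Q by blast
    have "psd n (\<lambda>i j. k s u * p i j (s, u))" if "s \<in> S" "u \<in> U" for s u
      using psd_scale[OF nn[OF that]] p(2) that by blast
    then have "psd n (\<lambda>i j. \<Sum>s\<in>S. \<Sum>u\<in>U. k s u * p i j (s, u))" by (intro psd_sum)
    moreover have "\<rho> (P i j) () = (\<Sum>s\<in>S. \<Sum>u\<in>U. k s u * p i j (s, u))" if "i < n" "j < n" for i j
      using p(1) that by (simp add: \<rho> mult.commute)
    ultimately have "psd n (\<lambda>i j. \<rho> (P i j) ())" by (subst psd_cong) auto
    then show "(\<lambda>i j. \<rho> (P i j)) \<in> mpos scalars n" by simp
  qed
  then show ?thesis using \<rho> by (auto simp: copr_def)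
qed

end

text \<open>Short names for the coproduct $\mathcal S_{X_n,A_n}$ of a pair of families, and for the
  image in the limit of the class of a function.\<close>

abbreviation "fam_fun d e n \<equiv> copr_fun (fam d n) (fam e n)"
abbreviation "fam_cls d e n \<equiv> copr_class (fam d n) (fam e n)"
abbreviation "fam_pre d e n \<equiv> copr_pre (fam d n) (fam e n)"
abbreviation "fam_elem d e n f \<equiv> fam_emb d e n (copr_class (fam d n) (fam e n) f)"

lemma fam_emb_conn:
  assumes "inductive_family dX" "inductive_family dA" "n \<ge> 1" "f \<in> fam_fun dX dA n"
  shows "fam_emb dX dA (Suc n) (fam_cls dX dA (Suc n) (pull dX dA n f)) =
    fam_elem dX dA n f"
proof -
  interpret C: coproduct "fam dX n" "fam dA n" by (rule coproduct_fam[OF assms(1,2)])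
  interpret os_sequence "fam_copr dX dA" "fam_conn dX dA" by (rule os_sequence_fam[OF assms(1,2)])
  have "fam_cls dX dA n f \<in> carrier (fam_copr dX dA n)"
    using assms by (auto simp: fam_copr_def C.carrier_Q)
  from lim_emb_ucp(2)[OF assms(3) this] show ?thesis
    by (simp add: fam_emb_def fam_conn_cls[OF assms(1,2,4)])
qed

text \<open>The compatibility \<open>comp\<close> says that the functionals of the levels commute with the connecting
  maps, so that the universal property of the limit yields a functional on it. The row sums $c$ need not be 1:
  in the application to one factor of a tensor product, $c$ is the mass of the fixed generator of
  the other factor.\<close>

lemma kernel_functional:
  fixes k :: "nat \<Rightarrow> nat list \<Rightarrow> nat list \<Rightarrow> complex"
  assumes X: "inductive_family dX" and A: "inductive_family dA"
    and nn: "\<And>n x a. \<lbrakk>n \<ge> 1; x \<in> fam dX n; a \<in> fam dA n\<rbrakk> \<Longrightarrow> nn (k n x a)"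
    and marg: "\<And>n x. \<lbrakk>n \<ge> 1; x \<in> fam dX n\<rbrakk> \<Longrightarrow> (\<Sum>a\<in>fam dA n. k n x a) = c"
    and comp: "\<And>n x a. \<lbrakk>n \<ge> 1; x \<in> fam dX n; a \<in> fam dA n\<rbrakk> \<Longrightarrow>
      k n x a = (\<Sum>i=1..dX n. \<Sum>j=1..dA n. k (Suc n) (x @ [i]) (a @ [j])) / of_nat (dX n)"
  shows "\<exists>F. linear_functional (fam_lim dX dA) F \<and>
    (\<forall>n\<ge>1. \<forall>f\<in>fam_fun dX dA n.
       F (fam_elem dX dA n f) = (\<Sum>x\<in>fam dX n. \<Sum>a\<in>fam dA n. f (x, a) * k n x a))"
proof (cases "c = 0")
  case True
  \<comment> \<open>a nonnegative kernel of mass zero vanishes, so no normalisation is necessary\<close>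
  have "k n x a = 0" if "n \<ge> 1" "x \<in> fam dX n" "a \<in> fam dA n" for n x a
  proof -
    have r: "k n x b \<in> \<real>" "0 \<le> Re (k n x b)" if "b \<in> fam dA n" for b
      using nn[OF \<open>n \<ge> 1\<close> \<open>x \<in> fam dX n\<close> that] by (auto simp: nn_def)
    have "(\<Sum>a\<in>fam dA n. Re (k n x a)) = 0" using marg[OF that(1,2)] True by (simp flip: Re_sum)
    then have "Re (k n x a) = 0" using sum_nonneg_eq_0_iff[OF finite_fam, of dA n "\<lambda>a. Re (k n x a)"] r that by auto
    then show ?thesis using r(1)[OF that(3)] by (auto simp: complex_is_Real_iff complex_eq_iff)
  qed
  then show ?thesis by (intro exI[of _ "\<lambda>_. 0"]) (auto simp: linear_functional_def)
next
  case False
  interpret C: coproduct "fam dX n" "fam dA n" for n by (rule coproduct_fam[OF X A])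
  interpret L: os_sequence "fam_copr dX dA" "fam_conn dX dA" by (rule os_sequence_fam[OF X A])
  have nnc: "nn c"
  proof -
    obtain x where x: "x \<in> fam dX 1" using fam_nonempty[OF X] by blast
    have "nn (\<Sum>a\<in>fam dA 1. k 1 x a)" using x nn by (intro nn_sum) auto
    then show ?thesis using marg[of 1 x] x by simp
  qed
  have nnk: "nn (k n x a / c)" if "n \<ge> 1" "x \<in> fam dX n" "a \<in> fam dA n" for n x a
    using nn[OF that] nnc by (auto simp: nn_def elim!: Reals_cases)
  have "\<exists>\<rho>. ucp (fam_copr dX dA n) scalars \<rho> \<and>
    (\<forall>f\<in>fam_fun dX dA n. \<rho> (fam_cls dX dA n f) =
       (\<lambda>_. \<Sum>x\<in>fam dX n. \<Sum>a\<in>fam dA n. f (x, a) * (k n x a / c)))" if n: "n \<ge> 1" for n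
    unfolding fam_copr_def
  proof (rule C.kernel_ucp)
    show "(\<Sum>a\<in>fam dA n. k n x a / c) = 1" if "x \<in> fam dX n" for x
      using marg[OF n that] False by (simp flip: sum_divide_distrib)
  qed (rule nnk[OF n])
  then have "\<exists>\<rho>. \<forall>n. n \<ge> 1 \<longrightarrow> ucp (fam_copr dX dA n) scalars (\<rho> n) \<and>
    (\<forall>f\<in>fam_fun dX dA n. \<rho> n (fam_cls dX dA n f) =
       (\<lambda>_. \<Sum>x\<in>fam dX n. \<Sum>a\<in>fam dA n. f (x, a) * (k n x a / c)))"
    by (intro choice) blast
  then obtain \<rho> where \<rho>: "\<And>n. n \<ge> 1 \<Longrightarrow> ucp (fam_copr dX dA n) scalars (\<rho> n)"
    "\<And>n f. \<lbrakk>n \<ge> 1; f \<in> fam_fun dX dA n\<rbrakk> \<Longrightarrow> \<rho> n (fam_cls dX dA n f) =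
       (\<lambda>_. \<Sum>x\<in>fam dX n. \<Sum>a\<in>fam dA n. f (x, a) * (k n x a / c))"
    by blast
  have "\<rho> (Suc n) (fam_conn dX dA n v) = \<rho> n v" if n: "n \<ge> 1" and v: "v \<in> carrier (fam_copr dX dA n)" for n v
  proof -
    obtain f where f: "v = fam_cls dX dA n f" "f \<in> fam_fun dX dA n"
      using v by (auto simp: fam_copr_def C.carrier_Q)
    have "(\<Sum>x\<in>fam dX (Suc n). \<Sum>a\<in>fam dA (Suc n). pull dX dA n f (x, a) * (k (Suc n) x a / c)) =
      (\<Sum>x\<in>fam dX n. \<Sum>i=1..dX n. \<Sum>a\<in>fam dA n. \<Sum>j=1..dA n.
         f (x, a) * (k (Suc n) (x @ [i]) (a @ [j]) / of_nat (dX n) / c))"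
      unfolding sum_fam_Suc pull_def[OF X A]
      by (intro sum.cong refl) (auto simp: fam_Suc)
    also have "\<dots> = (\<Sum>x\<in>fam dX n. \<Sum>a\<in>fam dA n. \<Sum>i=1..dX n. \<Sum>j=1..dA n.
         f (x, a) * (k (Suc n) (x @ [i]) (a @ [j]) / of_nat (dX n) / c))"
      by (intro sum.cong refl sum.swap)
    also have "\<dots> = (\<Sum>x\<in>fam dX n. \<Sum>a\<in>fam dA n. f (x, a) * (k n x a / c))"
      by (intro sum.cong refl, subst comp[OF n]) (auto simp: sum_distrib_left sum_divide_distrib)
    finally show ?thesis
      using \<rho>(2)[OF n f(2)] \<rho>(2)[of "Suc n", OF _ pull_fun[OF X A]] f by (simp add: fam_conn_cls[OF X A])
  qed
  from L.lim_universal[OF operator_system_scalars \<rho>(1) this] obtain \<psi> where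
    \<psi>: "ucp (fam_lim dX dA) scalars \<psi>"
      "\<And>n v. \<lbrakk>n \<ge> 1; v \<in> carrier (fam_copr dX dA n)\<rbrakk> \<Longrightarrow> \<psi> (fam_emb dX dA n v) = \<rho> n v"
    by (auto simp: fam_lim_def fam_emb_def)
  show ?thesis
  proof (intro exI[of _ "\<lambda>v. c * \<psi> v ()"] conjI allI impI ballI)
    show "linear_functional (fam_lim dX dA) (\<lambda>v. c * \<psi> v ())"
      using \<psi>(1) by (auto simp: ucp_def linear_map_def linear_functional_def algebra_simps)
    fix n f assume n: "1 \<le> n" and f: "f \<in> fam_fun dX dA n"
    have "fam_cls dX dA n f \<in> carrier (fam_copr dX dA n)"
      using f by (auto simp: fam_copr_def C.carrier_Q)
    then show "c * \<psi> (fam_elem dX dA n f) () =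
      (\<Sum>x\<in>fam dX n. \<Sum>a\<in>fam dA n. f (x, a) * k n x a)"
      using False by (simp add: \<psi>(2)[OF n] \<rho>(2)[OF n f] sum_distrib_left)
  qed
qed

section \<open>Bilinear forms and states on the maximal tensor product\<close>

definition bilinear_form :: "'v osys \<Rightarrow> 'w osys \<Rightarrow> ('v \<Rightarrow> 'w \<Rightarrow> complex) \<Rightarrow> bool" where
  "bilinear_form S T \<beta> \<longleftrightarrow> (\<forall>w\<in>carrier T. linear_functional S (\<lambda>v. \<beta> v w)) \<and>
     (\<forall>v\<in>carrier S. linear_functional T (\<beta> v))"

locale tensor_factors =
  S: matrix_ordered S + T: matrix_ordered T for S :: "'v osys" and T :: "'w osys"
begin

abbreviation "Free \<equiv> free_osys S T"
abbreviation "Null \<equiv> bilin_null S T"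
abbreviation "Alg \<equiv> alg_tensor S T"
abbreviation "tn \<equiv> tens S T"

lemma free_simps [simp]:
  "carrier Free = free_fun S T" "\<zero>\<^bsub>Free\<^esub> = (\<lambda>_. 0)"
  "f \<oplus>\<^bsub>Free\<^esub> g = (\<lambda>x. f x + g x)" "c \<odot>\<^bsub>Free\<^esub> f = (\<lambda>x. c * f x)"
  "adj Free f = (\<lambda>(v, w). if v \<in> carrier S \<and> w \<in> carrier T then cnj (f (adj S v, adj T w)) else 0)"
  by (simp_all add: free_osys_def fun_osys_def)

lemma free_fun_add:
  assumes f: "f \<in> free_fun S T" and g: "g \<in> free_fun S T"
  shows "(\<lambda>z. f z + g z) \<in> free_fun S T"
proof -
  have 1: "{z. f z + g z \<noteq> 0} \<subseteq> {z. f z \<noteq> 0} \<union> {z. g z \<noteq> 0}" by auto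
  have "finite {z. f z + g z \<noteq> 0}"
    by (rule finite_subset[OF 1]) (use f g in \<open>simp add: free_fun_def\<close>)
  moreover have "{z. f z + g z \<noteq> 0} \<subseteq> carrier S \<times> carrier T"
    by (rule subset_trans[OF 1]) (use f g in \<open>simp add: free_fun_def\<close>)
  ultimately show ?thesis by (simp add: free_fun_def)
qed

lemma free_fun_smult: "f \<in> free_fun S T \<Longrightarrow> (\<lambda>z. c * f z) \<in> free_fun S T"
  unfolding free_fun_def by (auto intro: finite_subset[of _ "{z. f z \<noteq> 0}"])

lemma free_fun_diff: "\<lbrakk>f \<in> free_fun S T; g \<in> free_fun S T\<rbrakk> \<Longrightarrow> (\<lambda>z. f z - g z) \<in> free_fun S T"
  using free_fun_add[of f "\<lambda>z. -1 * g z"] free_fun_smult[of g "-1"] by simp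

lemma free_fun_indicator: "\<lbrakk>v \<in> carrier S; w \<in> carrier T\<rbrakk> \<Longrightarrow> indicator {(v, w)} \<in> free_fun S T"
  unfolding free_fun_def by (auto simp: indicator_def)

lemma complex_space_Free: "complex_space Free"
  by (rule complex_spaceI)
    (auto simp: free_fun_add free_fun_smult algebra_simps, auto simp: free_fun_def)

interpretation F: complex_space Free by (rule complex_space_Free)

lemma Free_minus: "f \<in> free_fun S T \<Longrightarrow> \<ominus>\<^bsub>Free\<^esub> f = (\<lambda>x. - f x)"
  using F.smult_m1[of f] by simp

lemma Free_diff: "\<lbrakk>f \<in> free_fun S T; g \<in> free_fun S T\<rbrakk> \<Longrightarrow> f \<ominus>\<^bsub>Free\<^esub> g = (\<lambda>x. f x - g x)"
  by (simp add: a_minus_def Free_minus)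

lemma Null_free: "f \<in> Null \<Longrightarrow> f \<in> free_fun S T"
proof (induction rule: bilin_null.induct)
  case zero
  then show ?case by (simp add: free_fun_def)
qed (auto intro!: free_fun_add free_fun_smult free_fun_diff free_fun_indicator)

lemma Null_submodule: "submodule Null complex_ring Free"
proof (rule F.submoduleI)
  show "\<ominus>\<^bsub>Free\<^esub> f \<in> Null" if "f \<in> Null" for f
    using bilin_null.smult[OF that, of "-1"] Null_free[OF that] by (simp add: Free_minus)
qed (auto intro: Null_free bilin_null.zero bilin_null.add bilin_null.smult)

text \<open>The involution of the free space exchanges the indicator functions of elementary tensors,
  so it preserves each type of generator of \<^const>\<open>bilin_null\<close>; it therefore descends to the quotient.\<close>

lemma adj_indicator:
  assumes "v \<in> carrier S" "w \<in> carrier T"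
  shows "adj Free (indicator {(v, w)}) = indicator {(adj S v, adj T w)}"
proof
  fix z :: "'v \<times> 'w"
  obtain v' w' where z: "z = (v', w')" by force
  have "(v', w') = (adj S v, adj T w) \<longleftrightarrow> v' \<in> carrier S \<and> w' \<in> carrier T \<and> adj S v' = v \<and> adj T w' = w"
    using assms by (auto simp: S.adj_closed T.adj_closed S.adj_adj T.adj_adj)
  then show "adj Free (indicator {(v, w)}) z = indicator {(adj S v, adj T w)} z"
    by (auto simp: z indicator_def)
qed

lemma adj_Null: "f \<in> Null \<Longrightarrow> adj Free f \<in> Null"
proof (induction rule: bilin_null.induct)
  case zero
  have "adj Free (\<lambda>_. 0) = (\<lambda>_. 0)" by auto
  then show ?case using bilin_null.zero by metis
next
  case (add f g)
  have "adj Free (\<lambda>z. f z + g z) = (\<lambda>z. adj Free f z + adj Free g z)" by auto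
  then show ?case using bilin_null.add[OF add.IH] by metis
next
  case (smult f c)
  have "adj Free (\<lambda>z. c * f z) = (\<lambda>z. cnj c * adj Free f z)" by auto
  then show ?case using bilin_null.smult[OF smult.IH] by metis
next
  case (add_left v v' w)
  have "adj Free (\<lambda>z. indicator {(v \<oplus>\<^bsub>S\<^esub> v', w)} z - indicator {(v, w)} z - indicator {(v', w)} z) =
    (\<lambda>z. adj Free (indicator {(v \<oplus>\<^bsub>S\<^esub> v', w)}) z - adj Free (indicator {(v, w)}) z - adj Free (indicator {(v', w)}) z)"
    by auto
  also have "\<dots> \<in> Null"
    using add_left bilin_null.add_left[of "adj S v" S "adj S v'" "adj T w" T]
    by (simp add: adj_indicator S.adj_add S.adj_closed T.adj_closed del: free_simps)
  finally show ?case .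
next
  case (add_right v w w')
  have "adj Free (\<lambda>z. indicator {(v, w \<oplus>\<^bsub>T\<^esub> w')} z - indicator {(v, w)} z - indicator {(v, w')} z) =
    (\<lambda>z. adj Free (indicator {(v, w \<oplus>\<^bsub>T\<^esub> w')}) z - adj Free (indicator {(v, w)}) z - adj Free (indicator {(v, w')}) z)"
    by auto
  also have "\<dots> \<in> Null"
    using add_right bilin_null.add_right[of "adj S v" S "adj T w" T "adj T w'"]
    by (simp add: adj_indicator T.adj_add S.adj_closed T.adj_closed del: free_simps)
  finally show ?case .
next
  case (smult_left v w c)
  have "adj Free (\<lambda>z. indicator {(c \<odot>\<^bsub>S\<^esub> v, w)} z - c * indicator {(v, w)} z) =
    (\<lambda>z. adj Free (indicator {(c \<odot>\<^bsub>S\<^esub> v, w)}) z - cnj c * adj Free (indicator {(v, w)}) z)"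
    by auto
  also have "\<dots> \<in> Null"
    using smult_left bilin_null.smult_left[of "adj S v" S "adj T w" T "cnj c"]
    by (simp add: adj_indicator S.adj_smult S.adj_closed T.adj_closed del: free_simps)
  finally show ?case .
next
  case (smult_right v w c)
  have "adj Free (\<lambda>z. indicator {(v, c \<odot>\<^bsub>T\<^esub> w)} z - c * indicator {(v, w)} z) =
    (\<lambda>z. adj Free (indicator {(v, c \<odot>\<^bsub>T\<^esub> w)}) z - cnj c * adj Free (indicator {(v, w)}) z)"
    by auto
  also have "\<dots> \<in> Null"
    using smult_right bilin_null.smult_right[of "adj S v" S "adj T w" T "cnj c"]
    by (simp add: adj_indicator T.adj_smult S.adj_closed T.adj_closed del: free_simps)
  finally show ?case .
qed

definition cls :: "('v \<times> 'w \<Rightarrow> complex) \<Rightarrow> ('v \<times> 'w \<Rightarrow> complex) set" where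
  "cls f = Null +>\<^bsub>Free\<^esub> f"

lemma tens_cls: "tn v w = cls (indicator {(v, w)})"
  by (simp add: tens_def cls_def)

lemma alg_quotient:
  shows complex_space_Alg: "complex_space Alg" and cls_linear: "linear_map Free Alg cls"
    and carrier_Alg: "carrier Alg = cls ` free_fun S T" and unit_Alg: "\<one>\<^bsub>Alg\<^esub> = tn \<one>\<^bsub>S\<^esub> \<one>\<^bsub>T\<^esub>"
    and cls_eq: "\<And>f g. \<lbrakk>f \<in> free_fun S T; g \<in> free_fun S T\<rbrakk> \<Longrightarrow> cls f = cls g \<longleftrightarrow> (\<lambda>z. f z - g z) \<in> Null"
    and cls_self: "\<And>f. f \<in> free_fun S T \<Longrightarrow> f \<in> cls f"
    and cls_rep: "\<And>f g. \<lbrakk>f \<in> free_fun S T; g \<in> cls f\<rbrakk> \<Longrightarrow> g \<in> free_fun S T \<and> cls g = cls f"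
proof -
  have a: "\<And>x. x \<in> carrier Free \<Longrightarrow> adj Free x \<in> carrier Free"
  proof -
    fix f assume "f \<in> carrier Free"
    then have f: "finite {z. f z \<noteq> 0}" "{z. f z \<noteq> 0} \<subseteq> carrier S \<times> carrier T" by (auto simp: free_fun_def)
    have "{z. adj Free f z \<noteq> 0} \<subseteq> (\<lambda>(v, w). (adj S v, adj T w)) ` {z. f z \<noteq> 0}"
    proof
      fix z assume "z \<in> {z. adj Free f z \<noteq> 0}"
      then obtain v w where z: "z = (v, w)" "v \<in> carrier S" "w \<in> carrier T" "f (adj S v, adj T w) \<noteq> 0"
        by (cases z) (auto split: if_splits)
      then show "z \<in> (\<lambda>(v, w). (adj S v, adj T w)) ` {z. f z \<noteq> 0}"
        by (intro image_eqI[of _ _ "(adj S v, adj T w)"]) (auto simp: S.adj_adj T.adj_adj)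
    qed
    moreover from this have "{z. adj Free f z \<noteq> 0} \<subseteq> carrier S \<times> carrier T"
      using f(2) S.adj_closed T.adj_closed by fastforce
    ultimately show "adj Free f \<in> carrier Free"
      using f(1) finite_subset[of "{z. adj Free f z \<noteq> 0}"] by (simp only: free_simps(1) free_fun_def) blast
  qed
  have b: "\<And>x y. \<lbrakk>x \<in> carrier Free; y \<in> carrier Free\<rbrakk> \<Longrightarrow> adj Free (x \<oplus>\<^bsub>Free\<^esub> y) = adj Free x \<oplus>\<^bsub>Free\<^esub> adj Free y"
    by (auto simp: fun_eq_iff)
  have c: "indicator {(\<one>\<^bsub>S\<^esub>, \<one>\<^bsub>T\<^esub>)} \<in> carrier Free"
    using free_fun_indicator[OF S.unit_closed T.unit_closed] by simp
  have cl: "cls = (\<lambda>f. Null +>\<^bsub>Free\<^esub> f)" by (auto simp: cls_def)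
  note q = F.quotient[OF Null_submodule a b adj_Null c]
  show "complex_space Alg" unfolding alg_tensor_def by (rule q(1))
  show "linear_map Free Alg cls" unfolding alg_tensor_def cl by (rule q(2))
  show "carrier Alg = cls ` free_fun S T" unfolding alg_tensor_def cl using q(3) by (simp only: free_simps)
  show "\<one>\<^bsub>Alg\<^esub> = tn \<one>\<^bsub>S\<^esub> \<one>\<^bsub>T\<^esub>" unfolding alg_tensor_def tens_def by (rule q(4))
  show "cls f = cls g \<longleftrightarrow> (\<lambda>z. f z - g z) \<in> Null" if "f \<in> free_fun S T" "g \<in> free_fun S T" for f g
    unfolding cl by (subst q(6)) (use that in \<open>simp_all add: Free_diff\<close>)
  show "f \<in> cls f" if "f \<in> free_fun S T" for f unfolding cl using q(7)[of f] that by simp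
  show "g \<in> free_fun S T \<and> cls g = cls f" if "f \<in> free_fun S T" "g \<in> cls f" for f g
    using q(8)[of f g] that unfolding cl by simp
qed

sublocale A: complex_space Alg by (rule complex_space_Alg)

lemma cls_add: "\<lbrakk>f \<in> free_fun S T; g \<in> free_fun S T\<rbrakk> \<Longrightarrow> cls (\<lambda>z. f z + g z) = cls f \<oplus>\<^bsub>Alg\<^esub> cls g"
  using cls_linear by (simp add: linear_map_def)

lemma cls_smult: "f \<in> free_fun S T \<Longrightarrow> cls (\<lambda>z. c * f z) = c \<odot>\<^bsub>Alg\<^esub> cls f"
  using cls_linear by (simp add: linear_map_def)

lemma tens_closed: "\<lbrakk>v \<in> carrier S; w \<in> carrier T\<rbrakk> \<Longrightarrow> tn v w \<in> carrier Alg"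
  unfolding tens_cls carrier_Alg by (intro imageI free_fun_indicator)

lemma tens_add_left:
  assumes "v \<in> carrier S" "v' \<in> carrier S" "w \<in> carrier T"
  shows "tn (v \<oplus>\<^bsub>S\<^esub> v') w = tn v w \<oplus>\<^bsub>Alg\<^esub> tn v' w"
proof -
  note i = free_fun_indicator
  have "tn (v \<oplus>\<^bsub>S\<^esub> v') w = cls (\<lambda>z. indicator {(v, w)} z + indicator {(v', w)} z)"
    unfolding tens_cls using bilin_null.add_left[OF assms]
    by (subst cls_eq) (auto intro!: i free_fun_add assms simp: diff_diff_eq)
  then show ?thesis using assms by (simp add: cls_add i tens_cls)
qed

lemma tens_add_right:
  assumes "v \<in> carrier S" "w \<in> carrier T" "w' \<in> carrier T"
  shows "tn v (w \<oplus>\<^bsub>T\<^esub> w') = tn v w \<oplus>\<^bsub>Alg\<^esub> tn v w'"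
proof -
  note i = free_fun_indicator
  have "tn v (w \<oplus>\<^bsub>T\<^esub> w') = cls (\<lambda>z. indicator {(v, w)} z + indicator {(v, w')} z)"
    unfolding tens_cls using bilin_null.add_right[OF assms]
    by (subst cls_eq) (auto intro!: i free_fun_add assms simp: diff_diff_eq)
  then show ?thesis using assms by (simp add: cls_add i tens_cls)
qed

lemma tens_smult_left:
  assumes "v \<in> carrier S" "w \<in> carrier T"
  shows "tn (c \<odot>\<^bsub>S\<^esub> v) w = c \<odot>\<^bsub>Alg\<^esub> tn v w"
proof -
  have "tn (c \<odot>\<^bsub>S\<^esub> v) w = cls (\<lambda>z. c * indicator {(v, w)} z)"
    unfolding tens_cls using bilin_null.smult_left[OF assms]
    by (subst cls_eq) (auto intro!: free_fun_indicator free_fun_smult assms)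
  then show ?thesis using assms by (simp add: cls_smult free_fun_indicator tens_cls)
qed

lemma tens_smult_right:
  assumes "v \<in> carrier S" "w \<in> carrier T"
  shows "tn v (c \<odot>\<^bsub>T\<^esub> w) = c \<odot>\<^bsub>Alg\<^esub> tn v w"
proof -
  have "tn v (c \<odot>\<^bsub>T\<^esub> w) = cls (\<lambda>z. c * indicator {(v, w)} z)"
    unfolding tens_cls using bilin_null.smult_right[OF assms]
    by (subst cls_eq) (auto intro!: free_fun_indicator free_fun_smult assms)
  then show ?thesis using assms by (simp add: cls_smult free_fun_indicator tens_cls)
qed

lemma bilinear_form_tens:
  assumes "linear_functional Alg s" shows "bilinear_form S T (\<lambda>v w. s (tn v w))"
  using assms unfolding bilinear_form_def linear_functional_def
  by (simp add: tens_add_left tens_add_right tens_smult_left tens_smult_right tens_closed)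

text \<open>By induction on the support, every element of the free space is a combination of
  indicator functions of points.\<close>

lemma tens_determines:
  assumes s: "linear_functional Alg s" and s': "linear_functional Alg s'"
    and eq: "\<And>v w. \<lbrakk>v \<in> carrier S; w \<in> carrier T\<rbrakk> \<Longrightarrow> s (tn v w) = s' (tn v w)"
    and t: "t \<in> carrier Alg"
  shows "s t = s' t"
proof -
  have "\<forall>f. {z. f z \<noteq> 0} \<subseteq> A \<longrightarrow> s (cls f) = s' (cls f)" if "finite A" "A \<subseteq> carrier S \<times> carrier T" for A
    using that
  proof (induction A rule: finite_induct)
    case empty
    have z: "(\<lambda>_. 0) \<in> free_fun S T" by (simp add: free_fun_def)
    have "\<sigma> (cls (\<lambda>_. 0)) = 0" if "linear_functional Alg \<sigma>" for \<sigma>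
    proof -
      have "\<sigma> (0 \<odot>\<^bsub>Alg\<^esub> cls (\<lambda>_. 0)) = 0 * \<sigma> (cls (\<lambda>_. 0))"
        using that z carrier_Alg unfolding linear_functional_def by blast
      then show ?thesis using cls_smult[OF z, of 0] by simp
    qed
    moreover have "f = (\<lambda>_. 0)" if "{z. f z \<noteq> 0} \<subseteq> {}" for f :: "'v \<times> 'w \<Rightarrow> complex" using that by auto
    ultimately show ?case using s s' by metis
  next
    case (insert a A)
    show ?case
    proof (intro allI impI)
      fix f :: "'v \<times> 'w \<Rightarrow> complex" assume f: "{z. f z \<noteq> 0} \<subseteq> insert a A"
      let ?g = "f(a := 0)"
      obtain v w where a: "a = (v, w)" "v \<in> carrier S" "w \<in> carrier T" using insert.prems by auto
      have g: "{z. ?g z \<noteq> 0} \<subseteq> A" using f by auto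
      have "finite {z. ?g z \<noteq> 0}" using finite_subset[OF g insert.hyps(1)] .
      moreover have "{z. ?g z \<noteq> 0} \<subseteq> carrier S \<times> carrier T"
        by (rule subset_trans[OF g]) (use insert.prems in simp)
      ultimately have gf: "?g \<in> free_fun S T" by (simp only: free_fun_def mem_Collect_eq)
      have i: "indicator {a} \<in> free_fun S T" using a free_fun_indicator by simp
      have ic: "(\<lambda>z. f a * indicator {a} z) \<in> free_fun S T" using free_fun_smult[OF i] .
      have "cls f = cls (\<lambda>z. ?g z + f a * indicator {a} z)"
        by (rule arg_cong[where f = cls]) (auto simp: indicator_def)
      then have "cls f = cls ?g \<oplus>\<^bsub>Alg\<^esub> f a \<odot>\<^bsub>Alg\<^esub> tn v w"
        unfolding cls_add[OF gf ic] cls_smult[OF i] using a by (simp add: tens_cls)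
      moreover have "cls ?g \<in> carrier Alg" using gf carrier_Alg by blast
      ultimately show "s (cls f) = s' (cls f)"
        using s s' insert.IH[OF _ ] insert.prems g eq[OF a(2,3)] tens_closed[OF a(2,3)]
        by (simp add: linear_functional_def)
    qed
  qed
  moreover obtain f where "f \<in> free_fun S T" "t = cls f" using t carrier_Alg by auto
  ultimately show ?thesis by (auto simp: free_fun_def)
qed

text \<open>A bilinear form extends linearly to finitely supported functions on pairs and vanishes on each
  generator of \<^const>\<open>bilin_null\<close>.\<close>

lemma bilinear_form_extends:
  assumes \<beta>: "bilinear_form S T \<beta>"
  shows "\<exists>s. linear_functional Alg s \<and> (\<forall>v\<in>carrier S. \<forall>w\<in>carrier T. s (tn v w) = \<beta> v w)"
proof -
  define \<Phi> where "\<Phi> f = (\<Sum>z | f z \<noteq> 0. f z * \<beta> (fst z) (snd z))" for f :: "'v \<times> 'w \<Rightarrow> complex"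
  have \<Phi>: "\<Phi> f = (\<Sum>z\<in>A. f z * \<beta> (fst z) (snd z))" if "finite A" "{z. f z \<noteq> 0} \<subseteq> A" for f A
    unfolding \<Phi>_def using that by (intro sum.mono_neutral_left) auto
  have \<Phi>_add: "\<Phi> (\<lambda>z. f z + g z) = \<Phi> f + \<Phi> g" if f: "f \<in> free_fun S T" and g: "g \<in> free_fun S T" for f g
  proof -
    let ?A = "{z. f z \<noteq> 0} \<union> {z. g z \<noteq> 0}"
    have A: "finite ?A" using f g by (auto simp: free_fun_def)
    show ?thesis
      by (subst (1 2 3) \<Phi>[OF A]) (auto simp: sum.distrib algebra_simps)
  qed
  have \<Phi>_smult: "\<Phi> (\<lambda>z. c * f z) = c * \<Phi> f" if f: "f \<in> free_fun S T" for f c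
  proof -
    have A: "finite {z. f z \<noteq> 0}" using f by (auto simp: free_fun_def)
    show ?thesis
      by (subst (1 2) \<Phi>[OF A]) (auto simp: sum_distrib_left algebra_simps)
  qed
  have \<Phi>_diff: "\<Phi> (\<lambda>z. f z - g z) = \<Phi> f - \<Phi> g" if f: "f \<in> free_fun S T" and g: "g \<in> free_fun S T" for f g
    using \<Phi>_add[OF f free_fun_smult[OF g, of "-1"]] \<Phi>_smult[OF g, of "-1"] by simp
  have \<Phi>_ind: "\<Phi> (indicator {(v, w)}) = \<beta> v w" for v w
    by (subst \<Phi>[of "{(v, w)}"]) (auto simp: indicator_def)
  note \<Phi>s = \<Phi>_diff \<Phi>_smult \<Phi>_ind free_fun_indicator free_fun_diff free_fun_smult
  have \<Phi>_Null: "\<Phi> f = 0" if "f \<in> Null" for f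
    using that
  proof (induction rule: bilin_null.induct)
    case zero
    then show ?case by (simp add: \<Phi>_def)
  next
    case (add f g)
    then show ?case using \<Phi>_add Null_free by simp
  next
    case (smult f c)
    then show ?case using \<Phi>_smult Null_free by simp
  next
    case (add_left v v' w)
    then show ?case using \<beta> by (simp add: \<Phi>s bilinear_form_def linear_functional_def)
  next
    case (add_right v w w')
    then show ?case using \<beta> by (simp add: \<Phi>s bilinear_form_def linear_functional_def)
  next
    case (smult_left v w c)
    then show ?case using \<beta> by (simp add: \<Phi>s bilinear_form_def linear_functional_def)
  next
    case (smult_right v w c)
    then show ?case using \<beta> by (simp add: \<Phi>s bilinear_form_def linear_functional_def)
  qed
  define s where "s t = \<Phi> (SOME f. f \<in> t)" for t
  have s: "s (cls f) = \<Phi> f" if f: "f \<in> free_fun S T" for f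
  proof -
    define g where "g = (SOME g. g \<in> cls f)"
    have "g \<in> cls f" unfolding g_def by (rule someI[of _ f]) (rule cls_self[OF f])
    then have g: "g \<in> free_fun S T" "cls g = cls f" using cls_rep[OF f] by auto
    then have "(\<lambda>z. g z - f z) \<in> Null" using cls_eq f by blast
    then show ?thesis using \<Phi>_Null \<Phi>_diff[OF g(1) f] by (fastforce simp: s_def g_def)
  qed
  have "linear_functional Alg s"
    unfolding linear_functional_def carrier_Alg
    by (auto simp: cls_add[symmetric] cls_smult[symmetric] s free_fun_add free_fun_smult \<Phi>_add \<Phi>_smult)
  moreover have "\<forall>v\<in>carrier S. \<forall>w\<in>carrier T. s (tn v w) = \<beta> v w"
    by (simp add: tens_cls s free_fun_indicator \<Phi>_ind)
  ultimately show ?thesis by blast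
qed

lemma carrier_max [simp]: "carrier (max_tensor S T) = carrier Alg"
  by (simp add: max_tensor_def)

lemma state_linear: "state (max_tensor S T) s \<Longrightarrow> linear_functional Alg s"
  by (simp add: state_def linear_functional_def max_tensor_def)

lemma state_unit: "state (max_tensor S T) s \<Longrightarrow> s (tn \<one>\<^bsub>S\<^esub> \<one>\<^bsub>T\<^esub>) = 1"
  by (simp add: state_def max_tensor_def unit_Alg)

text \<open>The element $\alpha (P \otimes Q) \alpha^*$ for a row $\alpha$. A state only sees the positive
  elements of the tensor product itself, not its matrices, and up to Archimedean closure these are
  the elements of this form.\<close>

definition kron :: "nat \<Rightarrow> nat \<Rightarrow> (nat \<Rightarrow> nat \<Rightarrow> 'v) \<Rightarrow> (nat \<Rightarrow> nat \<Rightarrow> 'w) \<Rightarrow> (nat \<times> nat \<Rightarrow> complex) \<Rightarrow> ('v \<times> 'w \<Rightarrow> complex) set" where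
  "kron k m P Q \<alpha> = (\<Oplus>\<^bsub>Alg\<^esub>z\<in>{..<k} \<times> {..<m}. \<Oplus>\<^bsub>Alg\<^esub>y\<in>{..<k} \<times> {..<m}.
      (\<alpha> z * cnj (\<alpha> y)) \<odot>\<^bsub>Alg\<^esub> tn (P (fst z) (fst y)) (Q (snd z) (snd y)))"

lemma tensor_cone_1:
  "R \<in> tensor_cone S T 1 \<longleftrightarrow> (\<exists>k m P Q \<alpha>. P \<in> mpos S k \<and> Q \<in> mpos T m \<and> R 0 0 = kron k m P Q \<alpha>)"
proof -
  define E where "E k m P Q \<alpha> \<longleftrightarrow> (\<forall>i<1. \<forall>j<1. R i j =
      (\<Oplus>\<^bsub>Alg\<^esub>z\<in>{..<k} \<times> {..<m}. \<Oplus>\<^bsub>Alg\<^esub>w\<in>{..<k} \<times> {..<m}.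
          (\<alpha> i z * cnj (\<alpha> j w)) \<odot>\<^bsub>Alg\<^esub> tn (P (fst z) (fst w)) (Q (snd z) (snd w))))"
    for k m P Q and \<alpha> :: "nat \<Rightarrow> nat \<times> nat \<Rightarrow> complex"
  have 1: "R \<in> tensor_cone S T 1 \<longleftrightarrow> (\<exists>k m. \<exists>P\<in>mpos S k. \<exists>Q\<in>mpos T m. \<exists>\<alpha>. E k m P Q \<alpha>)"
    by (simp only: tensor_cone_def E_def mem_Collect_eq)
  have 2: "E k m P Q \<alpha> \<longleftrightarrow> R 0 0 = kron k m P Q (\<alpha> 0)" for k m P Q \<alpha>
    unfolding E_def kron_def by simp
  have 3: "(\<exists>\<alpha>. E k m P Q \<alpha>) \<longleftrightarrow> (\<exists>\<alpha>. R 0 0 = kron k m P Q \<alpha>)" for k m P Q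
  proof
    assume "\<exists>\<alpha>. R 0 0 = kron k m P Q \<alpha>"
    then obtain \<alpha> where "R 0 0 = kron k m P Q \<alpha>" ..
    then have "E k m P Q (\<lambda>_. \<alpha>)" unfolding 2 .
    then show "\<exists>\<alpha>. E k m P Q \<alpha>" by (rule exI[of _ "\<lambda>_. \<alpha>"])
  qed (auto simp: 2)
  show ?thesis unfolding 1 3 by blast
qed

lemma mpos_max_1:
  "(\<lambda>_ _. x) \<in> mpos (max_tensor S T) 1 \<longleftrightarrow> x \<in> carrier Alg \<and>
     (\<forall>\<epsilon>>0. \<exists>k m P Q \<alpha>. P \<in> mpos S k \<and> Q \<in> mpos T m \<and>
        x \<oplus>\<^bsub>Alg\<^esub> of_real \<epsilon> \<odot>\<^bsub>Alg\<^esub> \<one>\<^bsub>Alg\<^esub> = kron k m P Q \<alpha>)"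
  unfolding max_tensor_def archimedeanise_simps mem_Collect_eq mats_def
  by (simp add: tensor_cone_1[simplified] mshift_def)

lemma linear_functional_kron:
  assumes s: "linear_functional Alg s" and P: "P \<in> mpos S k" "Q \<in> mpos T m"
  shows "s (kron k m P Q \<alpha>) = (\<Sum>z\<in>{..<k} \<times> {..<m}. \<Sum>y\<in>{..<k} \<times> {..<m}.
        \<alpha> z * cnj (\<alpha> y) * s (tn (P (fst z) (fst y)) (Q (snd z) (snd y))))"
proof -
  have PQ: "tn (P (fst z) (fst y)) (Q (snd z) (snd y)) \<in> carrier Alg"
    if "z \<in> {..<k} \<times> {..<m}" "y \<in> {..<k} \<times> {..<m}" for z y
    by (intro tens_closed S.mats_D[OF S.mpos_mats[OF P(1)]] T.mats_D[OF T.mpos_mats[OF P(2)]])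
      (use that in auto)
  let ?I = "{..<k} \<times> {..<m}"
  let ?t = "\<lambda>z y. (\<alpha> z * cnj (\<alpha> y)) \<odot>\<^bsub>Alg\<^esub> tn (P (fst z) (fst y)) (Q (snd z) (snd y))"
  have t: "?t z \<in> ?I \<rightarrow> carrier Alg" if "z \<in> ?I" for z
    using PQ[OF that] by blast
  have "s (kron k m P Q \<alpha>) = (\<Sum>z\<in>?I. s (\<Oplus>\<^bsub>Alg\<^esub>y\<in>?I. ?t z y))"
    unfolding kron_def
    by (rule linear_functional_finsum[OF A.complex_space_axioms s])
      (use t in \<open>auto intro!: A.M.finsum_closed\<close>)
  also have "\<dots> = (\<Sum>z\<in>?I. \<Sum>y\<in>?I. s (?t z y))"
    by (intro sum.cong refl linear_functional_finsum[OF A.complex_space_axioms s] t) auto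
  also have "\<dots> = (\<Sum>z\<in>?I. \<Sum>y\<in>?I. \<alpha> z * cnj (\<alpha> y) * s (tn (P (fst z) (fst y)) (Q (snd z) (snd y))))"
    by (intro sum.cong refl) (use s PQ in \<open>simp add: linear_functional_def\<close>)
  finally show ?thesis .
qed

lemma stateI:
  assumes s: "linear_functional Alg s" and one: "s (tn \<one>\<^bsub>S\<^esub> \<one>\<^bsub>T\<^esub>) = 1"
    and pos: "\<And>k m P Q \<alpha>. \<lbrakk>P \<in> mpos S k; Q \<in> mpos T m\<rbrakk> \<Longrightarrow>
      nn (\<Sum>z\<in>{..<k} \<times> {..<m}. \<Sum>y\<in>{..<k} \<times> {..<m}.
        \<alpha> z * cnj (\<alpha> y) * s (tn (P (fst z) (fst y)) (Q (snd z) (snd y))))"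
  shows "state (max_tensor S T) s"
  unfolding state_def
proof (intro conjI allI impI)
  fix x assume "(\<lambda>i j. x) \<in> mpos (max_tensor S T) 1"
  then have x: "x \<in> carrier Alg"
    and cone: "\<forall>\<epsilon>>0. \<exists>k m P Q \<alpha>. P \<in> mpos S k \<and> Q \<in> mpos T m \<and>
        x \<oplus>\<^bsub>Alg\<^esub> of_real \<epsilon> \<odot>\<^bsub>Alg\<^esub> \<one>\<^bsub>Alg\<^esub> = kron k m P Q \<alpha>"
    unfolding mpos_max_1 by auto
  have e: "nn (s x + of_real \<epsilon>)" if \<epsilon>: "\<epsilon> > 0" for \<epsilon>
  proof -
    obtain k m P Q \<alpha> where P: "P \<in> mpos S k" "Q \<in> mpos T m" and
      eq: "x \<oplus>\<^bsub>Alg\<^esub> of_real \<epsilon> \<odot>\<^bsub>Alg\<^esub> \<one>\<^bsub>Alg\<^esub> = kron k m P Q \<alpha>"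
      using cone \<epsilon> by blast
    have "nn (s (x \<oplus>\<^bsub>Alg\<^esub> of_real \<epsilon> \<odot>\<^bsub>Alg\<^esub> \<one>\<^bsub>Alg\<^esub>))"
      unfolding eq linear_functional_kron[OF s P] by (rule pos[OF P])
    moreover have "\<one>\<^bsub>Alg\<^esub> \<in> carrier Alg" unfolding unit_Alg by (intro tens_closed S.unit_closed T.unit_closed)
    ultimately show ?thesis using s x one by (simp add: linear_functional_def unit_Alg)
  qed
  show "s x \<in> \<real>" using e[of 1] by (simp add: nn_def complex_is_Real_iff)
  have "0 \<le> Re (s x) + \<epsilon>" if "\<epsilon> > 0" for \<epsilon> using e[OF that] by (simp add: nn_def)
  then show "0 \<le> Re (s x)" by (rule field_le_epsilon)
qed (use s one in \<open>auto simp: linear_functional_def max_tensor_def unit_Alg\<close>)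

text \<open>Membership in the Archimedean closure asks for $v \otimes w + \epsilon (1 \otimes 1)$ to lie in
  the cone before closure, for each $\epsilon > 0$. It does, as a single compression of
  $\mathrm{diag}(v, 1) \otimes \mathrm{diag}(w, 1)$.\<close>

lemma state_nn:
  assumes s: "state (max_tensor S T) s" and v: "(\<lambda>_ _. v) \<in> mpos S 1" and w: "(\<lambda>_ _. w) \<in> mpos T 1"
  shows "nn (s (tn v w))"
proof -
  have diag: "(\<lambda>i j. if i = j then if i = 0 then v else \<one>\<^bsub>V\<^esub> else \<zero>\<^bsub>V\<^esub>) \<in> mpos V 2"
    if V: "matrix_ordered V" and v: "(\<lambda>_ _. v) \<in> mpos V 1" for V :: "'z osys" and v
  proof -
    interpret V: matrix_ordered V by fact
    have vc: "v \<in> carrier V" using V.mats_D[OF V.mpos_mats[OF v]] by simp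
    have "(\<lambda>_ _. \<one>\<^bsub>V\<^esub>) \<in> mpos V 1"
      by (rule V.mpos_cong[OF V.mpos_unit[of 1]]) (auto simp: mshift_def V.unit_closed)
    then have 1: "compress V 1 (\<lambda>i _. if i = 1 then 1 else 0) (\<lambda>_ _. \<one>\<^bsub>V\<^esub>) \<in> mpos V 2"
      by (rule V.mpos_compress)
    have 2: "compress V 1 (\<lambda>i _. if i = 0 then 1 else 0) (\<lambda>_ _. v) \<in> mpos V 2"
      by (rule V.mpos_compress[OF v])
    have c: "compress V 1 \<alpha> (\<lambda>_ _. u) i j = (\<alpha> i 0 * cnj (\<alpha> j 0)) \<odot>\<^bsub>V\<^esub> u" if "u \<in> carrier V" for \<alpha> u i j
      by (rule V.compress_1) (rule that)
    show ?thesis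
      by (rule V.mpos_cong[OF V.mpos_add[OF 2 1]])
        (auto simp: c[OF vc] c[OF V.unit_closed] vc V.unit_closed less_2_cases_iff simp del: One_nat_def)
  qed
  have vc: "v \<in> carrier S" "w \<in> carrier T"
    using S.mats_D[OF S.mpos_mats[OF v]] T.mats_D[OF T.mpos_mats[OF w]] by auto
  let ?P = "\<lambda>i j. if i = j then if i = 0 then v else \<one>\<^bsub>S\<^esub> else \<zero>\<^bsub>S\<^esub>"
  let ?Q = "\<lambda>i j. if i = j then if i = 0 then w else \<one>\<^bsub>T\<^esub> else \<zero>\<^bsub>T\<^esub>"
  have P: "?P \<in> mpos S 2" by (rule diag[OF S.matrix_ordered_axioms v])
  have Q: "?Q \<in> mpos T 2" by (rule diag[OF T.matrix_ordered_axioms w])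
  have tz: "tn \<zero>\<^bsub>S\<^esub> y = \<zero>\<^bsub>Alg\<^esub>" if "y \<in> carrier T" for y
    using tens_smult_left[of "\<zero>\<^bsub>S\<^esub>" y 0] that tens_closed[of "\<zero>\<^bsub>S\<^esub>" y] by simp
  have one: "\<one>\<^bsub>Alg\<^esub> \<in> carrier Alg" unfolding unit_Alg by (intro tens_closed S.unit_closed T.unit_closed)
  have "\<exists>\<alpha>. tn v w \<oplus>\<^bsub>Alg\<^esub> of_real \<epsilon> \<odot>\<^bsub>Alg\<^esub> \<one>\<^bsub>Alg\<^esub> = kron 2 2 ?P ?Q \<alpha>" if \<epsilon>: "\<epsilon> > 0" for \<epsilon>
  proof -
    \<comment> \<open>the row that selects the corners $v \otimes w$ and $1 \otimes 1$ with weights $1$ and $\epsilon$\<close>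
    let ?\<alpha> = "\<lambda>z :: nat \<times> nat. if z = (0, 0) then 1 else if z = (1, 1) then complex_of_real (sqrt \<epsilon>) else 0"
    let ?I = "{..<2} \<times> {..<2} :: (nat \<times> nat) set"
    have I: "?I = insert (0, 0) (insert (0, 1) (insert (1, 0) {(1, 1)}))"
      by (auto simp: less_2_cases_iff)
    have sq: "complex_of_real (sqrt \<epsilon>) * complex_of_real (sqrt \<epsilon>) = of_real \<epsilon>"
      using \<epsilon> by (simp flip: of_real_mult)
    let ?d = "\<lambda>z :: nat \<times> nat. if z = (0, 0) then tn v w else if z = (1, 1) then of_real \<epsilon> \<odot>\<^bsub>Alg\<^esub> \<one>\<^bsub>Alg\<^esub> else \<zero>\<^bsub>Alg\<^esub>"
    have d: "?d \<in> ?I \<rightarrow> carrier Alg" using tens_closed[OF vc] one by auto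
    have t: "(?\<alpha> z * cnj (?\<alpha> y)) \<odot>\<^bsub>Alg\<^esub> tn (?P (fst z) (fst y)) (?Q (snd z) (snd y)) = (if z = y then ?d y else \<zero>\<^bsub>Alg\<^esub>)"
      for z y
    proof (cases "z \<in> {(0, 0), (1, 1)} \<and> y \<in> {(0, 0), (1, 1)}")
      case True
      then show ?thesis using tens_closed[OF vc] by (auto simp: sq unit_Alg tz)
    next
      case False
      then have "?\<alpha> z * cnj (?\<alpha> y) = 0" by auto
      moreover have "tn (?P (fst z) (fst y)) (?Q (snd z) (snd y)) \<in> carrier Alg"
        by (intro tens_closed) (simp_all add: vc S.unit_closed T.unit_closed)
      ultimately have "(?\<alpha> z * cnj (?\<alpha> y)) \<odot>\<^bsub>Alg\<^esub> tn (?P (fst z) (fst y)) (?Q (snd z) (snd y)) = \<zero>\<^bsub>Alg\<^esub>"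
        by (simp only: A.smult_0)
      then show ?thesis using False by auto
    qed
    have inner: "(\<Oplus>\<^bsub>Alg\<^esub>y\<in>?I. (?\<alpha> z * cnj (?\<alpha> y)) \<odot>\<^bsub>Alg\<^esub> tn (?P (fst z) (fst y)) (?Q (snd z) (snd y))) = ?d z"
      if "z \<in> ?I" for z
      unfolding t by (rule A.M.finsum_singleton[OF that _ d]) simp
    have "(\<Oplus>\<^bsub>Alg\<^esub>z\<in>?I. \<Oplus>\<^bsub>Alg\<^esub>y\<in>?I.
          (?\<alpha> z * cnj (?\<alpha> y)) \<odot>\<^bsub>Alg\<^esub> tn (?P (fst z) (fst y)) (?Q (snd z) (snd y))) =
      (\<Oplus>\<^bsub>Alg\<^esub>z\<in>?I. ?d z)"
      by (rule A.M.finsum_cong'[OF refl d inner])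
    moreover have "(\<Oplus>\<^bsub>Alg\<^esub>z\<in>?I. ?d z) = tn v w \<oplus>\<^bsub>Alg\<^esub> of_real \<epsilon> \<odot>\<^bsub>Alg\<^esub> \<one>\<^bsub>Alg\<^esub>"
      unfolding I using tens_closed[OF vc] one by (simp add: Pi_def)
    ultimately show ?thesis by (intro exI[of _ ?\<alpha>]) (simp only: kron_def)
  qed
  then have "(\<lambda>i j. tn v w) \<in> mpos (max_tensor S T) 1"
    unfolding mpos_max_1 using tens_closed[OF vc] P Q by blast
  then show ?thesis using s by (simp add: state_def nn_def)
qed

end

section \<open>Kronecker products of positive semidefinite matrices\<close>

lemma psd_zero_diagonal:
  assumes M: "psd n M" and i: "i < n" "j < n" and 0: "M j j = 0"
  shows "M i j = 0"
proof (rule ccontr)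
  assume ne: "M i j \<noteq> 0"
  have h: "M j i = cnj (M i j)" by (rule psd_hermitian[OF M i])
  define r where "r = (cmod (M i j))\<^sup>2"
  have r: "r > 0" using ne by (simp add: r_def)
  have rr: "M i j * cnj (M i j) = of_real r" by (simp only: r_def complex_norm_square)
  \<comment> \<open>large enough to make the quadratic form negative at $e_i - t\, \overline{M_{ij}}\, e_j$\<close>
  define t where "t = (\<bar>Re (M i i)\<bar> + 1) / r"
  have "nn (quad n M (\<lambda>k. (if k = i then 1 else 0) + (if k = j then - (of_real t * cnj (M i j)) else 0)))"
    using M[unfolded psd_quad] by blast
  also have "quad n M (\<lambda>k. (if k = i then 1 else 0) + (if k = j then - (of_real t * cnj (M i j)) else 0)) =
     M i i - 2 * of_real t * (M i j * cnj (M i j))"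
    unfolding quad_2[OF i] h 0 by (simp add: algebra_simps)
  also have "\<dots> = M i i - of_real (2 * t * r)" unfolding rr by simp
  finally have "0 \<le> Re (M i i) - 2 * t * r" unfolding nn_def by simp
  moreover have "t * r = \<bar>Re (M i i)\<bar> + 1" using r by (simp add: t_def)
  ultimately show False by simp
qed

text \<open>The Cholesky decomposition: split off the rank one matrix that agrees with \<open>M\<close> in the last row and
  column; the remainder is the Schur complement, which is again positive semidefinite. If the last diagonal
  entry is zero then so are its row and column, and the division by zero in \<open>u\<close> gives $u = 0$
  as it should.\<close>

lemma psd_gram:
  "psd n M \<Longrightarrow> \<exists>v. \<forall>i<n. \<forall>j<n. M i j = (\<Sum>r<n. v r i * cnj (v r j))"
proof (induction n arbitrary: M)
  case 0
  then show ?case by simp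
next
  case (Suc n)
  define d where "d = Re (M n n)"
  have "nn (quad (Suc n) M (\<lambda>k. (if k = n then 1 else 0) + (if k = n then 0 else 0)))"
    using Suc.prems by (simp only: psd_quad)
  then have "nn (M n n)" by (subst (asm) quad_2) auto
  then have d: "M n n = of_real d" "d \<ge> 0" by (auto simp: nn_def d_def elim!: Reals_cases)
  have h: "M j i = cnj (M i j)" if "i \<le> n" "j \<le> n" for i j
    using psd_hermitian[OF Suc.prems, of i j] that by simp
  define u where "u i = M i n / of_real (sqrt d)" for i
  have un: "u i * cnj (u j) = M i n * M n j / of_real d" if "i \<le> n" "j \<le> n" for i j
  proof -
    have "complex_of_real (sqrt d) * complex_of_real (sqrt d) = of_real d" using d by (simp flip: of_real_mult)
    then show ?thesis using h[of j n] that by (simp add: u_def)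
  qed
  have col: "M i n = 0" if "d = 0" "i \<le> n" for i
    using psd_zero_diagonal[OF Suc.prems, of i n] that d by simp
  have last: "M i n = u i * cnj (u n)" "M n i = u n * cnj (u i)" if "i \<le> n" for i
    using that d un[of i n] un[of n i] col[of i] h[of i n] by (cases "d = 0"; simp)+
  let ?M = "\<lambda>i j. M i j - u i * cnj (u j)"
  have "psd n ?M"
    unfolding psd_quad
  proof
    fix w :: "nat \<Rightarrow> complex"
    define c where "c = (\<Sum>i<n. cnj (w i) * M i n)"
    \<comment> \<open>the last coordinate that minimises the quadratic form of \<open>M\<close> for given \<open>w\<close>\<close>
    define t where "t = - cnj c / of_real d"
    define w' where "w' k = (if k = n then t else w k)" for k
    have c': "(\<Sum>j<n. M n j * w j) = cnj c"
      unfolding c_def by (simp, rule sum.cong) (auto simp: h[of _ n])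
    have "quad (Suc n) M w' = (\<Sum>i<n. \<Sum>j<n. cnj (w i) * M i j * w j) + (\<Sum>i<n. cnj (w i) * M i n * t) +
        ((\<Sum>j<n. cnj t * M n j * w j) + cnj t * M n n * t)"
      unfolding quad_def by (simp add: w'_def sum.distrib)
    also have "(\<Sum>i<n. cnj (w i) * M i n * t) = c * t"
      by (simp add: c_def sum_distrib_right)
    also have "(\<Sum>j<n. cnj t * M n j * w j) = cnj t * cnj c"
      unfolding c'[symmetric] by (simp add: sum_distrib_left mult.assoc)
    finally have q: "quad (Suc n) M w' = quad n M w + c * t + (cnj t * cnj c + cnj t * M n n * t)"
      by (simp add: quad_def)
    have "(\<Sum>i<n. \<Sum>j<n. cnj (w i) * (u i * cnj (u j)) * w j) = (\<Sum>i<n. cnj (w i) * u i) * (\<Sum>j<n. cnj (u j) * w j)"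
      by (simp add: sum_product mult_ac)
    also have "\<dots> = (c / of_real (sqrt d)) * (cnj c / of_real (sqrt d))"
    proof -
      have "(\<Sum>j<n. cnj (u j) * w j) = (\<Sum>j<n. M n j * w j) / of_real (sqrt d)"
        unfolding sum_divide_distrib u_def by (rule sum.cong) (auto simp: h[of _ n])
      moreover have "(\<Sum>i<n. cnj (w i) * u i) = c / of_real (sqrt d)"
        by (simp add: u_def c_def sum_divide_distrib)
      ultimately show ?thesis unfolding c' by simp
    qed
    also have "\<dots> = c * cnj c / of_real d"
    proof -
      have "complex_of_real (sqrt d) * complex_of_real (sqrt d) = of_real d" using d by (simp flip: of_real_mult)
      then show ?thesis by simp
    qed
    finally have "quad n ?M w = quad n M w - c * cnj c / of_real d"
      by (simp add: quad_def algebra_simps sum_subtractf)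
    moreover have "quad (Suc n) M w' = quad n M w - c * cnj c / of_real d"
      unfolding q d(1) by (cases "d = 0") (simp_all add: t_def field_simps)
    ultimately show "nn (quad n ?M w)" using Suc.prems by (metis psd_quad)
  qed
  then obtain v where v: "\<forall>i<n. \<forall>j<n. ?M i j = (\<Sum>r<n. v r i * cnj (v r j))" using Suc.IH by blast
  let ?v = "\<lambda>r i. if r = n then u i else if i < n then v r i else 0"
  have "M i j = (\<Sum>r<Suc n. ?v r i * cnj (?v r j))" if "i < Suc n" "j < Suc n" for i j
  proof (cases "i < n \<and> j < n")
    case True
    then have "M i j = (\<Sum>r<n. v r i * cnj (v r j)) + u i * cnj (u j)" using v by (metis diff_add_cancel)
    then show ?thesis using True by simp
  next
    case False
    then have "M i j = u i * cnj (u j)" using that last[of i] last[of j] by (metis less_Suc_eq_le less_SucE)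
    moreover have "(\<Sum>r<n. ?v r i * cnj (?v r j)) = 0" using False by (intro sum.neutral) auto
    ultimately show ?thesis by simp
  qed
  then show ?case by (intro exI[of _ ?v]) simp
qed

text \<open>Writing \<open>A\<close> as a sum of rank one matrices $v_r v_r^*$ turns the quadratic form of the
  Kronecker product into a sum of quadratic forms of \<open>B\<close>.\<close>

lemma psd_kronecker:
  assumes A: "psd k A" and B: "psd m B"
  shows "nn (\<Sum>z\<in>{..<k} \<times> {..<m}. \<Sum>y\<in>{..<k} \<times> {..<m}.
    \<alpha> z * cnj (\<alpha> y) * (A (fst z) (fst y) * B (snd z) (snd y)))"
proof -
  obtain v where v: "\<And>i j. \<lbrakk>i < k; j < k\<rbrakk> \<Longrightarrow> A i j = (\<Sum>r<k. v r i * cnj (v r j))"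
    using psd_gram[OF A] by blast
  let ?I = "{..<k} \<times> {..<m}"
  define w where "w r l = (\<Sum>i<k. cnj (\<alpha> (i, l)) * cnj (v r i))" for r l
  have "(\<Sum>z\<in>?I. \<Sum>y\<in>?I. \<alpha> z * cnj (\<alpha> y) * (A (fst z) (fst y) * B (snd z) (snd y))) =
    (\<Sum>z\<in>?I. \<Sum>y\<in>?I. \<Sum>r<k. (\<alpha> z * v r (fst z)) * B (snd z) (snd y) * (cnj (\<alpha> y) * cnj (v r (fst y))))"
    by (intro sum.cong refl) (auto simp: v sum_distrib_left sum_distrib_right mult_ac)
  also have "\<dots> = (\<Sum>z\<in>?I. \<Sum>r<k. \<Sum>y\<in>?I. (\<alpha> z * v r (fst z)) * B (snd z) (snd y) * (cnj (\<alpha> y) * cnj (v r (fst y))))"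
    by (intro sum.cong refl sum.swap)
  also have "\<dots> = (\<Sum>r<k. \<Sum>z\<in>?I. \<Sum>y\<in>?I. (\<alpha> z * v r (fst z)) * B (snd z) (snd y) * (cnj (\<alpha> y) * cnj (v r (fst y))))"
    by (rule sum.swap)
  also have "\<dots> = (\<Sum>r<k. quad m B (w r))"
  proof (intro sum.cong refl)
    fix r
    have I: "(\<Sum>z\<in>?I. f z) = (\<Sum>l<m. \<Sum>i<k. f (i, l))" for f :: "nat \<times> nat \<Rightarrow> complex"
      unfolding sum.cartesian_product' by (simp add: sum.swap[of _ "{..<k}"])
    show "(\<Sum>z\<in>?I. \<Sum>y\<in>?I. (\<alpha> z * v r (fst z)) * B (snd z) (snd y) * (cnj (\<alpha> y) * cnj (v r (fst y)))) = quad m B (w r)"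
    proof -
      have "(\<Sum>z\<in>?I. \<Sum>y\<in>?I. (\<alpha> z * v r (fst z)) * B (snd z) (snd y) * (cnj (\<alpha> y) * cnj (v r (fst y)))) =
        (\<Sum>l<m. \<Sum>i<k. \<Sum>l'<m. \<Sum>i'<k. (\<alpha> (i, l) * v r i) * B l l' * (cnj (\<alpha> (i', l')) * cnj (v r i')))"
        unfolding I by simp
      also have "\<dots> = (\<Sum>l<m. \<Sum>l'<m. \<Sum>i<k. \<Sum>i'<k. (\<alpha> (i, l) * v r i) * B l l' * (cnj (\<alpha> (i', l')) * cnj (v r i')))"
        by (intro sum.cong refl sum.swap)
      also have "\<dots> = quad m B (w r)"
        unfolding quad_def w_def by (simp add: sum_distrib_left sum_distrib_right mult_ac)
      finally show ?thesis .
    qed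
  qed
  also have "nn \<dots>" using B by (intro nn_sum) (simp add: psd_quad)
  finally show ?thesis .
qed

lemma nn_limit:
  assumes f: "(f \<longlongrightarrow> l) F" and ev: "eventually (\<lambda>x. nn (f x)) F" and F: "F \<noteq> bot"
  shows "nn l"
proof -
  have "{z. nn z} = {z. Im z = 0} \<inter> {z. 0 \<le> Re z}" by (auto simp: nn_def complex_is_Real_iff)
  moreover have "closed {z. Im z = 0}" "closed {z. 0 \<le> Re z}"
    by (intro closed_Collect_eq closed_Collect_le continuous_intros)+
  ultimately have "closed {z. nn z}" by auto
  then show ?thesis using Lim_in_closed_set[OF _ _ F f, of "{z. nn z}"] ev by simp
qed

section \<open>Positive elements and generators of the limits\<close>

lemma mshift_cong: "P i j = Q i j \<Longrightarrow> mshift V r P i j = mshift V r Q i j"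
  unfolding mshift_def by presburger

text \<open>The cones of the limit are Archimedean closures of images of cones of coproducts, which are
  Archimedean closures in turn. Each closure costs half of $\epsilon$.\<close>

lemma fam_lim_positive:
  assumes X: "inductive_family dX" and A: "inductive_family dA"
    and P: "P \<in> mpos (fam_lim dX dA) k" and \<epsilon>: "\<epsilon> > 0"
  shows "\<exists>n\<ge>1. \<exists>p. (\<forall>i<k. \<forall>j<k. p i j \<in> fam_fun dX dA n \<and>
      mshift (fam_lim dX dA) \<epsilon> P i j = fam_elem dX dA n (p i j)) \<and>
    (\<forall>z\<in>fam dX n \<times> fam dA n. psd k (\<lambda>i j. p i j z))"
proof -
  interpret C: coproduct "fam dX n" "fam dA n" for n by (rule coproduct_fam[OF X A])
  interpret L: os_sequence "fam_copr dX dA" "fam_conn dX dA" by (rule os_sequence_fam[OF X A])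
  let ?L = "lim_pre (fam_copr dX dA) (fam_conn dX dA)"
  have PL: "P \<in> mats ?L k" "mshift ?L (\<epsilon> / 2) P \<in> mpos ?L k"
    using P \<epsilon> by (simp_all add: fam_lim_def lim_osys_def)
  then obtain n q where n: "n \<ge> 1" and q: "q \<in> mpos (fam_copr dX dA n) k"
      "\<forall>i<k. \<forall>j<k. mshift ?L (\<epsilon> / 2) P i j = L.emb n (q i j)"
    unfolding L.mpos_L by blast
  have qQ: "q \<in> mats (fam_pre dX dA n) k"
      "mshift (fam_pre dX dA n) (\<epsilon> / 2) q \<in> mpos (fam_pre dX dA n) k"
    using q(1) \<epsilon> by (simp_all add: fam_copr_def copr_def)
  then obtain p where p: "\<And>i j. \<lbrakk>i < k; j < k\<rbrakk> \<Longrightarrow> p i j \<in> fam_fun dX dA n"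
      "\<And>i j. \<lbrakk>i < k; j < k\<rbrakk> \<Longrightarrow> mshift (fam_pre dX dA n) (\<epsilon> / 2) q i j = fam_cls dX dA n (p i j)"
      "\<forall>z\<in>fam dX n \<times> fam dA n. psd k (\<lambda>i j. p i j z)"
    unfolding C.mpos_Q by blast
  interpret V: operator_system "fam_copr dX dA n" using n by (rule L.os)
  have m: "mshift (fam_copr dX dA n) = mshift (fam_pre dX dA n)"
    by (simp add: fam_copr_def copr_def)
  have qm: "q \<in> mats (fam_copr dX dA n) k" using V.mpos_mats[OF q(1)] .
  have "mshift (fam_lim dX dA) \<epsilon> P i j = fam_elem dX dA n (p i j)"
    if ij: "i < k" "j < k" for i j
  proof -
    have "mshift (fam_lim dX dA) \<epsilon> P i j = mshift ?L (\<epsilon> / 2) (mshift ?L (\<epsilon> / 2) P) i j"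
      using L.L.shift_shift[OF PL(1) ij, of "\<epsilon> / 2" "\<epsilon> / 2"] by (simp add: fam_lim_def lim_osys_def)
    also have "\<dots> = mshift ?L (\<epsilon> / 2) (\<lambda>i j. L.emb n (q i j)) i j"
      by (rule mshift_cong) (use q(2) ij in blast)
    also have "\<dots> = L.emb n (mshift (fam_copr dX dA n) (\<epsilon> / 2) q i j)"
      by (rule linear_shift[OF V.complex_space_axioms L.L.complex_space_axioms L.emb_linear[OF n] qm V.unit_closed _ ij, symmetric])
        (rule L.lim_one[OF n, symmetric])
    finally show ?thesis using p(2)[OF ij] by (simp add: m fam_emb_def)
  qed
  then show ?thesis using n p by blast
qed

context
  fixes dX dA :: "nat \<Rightarrow> nat"
  assumes X: "inductive_family dX" and A: "inductive_family dA"
begin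

interpretation C: coproduct "fam dX n" "fam dA n" for n by (rule coproduct_fam[OF X A])
interpretation L: os_sequence "fam_copr dX dA" "fam_conn dX dA" by (rule os_sequence_fam[OF X A])

lemma operator_system_fam_lim: "operator_system (fam_lim dX dA)"
  unfolding fam_lim_def by (rule L.operator_system_lim)

lemma carrier_fam_copr: "carrier (fam_copr dX dA n) = fam_cls dX dA n ` fam_fun dX dA n"
  by (simp add: fam_copr_def C.carrier_Q)

lemma fam_emb_closed:
  "\<lbrakk>n \<ge> 1; f \<in> fam_fun dX dA n\<rbrakk> \<Longrightarrow>
    fam_elem dX dA n f \<in> carrier (fam_lim dX dA)"
  using L.emb_closed[of n "fam_cls dX dA n f"]
  by (simp add: fam_lim_def fam_emb_def carrier_fam_copr)

lemma fam_lim_rep: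
  assumes "V \<in> carrier (fam_lim dX dA)"
  shows "\<exists>n\<ge>1. \<forall>m\<ge>n. \<exists>f\<in>fam_fun dX dA m. V = fam_elem dX dA m f"
proof -
  have "V \<in> carrier (lim_pre (fam_copr dX dA) (fam_conn dX dA))" using assms by (simp add: fam_lim_def)
  then obtain n where "n \<ge> 1" "\<forall>k\<ge>n. \<exists>v\<in>carrier (fam_copr dX dA k). V = lim_emb (fam_copr dX dA) (fam_conn dX dA) k v"
    by (rule L.lim_rep)
  then show ?thesis unfolding carrier_fam_copr fam_emb_def by blast
qed

lemma fam_lim_unit: "\<one>\<^bsub>fam_lim dX dA\<^esub> = fam_elem dX dA 1 (C.e0 1)"
  using L.lim_one[of 1] by (simp add: fam_lim_def fam_emb_def fam_copr_def C.unit_Q)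

lemma fam_gen_closed:
  "\<lbrakk>n \<ge> 1; x \<in> fam dX n; a \<in> fam dA n\<rbrakk> \<Longrightarrow> fam_emb dX dA n (fam_gen dX dA n x a) \<in> carrier (fam_lim dX dA)"
  unfolding C.copr_gen_cls by (intro fam_emb_closed C.gen_fun)

text \<open>The class of \<open>f\<close> is $\sum f(x, a)\, e_{x,a}$.\<close>

lemma fam_functional_expand:
  assumes s: "linear_functional (fam_lim dX dA) s" and n: "n \<ge> 1" and f: "f \<in> fam_fun dX dA n"
  shows "s (fam_elem dX dA n f) =
    (\<Sum>x\<in>fam dX n. \<Sum>a\<in>fam dA n. f (x, a) * s (fam_emb dX dA n (fam_gen dX dA n x a)))"
proof -
  have "linear_map (fam_pre dX dA n) (fam_lim dX dA) (fam_emb dX dA n)"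
    using L.emb_linear[OF n] by (simp add: linear_map_def fam_lim_def fam_emb_def fam_copr_def)
  from C.linear_functional_cls[OF linear_functional_comp[OF this s] f]
  show ?thesis by (simp add: sum.cartesian_product case_prod_beta)
qed

end

lemma sum_swap_pairs:
  "(\<Sum>x\<in>A. \<Sum>a\<in>B. \<Sum>y\<in>C. \<Sum>b\<in>D. f x a y b) = (\<Sum>y\<in>C. \<Sum>b\<in>D. \<Sum>x\<in>A. \<Sum>a\<in>B. f x a y b)"
  using sum.swap[of "\<lambda>z w. f (fst z) (snd z) (fst w) (snd w)" "C \<times> D" "A \<times> B"] by (simp add: sum.cartesian_product')

locale ns_families =
  fixes dX dY dA dB :: "nat \<Rightarrow> nat"
  assumes X: "inductive_family dX" and Y: "inductive_family dY"
    and A: "inductive_family dA" and B: "inductive_family dB"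
begin

abbreviation "SX \<equiv> fam_lim dX dA"
abbreviation "SY \<equiv> fam_lim dY dB"
abbreviation "FX n \<equiv> fam_fun dX dA n"
abbreviation "FY n \<equiv> fam_fun dY dB n"
abbreviation "elX n f \<equiv> fam_elem dX dA n f"
abbreviation "elY n g \<equiv> fam_elem dY dB n g"
text \<open>The index \<open>n\<close> of a generator is its level; \<open>cell\<close> and \<open>test\<close> are the functions
  $\chi_{\tilde x} \otimes \chi_{\tilde y}$ and $\chi_{\tilde a} \otimes \chi_{\tilde b}$.\<close>

abbreviation "cell x y \<equiv> ftensor (indicator (cyl dX x)) (indicator (cyl dY y))"
abbreviation "test a b \<equiv> ftensor (indicator (cyl dA a)) (indicator (cyl dB b))"
abbreviation "genX n x a \<equiv> fam_emb dX dA n (fam_gen dX dA n x a)"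
abbreviation "genY n y b \<equiv> fam_emb dY dB n (fam_gen dY dB n y b)"

sublocale CX: coproduct "fam dX n" "fam dA n" for n by (rule coproduct_fam[OF X A])
sublocale CY: coproduct "fam dY n" "fam dB n" for n by (rule coproduct_fam[OF Y B])
sublocale SX: operator_system SX by (rule operator_system_fam_lim[OF X A])
sublocale SY: operator_system SY by (rule operator_system_fam_lim[OF Y B])
sublocale tensor_factors SX SY by unfold_locales

text \<open>Two elements of the limits come from one common level, where the generators span.\<close>

lemma generators_determine:
  assumes s: "linear_functional Alg s" and s': "linear_functional Alg s'"
    and eq: "\<And>n x y a b. \<lbrakk>n \<ge> 1; x \<in> fam dX n; y \<in> fam dY n; a \<in> fam dA n; b \<in> fam dB n\<rbrakk> \<Longrightarrow>
      s (tn (genX n x a) (genY n y b)) = s' (tn (genX n x a) (genY n y b))"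
    and t: "t \<in> carrier Alg"
  shows "s t = s' t"
proof (rule tens_determines[OF s s' _ t])
  fix V W assume V: "V \<in> carrier SX" and W: "W \<in> carrier SY"
  obtain n where n: "n \<ge> 1" "\<forall>m\<ge>n. \<exists>f\<in>FX m. V = elX m f" using fam_lim_rep[OF X A V] by blast
  obtain m where m: "m \<ge> 1" "\<forall>k\<ge>m. \<exists>g\<in>FY k. W = elY k g" using fam_lim_rep[OF Y B W] by blast
  let ?k = "max n m"
  have k: "?k \<ge> 1" using n by simp
  obtain f where f: "f \<in> FX ?k" "V = elX ?k f" using n by (meson max.cobounded1)
  obtain g where g: "g \<in> FY ?k" "W = elY ?k g" using m by (meson max.cobounded2)
  have "\<sigma> (tn V W) = (\<Sum>x\<in>fam dX ?k. \<Sum>a\<in>fam dA ?k. \<Sum>y\<in>fam dY ?k. \<Sum>b\<in>fam dB ?k.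
      f (x, a) * (g (y, b) * \<sigma> (tn (genX ?k x a) (genY ?k y b))))" if \<sigma>: "linear_functional Alg \<sigma>" for \<sigma>
  proof -
    have b: "bilinear_form SX SY (\<lambda>v w. \<sigma> (tn v w))" by (rule bilinear_form_tens[OF \<sigma>])
    have "\<sigma> (tn V W) = (\<Sum>x\<in>fam dX ?k. \<Sum>a\<in>fam dA ?k. f (x, a) * \<sigma> (tn (genX ?k x a) W))"
      unfolding f(2) by (rule fam_functional_expand[OF X A _ k f(1)]) (use b W in \<open>simp add: bilinear_form_def\<close>)
    also have "\<dots> = (\<Sum>x\<in>fam dX ?k. \<Sum>a\<in>fam dA ?k. f (x, a) *
        (\<Sum>y\<in>fam dY ?k. \<Sum>b\<in>fam dB ?k. g (y, b) * \<sigma> (tn (genX ?k x a) (genY ?k y b))))"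
      unfolding g(2) using b fam_gen_closed[OF X A k]
      by (intro sum.cong refl arg_cong2[where f = "(*)"] fam_functional_expand[OF Y B _ k g(1)]) (simp add: bilinear_form_def)
    finally show ?thesis by (simp add: sum_distrib_left)
  qed
  from this[OF s] this[OF s'] show "s (tn V W) = s' (tn V W)" by (simp add: eq[OF k])
qed

lemma nn_generators:
  assumes s: "state (max_tensor SX SY) s" and "n \<ge> 1" "x \<in> fam dX n" "y \<in> fam dY n" "a \<in> fam dA n" "b \<in> fam dB n"
  shows "nn (s (tn (genX n x a) (genY n y b)))"
proof (rule state_nn[OF s])
  have gen: "(\<lambda>_ _. fam_emb d d' n (fam_gen d d' n x a)) \<in> mpos (fam_lim d d') 1"
    if d: "inductive_family d" "inductive_family d'" and x: "x \<in> fam d n" "a \<in> fam d' n" for d d' x a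
  proof -
    interpret C: coproduct "fam d n" "fam d' n" by (rule coproduct_fam[OF d])
    interpret L: os_sequence "fam_copr d d'" "fam_conn d d'" by (rule os_sequence_fam[OF d])
    have psd: "psd 1 (\<lambda>i j. indicator {(x, a)} z)" for z
      unfolding psd_quad quad_def by (simp add: nn_mult nn_norm indicator_def) (simp add: nn_def)
    have "(\<lambda>_ _. fam_gen d d' n x a) \<in> mpos (fam_pre d d' n) 1"
      unfolding C.mpos_Q using psd C.gen_fun[OF x] C.copr_gen_cls
      by (intro exI[of _ "\<lambda>_ _. indicator {(x, a)}"]) simp
    then have "(\<lambda>_ _. fam_gen d d' n x a) \<in> mpos (fam_copr d d' n) 1"
      unfolding fam_copr_def copr_def by (rule mpos_archimedeanise[OF C.matrix_ordered_Q])
    then show ?thesis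
      using ucp_mpos[OF L.lim_emb_ucp(1)[OF \<open>n \<ge> 1\<close>]] by (simp add: fam_lim_def fam_emb_def)
  qed
  show "(\<lambda>_ _. genX n x a) \<in> mpos SX 1" by (rule gen[OF X A]) fact+
  show "(\<lambda>_ _. genY n y b) \<in> mpos SY 1" by (rule gen[OF Y B]) fact+
qed

end

section \<open>States from no-signalling kernels\<close>

text \<open>The numbers $p(x, y, a, b)$ of the introduction, with independent levels \<open>n\<close> of $(x, a)$ and \<open>m\<close>
  of $(y, b)$. This separates the refinement of the two factors, so that for a fixed generator of
  one factor \<open>kernel_functional\<close> applies to the other one.\<close>

locale ns_kernel = ns_families +
  fixes k :: "nat \<Rightarrow> nat \<Rightarrow> nat list \<Rightarrow> nat list \<Rightarrow> nat list \<Rightarrow> nat list \<Rightarrow> complex"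
    and kA :: "nat \<Rightarrow> nat list \<Rightarrow> nat list \<Rightarrow> complex" and kB :: "nat \<Rightarrow> nat list \<Rightarrow> nat list \<Rightarrow> complex"
  assumes nn_k: "\<lbrakk>n \<ge> 1; m \<ge> 1; x \<in> fam dX n; y \<in> fam dY m; a \<in> fam dA n; b \<in> fam dB m\<rbrakk> \<Longrightarrow> nn (k n m x y a b)"
    and margA: "\<lbrakk>n \<ge> 1; m \<ge> 1; x \<in> fam dX n; y \<in> fam dY m; b \<in> fam dB m\<rbrakk> \<Longrightarrow> (\<Sum>a\<in>fam dA n. k n m x y a b) = kB m y b"
    and margB: "\<lbrakk>n \<ge> 1; m \<ge> 1; x \<in> fam dX n; y \<in> fam dY m; a \<in> fam dA n\<rbrakk> \<Longrightarrow> (\<Sum>b\<in>fam dB m. k n m x y a b) = kA n x a"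
    and total: "x \<in> fam dX 1 \<Longrightarrow> (\<Sum>a\<in>fam dA 1. kA 1 x a) = 1"
    and refineX: "\<lbrakk>n \<ge> 1; m \<ge> 1; x \<in> fam dX n; y \<in> fam dY m; a \<in> fam dA n; b \<in> fam dB m\<rbrakk> \<Longrightarrow>
      k n m x y a b = (\<Sum>i=1..dX n. \<Sum>j=1..dA n. k (Suc n) m (x @ [i]) y (a @ [j]) b) / of_nat (dX n)"
    and refineY: "\<lbrakk>n \<ge> 1; m \<ge> 1; x \<in> fam dX n; y \<in> fam dY m; a \<in> fam dA n; b \<in> fam dB m\<rbrakk> \<Longrightarrow>
      k n m x y a b = (\<Sum>i=1..dY m. \<Sum>j=1..dB m. k n (Suc m) x (y @ [i]) a (b @ [j])) / of_nat (dY m)"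
begin

text \<open>The form is computed from a chosen representative \<open>f\<close> of its first argument, and the functionals
  \<open>H\<close> on the second factor make it linear in the second argument. The functionals
  \<open>F\<close> on the first factor give it a second description which does not refer to \<open>f\<close>
  and shows that it is linear in the first argument.\<close>

lemma kernel_form:
  "\<exists>\<beta>. bilinear_form SX SY \<beta> \<and> (\<forall>n\<ge>1. \<forall>m\<ge>1. \<forall>f\<in>FX n. \<forall>g\<in>FY m.
     \<beta> (elX n f) (elY m g) = (\<Sum>x\<in>fam dX n. \<Sum>a\<in>fam dA n. \<Sum>y\<in>fam dY m. \<Sum>b\<in>fam dB m. f (x, a) * g (y, b) * k n m x y a b))"
proof -
  have "\<exists>H. \<forall>n x a. n \<ge> 1 \<longrightarrow> x \<in> fam dX n \<longrightarrow> a \<in> fam dA n \<longrightarrow> linear_functional SY (H n x a) \<and>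
    (\<forall>m\<ge>1. \<forall>g\<in>FY m. H n x a (elY m g) = (\<Sum>y\<in>fam dY m. \<Sum>b\<in>fam dB m. g (y, b) * k n m x y a b))"
    using kernel_functional[OF Y B nn_k margB refineY] by (intro choice allI) blast
  then obtain H where H: "\<And>n x a. \<lbrakk>n \<ge> 1; x \<in> fam dX n; a \<in> fam dA n\<rbrakk> \<Longrightarrow> linear_functional SY (H n x a)"
    "\<And>n x a m g. \<lbrakk>n \<ge> 1; x \<in> fam dX n; a \<in> fam dA n; m \<ge> 1; g \<in> FY m\<rbrakk> \<Longrightarrow>
       H n x a (elY m g) = (\<Sum>y\<in>fam dY m. \<Sum>b\<in>fam dB m. g (y, b) * k n m x y a b)" by blast
  have "\<exists>F. \<forall>m y b. m \<ge> 1 \<longrightarrow> y \<in> fam dY m \<longrightarrow> b \<in> fam dB m \<longrightarrow> linear_functional SX (F m y b) \<and>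
    (\<forall>n\<ge>1. \<forall>f\<in>FX n. F m y b (elX n f) = (\<Sum>x\<in>fam dX n. \<Sum>a\<in>fam dA n. f (x, a) * k n m x y a b))"
    using kernel_functional[OF X A nn_k margA refineX] by (intro choice allI) blast
  then obtain F where F: "\<And>m y b. \<lbrakk>m \<ge> 1; y \<in> fam dY m; b \<in> fam dB m\<rbrakk> \<Longrightarrow> linear_functional SX (F m y b)"
    "\<And>m y b n f. \<lbrakk>m \<ge> 1; y \<in> fam dY m; b \<in> fam dB m; n \<ge> 1; f \<in> FX n\<rbrakk> \<Longrightarrow>
       F m y b (elX n f) = (\<Sum>x\<in>fam dX n. \<Sum>a\<in>fam dA n. f (x, a) * k n m x y a b)" by blast
  have "\<exists>p. \<forall>V. V \<in> carrier SX \<longrightarrow> fst (p V) \<ge> 1 \<and> snd (p V) \<in> FX (fst (p V)) \<and> V = elX (fst (p V)) (snd (p V))"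
  proof (intro choice allI)
    fix V
    show "\<exists>p. V \<in> carrier SX \<longrightarrow> fst p \<ge> 1 \<and> snd p \<in> FX (fst p) \<and> V = elX (fst p) (snd p)"
      using fam_lim_rep[OF X A, of V] by (metis fst_conv order_refl snd_conv)
  qed
  then obtain p where p: "\<And>V. V \<in> carrier SX \<Longrightarrow> fst (p V) \<ge> 1" "\<And>V. V \<in> carrier SX \<Longrightarrow> snd (p V) \<in> FX (fst (p V))"
      "\<And>V. V \<in> carrier SX \<Longrightarrow> V = elX (fst (p V)) (snd (p V))" by blast
  define \<beta> where "\<beta> V W = (\<Sum>x\<in>fam dX (fst (p V)). \<Sum>a\<in>fam dA (fst (p V)). snd (p V) (x, a) * H (fst (p V)) x a W)" for V W
  have key: "\<beta> V (elY m g) = (\<Sum>y\<in>fam dY m. \<Sum>b\<in>fam dB m. g (y, b) * F m y b V)"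
    if V: "V \<in> carrier SX" and m: "m \<ge> 1" and g: "g \<in> FY m" for V m g
  proof -
    define n f where "n = fst (p V)" and "f = snd (p V)"
    have nf: "n \<ge> 1" "f \<in> FX n" "V = elX n f" unfolding n_def f_def by (rule p[OF V])+
    have "\<beta> V (elY m g) = (\<Sum>x\<in>fam dX n. \<Sum>a\<in>fam dA n. \<Sum>y\<in>fam dY m. \<Sum>b\<in>fam dB m. f (x, a) * (g (y, b) * k n m x y a b))"
      unfolding \<beta>_def n_def[symmetric] f_def[symmetric] using nf m g by (simp add: H(2) sum_distrib_left)
    also have "\<dots> = (\<Sum>y\<in>fam dY m. \<Sum>b\<in>fam dB m. \<Sum>x\<in>fam dX n. \<Sum>a\<in>fam dA n. f (x, a) * (g (y, b) * k n m x y a b))"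
      by (rule sum_swap_pairs)
    also have "\<dots> = (\<Sum>y\<in>fam dY m. \<Sum>b\<in>fam dB m. g (y, b) * F m y b V)"
      unfolding nf(3) using nf(1,2) m by (intro sum.cong refl) (simp add: F(2) sum_distrib_left mult_ac)
    finally show ?thesis .
  qed
  have "bilinear_form SX SY \<beta>"
    unfolding bilinear_form_def
  proof (intro conjI ballI)
    fix V assume V: "V \<in> carrier SX"
    show "linear_functional SY (\<beta> V)"
      using H(1)[OF p(1)[OF V]] unfolding linear_functional_def \<beta>_def
      by (auto simp: algebra_simps sum.distrib sum_distrib_left intro!: sum.cong)
  next
    fix W assume W: "W \<in> carrier SY"
    obtain m where "m \<ge> 1" "\<forall>k\<ge>m. \<exists>g\<in>FY k. W = elY k g" using fam_lim_rep[OF Y B W] by blast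
    then obtain g where m: "m \<ge> 1" and g: "g \<in> FY m" "W = elY m g" by blast
    show "linear_functional SX (\<lambda>V. \<beta> V W)"
      unfolding linear_functional_def g(2)
      using F(1)[OF m] by (auto simp: key[OF _ m g(1)] linear_functional_def algebra_simps sum.distrib sum_distrib_left
        intro!: sum.cong)
  qed
  moreover have "\<beta> (elX n f) (elY m g) = (\<Sum>x\<in>fam dX n. \<Sum>a\<in>fam dA n. \<Sum>y\<in>fam dY m. \<Sum>b\<in>fam dB m. f (x, a) * g (y, b) * k n m x y a b)"
    if n: "n \<ge> 1" and m: "m \<ge> 1" and f: "f \<in> FX n" and g: "g \<in> FY m" for n m f g
  proof -
    have "\<beta> (elX n f) (elY m g) = (\<Sum>y\<in>fam dY m. \<Sum>b\<in>fam dB m. \<Sum>x\<in>fam dX n. \<Sum>a\<in>fam dA n. f (x, a) * g (y, b) * k n m x y a b)"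
      using key[OF fam_emb_closed[OF X A n f] m g] by (simp add: F(2)[OF m _ _ n f] sum_distrib_left mult_ac)
    also have "\<dots> = (\<Sum>x\<in>fam dX n. \<Sum>a\<in>fam dA n. \<Sum>y\<in>fam dY m. \<Sum>b\<in>fam dB m. f (x, a) * g (y, b) * k n m x y a b)"
      by (rule sum_swap_pairs)
    finally show ?thesis .
  qed
  ultimately show ?thesis by blast
qed

text \<open>Both matrices are shifted by $\epsilon$, which makes the form a sum over $(x, a)$ and $(y, b)$
  of Kronecker products of positive semidefinite matrices with weights \<open>k\<close>. The shifted value is a
  polynomial in $\epsilon$ and tends to the value in question.\<close>

lemma kernel_form_positive:
  assumes \<beta>: "bilinear_form SX SY \<beta>"
    and val: "\<And>n m f g. \<lbrakk>n \<ge> 1; m \<ge> 1; f \<in> FX n; g \<in> FY m\<rbrakk> \<Longrightarrow> \<beta> (elX n f) (elY m g) =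
      (\<Sum>x\<in>fam dX n. \<Sum>a\<in>fam dA n. \<Sum>y\<in>fam dY m. \<Sum>b\<in>fam dB m. f (x, a) * g (y, b) * k n m x y a b)"
    and P: "P \<in> mpos SX r" and Q: "Q \<in> mpos SY t"
  shows "nn (\<Sum>z\<in>{..<r} \<times> {..<t}. \<Sum>w\<in>{..<r} \<times> {..<t}.
        \<alpha> z * cnj (\<alpha> w) * \<beta> (P (fst z) (fst w)) (Q (snd z) (snd w)))"
proof -
  let ?I = "{..<r} \<times> {..<t}"
  let ?P = "\<lambda>\<epsilon>. mshift SX \<epsilon> P" and ?Q = "\<lambda>\<epsilon>. mshift SY \<epsilon> Q"
  let ?T = "\<lambda>\<epsilon>. \<Sum>z\<in>?I. \<Sum>w\<in>?I. \<alpha> z * cnj (\<alpha> w) * \<beta> (?P \<epsilon> (fst z) (fst w)) (?Q \<epsilon> (snd z) (snd w))"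
  have pos: "nn (?T \<epsilon>)" if \<epsilon>: "\<epsilon> > 0" for \<epsilon>
  proof -
    obtain n p where n: "n \<ge> 1" and p: "\<And>i j. \<lbrakk>i < r; j < r\<rbrakk> \<Longrightarrow> p i j \<in> FX n"
      "\<And>i j. \<lbrakk>i < r; j < r\<rbrakk> \<Longrightarrow> ?P \<epsilon> i j = elX n (p i j)" "\<forall>z\<in>fam dX n \<times> fam dA n. psd r (\<lambda>i j. p i j z)"
      using fam_lim_positive[OF X A P \<epsilon>] by blast
    obtain m q where m: "m \<ge> 1" and q: "\<And>i j. \<lbrakk>i < t; j < t\<rbrakk> \<Longrightarrow> q i j \<in> FY m"
      "\<And>i j. \<lbrakk>i < t; j < t\<rbrakk> \<Longrightarrow> ?Q \<epsilon> i j = elY m (q i j)" "\<forall>z\<in>fam dY m \<times> fam dB m. psd t (\<lambda>i j. q i j z)"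
      using fam_lim_positive[OF Y B Q \<epsilon>] by blast
    let ?Z = "(fam dX n \<times> fam dA n) \<times> (fam dY m \<times> fam dB m)"
    let ?k = "\<lambda>c. k n m (fst (fst c)) (fst (snd c)) (snd (fst c)) (snd (snd c))"
    have \<beta>': "\<beta> (?P \<epsilon> (fst z) (fst w)) (?Q \<epsilon> (snd z) (snd w)) =
        (\<Sum>c\<in>?Z. p (fst z) (fst w) (fst c) * q (snd z) (snd w) (snd c) * ?k c)"
      if "z \<in> ?I" "w \<in> ?I" for z w
    proof -
      have i: "fst z < r" "fst w < r" "snd z < t" "snd w < t" using that by auto
      show ?thesis
        unfolding p(2)[OF i(1,2)] q(2)[OF i(3,4)] val[OF n m p(1)[OF i(1,2)] q(1)[OF i(3,4)]]
        by (simp add: sum.cartesian_product')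
    qed
    have "?T \<epsilon> = (\<Sum>z\<in>?I. \<Sum>w\<in>?I. \<Sum>c\<in>?Z.
        ?k c * (\<alpha> z * cnj (\<alpha> w) * (p (fst z) (fst w) (fst c) * q (snd z) (snd w) (snd c))))"
      by (intro sum.cong refl, subst \<beta>') (auto simp: sum_distrib_left mult_ac)
    also have "\<dots> = (\<Sum>z\<in>?I. \<Sum>c\<in>?Z. \<Sum>w\<in>?I.
        ?k c * (\<alpha> z * cnj (\<alpha> w) * (p (fst z) (fst w) (fst c) * q (snd z) (snd w) (snd c))))"
      by (intro sum.cong refl sum.swap)
    also have "\<dots> = (\<Sum>c\<in>?Z. \<Sum>z\<in>?I. \<Sum>w\<in>?I.
        ?k c * (\<alpha> z * cnj (\<alpha> w) * (p (fst z) (fst w) (fst c) * q (snd z) (snd w) (snd c))))"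
      by (rule sum.swap)
    also have "\<dots> = (\<Sum>c\<in>?Z. ?k c * (\<Sum>z\<in>?I. \<Sum>w\<in>?I.
        \<alpha> z * cnj (\<alpha> w) * (p (fst z) (fst w) (fst c) * q (snd z) (snd w) (snd c))))"
      by (simp add: sum_distrib_left)
    finally have T: "?T \<epsilon> = (\<Sum>c\<in>?Z. ?k c * (\<Sum>z\<in>?I. \<Sum>w\<in>?I.
        \<alpha> z * cnj (\<alpha> w) * (p (fst z) (fst w) (fst c) * q (snd z) (snd w) (snd c))))" .
    show ?thesis
      unfolding T
    proof (rule nn_sum, rule nn_mult)
      fix c assume c: "c \<in> ?Z"
      then show "nn (?k c)" using n m by (intro nn_k) auto
      show "nn (\<Sum>z\<in>?I. \<Sum>w\<in>?I. \<alpha> z * cnj (\<alpha> w) * (p (fst z) (fst w) (fst c) * q (snd z) (snd w) (snd c)))"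
        using p(3) q(3) c by (intro psd_kronecker[of r "\<lambda>i j. p i j (fst c)" t "\<lambda>i j. q i j (snd c)"]) auto
    qed
  qed
  have lim: "((\<lambda>\<epsilon>. \<beta> (?P \<epsilon> i j) (?Q \<epsilon> i' j')) \<longlongrightarrow> \<beta> (P i j) (Q i' j')) (at_right 0)"
    if ij: "i < r" "j < r" "i' < t" "j' < t" for i j i' j'
  proof -
    have c: "P i j \<in> carrier SX" "Q i' j' \<in> carrier SY"
      using SX.mats_D[OF SX.mpos_mats[OF P]] SY.mats_D[OF SY.mpos_mats[OF Q]] ij by auto
    have sh: "\<beta> (?P \<epsilon> i j) W = \<beta> (P i j) W + (if i = j then of_real \<epsilon> * \<beta> \<one>\<^bsub>SX\<^esub> W else 0)" if "W \<in> carrier SY" for W \<epsilon>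
      using \<beta> c that SX.unit_closed by (auto simp: mshift_def bilinear_form_def linear_functional_def)
    have sh': "\<beta> V (?Q \<epsilon> i' j') = \<beta> V (Q i' j') + (if i' = j' then of_real \<epsilon> * \<beta> V \<one>\<^bsub>SY\<^esub> else 0)" if "V \<in> carrier SX" for V \<epsilon>
      using \<beta> c that SY.unit_closed by (auto simp: mshift_def bilinear_form_def linear_functional_def)
    have Qc: "?Q \<epsilon> i' j' \<in> carrier SY" for \<epsilon> using c SY.unit_closed by (auto simp: mshift_def)
    show ?thesis
      unfolding sh[OF Qc] sh'[OF c(1)] sh'[OF SX.unit_closed]
      by (cases "i = j"; cases "i' = j'") (auto intro!: tendsto_eq_intros)
  qed
  have "(?T \<longlongrightarrow> (\<Sum>z\<in>?I. \<Sum>w\<in>?I. \<alpha> z * cnj (\<alpha> w) * \<beta> (P (fst z) (fst w)) (Q (snd z) (snd w)))) (at_right 0)"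
    by (intro tendsto_sum tendsto_mult tendsto_const lim) auto
  then show ?thesis
  proof (rule nn_limit)
    show "eventually (\<lambda>\<epsilon>. nn (?T \<epsilon>)) (at_right 0)"
      using pos by (auto simp: eventually_at_filter)
  qed simp
qed

theorem kernel_state:
  "\<exists>s. state (max_tensor SX SY) s \<and> (\<forall>n\<ge>1. \<forall>x\<in>fam dX n. \<forall>y\<in>fam dY n. \<forall>a\<in>fam dA n. \<forall>b\<in>fam dB n.
     s (tn (genX n x a) (genY n y b)) = k n n x y a b)"
proof -
  obtain \<beta> where \<beta>: "bilinear_form SX SY \<beta>"
    and val: "\<And>n m f g. \<lbrakk>n \<ge> 1; m \<ge> 1; f \<in> FX n; g \<in> FY m\<rbrakk> \<Longrightarrow> \<beta> (elX n f) (elY m g) =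
      (\<Sum>x\<in>fam dX n. \<Sum>a\<in>fam dA n. \<Sum>y\<in>fam dY m. \<Sum>b\<in>fam dB m. f (x, a) * g (y, b) * k n m x y a b)"
    using kernel_form by blast
  obtain s where s: "linear_functional Alg s" "\<And>v w. \<lbrakk>v \<in> carrier SX; w \<in> carrier SY\<rbrakk> \<Longrightarrow> s (tn v w) = \<beta> v w"
    using bilinear_form_extends[OF \<beta>] by blast
  have "state (max_tensor SX SY) s"
  proof (rule stateI[OF s(1)])
    have "\<beta> \<one>\<^bsub>SX\<^esub> \<one>\<^bsub>SY\<^esub> = (\<Sum>x\<in>fam dX 1. \<Sum>a\<in>fam dA 1. \<Sum>y\<in>fam dY 1. \<Sum>b\<in>fam dB 1. CX.e0 1 (x, a) * CY.e0 1 (y, b) * k 1 1 x y a b)"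
      unfolding fam_lim_unit[OF X A] fam_lim_unit[OF Y B] by (rule val) (simp_all add: CX.e0 CY.e0)
    also have "\<dots> = (\<Sum>x\<in>fam dX 1. \<Sum>a\<in>fam dA 1. \<Sum>y\<in>fam dY 1. \<Sum>b\<in>fam dB 1. k 1 1 x y a b / (of_nat (card (fam dX 1)) * of_nat (card (fam dY 1))))"
      by (intro sum.cong refl) (simp add: CX.e0_def CY.e0_def)
    also have "\<dots> = (\<Sum>x\<in>fam dX 1. \<Sum>a\<in>fam dA 1. \<Sum>y\<in>fam dY 1. kA 1 x a / (of_nat (card (fam dX 1)) * of_nat (card (fam dY 1))))"
      by (intro sum.cong refl) (simp add: margB flip: sum_divide_distrib)
    also have "\<dots> = (\<Sum>x\<in>fam dX 1. (\<Sum>a\<in>fam dA 1. kA 1 x a) / of_nat (card (fam dX 1)))"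
      using CY.S[of 1] by (simp add: sum_divide_distrib)
    also have "\<dots> = 1" using total CX.S[of 1] by simp
    finally show "s (tn \<one>\<^bsub>SX\<^esub> \<one>\<^bsub>SY\<^esub>) = 1" using s(2)[OF SX.unit_closed SY.unit_closed] by simp
    fix r t P Q \<alpha> assume P: "P \<in> mpos SX r" and Q: "Q \<in> mpos SY t"
    have "s (tn (P (fst z) (fst w)) (Q (snd z) (snd w))) = \<beta> (P (fst z) (fst w)) (Q (snd z) (snd w))"
      if "z \<in> {..<r} \<times> {..<t}" "w \<in> {..<r} \<times> {..<t}" for z w
      using that by (intro s(2) SX.mats_D[OF SX.mpos_mats[OF P]] SY.mats_D[OF SY.mpos_mats[OF Q]]) auto
    then have "(\<Sum>z\<in>{..<r} \<times> {..<t}. \<Sum>w\<in>{..<r} \<times> {..<t}. \<alpha> z * cnj (\<alpha> w) * s (tn (P (fst z) (fst w)) (Q (snd z) (snd w)))) =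
      (\<Sum>z\<in>{..<r} \<times> {..<t}. \<Sum>w\<in>{..<r} \<times> {..<t}. \<alpha> z * cnj (\<alpha> w) * \<beta> (P (fst z) (fst w)) (Q (snd z) (snd w)))"
      by (intro sum.cong refl arg_cong2[where f = "(*)"])
    then show "nn (\<Sum>z\<in>{..<r} \<times> {..<t}. \<Sum>w\<in>{..<r} \<times> {..<t}. \<alpha> z * cnj (\<alpha> w) * s (tn (P (fst z) (fst w)) (Q (snd z) (snd w))))"
      by (rule ssubst) (rule kernel_form_positive[OF \<beta> val P Q])
  qed
  moreover have "s (tn (genX n x a) (genY n y b)) = k n n x y a b"
    if n: "n \<ge> 1" and x: "x \<in> fam dX n" and y: "y \<in> fam dY n" and a: "a \<in> fam dA n" and b: "b \<in> fam dB n" for n x y a b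
  proof -
    have pick: "(\<Sum>u\<in>S. \<Sum>v\<in>U. indicator {(x, a)} (u, v) * h u v) = h x a" if "finite S" "finite U" "x \<in> S" "a \<in> U"
      for S U x a and h :: "nat list \<Rightarrow> nat list \<Rightarrow> complex"
    proof -
      have "(\<Sum>u\<in>S. \<Sum>v\<in>U. indicator {(x, a)} (u, v) * h u v) = (\<Sum>u\<in>S. if x = u then \<Sum>v\<in>U. if a = v then h u v else 0 else 0)"
        by (intro sum.cong refl) (auto simp: indicator_def intro!: sum.cong)
      then show ?thesis using that by simp
    qed
    have "\<beta> (genX n x a) (genY n y b) =
      (\<Sum>x'\<in>fam dX n. \<Sum>a'\<in>fam dA n. indicator {(x, a)} (x', a') * (\<Sum>y'\<in>fam dY n. \<Sum>b'\<in>fam dB n. indicator {(y, b)} (y', b') * k n n x' y' a' b'))"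
      unfolding CX.copr_gen_cls CY.copr_gen_cls val[OF n n CX.gen_fun[OF x a] CY.gen_fun[OF y b]]
      by (simp add: sum_distrib_left mult.assoc)
    also have "\<dots> = k n n x y a b" by (simp only: pick[OF finite_fam finite_fam x a] pick[OF finite_fam finite_fam y b])
    finally show ?thesis using s(2) fam_gen_closed[OF X A n x a] fam_gen_closed[OF Y B n y b] by simp
  qed
  ultimately show ?thesis by blast
qed

end

section \<open>The spaces of infinite sequences\<close>

text \<open>The points of $\Omega_d$.\<close>

definition Om :: "(nat \<Rightarrow> nat) \<Rightarrow> (nat \<Rightarrow> nat) set" where
  "Om d = (\<Pi>\<^sub>E i\<in>UNIV. {1..d i})"

lemma Om_iff: "\<omega> \<in> Om d \<longleftrightarrow> (\<forall>i. \<omega> i \<in> {1..d i})"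
  by (auto simp: Om_def PiE_iff)

lemma topspace_Omega [simp]: "topspace (Omega d) = Om d"
  by (simp add: Omega_def Om_def)

text \<open>The natural numbers are a discrete space, so the product topology on $\Omega_d$ is
  inherited from the type of all sequences, and continuity is \<^const>\<open>continuous_on\<close>.\<close>

lemma Omega_euclidean: "Omega d = top_of_set (Om d)"
proof -
  have "discrete_topology A = top_of_set A" for A :: "nat set"
    unfolding topology_eq
  proof
    fix S :: "nat set"
    have "open S" by (rule discrete_topology_class.open_discrete)
    then show "openin (discrete_topology A) S = openin (top_of_set A) S"
      by (auto simp: openin_subtopology)
  qed
  then have "Omega d = product_topology (\<lambda>i. top_of_set {1..d i}) UNIV" unfolding Omega_def by metis
  then show ?thesis
    by (simp only: subtopology_product_topology[symmetric] euclidean_product_topology Om_def)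
qed

lemma compact_Om: "compact (Om d)"
proof -
  have "compact_space (Omega d)"
    unfolding Omega_def by (simp add: compact_space_product_topology compact_space_discrete_topology)
  then show ?thesis by (metis Omega_euclidean compactin_euclidean_iff compactin_subspace subset_UNIV topspace_euclidean)
qed

lemma space_mu [simp]: "space (mu d) = Om d"
  by (simp add: mu_def Om_def space_PiM space_uniform_count_measure)

lemma prob_space_mu: "inductive_family d \<Longrightarrow> prob_space (mu d)"
  unfolding mu_def inductive_family_def
  by (intro prob_space_PiM prob_space_uniform_count_measure) (auto simp: not_less_eq_eq)

definition initial :: "nat \<Rightarrow> (nat \<Rightarrow> nat) \<Rightarrow> nat list" where
  "initial n \<omega> = map \<omega> [0..<n]"

lemma length_initial [simp]: "length (initial n \<omega>) = n"
  by (simp add: initial_def)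

lemma nth_initial [simp]: "i < n \<Longrightarrow> initial n \<omega> ! i = \<omega> i"
  by (simp add: initial_def)

lemma initial_Suc: "initial (Suc n) \<omega> = initial n \<omega> @ [\<omega> n]"
  by (simp add: initial_def)

lemma initial_fam: "\<omega> \<in> Om d \<Longrightarrow> initial n \<omega> \<in> fam d n"
  by (auto simp: fam_def Om_iff)

lemma length_fam: "x \<in> fam d n \<Longrightarrow> length x = n"
  by (simp add: fam_def)

lemma cyl_iff: "x \<in> fam d n \<Longrightarrow> \<omega> \<in> cyl d x \<longleftrightarrow> \<omega> \<in> Om d \<and> initial n \<omega> = x"
  by (auto simp: cyl_def length_fam list_eq_iff_nth_eq)

lemma cyl_sets: "cyl d x \<in> sets (mu d)"
proof -
  have "cyl d x = {\<omega> \<in> space (mu d). \<forall>i\<in>{..<length x}. \<omega> i = x ! i}"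
    by (auto simp: cyl_def)
  also have "\<dots> \<in> sets (mu d)"
  proof (rule sets.sets_Collect_finite_All)
    fix i
    have "{\<omega> \<in> space (mu d). \<omega> i \<in> {x ! i} \<inter> {1..d i}} \<in> sets (mu d)"
      unfolding mu_def by (rule sets_Collect_single) (auto simp: sets_uniform_count_measure)
    moreover have "{\<omega> \<in> space (mu d). \<omega> i \<in> {x ! i} \<inter> {1..d i}} = {\<omega> \<in> space (mu d). \<omega> i = x ! i}"
      unfolding space_mu by (auto simp: Om_iff)
    ultimately show "{\<omega> \<in> space (mu d). \<omega> i = x ! i} \<in> sets (mu d)" by simp
  qed auto
  finally show ?thesis .
qed

lemma measure_cyl:
  assumes d: "inductive_family d" and x: "x \<in> fam d n"
  shows "measure (mu d) (cyl d x) = 1 / card (fam d n)"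
proof -
  have 1: "prob_space (uniform_count_measure {1..d i})" for i
    using d by (intro prob_space_uniform_count_measure) (auto simp: inductive_family_def not_less_eq_eq)
  interpret product_prob_space "\<lambda>i. uniform_count_measure {1..d i}" UNIV
    using 1 by (simp add: product_prob_space_def product_prob_space_axioms_def product_sigma_finite_def prob_space_imp_sigma_finite)
  have "cyl d x = {\<omega>\<in>space (mu d). \<forall>i\<in>{..<n}. \<omega> i \<in> {x ! i}}"
    using length_fam[OF x] by (auto simp: cyl_def)
  moreover have "emeasure (mu d) {\<omega>\<in>space (mu d). \<forall>i\<in>{..<n}. \<omega> i \<in> {x ! i}} =
      (\<Prod>i\<in>{..<n}. emeasure (uniform_count_measure {1..d i}) {x ! i})"
    unfolding mu_def by (rule emeasure_PiM_Collect) (use x in \<open>auto simp: sets_uniform_count_measure fam_def\<close>)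
  moreover have "emeasure (uniform_count_measure {1..d i}) {x ! i} = ennreal (1 / d i)" if "i < n" for i
    using x that by (subst emeasure_uniform_count_measure) (auto simp: fam_def)
  ultimately have "emeasure (mu d) (cyl d x) = ennreal (\<Prod>i<n. 1 / d i)"
    by (simp add: prod_ennreal)
  then have "measure (mu d) (cyl d x) = (\<Prod>i<n. 1 / d i)"
    by (simp add: measure_def prod_nonneg)
  moreover have "card (fam d n) = (\<Prod>i<n. d i)"
  proof (induction n)
    case 0
    have "fam d 0 = {[]}" by (auto simp: fam_def)
    then show ?case by simp
  qed (simp add: card_fam_Suc)
  ultimately show ?thesis by (simp add: prod_dividef)
qed

lemma indicator_cyl:
  "x \<in> fam d n \<Longrightarrow> indicator (cyl d x) \<omega> = (if \<omega> \<in> Om d then if x = initial n \<omega> then 1 else 0 else (0 :: 'a :: zero_neq_one))"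
  by (auto simp: indicator_def cyl_iff)

text \<open>A cylinder is the disjoint union of its successors at the next level.\<close>

lemma indicator_cyl_refine:
  assumes x: "x \<in> fam d n"
  shows "indicator (cyl d x) \<omega> = (\<Sum>i=1..d n. indicator (cyl d (x @ [i])) \<omega> :: complex)"
proof (cases "\<omega> \<in> Om d")
  case True
  have "(\<Sum>i=1..d n. indicator (cyl d (x @ [i])) \<omega>) = (\<Sum>i=1..d n. if \<omega> n = i then if x = initial n \<omega> then 1 else 0 else 0)"
  proof (intro sum.cong refl)
    fix i assume "i \<in> {1..d n}"
    then have "x @ [i] \<in> fam d (Suc n)" using x by (auto simp: fam_Suc)
    then show "indicator (cyl d (x @ [i])) \<omega> = (if \<omega> n = i then if x = initial n \<omega> then 1 else 0 else 0)"
      using True by (auto simp: indicator_cyl initial_Suc)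
  qed
  also have "\<dots> = indicator (cyl d x) \<omega>" using True x by (auto simp: indicator_cyl Om_iff)
  finally show ?thesis ..
next
  case False
  then have "\<omega> \<notin> cyl d x" for x by (simp add: cyl_def)
  then show ?thesis by simp
qed

lemma indicator_cyl_sum: "(\<Sum>x\<in>fam d n. indicator (cyl d x) \<omega>) = (indicator (Om d) \<omega> :: complex)"
proof (cases "\<omega> \<in> Om d")
  case True
  then have "(\<Sum>x\<in>fam d n. indicator (cyl d x) \<omega>) = (\<Sum>x\<in>fam d n. if initial n \<omega> = x then 1 else (0 :: complex))"
    by (intro sum.cong refl) (auto simp: indicator_cyl)
  then show ?thesis using True initial_fam[OF True, of n] by (simp add: finite_fam)
next
  case False
  then have "\<omega> \<notin> cyl d x" for x by (simp add: cyl_def)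
  then show ?thesis using False by simp
qed

lemma initial_measurable: "initial n \<in> measurable (mu d) (count_space (fam d n))"
proof (subst measurable_count_space_eq2[OF finite_fam], intro conjI ballI)
  show "initial n \<in> space (mu d) \<rightarrow> fam d n" using initial_fam by auto
  fix x assume "x \<in> fam d n"
  then have "initial n -` {x} \<inter> space (mu d) = cyl d x" by (auto simp: cyl_iff)
  then show "initial n -` {x} \<inter> space (mu d) \<in> sets (mu d)" using cyl_sets by simp
qed

text \<open>The indicator function of a cylinder is a finite product of functions of one coordinate.\<close>

lemma continuous_indicator_cyl: "continuous_on (Om d) (indicator (cyl d x) :: _ \<Rightarrow> complex)"
proof -
  have "continuous_on (Om d) (\<lambda>\<omega>. \<Prod>i<length x. if \<omega> i = x ! i then 1 else 0 :: complex)"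
  proof (intro continuous_on_prod)
    fix i
    have "continuous_on (Om d) (\<lambda>\<omega>. \<omega> i)" by (rule continuous_on_subset[OF continuous_on_product_coordinates]) auto
    then show "continuous_on (Om d) (\<lambda>\<omega>. if \<omega> i = x ! i then 1 else 0 :: complex)"
      by (rule continuous_on_compose2[of UNIV "\<lambda>j. if j = x ! i then 1 else 0", rotated]) auto
  qed
  moreover have "(\<Prod>i<length x. if \<omega> i = x ! i then 1 else 0 :: complex) = indicator (cyl d x) \<omega>" if "\<omega> \<in> Om d" for \<omega>
    using that by (auto simp: indicator_def cyl_def)
  ultimately show ?thesis using continuous_on_cong by force
qed

section \<open>Essentially bounded functions\<close>

context finite_measure
begin

lemma measurable_cnj: "f \<in> borel_measurable M \<Longrightarrow> (\<lambda>x. cnj (f x)) \<in> borel_measurable M"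
  by (rule measurable_compose[OF _ borel_measurable_continuous_onI]) (auto intro: continuous_intros)

lemma Linf_fun_measurable: "f \<in> Linf_fun M \<Longrightarrow> f \<in> borel_measurable M"
  by (simp add: Linf_fun_def)

lemma Linf_funI: "\<lbrakk>f \<in> borel_measurable M; \<And>x. x \<in> space M \<Longrightarrow> cmod (f x) \<le> c\<rbrakk> \<Longrightarrow> f \<in> Linf_fun M"
  unfolding Linf_fun_def by auto

lemma fun_space_Linf: "fun_space (Linf_fun M)"
  unfolding fun_space_def
proof (intro conjI ballI allI)
  show "(\<lambda>_. 0) \<in> Linf_fun M" by (rule Linf_funI[of _ 0]) auto
  fix f assume f: "f \<in> Linf_fun M"
  then obtain c where [measurable]: "f \<in> borel_measurable M" and c: "AE x in M. cmod (f x) \<le> c"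
    by (auto simp: Linf_fun_def)
  show "(\<lambda>x. a * f x) \<in> Linf_fun M" for a
  proof -
    have "AE x in M. cmod (a * f x) \<le> cmod a * c" using c
      by eventually_elim (simp add: norm_mult mult_left_mono)
    then show ?thesis by (auto simp: Linf_fun_def)
  qed
  fix g assume g: "g \<in> Linf_fun M"
  then obtain e where [measurable]: "g \<in> borel_measurable M" and e: "AE x in M. cmod (g x) \<le> e"
    by (auto simp: Linf_fun_def)
  have "AE x in M. cmod (f x + g x) \<le> c + e" using c e
    by eventually_elim (metis add_mono norm_triangle_le)
  then show "(\<lambda>x. f x + g x) \<in> Linf_fun M" by (auto simp: Linf_fun_def)
qed

abbreviation "BF \<equiv> fun_osys (space M) (Linf_fun M)"

lemma null_Linf: "f \<in> null_fun M \<Longrightarrow> f \<in> Linf_fun M"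
  by (auto simp: null_fun_def Linf_fun_def intro!: exI[of _ 0])

lemma null_submodule: "submodule (null_fun M) complex_ring BF"
proof -
  interpret F: complex_space BF by (rule complex_space_fun[OF fun_space_Linf])
  show ?thesis
  proof (rule F.submoduleI)
    show "null_fun M \<subseteq> carrier BF" using null_Linf by auto
    show "\<zero>\<^bsub>BF\<^esub> \<in> null_fun M" by (simp add: null_fun_def)
    show "\<ominus>\<^bsub>BF\<^esub> f \<in> null_fun M" if "f \<in> null_fun M" for f
      using that null_Linf[OF that] by (simp add: fun_minus[OF fun_space_Linf] null_fun_def)
    show "f \<oplus>\<^bsub>BF\<^esub> g \<in> null_fun M" if "f \<in> null_fun M" "g \<in> null_fun M" for f g
      using that by (auto simp: null_fun_def elim: eventually_elim2)
    show "a \<odot>\<^bsub>BF\<^esub> f \<in> null_fun M" if "f \<in> null_fun M" for a f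
      using that by (auto simp: null_fun_def)
  qed
qed

lemma Linf_quotient:
  shows class_linear: "linear_map BF (Linf_osys M) (Linf_class M)"
    and carrier_Linf: "carrier (Linf_osys M) = Linf_class M ` Linf_fun M"
    and unit_Linf: "\<one>\<^bsub>Linf_osys M\<^esub> = Linf_class M (indicator (space M))"
    and class_eq: "\<And>f g. \<lbrakk>f \<in> Linf_fun M; g \<in> Linf_fun M\<rbrakk> \<Longrightarrow>
      Linf_class M f = Linf_class M g \<longleftrightarrow> (AE x in M. f x = g x)"
    and class_self: "\<And>f. f \<in> Linf_fun M \<Longrightarrow> f \<in> Linf_class M f"
    and class_rep: "\<And>f g. \<lbrakk>f \<in> Linf_fun M; g \<in> Linf_class M f\<rbrakk> \<Longrightarrow> g \<in> Linf_fun M \<and> Linf_class M g = Linf_class M f"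
proof -
  interpret F: complex_space BF by (rule complex_space_fun[OF fun_space_Linf])
  have cl: "Linf_class M = (\<lambda>f. null_fun M +>\<^bsub>BF\<^esub> f)" by (auto simp: Linf_class_def)
  have a: "\<And>x. x \<in> carrier BF \<Longrightarrow> adj BF x \<in> carrier BF"
    by (auto simp: Linf_fun_def measurable_cnj)
  have b: "\<And>x y. \<lbrakk>x \<in> carrier BF; y \<in> carrier BF\<rbrakk> \<Longrightarrow> adj BF (x \<oplus>\<^bsub>BF\<^esub> y) = adj BF x \<oplus>\<^bsub>BF\<^esub> adj BF y"
    by simp
  have c: "\<And>x. x \<in> null_fun M \<Longrightarrow> adj BF x \<in> null_fun M"
    by (auto simp: null_fun_def measurable_cnj)
  have d: "indicator (space M) \<in> carrier BF"
    unfolding fun_osys_simps by (rule Linf_funI[of _ 1]) (auto simp: indicator_def)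
  note q = F.quotient[OF null_submodule a b c d]
  show "linear_map BF (Linf_osys M) (Linf_class M)" unfolding Linf_osys_def cl by (rule q(2))
  show "carrier (Linf_osys M) = Linf_class M ` Linf_fun M" unfolding Linf_osys_def cl using q(3) by (simp only: fun_osys_simps)
  show "\<one>\<^bsub>Linf_osys M\<^esub> = Linf_class M (indicator (space M))" unfolding Linf_osys_def cl by (rule q(4))
  show "Linf_class M f = Linf_class M g \<longleftrightarrow> (AE x in M. f x = g x)" if "f \<in> Linf_fun M" "g \<in> Linf_fun M" for f g
    unfolding cl
    by (subst q(6))
      (use that in \<open>auto simp: fun_diff[OF fun_space_Linf] null_fun_def Linf_fun_measurable intro!: borel_measurable_diff\<close>)
  show "f \<in> Linf_class M f" if "f \<in> Linf_fun M" for f unfolding cl using q(7)[of f] that by simp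
  show "g \<in> Linf_fun M \<and> Linf_class M g = Linf_class M f" if "f \<in> Linf_fun M" "g \<in> Linf_class M f" for f g
    using q(8)[of f g] that unfolding cl by simp
qed

lemma mpos_Linf:
  "P \<in> mpos (Linf_osys M) n \<longleftrightarrow> (\<exists>p. (\<forall>i<n. \<forall>j<n. p i j \<in> Linf_fun M \<and> P i j = Linf_class M (p i j)) \<and>
     (AE x in M. psd n (\<lambda>i j. p i j x)))"
proof -
  have 1: "a_rcosets\<^bsub>BF\<^esub> null_fun M = Linf_class M ` Linf_fun M"
    unfolding carrier_Linf[symmetric] by (simp add: Linf_osys_def quot_osys_def)
  have "P \<in> mpos (Linf_osys M) n \<longleftrightarrow> (\<forall>i<n. \<forall>j<n. P i j \<in> Linf_class M ` Linf_fun M) \<and>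
      (\<exists>p. (\<forall>i<n. \<forall>j<n. p i j \<in> P i j) \<and> (AE x in M. psd n (\<lambda>i j. p i j x)))"
    by (simp add: Linf_osys_def quot_osys_def 1)
  also have "\<dots> \<longleftrightarrow> (\<exists>p. (\<forall>i<n. \<forall>j<n. p i j \<in> Linf_fun M \<and> P i j = Linf_class M (p i j)) \<and>
     (AE x in M. psd n (\<lambda>i j. p i j x)))"
  proof (intro iffI; elim conjE exE)
    fix p assume P: "\<forall>i<n. \<forall>j<n. P i j \<in> Linf_class M ` Linf_fun M" and p: "\<forall>i<n. \<forall>j<n. p i j \<in> P i j"
      and psd: "AE x in M. psd n (\<lambda>i j. p i j x)"
    have "p i j \<in> Linf_fun M \<and> P i j = Linf_class M (p i j)" if ij: "i < n" "j < n" for i j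
    proof -
      obtain f where f: "P i j = Linf_class M f" "f \<in> Linf_fun M" using P ij by blast
      moreover have "p i j \<in> Linf_class M f" using p ij f(1) by auto
      ultimately show ?thesis using class_rep[of f "p i j"] by simp
    qed
    then show "\<exists>p. (\<forall>i<n. \<forall>j<n. p i j \<in> Linf_fun M \<and> P i j = Linf_class M (p i j)) \<and>
        (AE x in M. psd n (\<lambda>i j. p i j x))" using psd by blast
  next
    fix p assume p: "\<forall>i<n. \<forall>j<n. p i j \<in> Linf_fun M \<and> P i j = Linf_class M (p i j)"
      and psd: "AE x in M. psd n (\<lambda>i j. p i j x)"
    then show "(\<forall>i<n. \<forall>j<n. P i j \<in> Linf_class M ` Linf_fun M) \<and>
      (\<exists>p. (\<forall>i<n. \<forall>j<n. p i j \<in> P i j) \<and> (AE x in M. psd n (\<lambda>i j. p i j x)))"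
      using class_self by (intro conjI exI[of _ p]) auto
  qed
  finally show ?thesis .
qed

lemma integrable_Linf: "f \<in> Linf_fun M \<Longrightarrow> integrable M f"
  unfolding Linf_fun_def by (auto intro: integrable_const_bound)

lemma Linf_mult: "\<lbrakk>f \<in> Linf_fun M; g \<in> Linf_fun M\<rbrakk> \<Longrightarrow> (\<lambda>x. f x * g x) \<in> Linf_fun M"
proof -
  assume f: "f \<in> Linf_fun M" and g: "g \<in> Linf_fun M"
  then obtain c e where [measurable]: "f \<in> borel_measurable M" "g \<in> borel_measurable M"
    and c: "AE x in M. cmod (f x) \<le> c" and e: "AE x in M. cmod (g x) \<le> e"
    by (auto simp: Linf_fun_def)
  have "AE x in M. cmod (f x * g x) \<le> max c 0 * max e 0" using c e
    by eventually_elim (auto simp: norm_mult intro!: mult_mono)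
  then show ?thesis by (auto simp: Linf_fun_def)
qed

lemma pairing_class:
  assumes g: "g \<in> borel_measurable M" and f: "f \<in> Linf_fun M"
  shows "pairing M g (Linf_class M f) = (\<integral>x. g x * f x \<partial>M)"
proof -
  define f' where "f' = (SOME f'. f' \<in> Linf_class M f)"
  have "f' \<in> Linf_class M f" unfolding f'_def by (rule someI[of _ f]) (rule class_self[OF f])
  then have f': "f' \<in> Linf_fun M" "Linf_class M f' = Linf_class M f" using class_rep[OF f] by auto
  then have ae: "AE x in M. f' x = f x" using class_eq f by blast
  have [measurable]: "f \<in> borel_measurable M" "f' \<in> borel_measurable M" using f f' Linf_fun_measurable by auto
  show ?thesis unfolding pairing_def f'_def[symmetric]
    by (rule integral_cong_AE) (use g ae in auto)
qed

lemma linear_functional_pairing: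
  assumes g: "g \<in> Linf_fun M" shows "linear_functional (Linf_osys M) (pairing M g)"
proof -
  have "pairing M g (Linf_class M f \<oplus>\<^bsub>Linf_osys M\<^esub> Linf_class M h) = pairing M g (Linf_class M f) + pairing M g (Linf_class M h)"
    if f: "f \<in> Linf_fun M" and h: "h \<in> Linf_fun M" for f h
  proof -
    have fh: "(\<lambda>x. f x + h x) \<in> Linf_fun M" using fun_space_Linf f h by (auto simp: fun_space_def)
    have "Linf_class M f \<oplus>\<^bsub>Linf_osys M\<^esub> Linf_class M h = Linf_class M (\<lambda>x. f x + h x)"
      using class_linear f h by (simp add: linear_map_def)
    then show ?thesis
      using pairing_class[OF Linf_fun_measurable[OF g]] f h fh integrable_Linf[OF Linf_mult[OF g]]
      by (simp add: distrib_left)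
  qed
  moreover have "pairing M g (c \<odot>\<^bsub>Linf_osys M\<^esub> Linf_class M f) = c * pairing M g (Linf_class M f)"
    if f: "f \<in> Linf_fun M" for f c
  proof -
    have cf: "(\<lambda>x. c * f x) \<in> Linf_fun M" using fun_space_Linf f by (auto simp: fun_space_def)
    have "c \<odot>\<^bsub>Linf_osys M\<^esub> Linf_class M f = Linf_class M (\<lambda>x. c * f x)"
      using class_linear f by (simp add: linear_map_def)
    then show ?thesis
      using pairing_class[OF Linf_fun_measurable[OF g]] f cf integrable_Linf[OF Linf_mult[OF g f]]
      by (simp add: mult.left_commute)
  qed
  ultimately show ?thesis unfolding linear_functional_def carrier_Linf by blast
qed

lemma nn_integral_complex:
  assumes h: "integrable M h" and nn: "AE x in M. nn (h x)"
  shows "nn (\<integral>x. h x \<partial>M)"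
proof -
  have "AE x in M. h x = complex_of_real (Re (h x))"
    using nn by eventually_elim (auto simp: nn_def complex_is_Real_iff complex_eq_iff)
  moreover have "h \<in> borel_measurable M" using h by auto
  ultimately have "(\<integral>x. h x \<partial>M) = (\<integral>x. complex_of_real (Re (h x)) \<partial>M)"
    by (intro integral_cong_AE) auto
  also have "\<dots> = complex_of_real (\<integral>x. Re (h x) \<partial>M)" by simp
  finally show ?thesis
    using nn by (auto simp: nn_def intro!: integral_nonneg_AE elim: eventually_mono)
qed

end

lemma linear_functional_fun_sum:
  assumes F: "fun_space F" and s: "linear_functional (fun_osys K F) s" and "finite I" "\<And>i. i \<in> I \<Longrightarrow> f i \<in> F"
  shows "s (\<lambda>x. \<Sum>i\<in>I. f i x) = (\<Sum>i\<in>I. s (f i))"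
proof -
  have "s (finsum (fun_osys K F) f I) = (\<Sum>i\<in>I. s (f i))"
    by (rule linear_functional_finsum[OF complex_space_fun[OF F] s]) (use assms in auto)
  then show ?thesis using fun_finsum[OF F assms(3,4), where K = K] by simp
qed

section \<open>The state of a correlation\<close>

lemma carrier_C_Omega: "f \<in> carrier (C_osys (Omega d)) \<longleftrightarrow> continuous_on (Om d) f \<and> (\<forall>\<omega>. \<omega> \<notin> Om d \<longrightarrow> f \<omega> = 0)"
  by (simp add: C_osys_def) (simp add: Omega_euclidean)

lemma one_C_Omega: "\<one>\<^bsub>C_osys (Omega d)\<^esub> = indicator (Om d)"
  by (simp add: C_osys_def)

lemma indicator_cyl_C: "indicator (cyl d x) \<in> carrier (C_osys (Omega d))"
  unfolding carrier_C_Omega using continuous_indicator_cyl by (auto simp: cyl_def)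

lemma indicator_Om_C: "indicator (Om d) \<in> carrier (C_osys (Omega d))"
proof -
  have "continuous_on (Om d) (indicator (Om d) :: _ \<Rightarrow> complex) \<longleftrightarrow> continuous_on (Om d) (\<lambda>_. 1 :: complex)"
    by (rule continuous_on_cong) auto
  then show ?thesis unfolding carrier_C_Omega by auto
qed

abbreviation CC :: "(nat \<Rightarrow> nat) \<Rightarrow> (nat \<Rightarrow> nat) \<Rightarrow> ((nat \<Rightarrow> nat) \<times> (nat \<Rightarrow> nat) \<Rightarrow> complex) osys" where
  "CC dA dB \<equiv> C_osys (prod_topology (Omega dA) (Omega dB))"

lemma carrier_CC:
  "f \<in> carrier (CC dA dB) \<longleftrightarrow> continuous_on (Om dA \<times> Om dB) f \<and> (\<forall>z. z \<notin> Om dA \<times> Om dB \<longrightarrow> f z = 0)"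
  by (simp add: C_osys_def) (simp add: Omega_euclidean)

lemma CC_fun_osys: "CC dA dB = fun_osys (Om dA \<times> Om dB) (carrier (CC dA dB))"
  by (simp add: C_osys_def)

lemma mpos_CC:
  "P \<in> mpos (CC dA dB) n \<longleftrightarrow>
    (\<forall>i<n. \<forall>j<n. P i j \<in> carrier (CC dA dB)) \<and> (\<forall>z\<in>Om dA \<times> Om dB. psd n (\<lambda>i j. P i j z))"
  by (subst CC_fun_osys) simp

lemma fun_space_CC: "fun_space (carrier (CC dA dB))"
  by (auto simp: fun_space_def carrier_CC intro!: continuous_on_add continuous_on_mult continuous_on_const)

lemma CC_simps:
  "f \<oplus>\<^bsub>CC dA dB\<^esub> g = (\<lambda>x. f x + g x)" "c \<odot>\<^bsub>CC dA dB\<^esub> f = (\<lambda>x. c * f x)"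
  by (simp_all add: C_osys_def)

lemma one_CC: "\<one>\<^bsub>CC dA dB\<^esub> = ftensor (indicator (Om dA)) (indicator (Om dB))"
  by (auto simp: C_osys_def ftensor_def indicator_def fun_eq_iff)

lemma ftensor_CC:
  assumes f: "f \<in> carrier (C_osys (Omega dA))" and g: "g \<in> carrier (C_osys (Omega dB))"
  shows "ftensor f g \<in> carrier (CC dA dB)"
proof -
  have "continuous_on (Om dA \<times> Om dB) (\<lambda>z. f (fst z) * g (snd z))"
  proof (rule continuous_on_mult)
    show "continuous_on (Om dA \<times> Om dB) (\<lambda>z. f (fst z))"
      by (rule continuous_on_compose2[of "Om dA" f]) (use f in \<open>auto simp: carrier_C_Omega intro: continuous_on_fst continuous_on_id\<close>)
    show "continuous_on (Om dA \<times> Om dB) (\<lambda>z. g (snd z))"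
      by (rule continuous_on_compose2[of "Om dB" g]) (use g in \<open>auto simp: carrier_C_Omega intro: continuous_on_snd continuous_on_id\<close>)
  qed
  then show ?thesis using f g by (auto simp: carrier_CC carrier_C_Omega ftensor_def case_prod_beta)
qed

lemma ftensor_sum_left: "ftensor (\<lambda>\<omega>. \<Sum>i\<in>I. f i \<omega>) g = (\<lambda>z. \<Sum>i\<in>I. ftensor (f i) g z)"
  by (auto simp: ftensor_def sum_distrib_right fun_eq_iff)

lemma ftensor_sum_right: "ftensor f (\<lambda>\<omega>. \<Sum>i\<in>I. g i \<omega>) = (\<lambda>z. \<Sum>i\<in>I. ftensor f (g i) z)"
  by (auto simp: ftensor_def sum_distrib_left fun_eq_iff)

lemma cyl_Linf:
  assumes "inductive_family d" shows "indicator (cyl d x) \<in> Linf_fun (mu d)"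
proof -
  interpret prob_space "mu d" by (rule prob_space_mu[OF assms])
  show ?thesis using cyl_sets[of d x] by (intro Linf_funI[of _ 1]) (auto simp: indicator_def)
qed

lemma Om_Linf:
  assumes "inductive_family d" shows "indicator (Om d) \<in> Linf_fun (mu d)"
proof -
  interpret prob_space "mu d" by (rule prob_space_mu[OF assms])
  have "Om d \<in> sets (mu d)" using sets.top[of "mu d"] by simp
  then show ?thesis by (intro Linf_funI[of _ 1]) (auto simp: indicator_def)
qed

lemma integral_indicator_complex:
  assumes "finite_measure M" "S \<in> sets M" shows "(\<integral>x. indicator S x \<partial>M) = complex_of_real (measure M S)"
proof -
  have "(\<integral>x. indicator S x \<partial>M) = (\<integral>x. complex_of_real (indicator S x) \<partial>M)"
    by (intro Bochner_Integration.integral_cong) (auto simp: indicator_def)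
  then show ?thesis using assms sets.sets_into_space by (simp add: Int_absorb2)
qed

context ns_families
begin

sublocale PP: pair_prob_space "mu dX" "mu dY"
  by (intro pair_prob_space.intro pair_sigma_finite.intro prob_space_mu X Y prob_space_imp_sigma_finite)

abbreviation "MM \<equiv> mu dX \<Otimes>\<^sub>M mu dY"

lemma space_MM: "space MM = Om dX \<times> Om dY"
  by (simp add: space_pair_measure)

lemma ftensor_Linf:
  assumes u: "u \<in> Linf_fun (mu dX)" and v: "v \<in> Linf_fun (mu dY)"
  shows "ftensor u v \<in> Linf_fun MM"
proof -
  obtain c where u': "u \<in> borel_measurable (mu dX)" and c: "AE x in mu dX. cmod (u x) \<le> c"
    using u by (auto simp: Linf_fun_def)
  obtain e where v': "v \<in> borel_measurable (mu dY)" and e: "AE x in mu dY. cmod (v x) \<le> e"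
    using v by (auto simp: Linf_fun_def)
  note [measurable] = u' v'
  have "ftensor u v = (\<lambda>z. u (fst z) * v (snd z))" by (auto simp: ftensor_def)
  then have uv [measurable]: "ftensor u v \<in> borel_measurable MM" by simp
  have "AE x in mu dX. AE y in mu dY. cmod (ftensor u v (x, y)) \<le> max c 0 * max e 0"
    using c
  proof eventually_elim
    case (elim x)
    show ?case using e by eventually_elim (use elim in \<open>auto simp: ftensor_def norm_mult intro!: mult_mono\<close>)
  qed
  then have "AE z in MM. cmod (ftensor u v z) \<le> max c 0 * max e 0"
    by (intro PP.AE_pair_measure) measurable
  then show ?thesis using uv by (auto simp: Linf_fun_def)
qed

lemma integral_ftensor:
  assumes u: "u \<in> Linf_fun (mu dX)" and v: "v \<in> Linf_fun (mu dY)"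
  shows "(\<integral>z. ftensor u v z \<partial>MM) = (\<integral>x. u x \<partial>mu dX) * (\<integral>y. v y \<partial>mu dY)"
proof -
  have "integrable MM (ftensor u v)" by (rule PP.P.integrable_Linf[OF ftensor_Linf[OF u v]])
  then have "(\<integral>z. ftensor u v z \<partial>MM) = (\<integral>x. (\<integral>y. ftensor u v (x, y) \<partial>mu dY) \<partial>mu dX)"
    by (rule PP.integral_fst'[symmetric])
  also have "\<dots> = (\<integral>x. u x * (\<integral>y. v y \<partial>mu dY) \<partial>mu dX)"
    using PP.M2.integrable_Linf[OF v] by (simp add: ftensor_def)
  also have "\<dots> = (\<integral>x. u x \<partial>mu dX) * (\<integral>y. v y \<partial>mu dY)"
    using PP.M1.integrable_Linf[OF u] by simp
  finally show ?thesis .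
qed

lemma integral_cyl_X: "x \<in> fam dX n \<Longrightarrow> (\<integral>\<omega>. indicator (cyl dX x) \<omega> \<partial>mu dX) = (1 / of_nat (card (fam dX n)) :: complex)"
  using integral_indicator_complex[OF PP.M1.finite_measure_axioms cyl_sets] measure_cyl[OF X] by simp

lemma integral_cyl_Y: "y \<in> fam dY n \<Longrightarrow> (\<integral>\<omega>. indicator (cyl dY y) \<omega> \<partial>mu dY) = (1 / of_nat (card (fam dY n)) :: complex)"
  using integral_indicator_complex[OF PP.M2.finite_measure_axioms cyl_sets] measure_cyl[OF Y] by simp

lemma integral_Om_X: "(\<integral>\<omega>. indicator (Om dX) \<omega> \<partial>mu dX) = (1 :: complex)"
  using integral_indicator_complex[OF PP.M1.finite_measure_axioms, of "Om dX"] PP.M1.prob_space sets.top[of "mu dX"] by simp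

lemma integral_Om_Y: "(\<integral>\<omega>. indicator (Om dY) \<omega> \<partial>mu dY) = (1 :: complex)"
  using integral_indicator_complex[OF PP.M2.finite_measure_axioms, of "Om dY"] PP.M2.prob_space sets.top[of "mu dY"] by simp

lemma const_Linf_X: "(\<lambda>_. c) \<in> Linf_fun (mu dX)"
  by (rule PP.M1.Linf_funI[of _ "cmod c"]) auto

lemma const_Linf_Y: "(\<lambda>_. c) \<in> Linf_fun (mu dY)"
  by (rule PP.M2.Linf_funI[of _ "cmod c"]) auto

end

locale ns_correlation = ns_families +
  fixes \<Gamma> assumes \<Gamma>: "\<Gamma> \<in> ns_corr dX dY dA dB"
begin

text \<open>The pairing $\langle g, \Gamma(f) \rangle$ as a form in \<open>g\<close> and \<open>f\<close>.\<close>

definition pair\<Gamma> where "pair\<Gamma> g f = pairing MM g (\<Gamma> f)"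

lemma ucp_\<Gamma>: "ucp (CC dA dB) (Linf_osys MM) \<Gamma>"
  using \<Gamma> by (simp add: ns_corr_def)

lemma \<Gamma>_rep:
  assumes "f \<in> carrier (CC dA dB)"
  shows "\<exists>h\<in>Linf_fun MM. \<Gamma> f = Linf_class MM h \<and> (\<forall>g\<in>Linf_fun MM. pair\<Gamma> g f = (\<integral>z. g z * h z \<partial>MM))"
proof -
  have "\<Gamma> f \<in> carrier (Linf_osys MM)" using ucp_\<Gamma> assms by (simp add: ucp_def linear_map_def)
  then obtain h where h: "h \<in> Linf_fun MM" "\<Gamma> f = Linf_class MM h" unfolding PP.P.carrier_Linf by blast
  show ?thesis
  proof (intro bexI[of _ h] conjI ballI)
    show "pair\<Gamma> g f = (\<integral>z. g z * h z \<partial>MM)" if "g \<in> Linf_fun MM" for g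
      unfolding pair\<Gamma>_def h(2) by (rule PP.P.pairing_class[OF PP.P.Linf_fun_measurable[OF that] h(1)])
  qed (rule h)+
qed

lemma pair\<Gamma>_sum_left:
  assumes f: "f \<in> carrier (CC dA dB)" and "finite I" and g: "\<And>i. i \<in> I \<Longrightarrow> g i \<in> Linf_fun MM"
  shows "pair\<Gamma> (\<lambda>z. \<Sum>i\<in>I. g i z) f = (\<Sum>i\<in>I. pair\<Gamma> (g i) f)"
proof -
  obtain h where h: "h \<in> Linf_fun MM" and L: "\<And>g. g \<in> Linf_fun MM \<Longrightarrow> pair\<Gamma> g f = (\<integral>z. g z * h z \<partial>MM)"
    using \<Gamma>_rep[OF f] by blast
  have s: "(\<lambda>z. \<Sum>i\<in>I. g i z) \<in> Linf_fun MM"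
    by (rule conjunct2[OF fun_finsum[OF PP.P.fun_space_Linf assms(2) g, where K = UNIV]])
  have "pair\<Gamma> (\<lambda>z. \<Sum>i\<in>I. g i z) f = (\<integral>z. (\<Sum>i\<in>I. g i z * h z) \<partial>MM)"
    using L[OF s] by (simp add: sum_distrib_right)
  also have "\<dots> = (\<Sum>i\<in>I. \<integral>z. g i z * h z \<partial>MM)"
    by (intro Bochner_Integration.integral_sum PP.P.integrable_Linf PP.P.Linf_mult g h)
  finally show ?thesis using L g by simp
qed

lemma pair\<Gamma>_sum_right:
  assumes g: "g \<in> Linf_fun MM" and "finite I" and f: "\<And>i. i \<in> I \<Longrightarrow> f i \<in> carrier (CC dA dB)"
  shows "pair\<Gamma> g (\<lambda>z. \<Sum>i\<in>I. f i z) = (\<Sum>i\<in>I. pair\<Gamma> g (f i))"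
proof -
  have "linear_functional (CC dA dB) (pair\<Gamma> g)"
    unfolding pair\<Gamma>_def[abs_def]
    by (rule linear_functional_comp[OF _ PP.P.linear_functional_pairing[OF g]]) (use ucp_\<Gamma> in \<open>simp add: ucp_def\<close>)
  then have "linear_functional (fun_osys (Om dA \<times> Om dB) (carrier (CC dA dB))) (pair\<Gamma> g)"
    by (simp flip: CC_fun_osys)
  from fun_space_CC this assms(2) f show ?thesis by (rule linear_functional_fun_sum)
qed

lemma pair\<Gamma>_nn:
  assumes f: "f \<in> carrier (CC dA dB)" "\<And>z. nn (f z)" and g: "g \<in> Linf_fun MM" "\<And>z. nn (g z)"
  shows "nn (pair\<Gamma> g f)"
proof -
  have one: "psd 1 (\<lambda>i j. c) \<longleftrightarrow> nn c" for c
  proof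
    assume "psd 1 (\<lambda>i j. c)"
    then have "nn (quad 1 (\<lambda>i j. c) (\<lambda>_. 1))" unfolding psd_quad by (rule spec)
    then show "nn c" by (simp add: quad_def)
  next
    assume "nn c"
    then have "nn ((cnj (v 0) * v 0) * c)" for v :: "nat \<Rightarrow> complex" by (intro nn_mult nn_norm)
    moreover have "quad 1 (\<lambda>i j. c) v = (cnj (v 0) * v 0) * c" for v by (simp add: quad_def)
    ultimately show "psd 1 (\<lambda>i j. c)" unfolding psd_quad by metis
  qed
  have "(\<lambda>i j. f) \<in> mpos (CC dA dB) 1"
    unfolding mpos_CC using f one by (simp del: One_nat_def)
  then have "(\<lambda>i j. \<Gamma> f) \<in> mpos (Linf_osys MM) 1" using ucp_\<Gamma> by (simp add: ucp_def)
  then obtain p where p: "\<forall>i<1. \<forall>j<1. p i j \<in> Linf_fun MM \<and> \<Gamma> f = Linf_class MM (p i j)"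
    "AE z in MM. psd 1 (\<lambda>i j. p i j z)"
    unfolding PP.P.mpos_Linf by (elim exE conjE) (rule that)
  have p0: "p 0 0 \<in> Linf_fun MM" "\<Gamma> f = Linf_class MM (p 0 0)" using p(1)[rule_format, of 0 0] by auto
  have "AE z in MM. nn (p 0 0 z)"
    using p(2)
  proof eventually_elim
    case (elim z)
    have "psd 1 (\<lambda>i j. p i j z) \<longleftrightarrow> psd 1 (\<lambda>i j. p 0 0 z)" by (rule psd_cong) simp
    then show ?case using elim one by simp
  qed
  then have "AE z in MM. nn (g z * p 0 0 z)" by eventually_elim (intro nn_mult g)
  then have "nn (\<integral>z. g z * p 0 0 z \<partial>MM)"
    by (intro PP.P.nn_integral_complex PP.P.integrable_Linf PP.P.Linf_mult g p0)
  then show ?thesis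
    unfolding pair\<Gamma>_def p0(2) using PP.P.pairing_class[OF PP.P.Linf_fun_measurable[OF g(1)] p0(1)] by simp
qed

text \<open>No-signalling: $\Gamma(1 \otimes f)$ is a function of the second variable alone, so the integral over
  $\Omega_X$ factors out.\<close>

lemma pair\<Gamma>_marginal_X:
  assumes f: "f \<in> carrier (C_osys (Omega dB))"
    and u: "u \<in> Linf_fun (mu dX)" and v: "v \<in> Linf_fun (mu dY)"
  shows "pair\<Gamma> (ftensor u v) (ftensor (indicator (Om dA)) f) =
    (\<integral>\<omega>. u \<omega> \<partial>mu dX) * pair\<Gamma> (ftensor (indicator (Om dX)) v) (ftensor (indicator (Om dA)) f)"
proof -
  obtain g where g: "g \<in> Linf_fun (mu dY)" "\<Gamma> (ftensor (indicator (Om dA)) f) = Linf_class MM (ftensor (\<lambda>_. 1) g)"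
    using \<Gamma> f unfolding ns_corr_def one_C_Omega by blast
  have "pair\<Gamma> (ftensor w v) (ftensor (indicator (Om dA)) f) = (\<integral>\<omega>. w \<omega> \<partial>mu dX) * (\<integral>\<omega>. v \<omega> * g \<omega> \<partial>mu dY)"
    if w: "w \<in> Linf_fun (mu dX)" for w
  proof -
    have "pair\<Gamma> (ftensor w v) (ftensor (indicator (Om dA)) f) = (\<integral>z. ftensor w v z * ftensor (\<lambda>_. 1) g z \<partial>MM)"
      unfolding pair\<Gamma>_def g(2)
      by (intro PP.P.pairing_class PP.P.Linf_fun_measurable ftensor_Linf w v g const_Linf_X)
    also have "\<dots> = (\<integral>z. ftensor w (\<lambda>\<omega>. v \<omega> * g \<omega>) z \<partial>MM)"
      by (intro Bochner_Integration.integral_cong refl) (auto simp: ftensor_def)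
    also have "\<dots> = (\<integral>\<omega>. w \<omega> \<partial>mu dX) * (\<integral>\<omega>. v \<omega> * g \<omega> \<partial>mu dY)"
      by (rule integral_ftensor[OF w PP.M2.Linf_mult[OF v g(1)]])
    finally show ?thesis .
  qed
  from this[OF u] this[OF Om_Linf[OF X]] show ?thesis by (simp add: integral_Om_X)
qed

lemma pair\<Gamma>_marginal_Y:
  assumes f: "f \<in> carrier (C_osys (Omega dA))"
    and u: "u \<in> Linf_fun (mu dX)" and v: "v \<in> Linf_fun (mu dY)"
  shows "pair\<Gamma> (ftensor u v) (ftensor f (indicator (Om dB))) =
    (\<integral>\<omega>. v \<omega> \<partial>mu dY) * pair\<Gamma> (ftensor u (indicator (Om dY))) (ftensor f (indicator (Om dB)))"
proof -
  obtain g where g: "g \<in> Linf_fun (mu dX)" "\<Gamma> (ftensor f (indicator (Om dB))) = Linf_class MM (ftensor g (\<lambda>_. 1))"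
    using \<Gamma> f unfolding ns_corr_def one_C_Omega by blast
  have "pair\<Gamma> (ftensor u w) (ftensor f (indicator (Om dB))) = (\<integral>\<omega>. w \<omega> \<partial>mu dY) * (\<integral>\<omega>. u \<omega> * g \<omega> \<partial>mu dX)"
    if w: "w \<in> Linf_fun (mu dY)" for w
  proof -
    have "pair\<Gamma> (ftensor u w) (ftensor f (indicator (Om dB))) = (\<integral>z. ftensor u w z * ftensor g (\<lambda>_. 1) z \<partial>MM)"
      unfolding pair\<Gamma>_def g(2)
      by (intro PP.P.pairing_class PP.P.Linf_fun_measurable ftensor_Linf u w g const_Linf_Y)
    also have "\<dots> = (\<integral>z. ftensor (\<lambda>\<omega>. u \<omega> * g \<omega>) w z \<partial>MM)"
      by (intro Bochner_Integration.integral_cong refl) (auto simp: ftensor_def)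
    also have "\<dots> = (\<integral>\<omega>. u \<omega> * g \<omega> \<partial>mu dX) * (\<integral>\<omega>. w \<omega> \<partial>mu dY)"
      by (rule integral_ftensor[OF PP.M1.Linf_mult[OF u g(1)] w])
    finally show ?thesis by simp
  qed
  from this[OF v] this[OF Om_Linf[OF Y]] show ?thesis by (simp add: integral_Om_Y)
qed

text \<open>The measure of a cell is $1 / (|X_n| |Y_m|)$, so \<open>mean\<close> is the mean of
  $\Gamma(\chi_{\tilde a} \otimes \chi_{\tilde b})$ over a cell; \<open>meanA\<close> and \<open>meanB\<close> are the marginal
  means of $\Gamma(\chi_{\tilde a} \otimes 1)$ and $\Gamma(1 \otimes \chi_{\tilde b})$.\<close>

definition mean where
  "mean n m x y a b = of_nat (card (fam dX n)) * of_nat (card (fam dY m)) *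
     pair\<Gamma> (cell x y) (test a b)"

definition meanA where
  "meanA n x a = of_nat (card (fam dX n)) *
     pair\<Gamma> (ftensor (indicator (cyl dX x)) (indicator (Om dY))) (ftensor (indicator (cyl dA a)) (indicator (Om dB)))"

definition meanB where
  "meanB m y b = of_nat (card (fam dY m)) *
     pair\<Gamma> (ftensor (indicator (Om dX)) (indicator (cyl dY y))) (ftensor (indicator (Om dA)) (indicator (cyl dB b)))"

lemma refine_fun: "x \<in> fam d n \<Longrightarrow> indicator (cyl d x) = (\<lambda>\<omega>. \<Sum>i=1..d n. indicator (cyl d (x @ [i])) \<omega> :: complex)"
  using indicator_cyl_refine by blast

lemma sum_fun: "(\<lambda>\<omega>. \<Sum>x\<in>fam d n. indicator (cyl d x) \<omega>) = (indicator (Om d) :: _ \<Rightarrow> complex)"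
  using indicator_cyl_sum by blast

lemmas test_functions = ftensor_CC indicator_cyl_C indicator_Om_C ftensor_Linf cyl_Linf Om_Linf X Y

sublocale ns_kernel dX dY dA dB mean meanA meanB
proof
  have cX: "card (fam dX n) \<noteq> 0" for n using CX.S[of n] by simp
  have cY: "card (fam dY n) \<noteq> 0" for n using CY.S[of n] by simp
  fix n m :: nat and x y a b :: "nat list"
  assume n: "1 \<le> n" "1 \<le> m"
  show "nn (mean n m x y a b)"
    unfolding mean_def
    by (intro nn_mult pair\<Gamma>_nn test_functions)
      (auto simp: nn_def ftensor_def indicator_def)
  assume x: "x \<in> fam dX n" and y: "y \<in> fam dY m"
  show "(\<Sum>a\<in>fam dA n. mean n m x y a b) = meanB m y b"
  proof -
    have "(\<Sum>a\<in>fam dA n. mean n m x y a b) = of_nat (card (fam dX n)) * of_nat (card (fam dY m)) *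
      (\<Sum>a\<in>fam dA n. pair\<Gamma> (cell x y) (test a b))"
      by (simp add: mean_def sum_distrib_left)
    also have "(\<Sum>a\<in>fam dA n. pair\<Gamma> (cell x y) (test a b)) =
      pair\<Gamma> (cell x y) (ftensor (indicator (Om dA)) (indicator (cyl dB b)))"
      unfolding sum_fun[where d = dA and n = n, symmetric] ftensor_sum_left
      by (intro pair\<Gamma>_sum_right[symmetric] test_functions finite_fam)
    also have "\<dots> = 1 / of_nat (card (fam dX n)) * pair\<Gamma> (ftensor (indicator (Om dX)) (indicator (cyl dY y))) (ftensor (indicator (Om dA)) (indicator (cyl dB b)))"
      by (subst pair\<Gamma>_marginal_X) (simp_all add: test_functions integral_cyl_X[OF x])
    finally show ?thesis using cX[of n] by (simp add: meanB_def)
  qed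
  show "(\<Sum>b\<in>fam dB m. mean n m x y a b) = meanA n x a"
  proof -
    have "(\<Sum>b\<in>fam dB m. mean n m x y a b) = of_nat (card (fam dX n)) * of_nat (card (fam dY m)) *
      (\<Sum>b\<in>fam dB m. pair\<Gamma> (cell x y) (test a b))"
      by (simp add: mean_def sum_distrib_left)
    also have "(\<Sum>b\<in>fam dB m. pair\<Gamma> (cell x y) (test a b)) =
      pair\<Gamma> (cell x y) (ftensor (indicator (cyl dA a)) (indicator (Om dB)))"
      unfolding sum_fun[where d = dB and n = m, symmetric] ftensor_sum_right
      by (intro pair\<Gamma>_sum_right[symmetric] test_functions finite_fam)
    also have "\<dots> = 1 / of_nat (card (fam dY m)) * pair\<Gamma> (ftensor (indicator (cyl dX x)) (indicator (Om dY))) (ftensor (indicator (cyl dA a)) (indicator (Om dB)))"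
      by (subst pair\<Gamma>_marginal_Y) (simp_all add: test_functions integral_cyl_Y[OF y])
    finally show ?thesis using cY[of m] by (simp add: meanA_def)
  qed
  assume a: "a \<in> fam dA n" and b: "b \<in> fam dB m"
  show "mean n m x y a b = (\<Sum>i=1..dX n. \<Sum>j=1..dA n. mean (Suc n) m (x @ [i]) y (a @ [j]) b) / of_nat (dX n)"
  proof -
    let ?L = "\<lambda>i j. pair\<Gamma> (cell (x @ [i]) y) (test (a @ [j]) b)"
    have "pair\<Gamma> (cell x y) (test a b) =
      (\<Sum>i=1..dX n. pair\<Gamma> (cell (x @ [i]) y) (test a b))"
      unfolding refine_fun[OF x] ftensor_sum_left by (intro pair\<Gamma>_sum_left test_functions) simp
    also have "\<dots> = (\<Sum>i=1..dX n. \<Sum>j=1..dA n. ?L i j)"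
      unfolding refine_fun[OF a] ftensor_sum_left by (intro sum.cong refl pair\<Gamma>_sum_right test_functions) simp
    finally have L: "pair\<Gamma> (cell x y) (test a b) =
      (\<Sum>i=1..dX n. \<Sum>j=1..dA n. ?L i j)" .
    have "dX n \<noteq> 0" using X by (auto simp: inductive_family_def dest: spec[of _ n])
    then show ?thesis
      unfolding mean_def L card_fam_Suc by (simp add: sum_distrib_left[symmetric])
  qed
  show "mean n m x y a b = (\<Sum>i=1..dY m. \<Sum>j=1..dB m. mean n (Suc m) x (y @ [i]) a (b @ [j])) / of_nat (dY m)"
  proof -
    let ?L = "\<lambda>i j. pair\<Gamma> (cell x (y @ [i])) (test a (b @ [j]))"
    have "pair\<Gamma> (cell x y) (test a b) =
      (\<Sum>i=1..dY m. pair\<Gamma> (cell x (y @ [i])) (test a b))"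
      unfolding refine_fun[OF y] ftensor_sum_right by (intro pair\<Gamma>_sum_left test_functions) simp
    also have "\<dots> = (\<Sum>i=1..dY m. \<Sum>j=1..dB m. ?L i j)"
      unfolding refine_fun[OF b] ftensor_sum_right by (intro sum.cong refl pair\<Gamma>_sum_right test_functions) simp
    finally have L: "pair\<Gamma> (cell x y) (test a b) =
      (\<Sum>i=1..dY m. \<Sum>j=1..dB m. ?L i j)" .
    have "dY m \<noteq> 0" using Y by (auto simp: inductive_family_def dest: spec[of _ m])
    then show ?thesis
      unfolding mean_def L card_fam_Suc by (simp add: sum_distrib_left[symmetric])
  qed
next
  fix x assume x: "x \<in> fam dX 1"
  have cX: "card (fam dX 1) \<noteq> 0" using CX.S[of 1] by simp
  have "(\<Sum>a\<in>fam dA 1. pair\<Gamma> (ftensor (indicator (cyl dX x)) (indicator (Om dY))) (ftensor (indicator (cyl dA a)) (indicator (Om dB)))) =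
    pair\<Gamma> (ftensor (indicator (cyl dX x)) (indicator (Om dY))) (ftensor (indicator (Om dA)) (indicator (Om dB)))"
    unfolding sum_fun[where d = dA and n = 1, symmetric] ftensor_sum_left
    by (intro pair\<Gamma>_sum_right[symmetric] test_functions finite_fam)
  also have "\<dots> = (\<integral>z. ftensor (indicator (cyl dX x)) (indicator (Om dY)) z * indicator (space MM) z \<partial>MM)"
  proof -
    have "\<Gamma> (ftensor (indicator (Om dA)) (indicator (Om dB))) = Linf_class MM (indicator (space MM))"
      using ucp_\<Gamma> unfolding one_CC[symmetric] PP.P.unit_Linf[symmetric] by (simp add: ucp_def)
    moreover have "indicator (space MM) \<in> Linf_fun MM"
      by (rule PP.P.Linf_funI[of _ 1]) (auto simp: indicator_def)
    ultimately show ?thesis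
      unfolding pair\<Gamma>_def by (simp add: PP.P.pairing_class PP.P.Linf_fun_measurable test_functions)
  qed
  also have "\<dots> = (\<integral>z. ftensor (indicator (cyl dX x)) (indicator (Om dY)) z \<partial>MM)"
    by (intro Bochner_Integration.integral_cong) auto
  also have "\<dots> = 1 / of_nat (card (fam dX 1))"
    by (subst integral_ftensor) (simp_all add: test_functions integral_cyl_X[OF x] integral_Om_Y)
  finally show "(\<Sum>a\<in>fam dA 1. meanA 1 x a) = 1"
    using cX by (simp add: meanA_def flip: sum_distrib_left)
qed

theorem state_of_correlation:
  "\<exists>s. state (tensor_lim dX dY dA dB) s \<and> represents dX dY dA dB \<Gamma> s"
  using kernel_state unfolding represents_def mean_def pair\<Gamma>_def by simp

end

section \<open>Uniform approximation and convergence of martingales\<close>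

text \<open>This is uniform continuity on a compact space, expressed in terms of common initial segments. The
  sequences are embedded by \<open>E\<close>, with left inverse \<open>D\<close>, into real sequences, which carry a metric;
  there, sequences with a long common initial segment are close. The metric enumerates the
  coordinates through \<^const>\<open>from_nat\<close>, which is why the required length \<open>N\<close> is an upper bound of the
  values of this enumeration.\<close>

lemma compact_cylinder_approximation:
  assumes f: "continuous_on (Om dA \<times> Om dB) (f :: _ \<Rightarrow> complex)" and \<epsilon>: "\<epsilon> > 0"
  shows "\<exists>N. \<forall>\<alpha>\<in>Om dA. \<forall>\<alpha>'\<in>Om dA. \<forall>\<beta>\<in>Om dB. \<forall>\<beta>'\<in>Om dB.
    initial N \<alpha> = initial N \<alpha>' \<longrightarrow> initial N \<beta> = initial N \<beta>' \<longrightarrow> cmod (f (\<alpha>, \<beta>) - f (\<alpha>', \<beta>')) < \<epsilon>"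
proof -
  define E :: "(nat \<Rightarrow> nat) \<Rightarrow> nat \<Rightarrow> real" where "E \<omega> = (\<lambda>i. real (\<omega> i))" for \<omega>
  define D :: "(nat \<Rightarrow> real) \<Rightarrow> nat \<Rightarrow> nat" where "D x = (\<lambda>i. nat \<lfloor>x i\<rfloor>)" for x
  have DE: "D (E \<omega>) = \<omega>" for \<omega> by (simp add: D_def E_def)
  have E: "continuous_on S E" for S
    unfolding E_def
    by (intro continuous_on_coordinatewise_then_product continuous_on_of_nat)
      (rule continuous_on_subset[OF continuous_on_product_coordinates], simp)
  have D: "continuous_on (E ` Om d) D" for d
    by (rule continuous_on_inv[OF E compact_Om]) (simp add: DE)
  let ?K = "E ` Om dA \<times> E ` Om dB"
  have "continuous_on ?K (\<lambda>z. f (D (fst z), D (snd z)))"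
  proof (rule continuous_on_compose2[OF f])
    show "continuous_on ?K (\<lambda>z. (D (fst z), D (snd z)))"
    proof (rule continuous_on_Pair)
      show "continuous_on ?K (\<lambda>z. D (fst z))"
        by (rule continuous_on_compose2[OF D[of dA] continuous_on_fst[OF continuous_on_id]]) auto
      show "continuous_on ?K (\<lambda>z. D (snd z))"
        by (rule continuous_on_compose2[OF D[of dB] continuous_on_snd[OF continuous_on_id]]) auto
    qed
    show "(\<lambda>z. (D (fst z), D (snd z))) ` ?K \<subseteq> Om dA \<times> Om dB"
    proof
      fix y assume "y \<in> (\<lambda>z. (D (fst z), D (snd z))) ` ?K"
      then obtain \<alpha> \<beta> where "\<alpha> \<in> Om dA" "\<beta> \<in> Om dB" "y = (D (E \<alpha>), D (E \<beta>))" by force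
      then show "y \<in> Om dA \<times> Om dB" by (simp add: DE)
    qed
  qed
  then have "uniformly_continuous_on ?K (\<lambda>z. f (D (fst z), D (snd z)))"
    by (rule compact_uniformly_continuous[OF _ compact_Times[OF compact_continuous_image[OF E compact_Om] compact_continuous_image[OF E compact_Om]]])
  then obtain \<delta> where \<delta>: "\<delta> > 0" "\<And>z w. \<lbrakk>z \<in> ?K; w \<in> ?K; dist w z < \<delta>\<rbrakk> \<Longrightarrow>
      dist (f (D (fst w), D (snd w))) (f (D (fst z), D (snd z))) < \<epsilon>"
    using \<epsilon> by (rule uniformly_continuous_onE) (rule that)
  obtain K where K: "(1 / 2) ^ K < \<delta> / 2" using real_arch_pow_inv[of "\<delta> / 2" "1 / 2"] \<delta> by auto
  define N where "N = Suc (\<Sum>n\<le>K. from_nat n :: nat)"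
  have close: "dist (E \<alpha>) (E \<alpha>') \<le> (1 / 2) ^ K" if i: "initial N \<alpha> = initial N \<alpha>'" for \<alpha> \<alpha>' :: "nat \<Rightarrow> nat"
  proof -
    have "E \<alpha> (from_nat n) = E \<alpha>' (from_nat n)" if "n \<le> K" for n
    proof -
      have "(from_nat n :: nat) \<le> (\<Sum>n\<le>K. from_nat n)" using that by (intro member_le_sum) auto
      then have "from_nat n < N" by (simp add: N_def)
      then show ?thesis using i unfolding E_def by (metis nth_initial)
    qed
    then have "{dist (E \<alpha> (from_nat n)) (E \<alpha>' (from_nat n)) |n. n \<le> K} = {0}" by (auto intro!: exI[of _ 0])
    then show ?thesis using dist_fun_le_dist_first_terms[of "E \<alpha>" "E \<alpha>'" K] by simp
  qed
  show ?thesis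
  proof (intro exI[of _ N] ballI impI)
    fix \<alpha> \<alpha>' \<beta> \<beta>' assume c: "\<alpha> \<in> Om dA" "\<alpha>' \<in> Om dA" "\<beta> \<in> Om dB" "\<beta>' \<in> Om dB"
      and e: "initial N \<alpha> = initial N \<alpha>'" "initial N \<beta> = initial N \<beta>'"
    have "dist (E \<alpha>, E \<beta>) (E \<alpha>', E \<beta>') \<le> dist (E \<alpha>) (E \<alpha>') + dist (E \<beta>) (E \<beta>')"
      unfolding dist_Pair_Pair by (rule sqrt_sum_squares_le_sum) auto
    also have "\<dots> < \<delta>" using close[OF e(1)] close[OF e(2)] K by simp
    finally show "cmod (f (\<alpha>, \<beta>) - f (\<alpha>', \<beta>')) < \<epsilon>"
      using \<delta>(2)[of "(E \<alpha>', E \<beta>')" "(E \<alpha>, E \<beta>)"] c by (simp add: dist_norm DE)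
  qed
qed

lemma summable_differences_convergent:
  fixes f :: "nat \<Rightarrow> real"
  assumes "summable (\<lambda>k. \<bar>f (Suc k) - f k\<bar>)" shows "convergent f"
proof -
  have "summable (\<lambda>k. f (Suc k) - f k)" using assms by (rule summable_rabs_cancel)
  then have "convergent (\<lambda>n. \<Sum>k<n. f (Suc k) - f k)" by (simp add: summable_iff_convergent)
  then have "convergent (\<lambda>n. f n - f 0)" by (simp add: sum_lessThan_telescope)
  then show ?thesis using convergent_add[OF _ convergent_const[of "f 0"]] by force
qed

text \<open>The hypothesis \<open>mart\<close> expresses the martingale property: increments are
  orthogonal to the past, so that the squared $L^2$ norm of an increment is the
  difference of squared norms. These norms increase and are bounded by 1, hence Cauchy. Along a
  subsequence that is fast enough for the first $k$ processes at its $k$-th step, the $L^1$ norms of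
  the increments of each process are eventually at most $2^{-k}$, so the increments are summable
  almost everywhere.\<close>

lemma (in prob_space) bounded_martingales_subsequence:
  fixes h :: "nat \<Rightarrow> nat \<Rightarrow> 'a \<Rightarrow> real" and N :: "nat \<Rightarrow> nat"
  assumes meas [measurable]: "\<And>i n. h i n \<in> borel_measurable M"
    and bound: "\<And>i n x. x \<in> space M \<Longrightarrow> \<bar>h i n x\<bar> \<le> 1"
    and mart: "\<And>i l n. \<lbrakk>N i \<le> l; l \<le> n\<rbrakk> \<Longrightarrow> (\<integral>x. h i n x * h i l x \<partial>M) = (\<integral>x. h i l x * h i l x \<partial>M)"
  shows "\<exists>r. strict_mono r \<and> (\<forall>i. AE x in M. convergent (\<lambda>k. h i (r k) x))"
proof -
  have int: "integrable M (\<lambda>x. h i n x * h i l x)" for i n l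
  proof (rule integrable_const_bound[of _ 1])
    show "AE x in M. norm (h i n x * h i l x) \<le> 1"
      using bound by (auto simp: abs_mult intro!: AE_I2 mult_le_one)
  qed measurable
  define a where "a i n = (\<integral>x. h i n x * h i n x \<partial>M)" for i n
  have diff: "(\<integral>x. (h i n x - h i l x)\<^sup>2 \<partial>M) = a i n - a i l" if "N i \<le> l" "l \<le> n" for i l n
  proof -
    have "(\<integral>x. (h i n x - h i l x)\<^sup>2 \<partial>M) = (\<integral>x. h i n x * h i n x - 2 * (h i n x * h i l x) + h i l x * h i l x \<partial>M)"
      by (simp add: power2_eq_square algebra_simps)
    also have "\<dots> = a i n - 2 * (\<integral>x. h i n x * h i l x \<partial>M) + a i l"
      unfolding a_def using int by simp
    finally show ?thesis using mart[OF that] by (simp add: a_def)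
  qed
  have mono: "a i l \<le> a i n" if "N i \<le> l" "l \<le> n" for i l n
    using diff[OF that] Bochner_Integration.integral_nonneg[of M "\<lambda>x. (h i n x - h i l x)\<^sup>2"] by simp
  have a1: "a i n \<le> 1" for i n
  proof -
    have "a i n \<le> (\<integral>x. 1 \<partial>M)" unfolding a_def
    proof (rule integral_mono[OF int])
      fix x assume "x \<in> space M"
      then have "\<bar>h i n x * h i n x\<bar> \<le> 1" using bound unfolding abs_mult by (intro mult_le_one) auto
      then show "h i n x * h i n x \<le> 1" by simp
    qed simp
    then show ?thesis by (simp add: prob_space)
  qed
  have cauchy: "\<exists>K\<ge>N i. \<forall>n\<ge>K. a i n - a i K < \<epsilon>" if \<epsilon>: "\<epsilon> > 0" for i \<epsilon>
  proof -
    have "incseq (\<lambda>n. a i (n + N i))" by (intro incseq_SucI mono) auto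
    then have "convergent (\<lambda>n. a i (n + N i))"
      using a1 by (elim incseq_convergent[where B = 1]) (auto simp: convergent_def)
    then have "Cauchy (\<lambda>n. a i (n + N i))" by (rule convergent_Cauchy)
    then obtain K where K: "\<And>m n. \<lbrakk>m \<ge> K; n \<ge> K\<rbrakk> \<Longrightarrow> dist (a i (m + N i)) (a i (n + N i)) < \<epsilon>"
      unfolding Cauchy_def using \<epsilon> by blast
    have "a i n - a i (K + N i) < \<epsilon>" if "n \<ge> K + N i" for n
      using K[of "n - N i" K] that by (simp add: dist_real_def abs_less_iff)
    then show ?thesis by (intro exI[of _ "K + N i"]) auto
  qed
  have "\<exists>K. \<forall>i\<le>k. N i \<le> K \<and> (\<forall>n\<ge>K. \<forall>l\<ge>K. l \<le> n \<longrightarrow> a i n - a i l < (1 / 4) ^ k)" for k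
  proof -
    have "\<exists>K. \<forall>i. K i \<ge> N i \<and> (\<forall>n\<ge>K i. a i n - a i (K i) < (1 / 4) ^ k)"
      using cauchy[of "(1 / 4) ^ k"] by (intro choice) auto
    then obtain K where K: "\<And>i. K i \<ge> N i" "\<And>i n. n \<ge> K i \<Longrightarrow> a i n - a i (K i) < (1 / 4) ^ k" by blast
    have le: "K i \<le> (\<Sum>i\<le>k. K i)" if "i \<le> k" for i using that by (intro member_le_sum) auto
    show ?thesis
    proof (intro exI[of _ "\<Sum>i\<le>k. K i"] allI impI conjI)
      fix i assume i: "i \<le> k"
      show "N i \<le> (\<Sum>i\<le>k. K i)" using le[OF i] K(1)[of i] by simp
      fix n l assume "n \<ge> (\<Sum>i\<le>k. K i)" "l \<ge> (\<Sum>i\<le>k. K i)" "l \<le> n"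
      then show "a i n - a i l < (1 / 4) ^ k"
        using K(2)[of i n] mono[of i "K i" l] K(1)[of i] le[OF i] by simp
    qed
  qed
  then obtain K where K: "\<And>k i. i \<le> k \<Longrightarrow> N i \<le> K k"
    "\<And>k i n l. \<lbrakk>i \<le> k; n \<ge> K k; l \<ge> K k; l \<le> n\<rbrakk> \<Longrightarrow> a i n - a i l < (1 / 4) ^ k" by metis
  \<comment> \<open>a strictly increasing sequence above \<open>K\<close>\<close>
  define r where "r k = (\<Sum>j\<le>k. Suc (K j))" for k
  have r: "strict_mono r" unfolding r_def by (rule strict_monoI_Suc) simp
  have Kr: "K k \<le> r k" for k
  proof -
    have "Suc (K k) \<le> (\<Sum>j\<le>k. Suc (K j))" by (intro member_le_sum) auto
    then show ?thesis by (simp add: r_def)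
  qed
  have "AE x in M. convergent (\<lambda>k. h i (r k) x)" for i
  proof -
    let ?g = "\<lambda>k x. h i (r (Suc (k + i))) x - h i (r (k + i)) x"
    have le: "r (k + i) \<le> r (Suc (k + i))" for k using r by (simp add: strict_mono_less_eq)
    have L1: "(\<integral>\<^sup>+x. ennreal \<bar>?g k x\<bar> \<partial>M) \<le> ennreal ((1 / 2) ^ k)" for k
    proof -
      \<comment> \<open>$2 c |g| \le c^2 + g^2$ bounds the $L^1$ norm of the increment $g$ by its $L^2$ norm\<close>
      define c :: real where "c = (1 / 2) ^ k"
      have c: "c > 0" "(1 / 4) ^ k = c * c" by (simp_all add: c_def flip: power_mult_distrib)
      have sq: "(\<integral>x. (?g k x)\<^sup>2 \<partial>M) \<le> c * c"
      proof -
        have "(\<integral>x. (?g k x)\<^sup>2 \<partial>M) < (1 / 4) ^ (k + i)"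
          using diff[of i "r (k + i)" "r (Suc (k + i))"] K[of i "k + i"] Kr[of "k + i"] le[of k]
          by (smt (verit) le_add2 order_trans)
        also have "(1 / 4) ^ (k + i) \<le> (1 / 4 :: real) ^ k" by (rule power_decreasing) auto
        finally show ?thesis unfolding c(2) by simp
      qed
      have ig: "integrable M (\<lambda>x. (?g k x)\<^sup>2)"
        using int by (simp add: power2_eq_square algebra_simps)
      have "(\<integral>\<^sup>+x. ennreal \<bar>?g k x\<bar> \<partial>M) \<le> (\<integral>\<^sup>+x. ennreal ((c * c + (?g k x)\<^sup>2) / (2 * c)) \<partial>M)"
      proof (intro nn_integral_mono ennreal_leI)
        fix x
        have "2 * c * \<bar>?g k x\<bar> \<le> c * c + (?g k x)\<^sup>2"
          using sum_squares_bound[of c "\<bar>?g k x\<bar>"] by (simp add: power2_eq_square)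
        then show "\<bar>?g k x\<bar> \<le> (c * c + (?g k x)\<^sup>2) / (2 * c)" using c by (simp add: field_simps)
      qed
      also have "\<dots> = ennreal (\<integral>x. (c * c + (?g k x)\<^sup>2) / (2 * c) \<partial>M)"
        using ig c by (intro nn_integral_eq_integral) auto
      also have "(\<integral>x. (c * c + (?g k x)\<^sup>2) / (2 * c) \<partial>M) = (c * c + (\<integral>x. (?g k x)\<^sup>2 \<partial>M)) / (2 * c)"
        using ig by (simp add: prob_space)
      also have "ennreal \<dots> \<le> ennreal c"
        using sq c by (intro ennreal_leI) (simp add: field_simps)
      finally show ?thesis by (simp add: c_def)
    qed
    have "(\<integral>\<^sup>+x. (\<Sum>k. ennreal \<bar>?g k x\<bar>) \<partial>M) = (\<Sum>k. \<integral>\<^sup>+x. ennreal \<bar>?g k x\<bar> \<partial>M)"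
      by (rule nn_integral_suminf) measurable
    also have "\<dots> \<le> (\<Sum>k. ennreal ((1 / 2) ^ k))" by (intro suminf_le L1) auto
    finally have le_geom: "(\<integral>\<^sup>+x. (\<Sum>k. ennreal \<bar>?g k x\<bar>) \<partial>M) \<le> (\<Sum>k. ennreal ((1 / 2) ^ k))" .
    have "summable (\<lambda>k. (1 / 2 :: real) ^ k)" by (rule summable_geometric) simp
    then have "(\<Sum>k. ennreal ((1 / 2) ^ k)) \<noteq> \<infinity>"
      unfolding infinity_ennreal_def by (rule ennreal_suminf_neq_top) simp
    then have "(\<integral>\<^sup>+x. (\<Sum>k. ennreal \<bar>?g k x\<bar>) \<partial>M) \<noteq> \<infinity>"
      unfolding infinity_ennreal_def by (rule neq_top_trans[OF _ le_geom])
    then have "AE x in M. (\<Sum>k. ennreal \<bar>?g k x\<bar>) \<noteq> \<infinity>"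
      by (intro nn_integral_PInf_AE) measurable
    then show ?thesis
    proof eventually_elim
      case (elim x)
      then have "summable (\<lambda>k. \<bar>?g k x\<bar>)" by (intro summable_suminf_not_top) auto
      then have "convergent (\<lambda>k. h i (r (k + i)) x)" by (intro summable_differences_convergent) simp
      then show ?case using convergent_ignore_initial_segment[of "\<lambda>k. h i (r k) x" i] by (rule iffD1[rotated])
    qed
  qed
  then show ?thesis using r by blast
qed

section \<open>The martingales of a state\<close>

context
  fixes dX dA :: "nat \<Rightarrow> nat"
  assumes X: "inductive_family dX" and A: "inductive_family dA"
begin

interpretation C: coproduct "fam dX n" "fam dA n" for n by (rule coproduct_fam[OF X A])
interpretation L: os_sequence "fam_copr dX dA" "fam_conn dX dA" by (rule os_sequence_fam[OF X A])

text \<open>Each copy of $\mathcal D_{A_n}$ has the unit of the coproduct as its unit.\<close>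

lemma fam_functional_gen_sum:
  assumes \<sigma>: "linear_functional (fam_lim dX dA) \<sigma>" and n: "n \<ge> 1" and x: "x \<in> fam dX n"
  shows "(\<Sum>a\<in>fam dA n. \<sigma> (fam_emb dX dA n (fam_gen dX dA n x a))) = \<sigma> \<one>\<^bsub>fam_lim dX dA\<^esub>"
proof -
  define f :: "nat list \<times> nat list \<Rightarrow> complex" where "f = (\<lambda>(t, u). if t = x then indicator (fam dA n) u else 0)"
  have f: "f \<in> fam_fun dX dA n"
    using x by (intro C.copr_funI) (auto simp: f_def indicator_def split: if_splits)
  have "fam_cls dX dA n f = \<one>\<^bsub>fam_pre dX dA n\<^esub>"
    using C.copr_inj_unit[OF x] by (simp add: copr_inj_def diag_osys_def f_def)
  then have "\<one>\<^bsub>fam_lim dX dA\<^esub> = fam_elem dX dA n f"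
    using L.lim_one[OF n] by (simp add: fam_lim_def fam_emb_def fam_copr_def)
  then have "\<sigma> \<one>\<^bsub>fam_lim dX dA\<^esub> =
      (\<Sum>t\<in>fam dX n. \<Sum>a\<in>fam dA n. f (t, a) * \<sigma> (fam_emb dX dA n (fam_gen dX dA n t a)))"
    using fam_functional_expand[OF X A \<sigma> n f] by simp
  also have "\<dots> = (\<Sum>t\<in>fam dX n. if x = t then \<Sum>a\<in>fam dA n. \<sigma> (fam_emb dX dA n (fam_gen dX dA n t a)) else 0)"
    by (intro sum.cong refl) (auto simp: f_def)
  also have "\<dots> = (\<Sum>a\<in>fam dA n. \<sigma> (fam_emb dX dA n (fam_gen dX dA n x a)))"
    using x by (simp add: finite_fam)
  finally show ?thesis by simp
qed

lemma fam_functional_gen_refine: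
  assumes \<sigma>: "linear_functional (fam_lim dX dA) \<sigma>" and n: "n \<ge> 1" and x: "x \<in> fam dX n" and a: "a \<in> fam dA n"
  shows "\<sigma> (fam_emb dX dA n (fam_gen dX dA n x a)) =
    (\<Sum>i=1..dX n. \<Sum>j=1..dA n. \<sigma> (fam_emb dX dA (Suc n) (fam_gen dX dA (Suc n) (x @ [i]) (a @ [j])))) / of_nat (dX n)"
proof -
  let ?g = "\<lambda>y b. \<sigma> (fam_emb dX dA (Suc n) (fam_gen dX dA (Suc n) y b))"
  have "\<sigma> (fam_emb dX dA n (fam_gen dX dA n x a)) =
      \<sigma> (fam_emb dX dA (Suc n) (fam_cls dX dA (Suc n) (pull dX dA n (indicator {(x, a)}))))"
    unfolding fam_emb_conn[OF X A n C.gen_fun[OF x a]] C.copr_gen_cls ..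
  also have "\<dots> = (\<Sum>y\<in>fam dX (Suc n). \<Sum>b\<in>fam dA (Suc n). pull dX dA n (indicator {(x, a)}) (y, b) * ?g y b)"
    by (rule fam_functional_expand[OF X A \<sigma> _ pull_fun[OF X A]]) simp
  also have "\<dots> = (\<Sum>y\<in>fam dX n. \<Sum>i=1..dX n. \<Sum>b\<in>fam dA n. \<Sum>j=1..dA n. indicator {(x, a)} (y, b) / of_nat (dX n) * ?g (y @ [i]) (b @ [j]))"
    unfolding sum_fam_Suc pull_def[OF X A] by (intro sum.cong refl) (auto simp: fam_Suc)
  also have "\<dots> = (\<Sum>y\<in>fam dX n. if x = y then \<Sum>i=1..dX n. \<Sum>b\<in>fam dA n. if a = b then \<Sum>j=1..dA n. ?g (y @ [i]) (b @ [j]) / of_nat (dX n) else 0 else 0)"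
    by (intro sum.cong refl) (auto simp: indicator_def intro!: sum.cong)
  also have "\<dots> = (\<Sum>i=1..dX n. \<Sum>j=1..dA n. ?g (x @ [i]) (a @ [j]) / of_nat (dX n))"
    using x a by (simp add: finite_fam)
  finally show ?thesis by (simp add: sum_divide_distrib)
qed

end

text \<open>A point of the cylinder of \<open>a\<close>; the entry 1 is admissible in every coordinate.\<close>

definition point :: "nat list \<Rightarrow> nat \<Rightarrow> nat" where
  "point a = (\<lambda>i. if i < length a then a ! i else 1)"

lemma point_Om: "\<lbrakk>inductive_family d; a \<in> fam d n\<rbrakk> \<Longrightarrow> point a \<in> Om d"
  by (auto simp: Om_iff point_def fam_def inductive_family_def)

lemma initial_point: "length a = n \<Longrightarrow> initial n (point a) = a"
  by (auto simp: list_eq_iff_nth_eq point_def)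

lemma initial_take: "l \<le> n \<Longrightarrow> initial l \<omega> = take l (initial n \<omega>)"
  by (auto simp: list_eq_iff_nth_eq)

lemma indicator_cyl_initial:
  assumes "\<omega> \<in> Om d" "\<omega>' \<in> Om d" "initial n \<omega> = initial n \<omega>'" "length a \<le> n"
  shows "indicator (cyl d a) \<omega> = (indicator (cyl d a) \<omega>' :: complex)"
proof -
  have "\<omega> i = \<omega>' i" if "i < length a" for i
    using that assms(3,4) nth_initial by (metis order_less_le_trans)
  then show ?thesis using assms(1,2) by (auto simp: indicator_def cyl_def)
qed

context ns_families
begin

text \<open>A function on $X_n \times Y_n$, viewed as a function of the first $n$ coordinates on
  $\Omega_X \times \Omega_Y$.\<close>

definition level_fun :: "nat \<Rightarrow> (nat list \<Rightarrow> nat list \<Rightarrow> complex) \<Rightarrow> (nat \<Rightarrow> nat) \<times> (nat \<Rightarrow> nat) \<Rightarrow> complex" where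
  "level_fun n G z = G (initial n (fst z)) (initial n (snd z))"

lemma level_fun_expand:
  assumes "z \<in> space MM"
  shows "level_fun n G z = (\<Sum>x\<in>fam dX n. \<Sum>y\<in>fam dY n. G x y * cell x y z)"
proof -
  obtain \<omega> \<omega>' where z: "z = (\<omega>, \<omega>')" "\<omega> \<in> Om dX" "\<omega>' \<in> Om dY" using assms by (auto simp: space_MM)
  have "(\<Sum>x\<in>fam dX n. \<Sum>y\<in>fam dY n. G x y * cell x y z) =
    (\<Sum>x\<in>fam dX n. if initial n \<omega> = x then \<Sum>y\<in>fam dY n. if initial n \<omega>' = y then G x y else 0 else 0)"
    using z by (intro sum.cong refl) (auto simp: ftensor_def indicator_cyl intro!: sum.cong)
  then show ?thesis using z initial_fam by (simp add: level_fun_def finite_fam)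
qed

lemma level_fun_sum_Linf: "(\<lambda>z. \<Sum>x\<in>fam dX n. \<Sum>y\<in>fam dY n. G x y * cell x y z) \<in> Linf_fun MM"
proof -
  have 1: "(\<lambda>z. G x y * cell x y z) \<in> Linf_fun MM" for x y
    using ftensor_Linf[OF cyl_Linf[OF X] cyl_Linf[OF Y]] PP.P.fun_space_Linf by (simp add: fun_space_def)
  have 2: "(\<lambda>z. \<Sum>y\<in>fam dY n. G x y * cell x y z) \<in> Linf_fun MM" for x
    by (rule conjunct2[OF fun_finsum[OF PP.P.fun_space_Linf finite_fam 1, where K = UNIV]])
  show ?thesis
    by (rule conjunct2[OF fun_finsum[OF PP.P.fun_space_Linf finite_fam 2, where K = UNIV]])
qed

lemma level_fun_measurable: "level_fun n G \<in> borel_measurable MM"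
  by (subst measurable_cong[OF level_fun_expand], assumption) (rule PP.P.Linf_fun_measurable[OF level_fun_sum_Linf])

lemma integral_level_fun:
  "(\<integral>z. level_fun n G z \<partial>MM) = (\<Sum>x\<in>fam dX n. \<Sum>y\<in>fam dY n. G x y) / (of_nat (card (fam dX n)) * of_nat (card (fam dY n)))"
proof -
  have i: "integrable MM (\<lambda>z. G x y * cell x y z)" for x y
    using PP.P.integrable_Linf[OF ftensor_Linf[OF cyl_Linf[OF X] cyl_Linf[OF Y]]] by simp
  have "(\<integral>z. level_fun n G z \<partial>MM) = (\<integral>z. (\<Sum>x\<in>fam dX n. \<Sum>y\<in>fam dY n. G x y * cell x y z) \<partial>MM)"
    by (intro Bochner_Integration.integral_cong refl level_fun_expand)
  also have "\<dots> = (\<Sum>x\<in>fam dX n. \<Sum>y\<in>fam dY n. \<integral>z. G x y * cell x y z \<partial>MM)"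
    by (subst Bochner_Integration.integral_sum, intro Bochner_Integration.integrable_sum i)
      (intro sum.cong refl Bochner_Integration.integral_sum i)
  also have "\<dots> = (\<Sum>x\<in>fam dX n. \<Sum>y\<in>fam dY n. G x y / (of_nat (card (fam dX n)) * of_nat (card (fam dY n))))"
    by (intro sum.cong refl) (simp add: integral_ftensor cyl_Linf X Y integral_cyl_X integral_cyl_Y)
  finally show ?thesis by (simp add: sum_divide_distrib)
qed

end

locale ns_state = ns_families +
  fixes s assumes s: "state (max_tensor SX SY) s"
begin

definition p :: "nat \<Rightarrow> nat list \<Rightarrow> nat list \<Rightarrow> nat list \<Rightarrow> nat list \<Rightarrow> complex" where
  "p n x y a b = s (tn (genX n x a) (genY n y b))"

lemma p_nn: "\<lbrakk>n \<ge> 1; x \<in> fam dX n; y \<in> fam dY n; a \<in> fam dA n; b \<in> fam dB n\<rbrakk> \<Longrightarrow> nn (p n x y a b)"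
  unfolding p_def by (rule nn_generators[OF s])

lemma s_bilinear: "bilinear_form SX SY (\<lambda>v w. s (tn v w))"
  by (rule bilinear_form_tens[OF state_linear[OF s]])

lemma s_left: "w \<in> carrier SY \<Longrightarrow> linear_functional SX (\<lambda>v. s (tn v w))"
  using s_bilinear by (simp add: bilinear_form_def)

lemma s_right: "v \<in> carrier SX \<Longrightarrow> linear_functional SY (\<lambda>w. s (tn v w))"
  using s_bilinear by (simp add: bilinear_form_def)

lemma p_sum_B: "\<lbrakk>n \<ge> 1; x \<in> fam dX n; y \<in> fam dY n; a \<in> fam dA n\<rbrakk> \<Longrightarrow> (\<Sum>b\<in>fam dB n. p n x y a b) = s (tn (genX n x a) \<one>\<^bsub>SY\<^esub>)"
  unfolding p_def by (intro fam_functional_gen_sum[OF Y B s_right] fam_gen_closed[OF X A])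

lemma p_sum_A: "\<lbrakk>n \<ge> 1; x \<in> fam dX n; y \<in> fam dY n; b \<in> fam dB n\<rbrakk> \<Longrightarrow> (\<Sum>a\<in>fam dA n. p n x y a b) = s (tn \<one>\<^bsub>SX\<^esub> (genY n y b))"
  unfolding p_def using fam_functional_gen_sum[OF X A s_left] fam_gen_closed[OF Y B] by blast

lemma p_sum: "\<lbrakk>n \<ge> 1; x \<in> fam dX n; y \<in> fam dY n\<rbrakk> \<Longrightarrow> (\<Sum>a\<in>fam dA n. \<Sum>b\<in>fam dB n. p n x y a b) = 1"
  using fam_functional_gen_sum[OF X A s_left[OF SY.unit_closed], of n x] state_unit[OF s]
  by (simp add: p_sum_B)

lemma p_refine:
  assumes n: "n \<ge> 1" and x: "x \<in> fam dX n" and y: "y \<in> fam dY n" and a: "a \<in> fam dA n" and b: "b \<in> fam dB n"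
  shows "p n x y a b = (\<Sum>i=1..dX n. \<Sum>j=1..dA n. \<Sum>i'=1..dY n. \<Sum>j'=1..dB n.
    p (Suc n) (x @ [i]) (y @ [i']) (a @ [j]) (b @ [j'])) / (of_nat (dX n) * of_nat (dY n))"
proof -
  have "p n x y a b = (\<Sum>i=1..dX n. \<Sum>j=1..dA n. s (tn (genX (Suc n) (x @ [i]) (a @ [j])) (genY n y b))) / of_nat (dX n)"
    unfolding p_def by (rule fam_functional_gen_refine[OF X A s_left[OF fam_gen_closed[OF Y B n y b]] n x a])
  also have "(\<Sum>i=1..dX n. \<Sum>j=1..dA n. s (tn (genX (Suc n) (x @ [i]) (a @ [j])) (genY n y b))) =
      (\<Sum>i=1..dX n. \<Sum>j=1..dA n. (\<Sum>i'=1..dY n. \<Sum>j'=1..dB n. p (Suc n) (x @ [i]) (y @ [i']) (a @ [j]) (b @ [j'])) / of_nat (dY n))"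
  proof (intro sum.cong refl)
    fix i j assume i: "i \<in> {1..dX n}" and j: "j \<in> {1..dA n}"
    have "x @ [i] \<in> fam dX (Suc n)" "a @ [j] \<in> fam dA (Suc n)" using x a i j by (auto simp: fam_Suc)
    then have "genX (Suc n) (x @ [i]) (a @ [j]) \<in> carrier SX" by (intro fam_gen_closed[OF X A]) auto
    from fam_functional_gen_refine[OF Y B s_right[OF this] n y b]
    show "s (tn (genX (Suc n) (x @ [i]) (a @ [j])) (genY n y b)) =
      (\<Sum>i'=1..dY n. \<Sum>j'=1..dB n. p (Suc n) (x @ [i]) (y @ [i']) (a @ [j]) (b @ [j'])) / of_nat (dY n)"
      unfolding p_def .
  qed
  finally show ?thesis by (simp add: sum_divide_distrib mult.commute)
qed

text \<open>The integral of \<open>f\<close> with respect to the probability distribution $p_n(x, y, \cdot, \cdot)$,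
  with \<open>f\<close> evaluated at one point of each cylinder; \<open>Phi\<close> is the function $\Phi_n(f)$ of the introduction.\<close>

definition phi :: "nat \<Rightarrow> ((nat \<Rightarrow> nat) \<times> (nat \<Rightarrow> nat) \<Rightarrow> complex) \<Rightarrow> nat list \<Rightarrow> nat list \<Rightarrow> complex" where
  "phi n f x y = (\<Sum>a\<in>fam dA n. \<Sum>b\<in>fam dB n. f (point a, point b) * p n x y a b)"

abbreviation "Phi n f \<equiv> level_fun n (phi n f)"

lemma phi_add: "phi n (\<lambda>z. f z + g z) x y = phi n f x y + phi n g x y"
  by (simp add: phi_def algebra_simps sum.distrib)

lemma phi_smult: "phi n (\<lambda>z. c * f z) x y = c * phi n f x y"
  by (simp add: phi_def algebra_simps sum_distrib_left)

lemma phi_sum: "phi n (\<lambda>z. \<Sum>i\<in>I. f i z) x y = (\<Sum>i\<in>I. phi n (f i) x y)"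
proof -
  have "phi n (\<lambda>z. \<Sum>i\<in>I. f i z) x y = (\<Sum>a\<in>fam dA n. \<Sum>b\<in>fam dB n. \<Sum>i\<in>I. f i (point a, point b) * p n x y a b)"
    by (simp add: phi_def sum_distrib_right)
  also have "\<dots> = (\<Sum>a\<in>fam dA n. \<Sum>i\<in>I. \<Sum>b\<in>fam dB n. f i (point a, point b) * p n x y a b)"
    by (intro sum.cong refl sum.swap)
  also have "\<dots> = (\<Sum>i\<in>I. phi n (f i) x y)" unfolding phi_def by (rule sum.swap)
  finally show ?thesis .
qed

lemma phi_bound:
  assumes n: "n \<ge> 1" "x \<in> fam dX n" "y \<in> fam dY n" and f: "\<And>z. z \<in> Om dA \<times> Om dB \<Longrightarrow> cmod (f z) \<le> c"
  shows "cmod (phi n f x y) \<le> c"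
proof -
  have re: "p n x y a b = of_real (Re (p n x y a b))" "Re (p n x y a b) \<ge> 0" if "a \<in> fam dA n" "b \<in> fam dB n" for a b
    using p_nn[OF n that] by (auto simp: nn_def complex_is_Real_iff complex_eq_iff)
  have "cmod (phi n f x y) \<le> (\<Sum>a\<in>fam dA n. \<Sum>b\<in>fam dB n. c * Re (p n x y a b))"
    unfolding phi_def
  proof (intro order_trans[OF norm_sum] sum_mono)
    fix a b assume ab: "a \<in> fam dA n" "b \<in> fam dB n"
    have "cmod (p n x y a b) = Re (p n x y a b)" using re[OF ab] by (metis abs_of_nonneg norm_of_real)
    moreover have "cmod (f (point a, point b)) \<le> c" using point_Om[OF A ab(1)] point_Om[OF B ab(2)] by (intro f) auto
    ultimately show "cmod (f (point a, point b) * p n x y a b) \<le> c * Re (p n x y a b)"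
      using re(2)[OF ab] by (simp add: norm_mult mult_right_mono)
  qed
  also have "\<dots> = c * Re (\<Sum>a\<in>fam dA n. \<Sum>b\<in>fam dB n. p n x y a b)"
    by (simp add: sum_distrib_left)
  finally show ?thesis using p_sum[OF n] by simp
qed

lemma phi_one:
  assumes n: "n \<ge> 1" "x \<in> fam dX n" "y \<in> fam dY n"
  shows "phi n (ftensor (indicator (Om dA)) (indicator (Om dB))) x y = 1"
proof -
  have "phi n (ftensor (indicator (Om dA)) (indicator (Om dB))) x y = (\<Sum>a\<in>fam dA n. \<Sum>b\<in>fam dB n. p n x y a b)"
    unfolding phi_def using point_Om[OF A] point_Om[OF B] by (intro sum.cong refl) (simp add: ftensor_def)
  then show ?thesis using p_sum[OF n] by simp
qed

lemma phi_psd: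
  assumes n: "n \<ge> 1" "x \<in> fam dX n" "y \<in> fam dY n"
    and P: "\<And>z. z \<in> Om dA \<times> Om dB \<Longrightarrow> psd l (\<lambda>i j. P i j z)"
  shows "psd l (\<lambda>i j. phi n (P i j) x y)"
proof -
  have "psd l (\<lambda>i j. p n x y a b * P i j (point a, point b))" if "a \<in> fam dA n" "b \<in> fam dB n" for a b
    using point_Om[OF A that(1)] point_Om[OF B that(2)] by (intro psd_scale[OF p_nn[OF n that]] P) auto
  then show ?thesis unfolding phi_def by (intro psd_sum) (simp add: mult.commute)
qed

text \<open>The functions \<open>f\<close> for which \<open>phi\<close> does not depend on the choice of the points in the
  cylinders of level \<open>n\<close>.\<close>

definition depends :: "nat \<Rightarrow> ((nat \<Rightarrow> nat) \<times> (nat \<Rightarrow> nat) \<Rightarrow> complex) \<Rightarrow> bool" where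
  "depends n f \<longleftrightarrow> (\<forall>\<alpha>\<in>Om dA. \<forall>\<alpha>'\<in>Om dA. \<forall>\<beta>\<in>Om dB. \<forall>\<beta>'\<in>Om dB.
     initial n \<alpha> = initial n \<alpha>' \<longrightarrow> initial n \<beta> = initial n \<beta>' \<longrightarrow> f (\<alpha>, \<beta>) = f (\<alpha>', \<beta>'))"

lemma depends_mono: "\<lbrakk>depends l f; l \<le> n\<rbrakk> \<Longrightarrow> depends n f"
  unfolding depends_def by (metis initial_take)

lemma depends_test: "\<lbrakk>length a \<le> n; length b \<le> n\<rbrakk> \<Longrightarrow> depends n (test a b)"
  unfolding depends_def ftensor_def
  by (intro ballI impI) (simp only: split_conv, intro arg_cong2[where f = "(*)"] indicator_cyl_initial)

lemma phi_refine:
  assumes n: "n \<ge> 1" "x \<in> fam dX n" "y \<in> fam dY n" and f: "depends n f"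
  shows "(\<Sum>i=1..dX n. \<Sum>i'=1..dY n. phi (Suc n) f (x @ [i]) (y @ [i'])) = of_nat (dX n) * of_nat (dY n) * phi n f x y"
proof -
  have d: "dX n \<noteq> 0" "dY n \<noteq> 0" using X Y by (auto simp: inductive_family_def dest: spec[of _ n])
  have fp: "f (point (a @ [j]), point (b @ [j'])) = f (point a, point b)"
    if "a \<in> fam dA n" "b \<in> fam dB n" "j \<in> {1..dA n}" "j' \<in> {1..dB n}" for a b j j'
  proof -
    have "a @ [j] \<in> fam dA (Suc n)" "b @ [j'] \<in> fam dB (Suc n)" using that by (auto simp: fam_Suc)
    moreover have "initial n (point (c @ [k])) = initial n (point c)" if "length c = n" for c k
      using that by (auto simp: list_eq_iff_nth_eq point_def nth_append)
    ultimately show ?thesis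
      using f that point_Om[OF A] point_Om[OF B] length_fam unfolding depends_def by metis
  qed
  let ?t = "\<lambda>i i' a j b j'. f (point a, point b) * p (Suc n) (x @ [i]) (y @ [i']) (a @ [j]) (b @ [j'])"
  have "(\<Sum>i=1..dX n. \<Sum>i'=1..dY n. phi (Suc n) f (x @ [i]) (y @ [i'])) =
    (\<Sum>i=1..dX n. \<Sum>i'=1..dY n. \<Sum>a\<in>fam dA n. \<Sum>j=1..dA n. \<Sum>b\<in>fam dB n. \<Sum>j'=1..dB n. ?t i i' a j b j')"
    unfolding phi_def sum_fam_Suc by (intro sum.cong refl) (simp add: fp)
  also have "\<dots> = (\<Sum>i=1..dX n. \<Sum>a\<in>fam dA n. \<Sum>i'=1..dY n. \<Sum>j=1..dA n. \<Sum>b\<in>fam dB n. \<Sum>j'=1..dB n. ?t i i' a j b j')"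
    by (intro sum.cong refl sum.swap)
  also have "\<dots> = (\<Sum>a\<in>fam dA n. \<Sum>i=1..dX n. \<Sum>i'=1..dY n. \<Sum>j=1..dA n. \<Sum>b\<in>fam dB n. \<Sum>j'=1..dB n. ?t i i' a j b j')"
    by (rule sum.swap)
  also have "\<dots> = (\<Sum>a\<in>fam dA n. \<Sum>i=1..dX n. \<Sum>j=1..dA n. \<Sum>i'=1..dY n. \<Sum>b\<in>fam dB n. \<Sum>j'=1..dB n. ?t i i' a j b j')"
    by (intro sum.cong refl sum.swap)
  also have "\<dots> = (\<Sum>a\<in>fam dA n. \<Sum>i=1..dX n. \<Sum>j=1..dA n. \<Sum>b\<in>fam dB n. \<Sum>i'=1..dY n. \<Sum>j'=1..dB n. ?t i i' a j b j')"
    by (intro sum.cong refl sum.swap)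
  also have "\<dots> = (\<Sum>a\<in>fam dA n. \<Sum>i=1..dX n. \<Sum>b\<in>fam dB n. \<Sum>j=1..dA n. \<Sum>i'=1..dY n. \<Sum>j'=1..dB n. ?t i i' a j b j')"
    by (intro sum.cong refl sum.swap)
  also have "\<dots> = (\<Sum>a\<in>fam dA n. \<Sum>b\<in>fam dB n. \<Sum>i=1..dX n. \<Sum>j=1..dA n. \<Sum>i'=1..dY n. \<Sum>j'=1..dB n. ?t i i' a j b j')"
    by (intro sum.cong refl sum.swap)
  also have "\<dots> = (\<Sum>a\<in>fam dA n. \<Sum>b\<in>fam dB n. of_nat (dX n) * of_nat (dY n) * (f (point a, point b) * p n x y a b))"
  proof (intro sum.cong refl)
    fix a b assume ab: "a \<in> fam dA n" "b \<in> fam dB n"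
    have "(\<Sum>i=1..dX n. \<Sum>j=1..dA n. \<Sum>i'=1..dY n. \<Sum>j'=1..dB n. ?t i i' a j b j') = f (point a, point b) *
      (\<Sum>i=1..dX n. \<Sum>j=1..dA n. \<Sum>i'=1..dY n. \<Sum>j'=1..dB n. p (Suc n) (x @ [i]) (y @ [i']) (a @ [j]) (b @ [j']))"
      by (simp only: sum_distrib_left)
    also have "\<dots> = of_nat (dX n) * of_nat (dY n) * (f (point a, point b) * p n x y a b)"
      using p_refine[OF n ab] d by simp
    finally show "(\<Sum>i=1..dX n. \<Sum>j=1..dA n. \<Sum>i'=1..dY n. \<Sum>j'=1..dB n. ?t i i' a j b j') =
      of_nat (dX n) * of_nat (dY n) * (f (point a, point b) * p n x y a b)" .
  qed
  finally show ?thesis by (simp add: phi_def sum_distrib_left)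
qed

text \<open>The martingale property: the mean of $\Phi_{n+1}(f)$ over a cell of level $n$ is the value
  of $\Phi_n(f)$ there.\<close>

lemma integral_Phi_step:
  assumes n: "n \<ge> 1" and f: "depends n f"
  shows "(\<integral>z. Phi (Suc n) f z * level_fun n G z \<partial>MM) = (\<integral>z. Phi n f z * level_fun n G z \<partial>MM)"
proof -
  have "(\<integral>z. Phi (Suc n) f z * level_fun n G z \<partial>MM) = (\<integral>z. level_fun (Suc n) (\<lambda>x y. phi (Suc n) f x y * G (butlast x) (butlast y)) z \<partial>MM)"
    by (simp add: level_fun_def initial_Suc)
  also have "\<dots> = (\<Sum>x\<in>fam dX n. \<Sum>i=1..dX n. \<Sum>y\<in>fam dY n. \<Sum>i'=1..dY n. phi (Suc n) f (x @ [i]) (y @ [i']) * G x y) /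
      (of_nat (card (fam dX (Suc n))) * of_nat (card (fam dY (Suc n))))"
    unfolding integral_level_fun sum_fam_Suc by simp
  also have "(\<Sum>x\<in>fam dX n. \<Sum>i=1..dX n. \<Sum>y\<in>fam dY n. \<Sum>i'=1..dY n. phi (Suc n) f (x @ [i]) (y @ [i']) * G x y) =
      (\<Sum>x\<in>fam dX n. \<Sum>y\<in>fam dY n. \<Sum>i=1..dX n. \<Sum>i'=1..dY n. phi (Suc n) f (x @ [i]) (y @ [i']) * G x y)"
    by (intro sum.cong refl sum.swap)
  also have "\<dots> = (\<Sum>x\<in>fam dX n. \<Sum>y\<in>fam dY n. of_nat (dX n) * of_nat (dY n) * phi n f x y * G x y)"
  proof (intro sum.cong refl)
    fix x y assume "x \<in> fam dX n" "y \<in> fam dY n"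
    from phi_refine[OF n this f]
    show "(\<Sum>i=1..dX n. \<Sum>i'=1..dY n. phi (Suc n) f (x @ [i]) (y @ [i']) * G x y) = of_nat (dX n) * of_nat (dY n) * phi n f x y * G x y"
      by (simp flip: sum_distrib_right)
  qed
  also have "\<dots> / (of_nat (card (fam dX (Suc n))) * of_nat (card (fam dY (Suc n)))) =
      (\<Sum>x\<in>fam dX n. \<Sum>y\<in>fam dY n. phi n f x y * G x y) / (of_nat (card (fam dX n)) * of_nat (card (fam dY n)))"
  proof -
    have "dX n \<noteq> 0" "dY n \<noteq> 0" using X Y by (auto simp: inductive_family_def dest: spec[of _ n])
    then show ?thesis by (simp add: card_fam_Suc mult.assoc flip: sum_distrib_left)
  qed
  also have "\<dots> = (\<integral>z. level_fun n (\<lambda>x y. phi n f x y * G x y) z \<partial>MM)" unfolding integral_level_fun ..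
  finally show ?thesis by (simp add: level_fun_def)
qed

lemma integral_Phi:
  assumes l: "l \<ge> 1" and f: "depends l f" and n: "l \<le> n"
  shows "(\<integral>z. Phi n f z * level_fun l G z \<partial>MM) = (\<integral>z. Phi l f z * level_fun l G z \<partial>MM)"
  using n
proof (induction n rule: dec_induct)
  case (step n)
  have "level_fun l G = level_fun n (\<lambda>x y. G (take l x) (take l y))"
    using step.hyps by (auto simp: level_fun_def initial_take[of l n])
  then show ?case using integral_Phi_step[of n f "\<lambda>x y. G (take l x) (take l y)"] step depends_mono[OF f, of n] l by simp
qed simp

end

section \<open>The correlation of a state\<close>

context ns_state
begin

lemma phi_nn:
  assumes n: "n \<ge> 1" "x \<in> fam dX n" "y \<in> fam dY n" and f: "\<And>z. nn (f z)"
  shows "nn (phi n f x y)"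
  unfolding phi_def by (intro nn_sum nn_mult f p_nn n)

lemma nn_test: "nn (test a b z)"
  by (cases z) (simp add: ftensor_def nn_def indicator_def)

lemma initial_fam_space:
  assumes "z \<in> space MM" shows "initial n (fst z) \<in> fam dX n" "initial n (snd z) \<in> fam dY n"
  using assms initial_fam by (auto simp: space_MM)

lemma Phi_bound:
  assumes "n \<ge> 1" "z \<in> space MM" "\<And>z. z \<in> Om dA \<times> Om dB \<Longrightarrow> cmod (f z) \<le> c"
  shows "cmod (Phi n f z) \<le> c"
  unfolding level_fun_def using assms by (intro phi_bound initial_fam_space)

text \<open>The processes are indexed by the countably many pairs of lists. They start at level 1, the first
  level of the sequences, and have the martingale property as soon as the level exceeds the lengths of the
  two lists.\<close>

lemma test_subsequence:
  "\<exists>levels. strict_mono levels \<and> (\<forall>k. levels k \<ge> 1) \<and> (AE z in MM. \<forall>a b. convergent (\<lambda>k. Phi (levels k) (test a b) z))"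
proof -
  define F where "F i = (case from_nat i of (a, b) \<Rightarrow> test a b)" for i
  define N where "N i = (case from_nat i of (a, b) \<Rightarrow> max (length (a :: nat list)) (length (b :: nat list)))" for i :: nat
  define h where "h i n z = Re (Phi (Suc n) (F i) z)" for i n z
  have depF: "depends (Suc l) (F i)" if "N i \<le> l" for i l
    using that depends_test by (auto simp: F_def N_def split: prod.splits)
  have nnF: "nn (F i z)" for i z using nn_test by (auto simp: F_def split: prod.splits)
  have hc: "Phi (Suc n) (F i) z = complex_of_real (h i n z)" if "z \<in> space MM" for i n z
    using phi_nn[OF _ initial_fam_space[OF that], of "Suc n" "F i"] nnF
    by (simp add: h_def level_fun_def nn_def complex_is_Real_iff complex_eq_iff)
  have "\<exists>r. strict_mono r \<and> (\<forall>i. AE z in MM. convergent (\<lambda>k. h i (r k) z))"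
  proof (rule PP.P.bounded_martingales_subsequence[where N = N])
    show "h i n \<in> borel_measurable MM" for i n
      unfolding h_def[abs_def] using level_fun_measurable by measurable
    show "\<bar>h i n z\<bar> \<le> 1" if "z \<in> space MM" for i n z
    proof -
      have "cmod (F i w) \<le> 1" for w
        by (cases w) (auto simp: F_def ftensor_def indicator_def split: prod.splits)
      then have "cmod (Phi (Suc n) (F i) z) \<le> 1" using that by (intro Phi_bound) auto
      then show ?thesis unfolding hc[OF that] by simp
    qed
    fix i l n assume l: "N i \<le> l" and n: "l \<le> n"
    have c: "complex_of_real (\<integral>z. h i m z * h i l z \<partial>MM) = (\<integral>z. Phi (Suc m) (F i) z * Phi (Suc l) (F i) z \<partial>MM)" for m
    proof -
      have "(\<integral>z. Phi (Suc m) (F i) z * Phi (Suc l) (F i) z \<partial>MM) = (\<integral>z. complex_of_real (h i m z * h i l z) \<partial>MM)"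
        by (intro Bochner_Integration.integral_cong refl) (simp add: hc)
      then show ?thesis by (simp only: integral_complex_of_real)
    qed
    have "complex_of_real (\<integral>z. h i n z * h i l z \<partial>MM) = complex_of_real (\<integral>z. h i l z * h i l z \<partial>MM)"
      unfolding c by (rule integral_Phi[OF _ depF[OF l]]) (use n in auto)
    then show "(\<integral>z. h i n z * h i l z \<partial>MM) = (\<integral>z. h i l z * h i l z \<partial>MM)" by (simp only: of_real_eq_iff)
  qed
  then obtain r where r: "strict_mono r" and ae: "\<And>i. AE z in MM. convergent (\<lambda>k. h i (r k) z)" by blast
  have "AE z in MM. \<forall>i. convergent (\<lambda>k. h i (r k) z)" using ae by (simp add: AE_all_countable)
  then have "AE z in MM. \<forall>a b. convergent (\<lambda>k. Phi (Suc (r k)) (test a b) z)"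
  proof (rule AE_mp, intro AE_I2 impI allI)
    fix z a b assume z: "z \<in> space MM" and conv: "\<forall>i. convergent (\<lambda>k. h i (r k) z)"
    have "F (to_nat (a, b)) = test a b" by (simp add: F_def)
    then have "Phi (Suc (r k)) (test a b) z = complex_of_real (h (to_nat (a, b)) (r k) z)" for k
      using hc[OF z, of "r k" "to_nat (a, b)"] by simp
    moreover have "convergent (\<lambda>k. complex_of_real (h (to_nat (a, b)) (r k) z))"
    proof -
      obtain c where "(\<lambda>k. h (to_nat (a, b)) (r k) z) \<longlonglongrightarrow> c" using conv unfolding convergent_def by blast
      then show ?thesis by (intro convergentI[OF tendsto_of_real])
    qed
    ultimately show "convergent (\<lambda>k. Phi (Suc (r k)) (test a b) z)" by simp
  qed
  moreover have "strict_mono (\<lambda>k. Suc (r k))" using r by (simp add: strict_mono_def)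
  ultimately show ?thesis by (intro exI[of _ "\<lambda>k. Suc (r k)"]) simp
qed

definition levels :: "nat \<Rightarrow> nat" where
  "levels = (SOME levels. strict_mono levels \<and> (\<forall>k. levels k \<ge> 1) \<and> (AE z in MM. \<forall>a b. convergent (\<lambda>k. Phi (levels k) (test a b) z)))"

lemma levels: "strict_mono levels" "levels k \<ge> 1" "AE z in MM. \<forall>a b. convergent (\<lambda>k. Phi (levels k) (test a b) z)"
  using someI_ex[OF test_subsequence] unfolding levels_def[symmetric] by auto

definition good :: "(nat \<Rightarrow> nat) \<times> (nat \<Rightarrow> nat) \<Rightarrow> bool" where
  "good z \<longleftrightarrow> z \<in> space MM \<and> (\<forall>a b. convergent (\<lambda>k. Phi (levels k) (test a b) z))"

lemma AE_good: "AE z in MM. good z"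
  using levels(3) AE_space by eventually_elim (simp add: good_def)

text \<open>The step function that agrees with \<open>f\<close> at the chosen points of the cylinders of level \<open>N\<close> is
  uniformly close to \<open>f\<close>, and $\Phi_n$ is a contraction.\<close>

lemma Phi_approximation:
  assumes n: "n \<ge> 1" and z: "z \<in> space MM"
    and N: "\<forall>\<alpha>\<in>Om dA. \<forall>\<alpha>'\<in>Om dA. \<forall>\<beta>\<in>Om dB. \<forall>\<beta>'\<in>Om dB.
      initial N \<alpha> = initial N \<alpha>' \<longrightarrow> initial N \<beta> = initial N \<beta>' \<longrightarrow> cmod (f (\<alpha>, \<beta>) - f (\<alpha>', \<beta>')) < \<epsilon>"
  shows "cmod (Phi n f z - (\<Sum>a\<in>fam dA N. \<Sum>b\<in>fam dB N. f (point a, point b) * Phi n (test a b) z)) \<le> \<epsilon>"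
proof -
  let ?g = "\<lambda>w. \<Sum>a\<in>fam dA N. \<Sum>b\<in>fam dB N. f (point a, point b) * test a b w"
  have "Phi n (\<lambda>w. f w + (-1) * ?g w) z = Phi n f z - (\<Sum>a\<in>fam dA N. \<Sum>b\<in>fam dB N. f (point a, point b) * Phi n (test a b) z)"
    by (simp only: level_fun_def phi_add phi_smult phi_sum) simp
  moreover have "cmod (Phi n (\<lambda>w. f w + (-1) * ?g w) z) \<le> \<epsilon>"
  proof (rule Phi_bound[OF n z])
    fix w assume "w \<in> Om dA \<times> Om dB"
    then obtain \<alpha> \<beta> where w: "w = (\<alpha>, \<beta>)" "\<alpha> \<in> Om dA" "\<beta> \<in> Om dB" by auto
    let ?a = "initial N \<alpha>" and ?b = "initial N \<beta>"
    have ab: "?a \<in> fam dA N" "?b \<in> fam dB N" using initial_fam w by auto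
    have "?g w = (\<Sum>a\<in>fam dA N. if ?a = a then \<Sum>b\<in>fam dB N. if ?b = b then f (point a, point b) else 0 else 0)"
      using w by (intro sum.cong refl) (auto simp: ftensor_def indicator_cyl intro!: sum.cong)
    also have "\<dots> = f (point ?a, point ?b)" using ab by (simp add: finite_fam)
    finally have g: "?g w = f (point ?a, point ?b)" .
    have "cmod (f (\<alpha>, \<beta>) - f (point ?a, point ?b)) < \<epsilon>"
      by (rule N[rule_format]) (use w ab point_Om[OF A] point_Om[OF B] in \<open>auto simp: initial_point\<close>)
    then show "cmod (f w + (-1) * ?g w) \<le> \<epsilon>" unfolding g by (simp add: w)
  qed
  ultimately show ?thesis by simp
qed

text \<open>By the preceding approximation, the sequence is up to $\epsilon$ a finite combination of
  sequences that converge.\<close>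

lemma Phi_convergent:
  assumes f: "f \<in> carrier (CC dA dB)" and z: "good z"
  shows "convergent (\<lambda>k. Phi (levels k) f z)"
proof -
  have "Cauchy (\<lambda>k. Phi (levels k) f z)"
  proof (rule CauchyI)
    fix e :: real assume e: "0 < e"
    then obtain N where N: "\<forall>\<alpha>\<in>Om dA. \<forall>\<alpha>'\<in>Om dA. \<forall>\<beta>\<in>Om dB. \<forall>\<beta>'\<in>Om dB.
      initial N \<alpha> = initial N \<alpha>' \<longrightarrow> initial N \<beta> = initial N \<beta>' \<longrightarrow> cmod (f (\<alpha>, \<beta>) - f (\<alpha>', \<beta>')) < e / 3"
      using compact_cylinder_approximation[of dA dB f "e / 3"] f by (auto simp: carrier_CC)
    define g where "g k = (\<Sum>a\<in>fam dA N. \<Sum>b\<in>fam dB N. f (point a, point b) * Phi (levels k) (test a b) z)" for k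
    have close: "cmod (Phi (levels k) f z - g k) \<le> e / 3" for k
      unfolding g_def by (rule Phi_approximation[OF levels(2) _ N]) (use z in \<open>simp add: good_def\<close>)
    define l where "l a b = lim (\<lambda>k. Phi (levels k) (test a b) z)" for a b
    have "(\<lambda>k. Phi (levels k) (test a b) z) \<longlonglongrightarrow> l a b" for a b
    proof -
      have "convergent (\<lambda>k. Phi (levels k) (test a b) z)" using z unfolding good_def by blast
      then show ?thesis unfolding l_def by (simp only: convergent_LIMSEQ_iff)
    qed
    then have "g \<longlonglongrightarrow> (\<Sum>a\<in>fam dA N. \<Sum>b\<in>fam dB N. f (point a, point b) * l a b)"
      unfolding g_def by (intro tendsto_intros)
    then have "Cauchy g" by (rule LIMSEQ_imp_Cauchy)
    then obtain M where M: "\<And>m n. \<lbrakk>m \<ge> M; n \<ge> M\<rbrakk> \<Longrightarrow> cmod (g m - g n) < e / 3"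
      using CauchyD[of g "e / 3"] e by auto
    have "cmod (Phi (levels m) f z - Phi (levels n) f z) < e" if mn: "m \<ge> M" "n \<ge> M" for m n
    proof -
      have tri: "cmod (u + v - w) \<le> cmod u + cmod v + cmod w" for u v w :: complex
        by (rule order_trans[OF norm_triangle_ineq4 add_right_mono[OF norm_triangle_ineq]])
      have "cmod (Phi (levels m) f z - Phi (levels n) f z) = cmod ((Phi (levels m) f z - g m) + (g m - g n) - (Phi (levels n) f z - g n))"
        by (rule arg_cong[where f = cmod]) simp
      also have "\<dots> \<le> cmod (Phi (levels m) f z - g m) + cmod (g m - g n) + cmod (Phi (levels n) f z - g n)" by (rule tri)
      finally show ?thesis using close[of m] close[of n] M[OF mn] by linarith
    qed
    then show "\<exists>M. \<forall>m\<ge>M. \<forall>n\<ge>M. cmod (Phi (levels m) f z - Phi (levels n) f z) < e" by blast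
  qed
  then show ?thesis by (rule Cauchy_convergent)
qed

definition limit_fun :: "((nat \<Rightarrow> nat) \<times> (nat \<Rightarrow> nat) \<Rightarrow> complex) \<Rightarrow> (nat \<Rightarrow> nat) \<times> (nat \<Rightarrow> nat) \<Rightarrow> complex" where
  "limit_fun f z = lim (\<lambda>k. Phi (levels k) f z)"

lemma limit_fun_lim: "\<lbrakk>f \<in> carrier (CC dA dB); good z\<rbrakk> \<Longrightarrow> (\<lambda>k. Phi (levels k) f z) \<longlonglongrightarrow> limit_fun f z"
  unfolding limit_fun_def using Phi_convergent convergent_LIMSEQ_iff by blast

lemma CC_bounded:
  assumes "f \<in> carrier (CC dA dB)" shows "\<exists>c. \<forall>z\<in>Om dA \<times> Om dB. cmod (f z) \<le> c"
proof -
  have "compact (f ` (Om dA \<times> Om dB))"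
    using assms by (intro compact_continuous_image compact_Times compact_Om) (simp add: carrier_CC)
  then have "bounded (f ` (Om dA \<times> Om dB))" by (rule compact_imp_bounded)
  then obtain c where "\<forall>y\<in>f ` (Om dA \<times> Om dB). cmod y \<le> c" unfolding bounded_iff by blast
  then show ?thesis by (intro exI[of _ c]) blast
qed

lemma limit_fun_Linf:
  assumes f: "f \<in> carrier (CC dA dB)" shows "limit_fun f \<in> Linf_fun MM"
proof -
  have "limit_fun f \<in> borel_measurable MM"
    unfolding limit_fun_def[abs_def] by (rule borel_measurable_lim_metric) (rule level_fun_measurable)
  moreover obtain c where c: "\<And>z. z \<in> Om dA \<times> Om dB \<Longrightarrow> cmod (f z) \<le> c" using CC_bounded[OF f] by blast
  have "AE z in MM. cmod (limit_fun f z) \<le> c"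
    using AE_good
  proof eventually_elim
    case (elim z)
    show ?case
    proof (rule LIMSEQ_le_const2[OF tendsto_norm[OF limit_fun_lim[OF f elim]]], intro exI allI impI)
      show "cmod (Phi (levels k) f z) \<le> c" for k
        using elim by (intro Phi_bound[OF levels(2) _ c]) (auto simp: good_def)
    qed
  qed
  ultimately show ?thesis by (auto simp: Linf_fun_def)
qed

definition limit_corr :: "((nat \<Rightarrow> nat) \<times> (nat \<Rightarrow> nat) \<Rightarrow> complex) \<Rightarrow> ((nat \<Rightarrow> nat) \<times> (nat \<Rightarrow> nat) \<Rightarrow> complex) set" where
  "limit_corr f = Linf_class MM (limit_fun f)"

lemma limit_corr_eqI:
  assumes "f \<in> carrier (CC dA dB)" "g \<in> Linf_fun MM" "\<And>z. good z \<Longrightarrow> limit_fun f z = g z"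
  shows "limit_corr f = Linf_class MM g"
proof -
  have "AE z in MM. limit_fun f z = g z" using AE_good by eventually_elim (rule assms(3))
  then show ?thesis unfolding limit_corr_def using PP.P.class_eq[OF limit_fun_Linf[OF assms(1)] assms(2)] by simp
qed

lemma limit_corr_linear: "linear_map (CC dA dB) (Linf_osys MM) limit_corr"
  unfolding linear_map_def
proof (intro conjI ballI allI)
  fix f assume f: "f \<in> carrier (CC dA dB)"
  note Lf = limit_fun_Linf[OF f]
  show "limit_corr f \<in> carrier (Linf_osys MM)" unfolding limit_corr_def PP.P.carrier_Linf using Lf by blast
  show "limit_corr (c \<odot>\<^bsub>CC dA dB\<^esub> f) = c \<odot>\<^bsub>Linf_osys MM\<^esub> limit_corr f" for c
  proof -
    have cf: "(\<lambda>z. c * f z) \<in> carrier (CC dA dB)" using fun_space_CC f by (simp add: fun_space_def)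
    have "limit_corr (\<lambda>z. c * f z) = Linf_class MM (\<lambda>z. c * limit_fun f z)"
    proof (rule limit_corr_eqI[OF cf])
      show "(\<lambda>z. c * limit_fun f z) \<in> Linf_fun MM" using PP.P.fun_space_Linf Lf by (simp add: fun_space_def)
      fix z assume z: "good z"
      have "(\<lambda>k. Phi (levels k) (\<lambda>z. c * f z) z) \<longlonglongrightarrow> c * limit_fun f z"
        unfolding level_fun_def phi_smult using tendsto_mult[OF tendsto_const limit_fun_lim[OF f z]] by (simp only: level_fun_def)
      then show "limit_fun (\<lambda>z. c * f z) z = c * limit_fun f z" using limit_fun_lim[OF cf z] LIMSEQ_unique by blast
    qed
    then show ?thesis using PP.P.class_linear Lf by (simp add: CC_simps limit_corr_def linear_map_def)
  qed
  fix g assume g: "g \<in> carrier (CC dA dB)"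
  note Lg = limit_fun_Linf[OF g]
  have fg: "(\<lambda>z. f z + g z) \<in> carrier (CC dA dB)" using fun_space_CC f g by (simp add: fun_space_def)
  have "limit_corr (\<lambda>z. f z + g z) = Linf_class MM (\<lambda>z. limit_fun f z + limit_fun g z)"
  proof (rule limit_corr_eqI[OF fg])
    show "(\<lambda>z. limit_fun f z + limit_fun g z) \<in> Linf_fun MM" using PP.P.fun_space_Linf Lf Lg by (simp add: fun_space_def)
    fix z assume z: "good z"
    have "(\<lambda>k. Phi (levels k) (\<lambda>z. f z + g z) z) \<longlonglongrightarrow> limit_fun f z + limit_fun g z"
      unfolding level_fun_def phi_add using tendsto_add[OF limit_fun_lim[OF f z] limit_fun_lim[OF g z]] by (simp only: level_fun_def)
    then show "limit_fun (\<lambda>z. f z + g z) z = limit_fun f z + limit_fun g z" using limit_fun_lim[OF fg z] LIMSEQ_unique by blast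
  qed
  then show "limit_corr (f \<oplus>\<^bsub>CC dA dB\<^esub> g) = limit_corr f \<oplus>\<^bsub>Linf_osys MM\<^esub> limit_corr g"
    using PP.P.class_linear Lf Lg by (simp add: CC_simps limit_corr_def linear_map_def)
qed

text \<open>At every point, $\Phi_n$ is a unital completely positive map into the complex numbers, and these properties are
  preserved by pointwise limits.\<close>

lemma limit_corr_ucp: "ucp (CC dA dB) (Linf_osys MM) limit_corr"
  unfolding ucp_def
proof (intro conjI allI ballI limit_corr_linear)
  show "limit_corr \<one>\<^bsub>CC dA dB\<^esub> = \<one>\<^bsub>Linf_osys MM\<^esub>"
    unfolding PP.P.unit_Linf one_CC
  proof (rule limit_corr_eqI)
    show one: "ftensor (indicator (Om dA)) (indicator (Om dB)) \<in> carrier (CC dA dB)"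
      by (intro ftensor_CC indicator_Om_C)
    show "indicator (space MM) \<in> Linf_fun MM" by (rule PP.P.Linf_funI[of _ 1]) (auto simp: indicator_def)
    fix z assume z: "good z"
    then have zs: "z \<in> space MM" by (simp add: good_def)
    have "(\<lambda>k. Phi (levels k) (ftensor (indicator (Om dA)) (indicator (Om dB))) z) = (\<lambda>k. 1)"
      unfolding level_fun_def using initial_fam_space[OF zs] levels(2) by (intro ext phi_one)
    then have "(\<lambda>k. 1) \<longlonglongrightarrow> limit_fun (ftensor (indicator (Om dA)) (indicator (Om dB))) z"
      using limit_fun_lim[OF one z] by simp
    then show "limit_fun (ftensor (indicator (Om dA)) (indicator (Om dB))) z = indicator (space MM) z"
      using zs by (simp add: LIMSEQ_const_iff)
  qed
  fix l P assume "P \<in> mpos (CC dA dB) l"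
  then have P: "\<And>i j. \<lbrakk>i < l; j < l\<rbrakk> \<Longrightarrow> P i j \<in> carrier (CC dA dB)"
      "\<And>z. z \<in> Om dA \<times> Om dB \<Longrightarrow> psd l (\<lambda>i j. P i j z)"
    unfolding mpos_CC by blast+
  show "(\<lambda>i j. limit_corr (P i j)) \<in> mpos (Linf_osys MM) l"
    unfolding PP.P.mpos_Linf
  proof (intro exI[of _ "\<lambda>i j. limit_fun (P i j)"] conjI allI impI)
    show "limit_fun (P i j) \<in> Linf_fun MM" "limit_corr (P i j) = Linf_class MM (limit_fun (P i j))" if "i < l" "j < l" for i j
      using limit_fun_Linf[OF P(1)[OF that]] by (simp_all add: limit_corr_def)
    show "AE z in MM. psd l (\<lambda>i j. limit_fun (P i j) z)"
      using AE_good
    proof eventually_elim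
      case (elim z)
      have "nn (quad l (\<lambda>i j. limit_fun (P i j) z) v)" for v
      proof (rule nn_limit)
        show "(\<lambda>k. quad l (\<lambda>i j. Phi (levels k) (P i j) z) v) \<longlonglongrightarrow> quad l (\<lambda>i j. limit_fun (P i j) z) v"
          unfolding quad_def by (intro tendsto_sum tendsto_mult tendsto_const limit_fun_lim P(1) elim) auto
        have "psd l (\<lambda>i j. Phi (levels k) (P i j) z)" for k
          unfolding level_fun_def using elim by (intro phi_psd[OF levels(2) initial_fam_space] P(2)) (auto simp: good_def)
        then show "\<forall>\<^sub>F k in sequentially. nn (quad l (\<lambda>i j. Phi (levels k) (P i j) z) v)"
          by (simp add: psd_quad)
      qed simp
      then show ?case by (simp add: psd_quad)
    qed
  qed
qed

text \<open>At points where a sequence diverges, \<^const>\<open>lim\<close> has a fixed default value, which has to be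
  included in the bound.\<close>

lemma lim_bounded:
  fixes f :: "nat \<Rightarrow> complex" assumes "\<And>k. cmod (f k) \<le> c"
  shows "cmod (lim f) \<le> max c (cmod (THE x. False))"
proof (cases "convergent f")
  case True
  then have "f \<longlonglongrightarrow> lim f" by (simp add: convergent_LIMSEQ_iff)
  from LIMSEQ_le_const2[OF tendsto_norm[OF this], of c] assms show ?thesis by auto
next
  case False
  then have "lim f = (THE x. False)" by (simp add: lim_def convergent_def)
  then show ?thesis by simp
qed

text \<open>Summing $p_n(x, y, a, b)$ over $b$ replaces $e_{y,b}$ by the unit, so $\Phi_n(f \otimes 1)$ does
  not involve the second variable; its pointwise limit \<open>g\<close> is taken on $\Omega_X$ itself.\<close>

lemma limit_corr_no_signalling_A:
  assumes f: "f \<in> carrier (C_osys (Omega dA))"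
  shows "\<exists>g\<in>Linf_fun (mu dX). limit_corr (ftensor f (indicator (Om dB))) = Linf_class MM (ftensor g (\<lambda>_. 1))"
proof -
  let ?F = "ftensor f (indicator (Om dB))"
  have F: "?F \<in> carrier (CC dA dB)" by (intro ftensor_CC f indicator_Om_C)
  obtain c where c: "\<And>z. z \<in> Om dA \<times> Om dB \<Longrightarrow> cmod (?F z) \<le> c" using CC_bounded[OF F] by blast
  define G where "G n x = (\<Sum>a\<in>fam dA n. f (point a) * s (tn (genX n x a) \<one>\<^bsub>SY\<^esub>))" for n x
  have phiG: "phi n ?F x y = G n x" if "n \<ge> 1" "x \<in> fam dX n" "y \<in> fam dY n" for n x y
  proof -
    have "phi n ?F x y = (\<Sum>a\<in>fam dA n. f (point a) * (\<Sum>b\<in>fam dB n. p n x y a b))"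
      unfolding phi_def sum_distrib_left
      by (intro sum.cong refl) (use point_Om[OF B] in \<open>simp add: ftensor_def\<close>)
    then show ?thesis using that by (simp add: G_def p_sum_B)
  qed
  define g where "g \<omega> = lim (\<lambda>k. G (levels k) (initial (levels k) \<omega>))" for \<omega>
  have "(\<lambda>\<omega>. G n (initial n \<omega>)) \<in> borel_measurable (mu dX)" for n
    by (rule measurable_compose[OF initial_measurable]) simp
  then have gm: "g \<in> borel_measurable (mu dX)" unfolding g_def[abs_def] by (intro borel_measurable_lim_metric)
  have g: "g \<in> Linf_fun (mu dX)"
  proof (rule PP.M1.Linf_funI[OF gm])
    fix \<omega> assume \<omega>: "\<omega> \<in> space (mu dX)"
    have "cmod (G (levels k) (initial (levels k) \<omega>)) \<le> c" for k
    proof -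
      obtain y where y: "y \<in> fam dY (levels k)" using fam_nonempty[OF Y] by blast
      have x: "initial (levels k) \<omega> \<in> fam dX (levels k)" using \<omega> by (intro initial_fam) simp
      show ?thesis unfolding phiG[OF levels(2) x y, symmetric] by (rule phi_bound[OF levels(2) x y c])
    qed
    then show "cmod (g \<omega>) \<le> max c (cmod (THE x. False))" unfolding g_def by (rule lim_bounded)
  qed
  have "limit_corr ?F = Linf_class MM (ftensor g (\<lambda>_. 1))"
  proof (rule limit_corr_eqI[OF F ftensor_Linf[OF g const_Linf_Y]])
    fix z assume "good z"
    then have "z \<in> space MM" by (simp add: good_def)
    then have "Phi (levels k) ?F z = G (levels k) (initial (levels k) (fst z))" for k
      unfolding level_fun_def by (intro phiG levels(2) initial_fam_space)
    then show "limit_fun ?F z = ftensor g (\<lambda>_. 1) z" by (cases z) (simp add: limit_fun_def g_def ftensor_def)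
  qed
  then show ?thesis using g by blast
qed

lemma limit_corr_no_signalling_B:
  assumes f: "f \<in> carrier (C_osys (Omega dB))"
  shows "\<exists>g\<in>Linf_fun (mu dY). limit_corr (ftensor (indicator (Om dA)) f) = Linf_class MM (ftensor (\<lambda>_. 1) g)"
proof -
  let ?F = "ftensor (indicator (Om dA)) f"
  have F: "?F \<in> carrier (CC dA dB)" by (intro ftensor_CC f indicator_Om_C)
  obtain c where c: "\<And>z. z \<in> Om dA \<times> Om dB \<Longrightarrow> cmod (?F z) \<le> c" using CC_bounded[OF F] by blast
  define G where "G n y = (\<Sum>b\<in>fam dB n. f (point b) * s (tn \<one>\<^bsub>SX\<^esub> (genY n y b)))" for n y
  have phiG: "phi n ?F x y = G n y" if "n \<ge> 1" "x \<in> fam dX n" "y \<in> fam dY n" for n x y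
  proof -
    have "phi n ?F x y = (\<Sum>b\<in>fam dB n. \<Sum>a\<in>fam dA n. ?F (point a, point b) * p n x y a b)"
      unfolding phi_def by (rule sum.swap)
    also have "\<dots> = (\<Sum>b\<in>fam dB n. f (point b) * (\<Sum>a\<in>fam dA n. p n x y a b))"
      unfolding sum_distrib_left
      by (intro sum.cong refl) (use point_Om[OF A] in \<open>simp add: ftensor_def\<close>)
    finally show ?thesis using that by (simp add: G_def p_sum_A)
  qed
  define g where "g \<omega> = lim (\<lambda>k. G (levels k) (initial (levels k) \<omega>))" for \<omega>
  have "(\<lambda>\<omega>. G n (initial n \<omega>)) \<in> borel_measurable (mu dY)" for n
    by (rule measurable_compose[OF initial_measurable]) simp
  then have gm: "g \<in> borel_measurable (mu dY)" unfolding g_def[abs_def] by (intro borel_measurable_lim_metric)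
  have g: "g \<in> Linf_fun (mu dY)"
  proof (rule PP.M2.Linf_funI[OF gm])
    fix \<omega> assume \<omega>: "\<omega> \<in> space (mu dY)"
    have "cmod (G (levels k) (initial (levels k) \<omega>)) \<le> c" for k
    proof -
      obtain x where x: "x \<in> fam dX (levels k)" using fam_nonempty[OF X] by blast
      have y: "initial (levels k) \<omega> \<in> fam dY (levels k)" using \<omega> by (intro initial_fam) simp
      show ?thesis unfolding phiG[OF levels(2) x y, symmetric] by (rule phi_bound[OF levels(2) x y c])
    qed
    then show "cmod (g \<omega>) \<le> max c (cmod (THE x. False))" unfolding g_def by (rule lim_bounded)
  qed
  have "limit_corr ?F = Linf_class MM (ftensor (\<lambda>_. 1) g)"
  proof (rule limit_corr_eqI[OF F ftensor_Linf[OF const_Linf_X g]])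
    fix z assume "good z"
    then have "z \<in> space MM" by (simp add: good_def)
    then have "Phi (levels k) ?F z = G (levels k) (initial (levels k) (snd z))" for k
      unfolding level_fun_def by (intro phiG levels(2) initial_fam_space)
    then show "limit_fun ?F z = ftensor (\<lambda>_. 1) g z" by (cases z) (simp add: limit_fun_def g_def ftensor_def)
  qed
  then show ?thesis using g by blast
qed

lemma limit_corr_ns_corr: "limit_corr \<in> ns_corr dX dY dA dB"
  unfolding ns_corr_def one_C_Omega using limit_corr_ucp limit_corr_no_signalling_A limit_corr_no_signalling_B by blast

text \<open>By the martingale property the mean of $\Phi_k(\chi_{\tilde a} \otimes \chi_{\tilde b})$ over a cell of
  level $n$ is the same for all $k \ge n$, namely $p_n(x, y, a, b)$, and dominated convergence gives
  the same mean for the limit.\<close>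

lemma limit_corr_represents: "represents dX dY dA dB limit_corr s"
  unfolding represents_def
proof (intro allI impI ballI)
  fix n x y a b
  assume n: "1 \<le> n" and x: "x \<in> fam dX n" and y: "y \<in> fam dY n" and a: "a \<in> fam dA n" and b: "b \<in> fam dB n"
  let ?u = "cell x y :: (nat \<Rightarrow> nat) \<times> (nat \<Rightarrow> nat) \<Rightarrow> complex"
  have F: "test a b \<in> carrier (CC dA dB)" by (intro ftensor_CC indicator_cyl_C)
  have u: "?u \<in> Linf_fun MM" by (intro ftensor_Linf cyl_Linf X Y)
  have dep: "depends n (test a b)" using length_fam[OF a] length_fam[OF b] by (intro depends_test) auto
  let ?G = "\<lambda>x' y'. if x' = x \<and> y' = y then 1 else 0 :: complex"
  have uG: "?u z = level_fun n ?G z" if "z \<in> space MM" for z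
    using that x y by (cases z) (auto simp: space_MM ftensor_def level_fun_def indicator_cyl)
  have "(\<lambda>k. \<integral>z. ?u z * Phi (levels k) (test a b) z \<partial>MM) \<longlonglongrightarrow> (\<integral>z. ?u z * limit_fun (test a b) z \<partial>MM)"
  proof (rule integral_dominated_convergence[where w = "\<lambda>_. 1"])
    have [measurable]: "?u \<in> borel_measurable MM" "limit_fun (test a b) \<in> borel_measurable MM" "Phi k (test a b) \<in> borel_measurable MM" for k
      using u limit_fun_Linf[OF F] PP.P.Linf_fun_measurable level_fun_measurable by auto
    show "(\<lambda>z. ?u z * limit_fun (test a b) z) \<in> borel_measurable MM" by measurable
    show "(\<lambda>z. ?u z * Phi (levels k) (test a b) z) \<in> borel_measurable MM" for k by measurable
    show "AE z in MM. (\<lambda>k. ?u z * Phi (levels k) (test a b) z) \<longlonglongrightarrow> ?u z * limit_fun (test a b) z"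
      using AE_good by eventually_elim (intro tendsto_mult tendsto_const limit_fun_lim F)
    show "AE z in MM. cmod (?u z * Phi (levels k) (test a b) z) \<le> 1" for k
    proof (rule AE_I2)
      fix z assume z: "z \<in> space MM"
      have "cmod (test a b w) \<le> 1" for w by (cases w) (auto simp: ftensor_def indicator_def)
      then have 1: "cmod (Phi (levels k) (test a b) z) \<le> 1" by (intro Phi_bound[OF levels(2) z])
      have "cmod (?u z) \<le> 1" by (cases z) (auto simp: ftensor_def indicator_def)
      then show "cmod (?u z * Phi (levels k) (test a b) z) \<le> 1" using 1 by (simp add: norm_mult mult_le_one)
    qed
  qed simp
  moreover have "(\<lambda>k. \<integral>z. ?u z * Phi (levels k) (test a b) z \<partial>MM) \<longlonglongrightarrow> (\<integral>z. Phi n (test a b) z * level_fun n ?G z \<partial>MM)"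
  proof (rule tendsto_eventually, rule eventually_sequentiallyI)
    fix k assume "n \<le> k"
    then have nR: "n \<le> levels k" using strict_mono_imp_increasing[OF levels(1), of k] by simp
    have "(\<integral>z. ?u z * Phi (levels k) (test a b) z \<partial>MM) = (\<integral>z. Phi (levels k) (test a b) z * level_fun n ?G z \<partial>MM)"
      by (intro Bochner_Integration.integral_cong refl) (simp add: uG)
    then show "(\<integral>z. ?u z * Phi (levels k) (test a b) z \<partial>MM) = (\<integral>z. Phi n (test a b) z * level_fun n ?G z \<partial>MM)"
      using integral_Phi[OF n dep nR] by simp
  qed
  ultimately have "(\<integral>z. ?u z * limit_fun (test a b) z \<partial>MM) = (\<integral>z. Phi n (test a b) z * level_fun n ?G z \<partial>MM)"
    by (rule LIMSEQ_unique)
  also have "\<dots> = (\<integral>z. level_fun n (\<lambda>x' y'. phi n (test a b) x' y' * ?G x' y') z \<partial>MM)"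
    by (simp add: level_fun_def)
  also have "\<dots> = (\<Sum>x'\<in>fam dX n. \<Sum>y'\<in>fam dY n. phi n (test a b) x' y' * ?G x' y') / (of_nat (card (fam dX n)) * of_nat (card (fam dY n)))"
    by (rule integral_level_fun)
  also have "(\<Sum>x'\<in>fam dX n. \<Sum>y'\<in>fam dY n. phi n (test a b) x' y' * ?G x' y') =
      (\<Sum>x'\<in>fam dX n. if x = x' then \<Sum>y'\<in>fam dY n. if y = y' then phi n (test a b) x' y' else 0 else 0)"
    by (intro sum.cong refl) (auto intro!: sum.cong)
  also have "\<dots> = phi n (test a b) x y" using x y by (simp add: finite_fam)
  also have "\<dots> = (\<Sum>a'\<in>fam dA n. if a = a' then \<Sum>b'\<in>fam dB n. if b = b' then p n x y a' b' else 0 else 0)"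
    unfolding phi_def
    by (intro sum.cong refl)
      (auto simp: ftensor_def indicator_cyl[OF a] indicator_cyl[OF b] point_Om[OF A] point_Om[OF B] initial_point length_fam intro!: sum.cong sum.neutral)
  also have "\<dots> = p n x y a b" using a b by (simp add: finite_fam)
  finally have "pairing MM ?u (limit_corr (test a b)) = p n x y a b / (of_nat (card (fam dX n)) * of_nat (card (fam dY n)))"
    unfolding limit_corr_def PP.P.pairing_class[OF PP.P.Linf_fun_measurable[OF u] limit_fun_Linf[OF F]] .
  then show "s (tn (genX n x a) (genY n y b)) =
      of_nat (card (fam dX n)) * of_nat (card (fam dY n)) * pairing MM ?u (limit_corr (test a b))"
    using CX.S[of n] CY.S[of n] by (simp add: p_def)
qed

end

lemma (in ns_families) represents_unique:
  assumes "state (tensor_lim dX dY dA dB) s" "represents dX dY dA dB \<Gamma> s"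
    and "state (tensor_lim dX dY dA dB) s'" "represents dX dY dA dB \<Gamma> s'" and t: "t \<in> carrier (tensor_lim dX dY dA dB)"
  shows "s t = s' t"
proof (rule generators_determine[OF state_linear[OF assms(1)] state_linear[OF assms(3)]])
  show "t \<in> carrier Alg" using t by simp
qed (use assms(2,4) in \<open>simp add: represents_def\<close>)

theorem theorem4p5:
  fixes dX dY dA dB :: "nat \<Rightarrow> nat"
  assumes "inductive_family dX" "inductive_family dY" "inductive_family dA" "inductive_family dB"
  shows "(\<forall>\<Gamma>\<in>ns_corr dX dY dA dB.
            \<exists>s. state (tensor_lim dX dY dA dB) s \<and> represents dX dY dA dB \<Gamma> s) \<and>
         (\<forall>s. state (tensor_lim dX dY dA dB) s \<longrightarrow>
            (\<exists>\<Gamma>\<in>ns_corr dX dY dA dB. \<forall>t\<in>carrier (tensor_lim dX dY dA dB).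
               s t = state_of dX dY dA dB \<Gamma> t))"
proof -
  interpret ns_families dX dY dA dB by (rule ns_families.intro) fact+
  show ?thesis
  proof (intro conjI ballI allI impI)
    fix \<Gamma> assume "\<Gamma> \<in> ns_corr dX dY dA dB"
    then interpret ns_correlation dX dY dA dB \<Gamma> by unfold_locales
    show "\<exists>s. state (tensor_lim dX dY dA dB) s \<and> represents dX dY dA dB \<Gamma> s"
      by (rule state_of_correlation)
  next
    fix s assume s: "state (tensor_lim dX dY dA dB) s"
    then interpret ns_state dX dY dA dB s by unfold_locales
    have "state (tensor_lim dX dY dA dB) (state_of dX dY dA dB limit_corr) \<and> represents dX dY dA dB limit_corr (state_of dX dY dA dB limit_corr)"
      unfolding state_of_def by (rule someI[of _ s]) (intro conjI s limit_corr_represents)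
    then show "\<exists>\<Gamma>\<in>ns_corr dX dY dA dB. \<forall>t\<in>carrier (tensor_lim dX dY dA dB). s t = state_of dX dY dA dB \<Gamma> t"
      using represents_unique[OF s limit_corr_represents] limit_corr_ns_corr by blast
  qed
qed

end
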